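(* Let $B\#_{\sigma}H$ be a crossed product of an algebra $B$ and a Hopf algebra $H$ (with $H$ measuring $B$ via $\triangleright$ and with $\sigma:H\otimes H\to B$), where $H$ is cocommutative and the image of $\sigma$ belongs to the centre of $B$. Let $\mathcal{C}(B\#H,H)$ and $\mathcal{C}(B\#_\sigma H,H)$ be the Ehresmann–Schauenburg bialgebroids of the Hopf Galois extensions $B\subseteq B\#H$ and $B\subseteq B\#_\sigma H$. Then there is an invertible normalised 2-cocycle $\tilde\sigma$ on $\mathcal{C}(B\#H,H)$ such that $\phi:\mathcal{C}(B\#H,H)^{\tilde\sigma}\to\mathcal{C}(B\#_\sigma H,H)$ is an isomorphism of left $B$-bialgebroids, where, for all $b,b',c,c'\in B$ and $h,g\in H$, $\tilde\sigma$ is given by $$\tilde{\sigma}\big(b\#h_{(1)}\otimes b'\#S(h_{(2)}),\; c\#g_{(1)}\otimes c'\#S(g_{(2)})\big)=b\,(h_{(1)}\triangleright c)\,\sigma(h_{(2)},g_{(1)})\,\big((h_{(3)}g_{(2)})\triangleright c'\big)\,(h_{(4)}\triangleright b')$$ and $\phi$ is given by $$\phi\big(b\#h_{(1)}\otimes b'\#S(h_{(2)})\big)=b\#_\sigma h_{(1)}\otimes b'\sigma^{-1}(S(h_{(3)}),h_{(4)})\#_\sigma S(h_{(2)}).$$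
   Context: All algebras (unital, associative), modules and comodules are vector spaces over $\mathbb{C}$. $H$ is a Hopf algebra with coproduct $\Delta(h)=h_{(1)}\otimes h_{(2)}$ (sumless Sweedler notation), counit $\epsilon$, antipode $S$. Coactions are written $\delta(a)=a_{(0)}\otimes a_{(1)}$. Crossed product. $H$ measures an algebra $B$ if there is a linear map $H\otimes B\to B$, $h\otimes b\mapsto h\triangleright b$, with $h\triangleright 1=\epsilon(h)1$ and $h\triangleright(bb')=(h_{(1)}\triangleright b)(h_{(2)}\triangleright b')$. Let $\sigma:H\otimes H\to B$ be a convolution invertible linear map with convolution inverse $\sigma^{-1}$, such that for all $h,k,m\in H$, $b\in B$: (1) $1\triangleright b=b$; (2) $h\triangleright(k\triangleright b)=\sigma(h_{(1)},k_{(1)})(h_{(2)}k_{(2)}\triangleright b)\sigma^{-1}(h_{(3)},k_{(3)})$; (3) $\sigma(h,1)=\sigma(1,h)=\epsilon(h)1$; (4) $(h_{(1)}\triangleright\sigma(k_{(1)},m_{(1)}))\sigma(h_{(2)},k_{(2)}m_{(2)})=\sigma(h_{(1)},k_{(1)})\sigma(h_{(2)}k_{(2)},m)$. The crossed product $B\#_\sigma H$ is the vector space $B\otimes H$ (with $b\#_\sigma h:=b\otimes h$) with product $(b\#_\sigma h)(b'\#_\sigma h')=b(h_{(1)}\triangleright b')\sigma(h_{(2)},h'_{(1)})\#_\sigma h_{(3)}h'_{(2)}$ and unit $1\#_\sigma 1$. It is a right $H$-comodule algebra via $b\#_\sigma h\mapsto b\#_\sigma h_{(1)}\otimes h_{(2)}$,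 with coinvariant subalgebra $B$ (identified with $B\#_\sigma 1$). Under the hypotheses of the claim, $\triangleright$ makes $B$ a left $H$-module algebra, and the smash product $B\#H$ is the vector space $B\otimes H$ with product $(b\#h)(b'\#g)=b(h_{(1)}\triangleright b')\#h_{(2)}g$ for the same $\triangleright$ (i.e. the crossed product for the trivial cocycle $\epsilon\otimes\epsilon$). Hopf Galois extensions. For a right $H$-comodule algebra $A$ with $B=A^{coH}=\{b\in A:\delta(b)=b\otimes 1_H\}$, the extension $B\subseteq A$ is Hopf Galois if $\chi:A\otimes_BA\to A\otimes H$, $a\otimes_Ba'\mapsto aa'_{(0)}\otimes a'_{(1)}$ is bijective; $A$ is always assumed faithfully flat as a left $B$-module. The translation map is $\tau(h)=\chi^{-1}(1\otimes h)$. The extension $B\subseteq B\#_\sigma H$ is Hopf Galois with $\tau(h)=\sigma^{-1}(S(h_{(2)}),h_{(3)})\#_\sigma S(h_{(1)})\otimes_B1\#_\sigma h_{(4)}$; in particular for $B\#H$ one has $\tau(h)=1\#S(h_{(1)})\otimes_B1\#h_{(2)}$. Ehresmann–Schauenburg bialgebroid. For a Hopf Galois extension $B=A^{coH}\subseteq A$, $\mathcal{C}(A,H)=\{a\otimes\tilde a\in A\otimes A: a_{(0)}\otimes\tau(a_{(1)})\tilde a=a\otimes\tilde a\otimes_B1\}$ (summation over simple tensors suppressed), equivalently the elements of $A\otimes A$ coinvariant for the diagonal coaction. It is a left $B$-bialgebroid with product $(a\otimes\tilde a)(a'\otimes\tilde a')=aa'\otimes\tilde a'\tilde a$, source $s(b)=b\otimes1$,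 target $t(b)=1\otimes b$, coproduct $\Delta(a\otimes\tilde a)=a_{(0)}\otimes\tau(a_{(1)})\otimes\tilde a$, counit $\epsilon(a\otimes\tilde a)=a\tilde a$. The space $\mathcal{C}(B\#H,H)$ is spanned by the elements $b\#h_{(1)}\otimes b'\#S(h_{(2)})$ with $b,b'\in B$, $h\in H$. Left bialgebroids. A left $B$-bialgebroid $\mathcal{L}$ is an algebra with an algebra map $\eta:B\otimes B^{op}\to\mathcal{L}$, with source $s=\eta(\cdot\otimes1)$ and target $t=\eta(1\otimes\cdot)$ (having commuting ranges), together with a $B$-coring structure $(\Delta,\epsilon)$ for the bimodule structure $b\triangleright a\triangleleft b'=s(b)t(b')a$, such that $\Delta$ corestricts to an algebra map into $\mathcal{L}\times_B\mathcal{L}=\{\sum a_i\otimes_Ba_i':\sum a_it(b)\otimes_Ba_i'=\sum a_i\otimes_Ba_i's(b)\ \forall b\in B\}$ (with factorwise product), and $\epsilon(1)=1$, $\epsilon(s(b)a)=b\epsilon(a)$, $\epsilon(as(\epsilon(a')))=\epsilon(aa')=\epsilon(at(\epsilon(a')))$. Write $\Delta(a)=a_{(1)}\otimes_Ba_{(2)}$. Morphisms of left $B$-bialgebroids are $B$-coring maps (bimodule maps compatible with $\Delta$ and $\epsilon$) that are also algebra maps. 2-cocycles and twists. $\mathcal{L}\otimes_{B\otimes B^{op}}\mathcal{L}$ is the tensor product balanced via $\eta$ (i.e. $a\eta(x)\otimes a'=a\otimes\eta(x)a'$), with $B$-bimodule structure $b\triangleright(a\otimes a')\triangleleft b'=s(b)t(b')a\otimes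 a'$. ${}_B\mathrm{Hom}_B(\mathcal{L}\otimes_{B\otimes B^{op}}\mathcal{L},B)$ is an algebra under the convolution $(f\star g)(a,a')=f(a_{(1)},a'_{(1)})g(a_{(2)},a'_{(2)})$ with unit $a\otimes a'\mapsto\epsilon(aa')$. An invertible normalised 2-cocycle on $\mathcal{L}$ is a convolution invertible element $\tilde\sigma$ of this algebra such that for all $a,a',a''\in\mathcal{L}$, $b,b'\in B$: (1) $\tilde\sigma(s(b)t(b')a,a')=b\tilde\sigma(a,a')b'$; (2) $\tilde\sigma(a,s(\tilde\sigma(a'_{(1)},a''_{(1)}))a'_{(2)}a''_{(2)})=\tilde\sigma(s(\tilde\sigma(a_{(1)},a'_{(1)}))a_{(2)}a'_{(2)},a'')$; (3) $\tilde\sigma(1,a)=\epsilon(a)=\tilde\sigma(a,1)$. The twist $\mathcal{L}^{\tilde\sigma}$ is the left $B$-bialgebroid with the same underlying $B$-coring as $\mathcal{L}$ and product $a\cdot_{\tilde\sigma}a'=s(\tilde\sigma(a_{(1)},a'_{(1)}))\,t(\tilde\sigma^{-1}(a_{(3)},a'_{(3)}))\,a_{(2)}a'_{(2)}$. *)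

theory Defs
  imports Complex_Main "HOL-Library.Poly_Mapping"
begin

section \<open>Complex vector spaces and algebras\<close>

class scaleC =
  fixes scaleC :: "complex \<Rightarrow> 'a \<Rightarrow> 'a" (infixr "*\<^sub>C" 75)

class cvector = ab_group_add + scaleC +
  assumes scaleC_add_right: "c *\<^sub>C (x + y) = c *\<^sub>C x + c *\<^sub>C y"
    and scaleC_add_left: "(c + d) *\<^sub>C x = c *\<^sub>C x + d *\<^sub>C x"
    and scaleC_scaleC: "c *\<^sub>C (d *\<^sub>C x) = (c * d) *\<^sub>C x"
    and scaleC_one: "1 *\<^sub>C x = x"

global_interpretation cvec: vector_space "scaleC :: complex \<Rightarrow> 'a \<Rightarrow> 'a::cvector"
  by unfold_locales (simp_all add: scaleC_add_right scaleC_add_left scaleC_scaleC scaleC_one)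

text \<open>Unital associative algebras. The class \<open>ring_1\<close> is avoided because it requires \<open>0 \<noteq> 1\<close>,
  which would exclude the zero algebra.\<close>

class calgebra = cvector + ring + monoid_mult +
  assumes scaleC_mult_left: "(c *\<^sub>C x) * y = c *\<^sub>C (x * y)"
    and scaleC_mult_right: "x * (c *\<^sub>C y) = c *\<^sub>C (x * y)"

instantiation complex :: calgebra
begin
definition scaleC_complex :: "complex \<Rightarrow> complex \<Rightarrow> complex" where "scaleC_complex c x = c * x"
instance by standard (simp_all add: scaleC_complex_def algebra_simps)
end

abbreviation clinear :: "('a::cvector \<Rightarrow> 'b::cvector) \<Rightarrow> bool" where
  "clinear \<equiv> Vector_Spaces.linear scaleC scaleC"

definition cbilinear :: "('a::cvector \<Rightarrow> 'b::cvector \<Rightarrow> 'c::cvector) \<Rightarrow> bool" where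
  "cbilinear f \<longleftrightarrow> (\<forall>y. clinear (\<lambda>x. f x y)) \<and> (\<forall>x. clinear (f x))"

lemma clinearI:
  assumes "\<And>x y. f (x + y) = f x + f y" "\<And>c x. f (c *\<^sub>C x) = c *\<^sub>C f x"
  shows "clinear f"
  using assms by unfold_locales

lemma clinear_add: "clinear f \<Longrightarrow> f (x + y) = f x + f y"
  and clinear_scale: "clinear f \<Longrightarrow> f (c *\<^sub>C x) = c *\<^sub>C f x"
  by (simp_all add: Vector_Spaces.linear_iff)

lemma clinear_zero: "clinear f \<Longrightarrow> f 0 = 0"
  using clinear_add[of f 0 0] by simp

lemma clinear_diff: "clinear f \<Longrightarrow> f (x - y) = f x - f y"
  using clinear_add[of f "x - y" y] by (simp add: algebra_simps)

text \<open>Elements of a quotient space \<open>V/N\<close> are represented by the cosets \<open>v + N\<close>.\<close>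

definition coset :: "'a::cvector set \<Rightarrow> 'a \<Rightarrow> 'a set" where
  "coset N v = (\<lambda>n. v + n) ` N"


section \<open>Tensor product over the complex numbers\<close>

instantiation poly_mapping :: (type, cvector) cvector
begin

lift_definition scaleC_poly_mapping :: "complex \<Rightarrow> ('a \<Rightarrow>\<^sub>0 'b) \<Rightarrow> ('a \<Rightarrow>\<^sub>0 'b)"
  is "\<lambda>c f x. c *\<^sub>C f x"
proof -
  fix c and f :: "'a \<Rightarrow> 'b"
  assume "finite {x. f x \<noteq> 0}"
  then show "finite {x. c *\<^sub>C f x \<noteq> 0}"
    by (rule rev_finite_subset) auto
qed

instance
  by standard
    (transfer; simp add: scaleC_add_right scaleC_add_left scaleC_scaleC scaleC_one fun_eq_iff)+

end

text \<open>\<open>('a \<times> 'b) \<Rightarrow>\<^sub>0 complex\<close> is the free vector space on \<open>'a \<times> 'b\<close>.\<close>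

definition tensor_rels :: "(('a::cvector \<times> 'b::cvector) \<Rightarrow>\<^sub>0 complex) set" where
  "tensor_rels =
     {Poly_Mapping.single (a + a', b) 1 - Poly_Mapping.single (a, b) 1 - Poly_Mapping.single (a', b) 1
        | a a' b. True} \<union>
     {Poly_Mapping.single (a, b + b') 1 - Poly_Mapping.single (a, b) 1 - Poly_Mapping.single (a, b') 1
        | a b b'. True} \<union>
     {Poly_Mapping.single (c *\<^sub>C a, b) 1 - c *\<^sub>C Poly_Mapping.single (a, b) 1 | a b c. True} \<union>
     {Poly_Mapping.single (a, c *\<^sub>C b) 1 - c *\<^sub>C Poly_Mapping.single (a, b) 1 | a b c. True}"

quotient_type (overloaded) ('a, 'b) tensor = "('a::cvector \<times> 'b::cvector) \<Rightarrow>\<^sub>0 complex" /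
  "\<lambda>x y. x - y \<in> cvec.span tensor_rels"
proof (intro equivpI reflpI sympI transpI)
  fix x y z :: "('a::cvector \<times> 'b::cvector) \<Rightarrow>\<^sub>0 complex"
  show "x - x \<in> cvec.span tensor_rels" by (simp add: cvec.span_zero)
  assume *: "x - y \<in> cvec.span tensor_rels"
  show "y - x \<in> cvec.span tensor_rels" using cvec.span_neg[OF *] by simp
  assume "y - z \<in> cvec.span tensor_rels"
  then show "x - z \<in> cvec.span tensor_rels" using cvec.span_add[OF *] by fastforce
qed

instantiation tensor :: (cvector, cvector) cvector
begin

lift_definition zero_tensor :: "('a, 'b) tensor" is 0 .

lift_definition plus_tensor :: "('a, 'b) tensor \<Rightarrow> ('a, 'b) tensor \<Rightarrow> ('a, 'b) tensor" is "(+)"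
  by (metis add_diff_add cvec.span_add)

lift_definition uminus_tensor :: "('a, 'b) tensor \<Rightarrow> ('a, 'b) tensor" is uminus
  by (metis cvec.span_neg minus_diff_minus)

lift_definition minus_tensor :: "('a, 'b) tensor \<Rightarrow> ('a, 'b) tensor \<Rightarrow> ('a, 'b) tensor" is "(-)"
proof -
  fix x y u v :: "('a \<times> 'b) \<Rightarrow>\<^sub>0 complex"
  assume "x - y \<in> cvec.span tensor_rels" "u - v \<in> cvec.span tensor_rels"
  then have "(x - y) - (u - v) \<in> cvec.span tensor_rels" by (rule cvec.span_diff)
  then show "(x - u) - (y - v) \<in> cvec.span tensor_rels" by (simp add: algebra_simps)
qed

lift_definition scaleC_tensor :: "complex \<Rightarrow> ('a, 'b) tensor \<Rightarrow> ('a, 'b) tensor" is "(*\<^sub>C)"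
  by (metis cvec.scale_right_diff_distrib cvec.span_scale)

instance
  by standard
    (transfer; simp add: scaleC_add_right scaleC_add_left scaleC_scaleC scaleC_one
       cvec.span_zero algebra_simps)+

end

lift_definition pure :: "'a::cvector \<Rightarrow> 'b::cvector \<Rightarrow> ('a, 'b) tensor" (infixr "\<otimes>" 72)
  is "\<lambda>a b. Poly_Mapping.single (a, b) 1" .

definition tlift_rep ::
  "('a \<Rightarrow> 'b \<Rightarrow> 'c::cvector) \<Rightarrow> (('a \<times> 'b) \<Rightarrow>\<^sub>0 complex) \<Rightarrow> 'c" where
  "tlift_rep f p = (\<Sum>q\<in>Poly_Mapping.keys p. Poly_Mapping.lookup p q *\<^sub>C f (fst q) (snd q))"

text \<open>The linear map on the tensor product induced by \<open>f\<close>; it is evaluated on a representative,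
  which is harmless for bilinear \<open>f\<close> (lemmas \<open>tlift_pure\<close> and \<open>clinear_tlift\<close> below). Sweedler
  notation is expressed through it.\<close>

definition tlift ::
  "('a::cvector \<Rightarrow> 'b::cvector \<Rightarrow> 'c::cvector) \<Rightarrow> ('a, 'b) tensor \<Rightarrow> 'c" where
  "tlift f t = tlift_rep f (rep_tensor t)"

lemma cbilinear_pure: "cbilinear pure"
  unfolding cbilinear_def
proof (intro conjI allI clinearI)
  fix a a' :: 'a and b b' :: 'b and c
  have "Poly_Mapping.single (a + a', b) 1 -
      (Poly_Mapping.single (a, b) 1 + Poly_Mapping.single (a', b) 1) \<in> cvec.span tensor_rels"
    by (rule cvec.span_base, unfold tensor_rels_def diff_diff_eq) blast
  then show "(a + a') \<otimes> b = a \<otimes> b + a' \<otimes> b" by transfer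
  have "Poly_Mapping.single (a, b + b') 1 -
      (Poly_Mapping.single (a, b) 1 + Poly_Mapping.single (a, b') 1) \<in> cvec.span tensor_rels"
    by (rule cvec.span_base, unfold tensor_rels_def diff_diff_eq) blast
  then show "a \<otimes> (b + b') = a \<otimes> b + a \<otimes> b'" by transfer
  have "Poly_Mapping.single (c *\<^sub>C a, b) 1 - c *\<^sub>C Poly_Mapping.single (a, b) 1
      \<in> cvec.span tensor_rels"
    by (rule cvec.span_base, unfold tensor_rels_def) blast
  then show "(c *\<^sub>C a) \<otimes> b = c *\<^sub>C (a \<otimes> b)" by transfer
  have "Poly_Mapping.single (a, c *\<^sub>C b) 1 - c *\<^sub>C Poly_Mapping.single (a, b) 1
      \<in> cvec.span tensor_rels"
    by (rule cvec.span_base, unfold tensor_rels_def) blast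
  then show "a \<otimes> (c *\<^sub>C b) = c *\<^sub>C (a \<otimes> b)" by transfer
qed

lemma tlift_rep_superset:
  assumes "finite K" "Poly_Mapping.keys p \<subseteq> K"
  shows "tlift_rep f p = (\<Sum>q\<in>K. Poly_Mapping.lookup p q *\<^sub>C f (fst q) (snd q))"
  unfolding tlift_rep_def
  by (rule sum.mono_neutral_left) (use assms in \<open>auto simp: in_keys_iff\<close>)

lemma tlift_rep_add: "tlift_rep f (p + q) = tlift_rep f p + tlift_rep f q"
proof -
  let ?K = "Poly_Mapping.keys p \<union> Poly_Mapping.keys q"
  have "Poly_Mapping.keys (p + q) \<subseteq> ?K" by (rule Poly_Mapping.keys_add)
  then show ?thesis
    by (simp add: tlift_rep_superset[of ?K] lookup_add scaleC_add_left sum.distrib)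
qed

lemma tlift_rep_scale: "tlift_rep f (c *\<^sub>C p) = c *\<^sub>C tlift_rep f p"
proof -
  have l: "Poly_Mapping.lookup (c *\<^sub>C p) x = c * Poly_Mapping.lookup p x" for x
    by transfer (simp add: scaleC_complex_def)
  then have "Poly_Mapping.keys (c *\<^sub>C p) \<subseteq> Poly_Mapping.keys p" by (auto simp: in_keys_iff)
  then show ?thesis
    by (simp add: tlift_rep_superset[of "Poly_Mapping.keys p"] l cvec.scale_sum_right scaleC_scaleC)
qed

lemma clinear_tlift_rep: "clinear (tlift_rep f)"
  by (rule clinearI) (fact tlift_rep_add tlift_rep_scale)+

lemma tlift_rep_single: "tlift_rep f (Poly_Mapping.single (a, b) 1) = f a b"
  by (simp add: tlift_rep_def scaleC_one)

lemma tlift_rep_span: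
  assumes f: "cbilinear f" and p: "p \<in> cvec.span tensor_rels"
  shows "tlift_rep f p = 0"
  using p
proof (induction rule: cvec.span_induct_alt)
  case base
  then show ?case by (simp add: tlift_rep_def)
next
  case (step c x y)
  have l: "clinear (\<lambda>x. f x b)" "clinear (f a)" for a b using f by (auto simp: cbilinear_def)
  have "tlift_rep f x = 0"
    using step(1) unfolding tensor_rels_def
    by (auto simp: clinear_diff[OF clinear_tlift_rep] tlift_rep_scale tlift_rep_single
        clinear_add[OF l(1)] clinear_add[OF l(2)] clinear_scale[OF l(1)] clinear_scale[OF l(2)])
  with step show ?case by (simp add: tlift_rep_add tlift_rep_scale)
qed

lemma tlift_abs:
  assumes "cbilinear f"
  shows "tlift f (abs_tensor p) = tlift_rep f p"
proof -
  have "rep_tensor (abs_tensor p) - p \<in> cvec.span tensor_rels"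
    using Quotient3_rep_abs[OF Quotient3_tensor, of p] by (simp add: cvec.span_zero)
  from tlift_rep_span[OF assms this] show ?thesis
    by (simp add: tlift_def clinear_diff[OF clinear_tlift_rep])
qed

lemma tlift_pure: "cbilinear f \<Longrightarrow> tlift f (a \<otimes> b) = f a b"
  by (simp add: pure.abs_eq tlift_abs tlift_rep_single)

lemma clinear_tlift:
  assumes "cbilinear f"
  shows "clinear (tlift f)"
proof (rule clinearI)
  fix x y :: "('a, 'b) tensor" and c
  obtain p q where "x = abs_tensor p" "y = abs_tensor q"
    by (metis Quotient3_abs_rep[OF Quotient3_tensor])
  then show "tlift f (x + y) = tlift f x + tlift f y" "tlift f (c *\<^sub>C x) = c *\<^sub>C tlift f x"
    by (simp_all add: plus_tensor.abs_eq scaleC_tensor.abs_eq tlift_abs[OF assms]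
        tlift_rep_add tlift_rep_scale)
qed


section \<open>Hopf algebras\<close>

text \<open>\<open>sweedler2 \<Delta> f h\<close> is \<open>f h\<^sub>(\<^sub>1\<^sub>) h\<^sub>(\<^sub>2\<^sub>)\<close> in sumless Sweedler notation, and similarly for
  \<open>sweedler3\<close>, \<open>sweedler4\<close>; the map \<open>f\<close> is multilinear in all uses.\<close>

definition sweedler2 ::
  "('h::cvector \<Rightarrow> ('h, 'h) tensor) \<Rightarrow> ('h \<Rightarrow> 'h \<Rightarrow> 'c::cvector) \<Rightarrow> 'h \<Rightarrow> 'c" where
  "sweedler2 \<Delta> f h = tlift f (\<Delta> h)"

definition sweedler3 ::
  "('h::cvector \<Rightarrow> ('h, 'h) tensor) \<Rightarrow> ('h \<Rightarrow> 'h \<Rightarrow> 'h \<Rightarrow> 'c::cvector) \<Rightarrow> 'h \<Rightarrow> 'c" where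
  "sweedler3 \<Delta> f h = sweedler2 \<Delta> (\<lambda>x h3. sweedler2 \<Delta> (\<lambda>h1 h2. f h1 h2 h3) x) h"

definition sweedler4 ::
  "('h::cvector \<Rightarrow> ('h, 'h) tensor) \<Rightarrow> ('h \<Rightarrow> 'h \<Rightarrow> 'h \<Rightarrow> 'h \<Rightarrow> 'c::cvector) \<Rightarrow> 'h \<Rightarrow> 'c" where
  "sweedler4 \<Delta> f h = sweedler2 \<Delta> (\<lambda>x h4. sweedler3 \<Delta> (\<lambda>h1 h2 h3. f h1 h2 h3 h4) x) h"

locale hopf_algebra =
  fixes \<Delta> :: "'h::calgebra \<Rightarrow> ('h, 'h) tensor"
    and \<epsilon> :: "'h \<Rightarrow> complex"
    and S :: "'h \<Rightarrow> 'h"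
  assumes comult_linear: "clinear \<Delta>"
    and counit_linear: "clinear \<epsilon>"
    and antipode_linear: "clinear S"
    and coassoc: "sweedler2 \<Delta> (\<lambda>x y. sweedler2 \<Delta> (\<lambda>x1 x2. x1 \<otimes> (x2 \<otimes> y)) x) h =
                  sweedler2 \<Delta> (\<lambda>x y. x \<otimes> \<Delta> y) h"
    and counit_left: "sweedler2 \<Delta> (\<lambda>x y. \<epsilon> x *\<^sub>C y) h = h"
    and counit_right: "sweedler2 \<Delta> (\<lambda>x y. \<epsilon> y *\<^sub>C x) h = h"
    and comult_mult: "\<Delta> (h * k) =
          sweedler2 \<Delta> (\<lambda>h1 h2. sweedler2 \<Delta> (\<lambda>k1 k2. (h1 * k1) \<otimes> (h2 * k2)) k) h"
    and comult_one: "\<Delta> 1 = 1 \<otimes> 1"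
    and counit_mult: "\<epsilon> (h * k) = \<epsilon> h * \<epsilon> k"
    and counit_one: "\<epsilon> 1 = 1"
    and antipode_left: "sweedler2 \<Delta> (\<lambda>x y. S x * y) h = \<epsilon> h *\<^sub>C 1"
    and antipode_right: "sweedler2 \<Delta> (\<lambda>x y. x * S y) h = \<epsilon> h *\<^sub>C 1"

definition cocommutative :: "('h::cvector \<Rightarrow> ('h, 'h) tensor) \<Rightarrow> bool" where
  "cocommutative \<Delta> \<longleftrightarrow> (\<forall>h. sweedler2 \<Delta> (\<lambda>h1 h2. h2 \<otimes> h1) h = \<Delta> h)"


section \<open>Crossed products\<close>

text \<open>Linear maps \<open>H \<otimes> B \<rightarrow> B\<close> and \<open>H \<otimes> H \<rightarrow> B\<close> are given as bilinear maps; \<open>\<sigma>'\<close> is the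
  convolution inverse of \<open>\<sigma>\<close>.\<close>

locale crossed_product = hopf_algebra \<Delta> \<epsilon> S
  for \<Delta> :: "'h::calgebra \<Rightarrow> ('h, 'h) tensor" and \<epsilon> S +
  fixes act :: "'h \<Rightarrow> 'b::calgebra \<Rightarrow> 'b"
    and \<sigma> \<sigma>' :: "'h \<Rightarrow> 'h \<Rightarrow> 'b"
  assumes act_bilinear: "cbilinear act"
    and act_unit: "act h 1 = \<epsilon> h *\<^sub>C 1"
    and act_mult: "act h (b * b') = sweedler2 \<Delta> (\<lambda>h1 h2. act h1 b * act h2 b') h"
    and sigma_bilinear: "cbilinear \<sigma>"
    and sigma'_bilinear: "cbilinear \<sigma>'"
    and sigma_right_inverse:
      "sweedler2 \<Delta> (\<lambda>h1 h2. sweedler2 \<Delta> (\<lambda>k1 k2. \<sigma> h1 k1 * \<sigma>' h2 k2) k) h = (\<epsilon> h * \<epsilon> k) *\<^sub>C 1"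
    and sigma_left_inverse:
      "sweedler2 \<Delta> (\<lambda>h1 h2. sweedler2 \<Delta> (\<lambda>k1 k2. \<sigma>' h1 k1 * \<sigma> h2 k2) k) h = (\<epsilon> h * \<epsilon> k) *\<^sub>C 1"
    and one_act: "act 1 b = b"
    and twisted_module: "act h (act k b) =
      sweedler3 \<Delta> (\<lambda>h1 h2 h3. sweedler3 \<Delta> (\<lambda>k1 k2 k3.
        \<sigma> h1 k1 * act (h2 * k2) b * \<sigma>' h3 k3) k) h"
    and sigma_one_right: "\<sigma> h 1 = \<epsilon> h *\<^sub>C 1"
    and sigma_one_left: "\<sigma> 1 h = \<epsilon> h *\<^sub>C 1"
    and sigma_cocycle:
      "sweedler2 \<Delta> (\<lambda>h1 h2. sweedler2 \<Delta> (\<lambda>k1 k2. sweedler2 \<Delta> (\<lambda>m1 m2.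
          act h1 (\<sigma> k1 m1) * \<sigma> h2 (k2 * m2)) m) k) h =
       sweedler2 \<Delta> (\<lambda>h1 h2. sweedler2 \<Delta> (\<lambda>k1 k2. \<sigma> h1 k1 * \<sigma> (h2 * k2) m) k) h"

definition crossed_mult ::
  "('h::calgebra \<Rightarrow> ('h, 'h) tensor) \<Rightarrow> ('h \<Rightarrow> 'b::calgebra \<Rightarrow> 'b) \<Rightarrow> ('h \<Rightarrow> 'h \<Rightarrow> 'b) \<Rightarrow>
   ('b, 'h) tensor \<Rightarrow> ('b, 'h) tensor \<Rightarrow> ('b, 'h) tensor" where
  "crossed_mult \<Delta> act \<sigma> x y =
     tlift (\<lambda>b h. tlift (\<lambda>b' h'.
       sweedler3 \<Delta> (\<lambda>h1 h2 h3. sweedler2 \<Delta> (\<lambda>k1 k2.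
         (b * act h1 b' * \<sigma> h2 k1) \<otimes> (h3 * k2)) h') h) y) x"

definition smash_mult ::
  "('h::calgebra \<Rightarrow> ('h, 'h) tensor) \<Rightarrow> ('h \<Rightarrow> 'b::calgebra \<Rightarrow> 'b) \<Rightarrow>
   ('b, 'h) tensor \<Rightarrow> ('b, 'h) tensor \<Rightarrow> ('b, 'h) tensor" where
  "smash_mult \<Delta> act x y =
     tlift (\<lambda>b h. tlift (\<lambda>b' g.
       sweedler2 \<Delta> (\<lambda>h1 h2. (b * act h1 b') \<otimes> (h2 * g)) h) y) x"

text \<open>A right \<open>H\<close>-comodule algebra \<open>A\<close> on the vector space \<open>'a\<close>, together with an identification
  \<open>ext_emb\<close> of the algebra \<open>B\<close> with the coinvariant subalgebra of \<open>A\<close>.\<close>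

record (overloaded) ('a, 'b, 'h) extension =
  ext_mul :: "'a \<Rightarrow> 'a \<Rightarrow> 'a"
  ext_one :: 'a
  ext_coact :: "'a \<Rightarrow> ('a, 'h) tensor"
  ext_emb :: "'b \<Rightarrow> 'a"

definition crossed_extension ::
  "('h::calgebra \<Rightarrow> ('h, 'h) tensor) \<Rightarrow> ('h \<Rightarrow> 'b::calgebra \<Rightarrow> 'b) \<Rightarrow> ('h \<Rightarrow> 'h \<Rightarrow> 'b) \<Rightarrow>
   (('b, 'h) tensor, 'b, 'h) extension" where
  "crossed_extension \<Delta> act \<sigma> =
    \<lparr>ext_mul = crossed_mult \<Delta> act \<sigma>,
     ext_one = 1 \<otimes> 1,
     ext_coact = tlift (\<lambda>b. sweedler2 \<Delta> (\<lambda>h1 h2. (b \<otimes> h1) \<otimes> h2)),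
     ext_emb = (\<lambda>b. b \<otimes> 1)\<rparr>"

definition smash_extension ::
  "('h::calgebra \<Rightarrow> ('h, 'h) tensor) \<Rightarrow> ('h \<Rightarrow> 'b::calgebra \<Rightarrow> 'b) \<Rightarrow>
   (('b, 'h) tensor, 'b, 'h) extension" where
  "smash_extension \<Delta> act =
    \<lparr>ext_mul = smash_mult \<Delta> act,
     ext_one = 1 \<otimes> 1,
     ext_coact = tlift (\<lambda>b. sweedler2 \<Delta> (\<lambda>h1 h2. (b \<otimes> h1) \<otimes> h2)),
     ext_emb = (\<lambda>b. b \<otimes> 1)\<rparr>"


section \<open>Balanced tensor products\<close>

text \<open>For subspaces \<open>M\<close>, \<open>N\<close> with a right action \<open>r\<close> on \<open>M\<close> and a left action \<open>l\<close> on \<open>N\<close> of \<open>'b\<close>,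
  the balanced tensor product of \<open>M\<close> and \<open>N\<close> is the quotient of the complex tensor product of
  \<open>M\<close> and \<open>N\<close> (which is the subspace \<open>tensor_span M N\<close> of the ambient tensor product) by
  \<open>balancing M N r l\<close>. Its elements are cosets.\<close>

definition tensor_span :: "'u::cvector set \<Rightarrow> 'v::cvector set \<Rightarrow> ('u, 'v) tensor set" where
  "tensor_span M N = cvec.span {x \<otimes> y | x y. x \<in> M \<and> y \<in> N}"

definition balancing ::
  "'u::cvector set \<Rightarrow> 'v::cvector set \<Rightarrow> ('u \<Rightarrow> 'b \<Rightarrow> 'u) \<Rightarrow> ('b \<Rightarrow> 'v \<Rightarrow> 'v) \<Rightarrow>
   ('u, 'v) tensor set" where
  "balancing M N r l = cvec.span {r x b \<otimes> y - x \<otimes> l b y | x b y. x \<in> M \<and> y \<in> N}"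

definition balanced_tensor ::
  "'u::cvector set \<Rightarrow> 'v::cvector set \<Rightarrow> ('u \<Rightarrow> 'b \<Rightarrow> 'u) \<Rightarrow> ('b \<Rightarrow> 'v \<Rightarrow> 'v) \<Rightarrow>
   ('u, 'v) tensor set set" where
  "balanced_tensor M N r l = coset (balancing M N r l) ` tensor_span M N"


section \<open>Left bialgebroids\<close>

text \<open>\<open>src\<close> and \<open>tgt\<close> determine the algebra map from \<open>B \<otimes> B\<^sup>o\<^sup>p\<close> by
  \<open>\<eta> (b \<otimes> b') = src b \<cdot> tgt b'\<close>. The values of \<open>comul\<close> are cosets, i.e. elements of the balanced tensor
  product over \<open>B\<close>.\<close>

record (overloaded) ('b, 'l) bialgebroid =
  bcar :: "'l set"
  bmul :: "'l \<Rightarrow> 'l \<Rightarrow> 'l"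
  bone :: 'l
  src :: "'b \<Rightarrow> 'l"
  tgt :: "'b \<Rightarrow> 'l"
  comul :: "'l \<Rightarrow> ('l, 'l) tensor set"
  counit :: "'l \<Rightarrow> 'b"

definition eta :: "('b, 'l) bialgebroid \<Rightarrow> 'b \<Rightarrow> 'b \<Rightarrow> 'l" where
  "eta L b b' = bmul L (src L b) (tgt L b')"

text \<open>The bimodule structure is \<open>b \<triangleright> a \<triangleleft> b' = src b \<cdot> tgt b' \<cdot> a\<close>.\<close>

definition bbalancing :: "('b::calgebra, 'l::cvector) bialgebroid \<Rightarrow> ('l, 'l) tensor set" where
  "bbalancing L =
     balancing (bcar L) (bcar L) (\<lambda>x b. bmul L (tgt L b) x) (\<lambda>b y. bmul L (src L b) y)"

definition btensor :: "('b::calgebra, 'l::cvector) bialgebroid \<Rightarrow> ('l, 'l) tensor set set" where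
  "btensor L =
     balanced_tensor (bcar L) (bcar L) (\<lambda>x b. bmul L (tgt L b) x) (\<lambda>b y. bmul L (src L b) y)"

definition bclass ::
  "('b::calgebra, 'l::cvector) bialgebroid \<Rightarrow> ('l, 'l) tensor \<Rightarrow> ('l, 'l) tensor set" where
  "bclass L z = coset (bbalancing L) z"

definition bbalancing3 ::
  "('b::calgebra, 'l::cvector) bialgebroid \<Rightarrow> ('l, ('l, 'l) tensor) tensor set" where
  "bbalancing3 L = cvec.span
     ({bmul L (tgt L b) x \<otimes> (y \<otimes> z) - x \<otimes> (bmul L (src L b) y \<otimes> z)
        | b x y z. x \<in> bcar L \<and> y \<in> bcar L \<and> z \<in> bcar L} \<union>
      {x \<otimes> (bmul L (tgt L b) y \<otimes> z) - x \<otimes> (y \<otimes> bmul L (src L b) z)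
        | b x y z. x \<in> bcar L \<and> y \<in> bcar L \<and> z \<in> bcar L})"

text \<open>A list of pairs \<open>(a\<^sub>(\<^sub>1\<^sub>), a\<^sub>(\<^sub>2\<^sub>))\<close> of elements of the carrier whose sum of simple tensors represents
  \<open>\<Delta>(a)\<close>, and a list of triples representing the iterated coproduct. The representatives are
  chosen arbitrarily; every expression summed over these lists below descends to the
  balanced tensor product (this uses the preceding axioms of a bialgebroid or of a cocycle), so
  that it does not depend on the choice.\<close>

definition cop :: "('b::calgebra, 'l::cvector) bialgebroid \<Rightarrow> 'l \<Rightarrow> ('l \<times> 'l) list" where
  "cop L a = (SOME xs. set xs \<subseteq> bcar L \<times> bcar L \<and> (\<Sum>(x, y)\<leftarrow>xs. x \<otimes> y) \<in> comul L a)"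

definition cop3 :: "('b::calgebra, 'l::cvector) bialgebroid \<Rightarrow> 'l \<Rightarrow> ('l \<times> 'l \<times> 'l) list" where
  "cop3 L a = [(x1, x2, y). (x, y) \<leftarrow> cop L a, (x1, x2) \<leftarrow> cop L x]"

definition linear_on :: "'u::cvector set \<Rightarrow> ('u \<Rightarrow> 'v::cvector) \<Rightarrow> bool" where
  "linear_on V f \<longleftrightarrow>
     (\<forall>x\<in>V. \<forall>y\<in>V. f (x + y) = f x + f y) \<and> (\<forall>c. \<forall>x\<in>V. f (c *\<^sub>C x) = c *\<^sub>C f x)"

definition algebra_on :: "'l::cvector set \<Rightarrow> ('l \<Rightarrow> 'l \<Rightarrow> 'l) \<Rightarrow> 'l \<Rightarrow> bool" where
  "algebra_on V m u \<longleftrightarrow>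
     cvec.subspace V \<and> u \<in> V \<and>
     (\<forall>x\<in>V. \<forall>y\<in>V. m x y \<in> V) \<and>
     (\<forall>x\<in>V. linear_on V (m x)) \<and> (\<forall>y\<in>V. linear_on V (\<lambda>x. m x y)) \<and>
     (\<forall>x\<in>V. \<forall>y\<in>V. \<forall>z\<in>V. m (m x y) z = m x (m y z)) \<and>
     (\<forall>x\<in>V. m u x = x \<and> m x u = x)"

locale left_bialgebroid =
  fixes L :: "('b::calgebra, 'l::cvector) bialgebroid"
  assumes algebra: "algebra_on (bcar L) (bmul L) (bone L)"
    and src_closed: "src L b \<in> bcar L"
    and tgt_closed: "tgt L b \<in> bcar L"
    and src_linear: "clinear (src L)"
    and tgt_linear: "clinear (tgt L)"
    and src_one: "src L 1 = bone L"
    and tgt_one: "tgt L 1 = bone L"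
    and src_mult: "src L (b * b') = bmul L (src L b) (src L b')"
    and tgt_mult: "tgt L (b * b') = bmul L (tgt L b') (tgt L b)"
    and src_tgt_commute: "bmul L (src L b) (tgt L b') = bmul L (tgt L b') (src L b)"
    \<comment> \<open>coring structure\<close>
    and comul_closed: "a \<in> bcar L \<Longrightarrow> comul L a \<in> btensor L"
    and comul_add: "a \<in> bcar L \<Longrightarrow> a' \<in> bcar L \<Longrightarrow>
      comul L (a + a') = bclass L ((\<Sum>(x, y)\<leftarrow>cop L a. x \<otimes> y) + (\<Sum>(x, y)\<leftarrow>cop L a'. x \<otimes> y))"
    and comul_scale: "a \<in> bcar L \<Longrightarrow>
      comul L (c *\<^sub>C a) = bclass L (c *\<^sub>C (\<Sum>(x, y)\<leftarrow>cop L a. x \<otimes> y))"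
    and comul_bimodule: "a \<in> bcar L \<Longrightarrow>
      comul L (bmul L (eta L b b') a) =
        bclass L (\<Sum>(x, y)\<leftarrow>cop L a. bmul L (src L b) x \<otimes> bmul L (tgt L b') y)"
    and counit_linear: "linear_on (bcar L) (counit L)"
    and counit_bimodule: "a \<in> bcar L \<Longrightarrow>
      counit L (bmul L (eta L b b') a) = b * counit L a * b'"
    and comul_coassoc: "a \<in> bcar L \<Longrightarrow>
      (\<Sum>(x, y)\<leftarrow>cop L a. \<Sum>(x1, x2)\<leftarrow>cop L x. x1 \<otimes> (x2 \<otimes> y)) -
      (\<Sum>(x, y)\<leftarrow>cop L a. \<Sum>(y1, y2)\<leftarrow>cop L y. x \<otimes> (y1 \<otimes> y2)) \<in> bbalancing3 L"
    and comul_counit_left: "a \<in> bcar L \<Longrightarrow>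
      (\<Sum>(x, y)\<leftarrow>cop L a. bmul L (src L (counit L x)) y) = a"
    and comul_counit_right: "a \<in> bcar L \<Longrightarrow>
      (\<Sum>(x, y)\<leftarrow>cop L a. bmul L (tgt L (counit L y)) x) = a"
    \<comment> \<open>the coproduct corestricts to an algebra map into the Takeuchi product\<close>
    and comul_takeuchi: "a \<in> bcar L \<Longrightarrow>
      bclass L (\<Sum>(x, y)\<leftarrow>cop L a. bmul L x (tgt L b) \<otimes> y) =
      bclass L (\<Sum>(x, y)\<leftarrow>cop L a. x \<otimes> bmul L y (src L b))"
    and comul_one: "comul L (bone L) = bclass L (bone L \<otimes> bone L)"
    and comul_mult: "a \<in> bcar L \<Longrightarrow> a' \<in> bcar L \<Longrightarrow>
      comul L (bmul L a a') =
        bclass L (\<Sum>(x, y)\<leftarrow>cop L a. \<Sum>(x', y')\<leftarrow>cop L a'. bmul L x x' \<otimes> bmul L y y')"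
    and counit_one: "counit L (bone L) = 1"
    and counit_src: "a \<in> bcar L \<Longrightarrow> counit L (bmul L (src L b) a) = b * counit L a"
    and counit_mult_src: "a \<in> bcar L \<Longrightarrow> a' \<in> bcar L \<Longrightarrow>
      counit L (bmul L a (src L (counit L a'))) = counit L (bmul L a a')"
    and counit_mult_tgt: "a \<in> bcar L \<Longrightarrow> a' \<in> bcar L \<Longrightarrow>
      counit L (bmul L a (tgt L (counit L a'))) = counit L (bmul L a a')"

definition bialgebroid_morphism ::
  "('b::calgebra, 'l::cvector) bialgebroid \<Rightarrow> ('b, 'm::cvector) bialgebroid \<Rightarrow>
   ('l \<Rightarrow> 'm) \<Rightarrow> bool" where
  "bialgebroid_morphism L M \<phi> \<longleftrightarrow>
     \<phi> ` bcar L \<subseteq> bcar M \<and> linear_on (bcar L) \<phi> \<and>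
     (\<forall>a\<in>bcar L. \<forall>b b'. \<phi> (bmul L (eta L b b') a) = bmul M (eta M b b') (\<phi> a)) \<and>
     (\<forall>a\<in>bcar L. comul M (\<phi> a) = bclass M (\<Sum>(x, y)\<leftarrow>cop L a. \<phi> x \<otimes> \<phi> y)) \<and>
     (\<forall>a\<in>bcar L. counit M (\<phi> a) = counit L a) \<and>
     (\<forall>a\<in>bcar L. \<forall>a'\<in>bcar L. \<phi> (bmul L a a') = bmul M (\<phi> a) (\<phi> a')) \<and>
     \<phi> (bone L) = bone M"

definition bialgebroid_iso ::
  "('b::calgebra, 'l::cvector) bialgebroid \<Rightarrow> ('b, 'm::cvector) bialgebroid \<Rightarrow>
   ('l \<Rightarrow> 'm) \<Rightarrow> bool" where
  "bialgebroid_iso L M \<phi> \<longleftrightarrow>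
     left_bialgebroid L \<and> left_bialgebroid M \<and>
     bialgebroid_morphism L M \<phi> \<and> bij_betw \<phi> (bcar L) (bcar M)"


section \<open>Cocycles and twists\<close>

text \<open>Elements of \<open>\<^sub>BHom\<^sub>B(L \<otimes> L, B)\<close>, the tensor product being balanced over \<open>B \<otimes> B\<^sup>o\<^sup>p\<close>, as bilinear
  functions on the carrier.\<close>

definition bihom :: "('b::calgebra, 'l::cvector) bialgebroid \<Rightarrow> ('l \<Rightarrow> 'l \<Rightarrow> 'b) \<Rightarrow> bool" where
  "bihom L f \<longleftrightarrow>
     (\<forall>a\<in>bcar L. linear_on (bcar L) (f a)) \<and>
     (\<forall>a'\<in>bcar L. linear_on (bcar L) (\<lambda>a. f a a')) \<and>
     (\<forall>a\<in>bcar L. \<forall>a'\<in>bcar L. \<forall>b b'.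
        f (bmul L a (eta L b b')) a' = f a (bmul L (eta L b b') a')) \<and>
     (\<forall>a\<in>bcar L. \<forall>a'\<in>bcar L. \<forall>b b'.
        f (bmul L (eta L b b') a) a' = b * f a a' * b')"

definition conv ::
  "('b::calgebra, 'l::cvector) bialgebroid \<Rightarrow> ('l \<Rightarrow> 'l \<Rightarrow> 'b) \<Rightarrow> ('l \<Rightarrow> 'l \<Rightarrow> 'b) \<Rightarrow>
   'l \<Rightarrow> 'l \<Rightarrow> 'b" where
  "conv L f g a a' = (\<Sum>(x, y)\<leftarrow>cop L a. \<Sum>(x', y')\<leftarrow>cop L a'. f x x' * g y y')"

definition is_conv_inverse ::
  "('b::calgebra, 'l::cvector) bialgebroid \<Rightarrow> ('l \<Rightarrow> 'l \<Rightarrow> 'b) \<Rightarrow> ('l \<Rightarrow> 'l \<Rightarrow> 'b) \<Rightarrow> bool" where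
  "is_conv_inverse L f g \<longleftrightarrow> bihom L g \<and>
     (\<forall>a\<in>bcar L. \<forall>a'\<in>bcar L. conv L f g a a' = counit L (bmul L a a') \<and>
        conv L g f a a' = counit L (bmul L a a'))"

text \<open>The inverse is unique on the carrier.\<close>

definition conv_inverse ::
  "('b::calgebra, 'l::cvector) bialgebroid \<Rightarrow> ('l \<Rightarrow> 'l \<Rightarrow> 'b) \<Rightarrow> 'l \<Rightarrow> 'l \<Rightarrow> 'b" where
  "conv_inverse L f = (SOME g. is_conv_inverse L f g)"

text \<open>\<open>s(f(a\<^sub>(\<^sub>1\<^sub>), a'\<^sub>(\<^sub>1\<^sub>))) a\<^sub>(\<^sub>2\<^sub>) a'\<^sub>(\<^sub>2\<^sub>)\<close>\<close>

definition left_twisted_mult ::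
  "('b::calgebra, 'l::cvector) bialgebroid \<Rightarrow> ('l \<Rightarrow> 'l \<Rightarrow> 'b) \<Rightarrow> 'l \<Rightarrow> 'l \<Rightarrow> 'l" where
  "left_twisted_mult L f a a' =
     (\<Sum>(x, y)\<leftarrow>cop L a. \<Sum>(x', y')\<leftarrow>cop L a'. bmul L (src L (f x x')) (bmul L y y'))"

definition invertible_normalised_2cocycle ::
  "('b::calgebra, 'l::cvector) bialgebroid \<Rightarrow> ('l \<Rightarrow> 'l \<Rightarrow> 'b) \<Rightarrow> bool" where
  "invertible_normalised_2cocycle L f \<longleftrightarrow>
     left_bialgebroid L \<and> bihom L f \<and> (\<exists>g. is_conv_inverse L f g) \<and>
     (\<forall>a\<in>bcar L. \<forall>a'\<in>bcar L. \<forall>a''\<in>bcar L.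
        f a (left_twisted_mult L f a' a'') = f (left_twisted_mult L f a a') a'') \<and>
     (\<forall>a\<in>bcar L. f (bone L) a = counit L a \<and> f a (bone L) = counit L a)"

definition twist ::
  "('b::calgebra, 'l::cvector) bialgebroid \<Rightarrow> ('l \<Rightarrow> 'l \<Rightarrow> 'b) \<Rightarrow> ('b, 'l) bialgebroid" where
  "twist L f = L\<lparr>bmul := (\<lambda>a a'.
     \<Sum>(a1, a2, a3)\<leftarrow>cop3 L a. \<Sum>(a1', a2', a3')\<leftarrow>cop3 L a'.
       bmul L (src L (f a1 a1'))
         (bmul L (tgt L (conv_inverse L f a3 a3')) (bmul L a2 a2')))\<rparr>"


section \<open>The Ehresmann--Schauenburg bialgebroid\<close>

text \<open>Below, \<open>A\<close> denotes the algebra of the extension \<open>E\<close> and \<open>B\<close> its subalgebra of coinvariants.\<close>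

definition ext_balancing ::
  "('a::cvector, 'b::calgebra, 'h::cvector) extension \<Rightarrow> ('a, 'a) tensor set" where
  "ext_balancing E =
     balancing UNIV UNIV (\<lambda>a b. ext_mul E a (ext_emb E b)) (\<lambda>b a. ext_mul E (ext_emb E b) a)"

text \<open>\<open>A \<otimes>\<^sub>B A\<close>\<close>

definition ext_tensor ::
  "('a::cvector, 'b::calgebra, 'h::cvector) extension \<Rightarrow> ('a, 'a) tensor set set" where
  "ext_tensor E =
     balanced_tensor UNIV UNIV (\<lambda>a b. ext_mul E a (ext_emb E b)) (\<lambda>b a. ext_mul E (ext_emb E b) a)"

text \<open>The canonical map \<open>\<chi>\<close>, computed on any representative of the coset.\<close>

definition canonical_map ::
  "('a::cvector, 'b::calgebra, 'h::cvector) extension \<Rightarrow> ('a, 'a) tensor set \<Rightarrow> ('a, 'h) tensor" where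
  "canonical_map E X =
     tlift (\<lambda>a a'. tlift (\<lambda>a0 a1. ext_mul E a a0 \<otimes> a1) (ext_coact E a')) (SOME x. x \<in> X)"

text \<open>The translation map \<open>\<tau>\<close>; for a Hopf Galois extension \<open>\<chi>\<close> is bijective.\<close>

definition translation_map ::
  "('a::cvector, 'b::calgebra, 'h::cvector) extension \<Rightarrow> 'h \<Rightarrow> ('a, 'a) tensor set" where
  "translation_map E h = inv_into (ext_tensor E) (canonical_map E) (ext_one E \<otimes> h)"

text \<open>A linear choice of representatives of \<open>\<tau>(h)\<close> in \<open>A \<otimes> A\<close>; only its classes modulo
  \<open>ext_balancing E\<close> matter.\<close>

definition translation_rep ::
  "('a::cvector, 'b::calgebra, 'h::cvector) extension \<Rightarrow> 'h \<Rightarrow> ('a, 'a) tensor" where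
  "translation_rep E = (SOME f. clinear f \<and> (\<forall>h. f h \<in> translation_map E h))"

text \<open>The condition \<open>a\<^sub>(\<^sub>0\<^sub>) \<otimes> \<tau>(a\<^sub>(\<^sub>1\<^sub>)) a' = a \<otimes> a' \<otimes>\<^sub>B 1\<close> in \<open>A \<otimes> (A \<otimes>\<^sub>B A)\<close>, which is the quotient of
  \<open>A \<otimes> (A \<otimes> A)\<close> by the span of \<open>a \<otimes> n\<close> with \<open>n\<close> in \<open>ext_balancing E\<close>.\<close>

definition es_carrier ::
  "('a::cvector, 'b::calgebra, 'h::cvector) extension \<Rightarrow> ('a, 'a) tensor set" where
  "es_carrier E = {x.
     tlift (\<lambda>a a'. tlift (\<lambda>a0 a1.
       a0 \<otimes> tlift (\<lambda>u v. u \<otimes> ext_mul E v a') (translation_rep E a1)) (ext_coact E a)) x -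
     tlift (\<lambda>a a'. a \<otimes> (a' \<otimes> ext_one E)) x
     \<in> cvec.span {a \<otimes> n | a n. n \<in> ext_balancing E}}"

definition es_mult ::
  "('a::cvector, 'b::calgebra, 'h::cvector) extension \<Rightarrow>
   ('a, 'a) tensor \<Rightarrow> ('a, 'a) tensor \<Rightarrow> ('a, 'a) tensor" where
  "es_mult E x y = tlift (\<lambda>a c. tlift (\<lambda>a' c'. ext_mul E a a' \<otimes> ext_mul E c' c) y) x"

definition es_src ::
  "('a::cvector, 'b::calgebra, 'h::cvector) extension \<Rightarrow> 'b \<Rightarrow> ('a, 'a) tensor" where
  "es_src E b = ext_emb E b \<otimes> ext_one E"

definition es_tgt ::
  "('a::cvector, 'b::calgebra, 'h::cvector) extension \<Rightarrow> 'b \<Rightarrow> ('a, 'a) tensor" where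
  "es_tgt E b = ext_one E \<otimes> ext_emb E b"

text \<open>The coproduct \<open>\<Delta>(a \<otimes> a') = a\<^sub>(\<^sub>0\<^sub>) \<otimes> \<tau>(a\<^sub>(\<^sub>1\<^sub>)) \<otimes> a'\<close> is a priori an element of
  \<open>A \<otimes> (A \<otimes>\<^sub>B A) \<otimes> A = (A \<otimes> A) \<otimes>\<^sub>B (A \<otimes> A)\<close>, a quotient of \<open>(A \<otimes> A) \<otimes> (A \<otimes> A)\<close>; as an element of the balanced
  tensor product of the carrier \<open>C\<close> with itself it is the unique preimage under the
  map induced by the inclusion of \<open>C\<close> in \<open>A \<otimes> A\<close>, which is injective when \<open>A\<close> is flat over \<open>B\<close>.\<close>

definition es_comul ::
  "('a::cvector, 'b::calgebra, 'h::cvector) extension \<Rightarrow>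
   ('a, 'a) tensor \<Rightarrow> (('a, 'a) tensor, ('a, 'a) tensor) tensor set" where
  "es_comul E x = (THE Z.
     Z \<in> balanced_tensor (es_carrier E) (es_carrier E)
           (\<lambda>u b. es_mult E (es_tgt E b) u) (\<lambda>b u. es_mult E (es_src E b) u) \<and>
     Z \<subseteq> coset
           (balancing UNIV UNIV (\<lambda>u b. es_mult E (es_tgt E b) u) (\<lambda>b u. es_mult E (es_src E b) u))
           (tlift (\<lambda>a a'. tlift (\<lambda>a0 a1. tlift (\<lambda>u v. (a0 \<otimes> u) \<otimes> (v \<otimes> a'))
              (translation_rep E a1)) (ext_coact E a)) x))"

definition es_counit ::
  "('a::cvector, 'b::calgebra, 'h::cvector) extension \<Rightarrow> ('a, 'a) tensor \<Rightarrow> 'b" where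
  "es_counit E x = inv_into UNIV (ext_emb E) (tlift (ext_mul E) x)"

definition ES ::
  "('a::cvector, 'b::calgebra, 'h::cvector) extension \<Rightarrow> ('b, ('a, 'a) tensor) bialgebroid" where
  "ES E = \<lparr>bcar = es_carrier E, bmul = es_mult E, bone = ext_one E \<otimes> ext_one E,
     src = es_src E, tgt = es_tgt E, comul = es_comul E, counit = es_counit E\<rparr>"

text \<open>The elements \<open>b # h\<^sub>(\<^sub>1\<^sub>) \<otimes> b' # S(h\<^sub>(\<^sub>2\<^sub>))\<close>, which span the bialgebroid of \<open>B # H\<close>.\<close>

definition es_gen ::
  "('h::calgebra \<Rightarrow> ('h, 'h) tensor) \<Rightarrow> ('h \<Rightarrow> 'h) \<Rightarrow> 'b::calgebra \<Rightarrow> 'b \<Rightarrow> 'h \<Rightarrow>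
   (('b, 'h) tensor, ('b, 'h) tensor) tensor" where
  "es_gen \<Delta> S b b' h = sweedler2 \<Delta> (\<lambda>h1 h2. (b \<otimes> h1) \<otimes> (b' \<otimes> S h2)) h"

end

theory Submission
  imports Defs
begin

text \<open>
  Over a cocommutative coalgebra \<open>X\<close> the coalgebra maps \<open>X \<rightarrow> H\<close> (``points'') form a group under
  convolution, and convolution products behave as if \<open>X\<close> were spanned by group-like elements. As a
  linear map \<open>X \<rightarrow> B\<close> may be substituted for an element of \<open>B\<close>, an identity between Sweedler expressions
  reduces to the one-line computation in which every element of \<open>H\<close> is group-like.

  Since \<open>\<sigma>\<close> is central, \<open>b \<otimes> b' \<otimes> h \<mapsto> (b # h\<^sub>1) \<otimes> \<gamma>\<^sup>-\<^sup>1(h\<^sub>2) b'\<close>, where \<open>\<gamma>\<^sup>-\<^sup>1\<close> is the convolution inverse of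
  \<open>\<gamma>(h) = 1 # h\<close>, identifies \<open>B \<otimes> B \<otimes> H\<close> with the Ehresmann--Schauenburg bialgebroid of \<open>B #\<^sub>\<sigma> H\<close>. In these
  coordinates the coring structure does not involve \<open>\<sigma>\<close>, and the product of \<open>b \<otimes> b' \<otimes> h\<close> and \<open>c \<otimes> c' \<otimes> g\<close> is
  \<open>b (h\<^sub>1 \<rhd> c) \<sigma>(h\<^sub>2, g\<^sub>1) \<otimes> \<sigma>\<^sup>-\<^sup>1(h\<^sub>3, g\<^sub>2) (h\<^sub>4 \<rhd> c') b' \<otimes> h\<^sub>5 g\<^sub>3\<close>. The smash product is the case of the trivial
  cocycle; twisting its bialgebroid by \<open>b (h\<^sub>1 \<rhd> c) \<sigma>(h\<^sub>2, g) (h\<^sub>3 \<rhd> c') b'\<close> multiplies the two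
  tensor factors by \<open>\<sigma>\<close> and \<open>\<sigma>\<^sup>-\<^sup>1\<close>, which gives the product for \<open>\<sigma>\<close>. Hence \<open>\<phi>\<close> is the identity in coordinates.
\<close>

section \<open>Linear algebra of tensor products\<close>

text \<open>Three points need an argument. Centrality of \<sigma> turns the twisted module law into
  an honest action, because the two values of \<sigma> cancel; only then is the smash product the
  crossed product of the trivial cocycle. It is used again to move \<sigma> past the action in the
  associativity and cocycle computations. Second, coproducts are cosets, and \<open>cop\<close> and
  \<open>translation_rep\<close> choose arbitrary representatives. Sums over them are replaced by
  explicit ones; this is legitimate when the summand is balanced, and for two arguments it also
  takes the Takeuchi property, which shifts scalars from the second coproduct to the first.
  Congruence modulo balancing is decided by a normal form that pushes the B-component of the right
  factor into the left one, and the same device shows that the coproduct of the carrier is well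
  defined. Third, the convolution inverse in the twist is only chosen, so it must be shown unique: a
  balanced form is determined by its values on 1 \<otimes> 1 \<otimes> H, and there the usual
  argument in a convolution algebra applies.\<close>

lemma tensor_induct [case_names pure add]:
  fixes t :: "('a::cvector, 'b::cvector) tensor"
  assumes pure: "\<And>a b. P (a \<otimes> b)" and add: "\<And>x y. P x \<Longrightarrow> P y \<Longrightarrow> P (x + y)"
  shows "P t"
proof -
  obtain p where t: "t = abs_tensor p"
    by (metis Quotient3_abs_rep[OF Quotient3_tensor])
  have "P (abs_tensor p)"
  proof (induction p rule: Poly_Mapping.update_induct)
    case const
    have "0 \<otimes> 0 = (0::('a, 'b) tensor)"
      using cbilinear_pure clinear_zero unfolding cbilinear_def by blast
    then show ?case using pure[of 0 0] by (simp add: zero_tensor.abs_eq)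
  next
    case (update f a b)
    obtain u v where a: "a = (u, v)" by (cases a)
    have "Poly_Mapping.update a b f = f + b *\<^sub>C Poly_Mapping.single a 1"
      using update(1)
      by transfer (auto simp: fun_eq_iff scaleC_complex_def when_def)
    then have "abs_tensor (Poly_Mapping.update a b f) = abs_tensor f + b *\<^sub>C (u \<otimes> v)"
      by (simp add: plus_tensor.abs_eq scaleC_tensor.abs_eq pure.abs_eq a)
    \<comment> \<open>The coefficient is absorbed into the left factor, so the new summand is again
      pure; sums of pure tensors therefore exhaust the tensor product.\<close>
    also have "b *\<^sub>C (u \<otimes> v) = (b *\<^sub>C u) \<otimes> v"
      using cbilinear_pure clinear_scale unfolding cbilinear_def by metis
    finally show ?case using add[OF update(3) pure] by metis
  qed
  then show ?thesis by (simp add: t)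
qed

lemma cbilinearI:
  assumes "\<And>y. clinear (\<lambda>x. f x y)" "\<And>x. clinear (f x)"
  shows "cbilinear f"
  using assms by (simp add: cbilinear_def)

lemma cbilinear_left: "cbilinear f \<Longrightarrow> clinear (\<lambda>x. f x y)"
  and cbilinear_right: "cbilinear f \<Longrightarrow> clinear (f x)"
  by (simp_all add: cbilinear_def)

lemma clinear_id [simp]: "clinear (\<lambda>x. x)"
  by (rule clinearI) simp_all

lemma clinear_compose: "clinear f \<Longrightarrow> clinear g \<Longrightarrow> clinear (\<lambda>x. f (g x))"
  by (rule clinearI) (simp_all add: clinear_add clinear_scale)

lemma clinear_scaleC [simp]: "clinear f \<Longrightarrow> clinear (\<lambda>x. c *\<^sub>C f x)"
  by (rule clinearI) (simp_all add: clinear_add clinear_scale scaleC_add_right scaleC_scaleC mult.commute)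

lemma clinear_minus: "clinear f \<Longrightarrow> clinear g \<Longrightarrow> clinear (\<lambda>x. f x - g x)"
  by (rule clinearI) (simp_all add: clinear_add clinear_scale scaleC_add_right cvec.scale_right_diff_distrib algebra_simps)

lemma cbilinear_compose:
  assumes "cbilinear m" "clinear f" "clinear g"
  shows "cbilinear (\<lambda>x y. m (f x) (g y))"
  by (rule cbilinearI)
    (rule clinear_compose[OF cbilinear_left[OF assms(1)] assms(2)],
     rule clinear_compose[OF cbilinear_right[OF assms(1)] assms(3)])

lemma cbilinear_post: "clinear f \<Longrightarrow> cbilinear m \<Longrightarrow> cbilinear (\<lambda>x y. f (m x y))"
  by (rule cbilinearI)
    (erule clinear_compose[OF _ cbilinear_left], assumption, erule clinear_compose[OF _ cbilinear_right], assumption)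

lemma cbilinear_flip: "cbilinear m \<Longrightarrow> cbilinear (\<lambda>x y. m y x)"
  by (simp add: cbilinear_def)

lemma cbilinear_mult: "cbilinear ((*) :: 'a::calgebra \<Rightarrow> 'a \<Rightarrow> 'a)"
  by (intro cbilinearI clinearI) (simp_all add: scaleC_mult_left scaleC_mult_right algebra_simps)

lemma cbilinear_scaleC: "cbilinear scaleC"
  by (intro cbilinearI clinearI)
    (simp_all add: scaleC_add_left scaleC_add_right scaleC_scaleC scaleC_complex_def mult.commute)

lemma tensor_ext:
  assumes "clinear f" "clinear g" "\<And>a b. f (a \<otimes> b) = g (a \<otimes> b)"
  shows "f t = g t"
  by (induction t rule: tensor_induct) (simp_all add: assms clinear_add[OF assms(1)] clinear_add[OF assms(2)])

text \<open>\<open>tlift\<close> evaluates on a fixed representative of \<open>t\<close>, that is,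
  as a fixed finite combination of values of \<open>F x\<close>; linearity in the parameter is
  inherited from each value.\<close>

lemma clinear_tlift_param:
  assumes "\<And>u v. clinear (\<lambda>x. F x u v)"
  shows "clinear (\<lambda>x. tlift (F x) t)"
  by (rule clinearI)
    (simp_all add: tlift_def tlift_rep_def clinear_add[OF assms] clinear_scale[OF assms]
       scaleC_add_right sum.distrib cvec.scale_sum_right scaleC_scaleC mult.commute)

lemma cbilinear_tlift:
  assumes "\<And>x. cbilinear (F x)" "\<And>u v. clinear (\<lambda>x. F x u v)"
  shows "cbilinear (\<lambda>x. tlift (F x))"
  by (intro cbilinearI clinear_tlift clinear_tlift_param assms)

lemma tlift_post:
  assumes "clinear f" "cbilinear F"
  shows "f (tlift F t) = tlift (\<lambda>u v. f (F u v)) t"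
  by (rule tensor_ext[where t = t])
    (simp_all add: clinear_compose[OF assms(1) clinear_tlift[OF assms(2)]]
      clinear_tlift[OF cbilinear_post[OF assms]] tlift_pure[OF assms(2)] tlift_pure[OF cbilinear_post[OF assms]])

text \<open>Fubini for Sweedler sums: both sides are linear in \<open>t\<close> and agree on pure
  tensors.\<close>

lemma tlift_swap:
  assumes "\<And>u v. cbilinear (F u v)" "\<And>p q. cbilinear (\<lambda>u v. F u v p q)"
  shows "tlift (\<lambda>u v. tlift (F u v) t) s = tlift (\<lambda>p q. tlift (\<lambda>u v. F u v p q) s) t"
proof (rule tensor_ext[where t = t])
  show "clinear (\<lambda>t. tlift (\<lambda>u v. tlift (F u v) t) s)"
    by (rule clinear_tlift_param) (rule clinear_tlift[OF assms(1)])
  have b: "cbilinear (\<lambda>p q. tlift (\<lambda>u v. F u v p q) s)"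
  proof (rule cbilinearI)
    show "clinear (\<lambda>p. tlift (\<lambda>u v. F u v p q) s)" for q
      by (rule clinear_tlift_param) (rule cbilinear_left[OF assms(1)])
    show "clinear (\<lambda>q. tlift (\<lambda>u v. F u v p q) s)" for p
      by (rule clinear_tlift_param) (rule cbilinear_right[OF assms(1)])
  qed
  show "clinear (tlift (\<lambda>p q. tlift (\<lambda>u v. F u v p q) s))"
    by (rule clinear_tlift[OF b])
  show "tlift (\<lambda>u v. tlift (F u v) (a \<otimes> b)) s = tlift (\<lambda>p q. tlift (\<lambda>u v. F u v p q) s) (a \<otimes> b)" for a b
    unfolding tlift_pure[OF b] tlift_pure[OF assms(1)] ..
qed

lemma clinear_sweedler2: "clinear D \<Longrightarrow> cbilinear F \<Longrightarrow> clinear (sweedler2 D F)"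
  unfolding sweedler2_def by (rule clinear_compose[OF clinear_tlift])

lemma clinear_sweedler2_param:
  "(\<And>u v. clinear (\<lambda>x. F x u v)) \<Longrightarrow> clinear (\<lambda>x. sweedler2 D (F x) h)"
  unfolding sweedler2_def by (rule clinear_tlift_param)

lemma sweedler2_post:
  "clinear f \<Longrightarrow> cbilinear F \<Longrightarrow> f (sweedler2 D F h) = sweedler2 D (\<lambda>u v. f (F u v)) h"
  unfolding sweedler2_def by (rule tlift_post)

lemma sweedler2_swap:
  assumes "\<And>u v. cbilinear (F u v)" "\<And>p q. cbilinear (\<lambda>u v. F u v p q)"
  shows "sweedler2 D (\<lambda>u v. sweedler2 D' (F u v) k) h = sweedler2 D' (\<lambda>p q. sweedler2 D (\<lambda>u v. F u v p q) h) k"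
  unfolding sweedler2_def by (rule tlift_swap) (rule assms)+

lemma tensor_span_list:
  assumes "z \<in> tensor_span M N" "cvec.subspace M"
  obtains xs where "set xs \<subseteq> M \<times> N" "z = (\<Sum>(x, y)\<leftarrow>xs. x \<otimes> y)"
proof -
  have "\<exists>xs. set xs \<subseteq> M \<times> N \<and> z = (\<Sum>(x, y)\<leftarrow>xs. x \<otimes> y)"
    using assms(1) unfolding tensor_span_def
  proof (induction rule: cvec.span_induct_alt)
    case base
    show ?case by (rule exI[of _ "[]"]) simp
  next
    case (step c w z)
    then obtain x y xs where *: "w = x \<otimes> y" "x \<in> M" "y \<in> N" "set xs \<subseteq> M \<times> N" "z = (\<Sum>(x, y)\<leftarrow>xs. x \<otimes> y)"
      by auto
    have "c *\<^sub>C w = (c *\<^sub>C x) \<otimes> y"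
      by (simp add: * clinear_scale[OF cbilinear_left[OF cbilinear_pure]])
    then show ?case using * cvec.subspace_scale[OF assms(2), of x c]
      by (intro exI[of _ "(c *\<^sub>C x, y) # xs"]) auto
  qed
  then show ?thesis using that by blast
qed

lemma tlift_sum_list:
  assumes "cbilinear F"
  shows "tlift F (\<Sum>(x, y)\<leftarrow>xs. x \<otimes> y) = (\<Sum>(x, y)\<leftarrow>xs. F x y)"
  by (induction xs) (auto simp: clinear_zero[OF clinear_tlift[OF assms]]
      clinear_add[OF clinear_tlift[OF assms]] tlift_pure[OF assms])

lemma tlift_in_subspace:
  assumes "cvec.subspace W" "cbilinear F" "\<And>x y. F x y \<in> W"
  shows "tlift F t \<in> W"
  by (induction t rule: tensor_induct)
    (simp_all add: tlift_pure[OF assms(2)] assms(3) clinear_add[OF clinear_tlift[OF assms(2)]]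
      cvec.subspace_add[OF assms(1)])

lemma coset_eq_iff:
  assumes "cvec.subspace N"
  shows "coset N x = coset N y \<longleftrightarrow> x - y \<in> N"
proof
  assume "coset N x = coset N y"
  moreover have "x + 0 \<in> coset N x"
    using cvec.subspace_0[OF assms] unfolding coset_def by blast
  ultimately obtain n where "n \<in> N" "x = y + n" unfolding coset_def by auto
  then show "x - y \<in> N" by simp
next
  have *: "coset N x \<subseteq> coset N y" if "x - y \<in> N" for x y
  proof
    fix z assume "z \<in> coset N x"
    then obtain n where "n \<in> N" "z = x + n" unfolding coset_def by auto
    then have "z = y + ((x - y) + n)" "(x - y) + n \<in> N"
      using that cvec.subspace_add[OF assms] by auto
    then show "z \<in> coset N y" unfolding coset_def by blast
  qed
  assume "x - y \<in> N"
  moreover then have "y - x \<in> N" using cvec.subspace_neg[OF assms] by fastforce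
  ultimately show "coset N x = coset N y" using * by blast
qed

lemma mem_coset_iff:
  assumes "cvec.subspace N"
  shows "z \<in> coset N x \<longleftrightarrow> z - x \<in> N"
proof -
  have "z \<in> coset N x \<longleftrightarrow> (\<exists>n\<in>N. z = x + n)" unfolding coset_def by auto
  also have "\<dots> \<longleftrightarrow> z - x \<in> N" by (metis add_diff_cancel_left' add_diff_cancel_right' diff_add_cancel)
  finally show ?thesis .
qed

section \<open>Convolution over a cocommutative coalgebra\<close>

text \<open>The pairing \<open>m\<close> is a parameter because products of H, B and B # H, the
  action, cocycles and \<otimes> itself are all convolved in the same way.\<close>

definition cv :: "('x::cvector \<Rightarrow> ('x, 'x) tensor) \<Rightarrow> ('a \<Rightarrow> 'b \<Rightarrow> 'c::cvector) \<Rightarrow>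
    ('x \<Rightarrow> 'a) \<Rightarrow> ('x \<Rightarrow> 'b) \<Rightarrow> 'x \<Rightarrow> 'c" where
  "cv D m f g x = sweedler2 D (\<lambda>u v. m (f u) (g v)) x"

definition ctrilinear :: "('a::cvector \<Rightarrow> 'b::cvector \<Rightarrow> 'c::cvector \<Rightarrow> 'd::cvector) \<Rightarrow> bool" where
  "ctrilinear F \<longleftrightarrow> (\<forall>y z. clinear (\<lambda>x. F x y z)) \<and> (\<forall>x z. clinear (\<lambda>y. F x y z)) \<and> (\<forall>x y. clinear (F x y))"

lemma ctrilinearI:
  assumes "\<And>y z. clinear (\<lambda>x. F x y z)" "\<And>x z. clinear (\<lambda>y. F x y z)" "\<And>x y. clinear (F x y)"
  shows "ctrilinear F"
  using assms by (simp add: ctrilinear_def)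

lemma ctrilinear_1: "ctrilinear F \<Longrightarrow> clinear (\<lambda>x. F x y z)"
  and ctrilinear_2: "ctrilinear F \<Longrightarrow> clinear (\<lambda>y. F x y z)"
  and ctrilinear_3: "ctrilinear F \<Longrightarrow> clinear (F x y)"
  by (simp_all add: ctrilinear_def)

text \<open>Separated from Hopf algebras so that it can be instantiated with H, H \<otimes> H and H
  \<otimes> H \<otimes> H, which serve as parameter spaces for identities in one, two and three
  variables.\<close>

locale coalgebra =
  fixes D :: "'x::cvector \<Rightarrow> ('x, 'x) tensor" and e :: "'x \<Rightarrow> complex"
  assumes D_linear: "clinear D" and e_linear: "clinear e"
    and D_coassoc: "sweedler2 D (\<lambda>x y. sweedler2 D (\<lambda>x1 x2. x1 \<otimes> (x2 \<otimes> y)) x) h =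
                  sweedler2 D (\<lambda>x y. x \<otimes> D y) h"
    and D_counit_left: "sweedler2 D (\<lambda>x y. e x *\<^sub>C y) h = h"
    and D_counit_right: "sweedler2 D (\<lambda>x y. e y *\<^sub>C x) h = h"
begin

text \<open>Coassociativity is assumed for the universal trilinear map only; a general trilinear
  \<open>F\<close> factors through it by a linear map \<open>?G\<close>.\<close>

lemma sw_coassoc:
  assumes F: "ctrilinear F"
  shows "sweedler2 D (\<lambda>x y. sweedler2 D (\<lambda>x1 x2. F x1 x2 y) x) h =
         sweedler2 D (\<lambda>x y. sweedler2 D (\<lambda>y1 y2. F x y1 y2) y) h"
proof -
  let ?G = "tlift (\<lambda>a t. tlift (F a) t)"
  have bF: "cbilinear (F a)" for a
    by (rule cbilinearI) (rule ctrilinear_2[OF F], rule ctrilinear_3[OF F])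
  have b: "cbilinear (\<lambda>a t. tlift (F a) t)"
    by (rule cbilinear_tlift) (rule bF, rule ctrilinear_1[OF F])
  have G: "clinear ?G" by (rule clinear_tlift) (rule b)
  have p: "cbilinear (\<lambda>(x1 :: 'x) (x2 :: 'x). x1 \<otimes> (x2 \<otimes> y))" for y :: 'x
    by (rule cbilinear_compose[OF cbilinear_pure]) (simp_all add: cbilinear_left[OF cbilinear_pure])
  have pp: "cbilinear (\<lambda>(x :: 'x) (y :: 'x). sweedler2 D (\<lambda>x1 x2. x1 \<otimes> (x2 \<otimes> y)) x)"
    by (rule cbilinearI)
      (rule clinear_sweedler2[OF D_linear p], rule clinear_sweedler2_param,
       rule clinear_compose[OF cbilinear_right[OF cbilinear_pure] cbilinear_right[OF cbilinear_pure]])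
  have "?G (sweedler2 D (\<lambda>x y. sweedler2 D (\<lambda>x1 x2. x1 \<otimes> (x2 \<otimes> y)) x) h) =
      sweedler2 D (\<lambda>x y. sweedler2 D (\<lambda>x1 x2. F x1 x2 y) x) h"
    unfolding sweedler2_post[OF G pp] sweedler2_post[OF G p] tlift_pure[OF b] tlift_pure[OF bF] ..
  moreover have "?G (sweedler2 D (\<lambda>x y. x \<otimes> D y) h) =
      sweedler2 D (\<lambda>x y. sweedler2 D (\<lambda>y1 y2. F x y1 y2) y) h"
    by (simp add: sweedler2_post[OF G cbilinear_compose[OF cbilinear_pure clinear_id D_linear]]
        tlift_pure[OF b]) (simp add: sweedler2_def)
  ultimately show ?thesis by (simp add: D_coassoc)
qed

lemma sw_counit_left: "clinear f \<Longrightarrow> sweedler2 D (\<lambda>x y. e x *\<^sub>C f y) h = f h"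
  using sweedler2_post[OF _ cbilinear_compose[OF cbilinear_scaleC e_linear clinear_id], of f D h]
  by (simp only: D_counit_left clinear_scale)

lemma sw_counit_right: "clinear f \<Longrightarrow> sweedler2 D (\<lambda>x y. e y *\<^sub>C f x) h = f h"
  using sweedler2_post[OF _ cbilinear_flip[OF cbilinear_compose[OF cbilinear_scaleC e_linear clinear_id]],
      of f D h]
  by (simp only: D_counit_right clinear_scale)

text \<open>The constants of the convolution calculus: convolving with \<open>cc v\<close> is the
  same as pairing with the fixed vector \<open>v\<close>, and \<open>cc 1\<close> is the convolution
  unit.\<close>

abbreviation cc :: "'v::cvector \<Rightarrow> 'x \<Rightarrow> 'v" where "cc v \<equiv> \<lambda>x. e x *\<^sub>C v"

lemma clinear_cc [simp]: "clinear (cc v)"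
  by (rule clinear_compose[OF cbilinear_left[OF cbilinear_scaleC] e_linear])

lemma clinear_cv [simp]: "cbilinear m \<Longrightarrow> clinear f \<Longrightarrow> clinear g \<Longrightarrow> clinear (cv D m f g)"
  unfolding cv_def[abs_def] by (rule clinear_sweedler2[OF D_linear cbilinear_compose])

lemma cv_cc_left: "cbilinear m \<Longrightarrow> clinear f \<Longrightarrow> cv D m (cc a) f = (\<lambda>x. m a (f x))"
  using sw_counit_left[OF clinear_compose[OF cbilinear_right], of m f a]
  by (simp add: fun_eq_iff cv_def clinear_scale[OF cbilinear_left[of m]])

lemma cv_cc_right: "cbilinear m \<Longrightarrow> clinear f \<Longrightarrow> cv D m f (cc a) = (\<lambda>x. m (f x) a)"
  using sw_counit_right[OF clinear_compose[OF cbilinear_left], of m f a]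
  by (simp add: fun_eq_iff cv_def clinear_scale[OF cbilinear_right[of m]])

lemma cv_cc_cc: "cbilinear m \<Longrightarrow> cv D m (cc a) (cc b) = cc (m a b)"
  by (simp add: cv_cc_left clinear_scale[OF cbilinear_right[of m]])

lemma cv_post: "clinear f \<Longrightarrow> cbilinear m \<Longrightarrow> clinear g \<Longrightarrow> clinear h \<Longrightarrow>
    f (cv D m g h x) = cv D (\<lambda>a b. f (m a b)) g h x"
  unfolding cv_def by (rule sweedler2_post) (simp_all add: cbilinear_compose)

text \<open>Hypothesis \<open>eq\<close> is the identity that would be needed if \<open>x\<close>
  were group-like; coassociativity of \<open>D\<close> lifts it to convolutions. The four pairings
  may differ, which also covers module and action laws.\<close>

lemma cv_assoc:
  assumes "cbilinear m" "cbilinear n" "cbilinear m'" "cbilinear n'"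
    and lin: "clinear f" "clinear g" "clinear k"
    and eq: "\<And>a b c. m (n a b) c = m' a (n' b c)"
  shows "cv D m (cv D n f g) k = cv D m' f (cv D n' g k)"
proof
  fix x
  have "cv D m (cv D n f g) k x = sweedler2 D (\<lambda>x y. sweedler2 D (\<lambda>x1 x2. m (n (f x1) (g x2)) (k y)) x) x"
    unfolding cv_def
    by (subst sweedler2_post[OF cbilinear_left[OF assms(1)]]) (simp_all add: cbilinear_compose assms)
  also have "\<dots> = sweedler2 D (\<lambda>x y. sweedler2 D (\<lambda>y1 y2. m (n (f x) (g y1)) (k y2)) y) x"
    by (intro sw_coassoc ctrilinearI clinear_compose[OF cbilinear_left[OF assms(1)]]
        clinear_compose[OF cbilinear_left[OF assms(2)]]
        clinear_compose[OF cbilinear_right[OF assms(2)]] clinear_compose[OF cbilinear_right[OF assms(1)]] lin)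
  also have "\<dots> = cv D m' f (cv D n' g k) x"
    unfolding cv_def eq
    by (subst sweedler2_post[OF cbilinear_right[OF assms(3)]]) (simp_all add: cbilinear_compose assms)
  finally show "cv D m (cv D n f g) k x = cv D m' f (cv D n' g k) x" .
qed

end

locale cocomm_coalgebra = coalgebra +
  assumes D_cocomm: "sweedler2 D (\<lambda>x y. y \<otimes> x) h = D h"
begin

lemma sw_comm: "cbilinear F \<Longrightarrow> sweedler2 D (\<lambda>x y. F y x) h = sweedler2 D F h"
proof -
  assume F: "cbilinear F"
  have "tlift F (sweedler2 D (\<lambda>x y. y \<otimes> x) h) = sweedler2 D (\<lambda>x y. tlift F (y \<otimes> x)) h"
    by (rule sweedler2_post[OF clinear_tlift[OF F] cbilinear_flip[OF cbilinear_pure]])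
  then show ?thesis unfolding D_cocomm tlift_pure[OF F] by (simp add: sweedler2_def)
qed

lemma cv_comm: "cbilinear m \<Longrightarrow> clinear f \<Longrightarrow> clinear g \<Longrightarrow> cv D m f g = cv D (\<lambda>a b. m b a) g f"
  using sw_comm[OF cbilinear_compose, of m f g] by (simp add: cv_def fun_eq_iff)

lemma cv_left_commute:
  assumes "cbilinear m" "cbilinear n" "cbilinear m'" "cbilinear n'"
    and lin: "clinear f" "clinear g" "clinear k"
    and eq: "\<And>a b c. m a (n b c) = m' b (n' a c)"
  shows "cv D m f (cv D n g k) = cv D m' g (cv D n' f k)"
proof -
  let ?q = "\<lambda>t c. tlift (\<lambda>a b. m a (n b c)) t"
  have bil: "cbilinear (\<lambda>a b. m a (n b c))" for c
    by (rule cbilinear_compose[OF assms(1) clinear_id cbilinear_left[OF assms(2)]])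
  have q: "cbilinear ?q"
    by (intro cbilinear_flip[OF cbilinear_tlift] bil) (intro clinear_compose[OF cbilinear_right[OF assms(1)]] cbilinear_right assms)
  have qf: "cbilinear (\<lambda>a b. b \<otimes> a)" by (rule cbilinear_flip[OF cbilinear_pure])
  have "cv D m f (cv D n g k) = cv D ?q (cv D pure f g) k"
    by (rule cv_assoc[symmetric, OF q cbilinear_pure assms(1,2) lin]) (simp add: tlift_pure[OF bil])
  also have "cv D pure f g = cv D (\<lambda>a b. b \<otimes> a) g f"
    by (rule cv_comm[OF cbilinear_pure lin(1,2)])
  also have "cv D ?q (cv D (\<lambda>a b. b \<otimes> a) g f) k = cv D m' g (cv D n' f k)"
    by (rule cv_assoc[OF q qf assms(3,4) lin(2,1,3)]) (unfold tlift_pure[OF bil], rule eq)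
  finally show ?thesis .
qed

text \<open>The middle-four exchange: cocommutativity swaps the second and third Sweedler legs. This
  one rule makes products of points points again.\<close>

lemma cv_interchange:
  assumes "cbilinear m" "cbilinear n" "cbilinear p" "cbilinear m'" "cbilinear n'" "cbilinear p'"
    and lin: "clinear f" "clinear g" "clinear k" "clinear l"
    and eq: "\<And>a b c d. m (n a b) (p c d) = m' (n' a c) (p' b d)"
  shows "cv D m (cv D n f g) (cv D p k l) = cv D m' (cv D n' f k) (cv D p' g l)"
proof -
  \<comment> \<open>\<open>Q\<close> encodes the four-fold expression with all arguments nested to
    the right, the only shape in which the two middle factors can be exchanged directly.\<close>
  define Q where "Q a t = tlift (\<lambda>b s. tlift (\<lambda>c d. m (n a b) (p c d)) s) t" for a and t
  have l1: "clinear (\<lambda>a. m (n a b) z)" for b z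
    by (rule clinear_compose[OF cbilinear_left[OF assms(1)] cbilinear_left[OF assms(2)]])
  have l2: "clinear (\<lambda>b. m (n a b) z)" for a z
    by (rule clinear_compose[OF cbilinear_left[OF assms(1)] cbilinear_right[OF assms(2)]])
  have b1: "cbilinear (\<lambda>c d. m y (p c d))" for y
    by (rule cbilinear_post[OF cbilinear_right[OF assms(1)] assms(3)])
  have b2: "cbilinear (\<lambda>b s. tlift (\<lambda>c d. m (n a b) (p c d)) s)" for a
    by (rule cbilinear_tlift) (rule b1, rule l2)
  have Q: "cbilinear Q" unfolding Q_def
    by (rule cbilinear_tlift[OF b2]) (rule clinear_tlift_param, rule l1)
  have Qe: "Q a (b \<otimes> (c \<otimes> d)) = m (n a b) (p c d)" for a b c d
    by (simp add: Q_def tlift_pure[OF b2] tlift_pure[OF b1])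
  let ?pk = "cv D pure k l"
  have P: "clinear ?pk" by (simp add: cbilinear_pure lin)
  let ?r = "\<lambda>y s. tlift (\<lambda>c d. m y (p c d)) s"
  have r: "cbilinear ?r"
    by (rule cbilinear_tlift[OF b1]) (rule cbilinear_left[OF assms(1)])
  have e1: "cv D m (cv D n f g) (cv D p k l) = cv D Q f (cv D pure g (cv D pure k l))"
  proof -
    have "cv D m (cv D n f g) (cv D p k l) = cv D ?r (cv D n f g) (cv D pure k l)"
    proof
      fix x
      have lp: "clinear (tlift p)" by (rule clinear_tlift[OF assms(3)])
      have c: "cv D p k l y = tlift p (cv D pure k l y)" for y
        using cv_post[OF lp cbilinear_pure lin(3,4)] by (simp add: tlift_pure[OF assms(3)])
      show "cv D m (cv D n f g) (cv D p k l) x = cv D ?r (cv D n f g) (cv D pure k l) x"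
        unfolding cv_def[of D m] cv_def[of D ?r] c
        by (simp add: tlift_post[OF cbilinear_right[OF assms(1)] assms(3)])
    qed
    also have "\<dots> = cv D Q f (cv D pure g (cv D pure k l))"
      by (rule cv_assoc[OF r assms(2) Q cbilinear_pure lin(1,2) P])
        (simp add: Q_def tlift_pure[OF b2])
    finally show ?thesis .
  qed
  let ?t = "\<lambda>c t. tlift (\<lambda>b d. b \<otimes> (c \<otimes> d)) t"
  have b4: "cbilinear (\<lambda>b d. b \<otimes> (c \<otimes> d))" for c
    by (rule cbilinear_compose[OF cbilinear_pure clinear_id cbilinear_right[OF cbilinear_pure]])
  have t: "cbilinear ?t"
    by (rule cbilinear_tlift[OF b4])
      (intro clinear_compose[OF cbilinear_right[OF cbilinear_pure]] cbilinear_left[OF cbilinear_pure])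
  have e2: "cv D pure g (cv D pure k l) = cv D ?t k (cv D pure g l)"
    by (rule cv_left_commute[OF cbilinear_pure cbilinear_pure t cbilinear_pure lin(2,3,4)])
      (simp add: tlift_pure[OF b4])
  define R where "R y s = tlift (\<lambda>b d. m' y (p' b d)) s" for y s
  have b3: "cbilinear (\<lambda>b d. m' y (p' b d))" for y
    by (rule cbilinear_post[OF cbilinear_right[OF assms(4)] assms(6)])
  have R: "cbilinear R" unfolding R_def
    by (rule cbilinear_tlift[OF b3]) (rule cbilinear_left[OF assms(4)])
  have e3: "cv D Q f (cv D ?t k (cv D pure g l)) = cv D R (cv D n' f k) (cv D pure g l)"
  proof (rule cv_assoc[symmetric, OF R assms(5) Q t lin(1,3)])
    show "clinear (cv D pure g l)" by (simp add: cbilinear_pure lin)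
    show "R (n' a b) c = Q a (?t b c)" for a b c
    proof (rule tensor_ext[where t = c])
      show "clinear (R (n' a b))" by (rule cbilinear_right[OF R])
      show "clinear (\<lambda>c. Q a (?t b c))"
        by (rule clinear_compose[OF cbilinear_right[OF Q] cbilinear_right[OF t]])
      show "R (n' a b) (u \<otimes> v) = Q a (?t b (u \<otimes> v))" for u v
        by (simp add: R_def tlift_pure[OF b3] tlift_pure[OF b4] Qe eq)
    qed
  qed
  have e4: "cv D m' (cv D n' f k) (cv D p' g l) = cv D R (cv D n' f k) (cv D pure g l)"
  proof
    fix x
    have lp: "clinear (tlift p')" by (rule clinear_tlift[OF assms(6)])
    have c: "cv D p' g l y = tlift p' (cv D pure g l y)" for y
      using cv_post[OF lp cbilinear_pure lin(2,4)] by (simp add: tlift_pure[OF assms(6)])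
    show "cv D m' (cv D n' f k) (cv D p' g l) x = cv D R (cv D n' f k) (cv D pure g l) x"
      unfolding cv_def[of D m'] cv_def[of D R] c R_def
      by (simp add: tlift_post[OF cbilinear_right[OF assms(4)] assms(6)])
  qed
  show ?thesis unfolding e1 e2 e3 e4 ..
qed

end

lemma cbilinear_pure_left [simp]: "clinear f \<Longrightarrow> clinear (\<lambda>x. f x \<otimes> b)"
  by (rule clinear_compose[OF cbilinear_left[OF cbilinear_pure]])

lemma cbilinear_pure_right [simp]: "clinear f \<Longrightarrow> clinear (\<lambda>x. a \<otimes> f x)"
  by (rule clinear_compose[OF cbilinear_right[OF cbilinear_pure]])

declare cbilinear_pure [simp] cbilinear_mult [simp] cbilinear_scaleC [simp]

definition coalg_map :: "('x::cvector \<Rightarrow> ('x, 'x) tensor) \<Rightarrow> ('x \<Rightarrow> complex) \<Rightarrow>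
    ('y::cvector \<Rightarrow> ('y, 'y) tensor) \<Rightarrow> ('y \<Rightarrow> complex) \<Rightarrow> ('x \<Rightarrow> 'y) \<Rightarrow> bool" where
  "coalg_map D e D' e' \<alpha> \<longleftrightarrow> clinear \<alpha> \<and> (\<forall>x. D' (\<alpha> x) = cv D pure \<alpha> \<alpha> x) \<and> (\<forall>x. e' (\<alpha> x) = e x)"

lemma coalg_map_linear: "coalg_map D e D' e' \<alpha> \<Longrightarrow> clinear \<alpha>"
  by (simp add: coalg_map_def)

lemma coalg_map_counit: "coalg_map D e D' e' \<alpha> \<Longrightarrow> e' (\<alpha> x) = e x"
  by (simp add: coalg_map_def)

text \<open>Convolution commutes with precomposition by a coalgebra map. Identities proved over H or
  H \<otimes> H are carried in this way to arbitrary points.\<close>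

lemma cv_pullback:
  assumes "coalg_map D e D' e' \<alpha>" "cbilinear m" "clinear f" "clinear g"
  shows "cv D' m f g (\<alpha> x) = cv D m (\<lambda>x. f (\<alpha> x)) (\<lambda>x. g (\<alpha> x)) x"
proof -
  have b: "cbilinear (\<lambda>u v. m (f u) (g v))" by (rule cbilinear_compose[OF assms(2,3,4)])
  have "cv D' m f g (\<alpha> x) = tlift (\<lambda>u v. m (f u) (g v)) (sweedler2 D (\<lambda>u v. \<alpha> u \<otimes> \<alpha> v) x)"
    using assms(1) by (simp add: cv_def sweedler2_def[of D'] coalg_map_def)
  also have "\<dots> = cv D m (\<lambda>x. f (\<alpha> x)) (\<lambda>x. g (\<alpha> x)) x"
    unfolding cv_def
    by (subst sweedler2_post[OF clinear_tlift[OF b]])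
      (simp_all add: cbilinear_compose coalg_map_linear[OF assms(1)] tlift_pure[OF b])
  finally show ?thesis .
qed

context cocomm_coalgebra
begin

text \<open>\<open>sub E f\<close> substitutes the function \<open>f\<close> for a constant \<open>b\<close> in an expression \<open>E b\<close>: identities that
  hold for constants hold for arbitrary linear functions.\<close>

definition sub :: "('v::cvector \<Rightarrow> 'a \<Rightarrow> 'w::cvector) \<Rightarrow> ('a \<Rightarrow> 'v) \<Rightarrow> 'a \<Rightarrow> 'w" where
  "sub E f x = sweedler2 D (\<lambda>u v. E (f u) v) x"

lemma cbilinear_cc [simp]: "cbilinear (\<lambda>b. cc b)"
  by (rule cbilinearI) simp_all

lemma cbilinear_cv_left [simp]:
  assumes "cbilinear E" "cbilinear m" "clinear g"
  shows "cbilinear (\<lambda>b. cv D m (E b) g)"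
proof (rule cbilinearI)
  show "clinear (\<lambda>b. cv D m (E b) g x)" for x
    unfolding cv_def
    by (intro clinear_sweedler2_param clinear_compose[OF cbilinear_left[OF assms(2)]] cbilinear_left[OF assms(1)])
  show "clinear (cv D m (E b) g)" for b
    using assms by (simp add: cbilinear_right)
qed

lemma cbilinear_cv_right [simp]:
  assumes "cbilinear E" "cbilinear m" "clinear g"
  shows "cbilinear (\<lambda>b. cv D m g (E b))"
proof (rule cbilinearI)
  show "clinear (\<lambda>b. cv D m g (E b) x)" for x
    unfolding cv_def
    by (intro clinear_sweedler2_param clinear_compose[OF cbilinear_right[OF assms(2)]] cbilinear_left[OF assms(1)])
  show "clinear (cv D m g (E b))" for b
    using assms by (simp add: cbilinear_right)
qed

lemma sub_eq_cv: "sub E f = cv D E f (\<lambda>x. x)"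
  by (simp add: fun_eq_iff sub_def cv_def)

lemma clinear_sub [simp]: "cbilinear E \<Longrightarrow> clinear f \<Longrightarrow> clinear (sub E f)"
  by (simp add: sub_eq_cv)

lemma sub_cc: "clinear f \<Longrightarrow> sub (\<lambda>b. cc b) f = f"
  by (simp add: fun_eq_iff sub_def sw_counit_right)

lemma sub_left:
  assumes "cbilinear E" "cbilinear m" "clinear f" "clinear g"
  shows "sub (\<lambda>b. cv D m (E b) g) f = cv D m (sub E f) g"
proof
  fix x
  have "sub (\<lambda>b. cv D m (E b) g) f x =
      sweedler2 D (\<lambda>u v. sweedler2 D (\<lambda>v1 v2. m (E (f u) v1) (g v2)) v) x"
    by (simp add: sub_def cv_def)
  also have "\<dots> = sweedler2 D (\<lambda>x y. sweedler2 D (\<lambda>u v1. m (E (f u) v1) (g y)) x) x"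
    by (rule sw_coassoc[symmetric], rule ctrilinearI)
      (rule clinear_compose[OF cbilinear_left[OF assms(2)] clinear_compose[OF cbilinear_left[OF assms(1)] assms(3)]],
       rule clinear_compose[OF cbilinear_left[OF assms(2)] cbilinear_right[OF assms(1)]],
       rule clinear_compose[OF cbilinear_right[OF assms(2)] assms(4)])
  also have "\<dots> = cv D m (sub E f) g x"
    unfolding cv_def sub_def
    by (subst sweedler2_post[OF cbilinear_left[OF assms(2)]]) (simp_all add: cbilinear_compose[OF assms(1)] assms)
  finally show "sub (\<lambda>b. cv D m (E b) g) f x = cv D m (sub E f) g x" .
qed

text \<open>Substitution consumes the first Sweedler leg, whereas here \<open>g\<close> stands in
  front of \<open>E\<close>; cocommutativity brings the substituted expression to the left, where
  coassociativity suffices.\<close>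

lemma sub_right:
  assumes "cbilinear E" "cbilinear m" "clinear f" "clinear g"
  shows "sub (\<lambda>b. cv D m g (E b)) f = cv D m g (sub E f)"
proof -
  have E: "clinear (E b)" "clinear (sub E f)" for b using assms by (simp_all add: cbilinear_right)
  have "cv D m g (E b) = cv D (\<lambda>a c. m c a) (E b) g" for b
    by (rule cv_comm[OF assms(2,4) E(1)])
  then have "sub (\<lambda>b. cv D m g (E b)) f = cv D (\<lambda>a c. m c a) (sub E f) g"
    using sub_left[OF assms(1) cbilinear_flip[OF assms(2)] assms(3,4)] by simp
  also have "\<dots> = cv D m g (sub E f)"
    using cv_comm[OF assms(2,4) E(2)] by simp
  finally show ?thesis .
qed

lemma cv_flip_subspace:
  assumes "cvec.subspace W" "cbilinear m" "clinear f" "clinear g" "\<And>u v. m (f u) (g v) \<in> W"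
  shows "cv D m f g x \<in> W"
  unfolding cv_def sweedler2_def
  by (rule tlift_in_subspace[OF assms(1) cbilinear_compose[OF assms(2,3,4)]]) (rule assms(5))

end

subsection \<open>Tensor products of coalgebras\<close>

text \<open>The coproduct of the tensor product coalgebra, with the two middle factors
  flipped.\<close>

definition tD :: "('x::cvector \<Rightarrow> ('x, 'x) tensor) \<Rightarrow> ('y::cvector \<Rightarrow> ('y, 'y) tensor) \<Rightarrow>
    ('x, 'y) tensor \<Rightarrow> (('x, 'y) tensor, ('x, 'y) tensor) tensor" where
  "tD D D' = tlift (\<lambda>x y. sweedler2 D (\<lambda>x1 x2. sweedler2 D' (\<lambda>y1 y2. (x1 \<otimes> y1) \<otimes> (x2 \<otimes> y2)) y) x)"

definition te :: "('x::cvector \<Rightarrow> complex) \<Rightarrow> ('y::cvector \<Rightarrow> complex) \<Rightarrow> ('x, 'y) tensor \<Rightarrow> complex" where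
  "te e e' = tlift (\<lambda>x y. e x * e' y)"

locale two_coalgebras = X: cocomm_coalgebra D e + Y: cocomm_coalgebra D' e'
  for D :: "'x::cvector \<Rightarrow> ('x, 'x) tensor" and e :: "'x \<Rightarrow> complex"
    and D' :: "'y::cvector \<Rightarrow> ('y, 'y) tensor" and e' :: "'y \<Rightarrow> complex"
begin

lemma cbilinear_sweedler_pair:
  assumes "\<And>b c d. clinear (\<lambda>a. F a b c d)" "\<And>a c d. clinear (\<lambda>b. F a b c d)"
    "\<And>a b d. clinear (\<lambda>c. F a b c d)" "\<And>a b c. clinear (\<lambda>d. F a b c d)"
  shows "cbilinear (\<lambda>x y. sweedler2 D (\<lambda>x1 x2. sweedler2 D' (\<lambda>y1 y2. F x1 x2 y1 y2) y) x)"
proof (rule cbilinearI)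
  have b: "cbilinear (\<lambda>y1 y2. F x1 x2 y1 y2)" for x1 x2
    by (rule cbilinearI) (rule assms)+
  have "cbilinear (\<lambda>x1 x2. sweedler2 D' (F x1 x2) y)" for y
    by (rule cbilinearI) (rule clinear_sweedler2_param, rule assms)+
  then show "clinear (\<lambda>x. sweedler2 D (\<lambda>x1 x2. sweedler2 D' (\<lambda>y1 y2. F x1 x2 y1 y2) y) x)" for y
    by (rule clinear_sweedler2[OF X.D_linear])
  show "clinear (\<lambda>y. sweedler2 D (\<lambda>x1 x2. sweedler2 D' (\<lambda>y1 y2. F x1 x2 y1 y2) y) x)" for x
    by (rule clinear_sweedler2_param) (rule clinear_sweedler2[OF Y.D_linear b])
qed

lemma tD_bil: "cbilinear (\<lambda>x y. sweedler2 D (\<lambda>x1 x2. sweedler2 D' (\<lambda>y1 y2. (x1 \<otimes> y1) \<otimes> (x2 \<otimes> y2)) y) x)"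
  by (rule cbilinear_sweedler_pair) simp_all

lemma tD_pure: "tD D D' (x \<otimes> y) = sweedler2 D (\<lambda>x1 x2. sweedler2 D' (\<lambda>y1 y2. (x1 \<otimes> y1) \<otimes> (x2 \<otimes> y2)) y) x"
  by (simp add: tD_def tlift_pure[OF tD_bil])

lemma clinear_tD: "clinear (tD D D')"
  unfolding tD_def by (rule clinear_tlift[OF tD_bil])

lemma te_bil: "cbilinear (\<lambda>x y. e x * e' y)"
  by (rule cbilinear_compose[OF cbilinear_mult X.e_linear Y.e_linear])

lemma clinear_te: "clinear (te e e')"
  unfolding te_def by (rule clinear_tlift[OF te_bil])

lemma te_pure [simp]: "te e e' (x \<otimes> y) = e x * e' y"
  by (simp add: te_def tlift_pure[OF te_bil])

lemma sweedler2_tD: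
  assumes F: "cbilinear F"
  shows "sweedler2 (tD D D') F (x \<otimes> y) =
    sweedler2 D (\<lambda>x1 x2. sweedler2 D' (\<lambda>y1 y2. F (x1 \<otimes> y1) (x2 \<otimes> y2)) y) x"
proof -
  have b: "cbilinear (\<lambda>y1 y2. (x1 \<otimes> y1) \<otimes> (x2 \<otimes> y2))" for x1 :: 'x and x2 :: 'x
    by (rule cbilinearI) simp_all
  have b2: "cbilinear (\<lambda>x1 x2. sweedler2 D' (\<lambda>y1 y2. (x1 \<otimes> y1) \<otimes> (x2 \<otimes> y2)) y)" for y
    by (rule cbilinearI) (rule clinear_sweedler2_param, simp)+
  show ?thesis
    unfolding sweedler2_def[of "tD D D'"] tD_pure
    unfolding sweedler2_post[OF clinear_tlift[OF F] b2] sweedler2_post[OF clinear_tlift[OF F] b]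
    by (simp add: tlift_pure[OF F])
qed

lemma cv_tD:
  assumes "cbilinear m" "clinear f" "clinear g"
  shows "cv (tD D D') m f g (x \<otimes> y) =
    sweedler2 D (\<lambda>x1 x2. sweedler2 D' (\<lambda>y1 y2. m (f (x1 \<otimes> y1)) (g (x2 \<otimes> y2))) y) x"
  unfolding cv_def by (rule sweedler2_tD[OF cbilinear_compose[OF assms]])

lemma cocomm_coalgebra_tD: "cocomm_coalgebra (tD D D') (te e e')"
proof (intro cocomm_coalgebra.intro coalgebra.intro cocomm_coalgebra_axioms.intro)
  let ?E = "tD D D'"
  show "clinear ?E" by (rule clinear_tD)
  show "clinear (te e e')" by (rule clinear_te)
  fix h :: "('x, 'y) tensor"
  have swE: "clinear (sweedler2 ?E F)" if "cbilinear F" for F :: "('x, 'y) tensor \<Rightarrow> ('x, 'y) tensor \<Rightarrow> 'z::cvector"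
    by (rule clinear_sweedler2[OF clinear_tD that])
  show "sweedler2 ?E (\<lambda>x y. y \<otimes> x) h = ?E h"
  proof (rule tensor_ext[where t = h])
    have f: "cbilinear (\<lambda>(x::('x,'y) tensor) (y::('x,'y) tensor). y \<otimes> x)" by (rule cbilinear_flip[OF cbilinear_pure])
    show "clinear (sweedler2 ?E (\<lambda>x y. y \<otimes> x))" by (rule swE[OF f])
    show "clinear ?E" by (rule clinear_tD)
    fix a b
    have b1: "cbilinear (\<lambda>x1 x2. sweedler2 D' (\<lambda>y1 y2. (x1 \<otimes> y2) \<otimes> (x2 \<otimes> y1)) b)"
      by (rule cbilinearI) (rule clinear_sweedler2_param, simp)+
    have b2: "cbilinear (\<lambda>y1 y2. (x1 \<otimes> y1) \<otimes> (x2 \<otimes> y2))" for x1 x2 :: 'x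
      by (rule cbilinearI) simp_all
    have "sweedler2 ?E (\<lambda>x y. y \<otimes> x) (a \<otimes> b) =
        sweedler2 D (\<lambda>x1 x2. sweedler2 D' (\<lambda>y1 y2. (x2 \<otimes> y2) \<otimes> (x1 \<otimes> y1)) b) a"
      by (rule sweedler2_tD[OF f])
    also have "\<dots> = sweedler2 D (\<lambda>x1 x2. sweedler2 D' (\<lambda>y1 y2. (x1 \<otimes> y2) \<otimes> (x2 \<otimes> y1)) b) a"
      by (rule X.sw_comm[OF b1])
    also have "\<dots> = ?E (a \<otimes> b)"
      unfolding Y.sw_comm[OF b2] by (simp add: tD_pure)
    finally show "sweedler2 ?E (\<lambda>x y. y \<otimes> x) (a \<otimes> b) = ?E (a \<otimes> b)" .
  qed
  show "sweedler2 ?E (\<lambda>x y. te e e' x *\<^sub>C y) h = h"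
  proof (rule tensor_ext[where t = h])
    have f: "cbilinear (\<lambda>x (y::('x,'y) tensor). te e e' x *\<^sub>C y)"
      by (rule cbilinear_compose[OF cbilinear_scaleC clinear_te clinear_id])
    show "clinear (sweedler2 ?E (\<lambda>x y. te e e' x *\<^sub>C y))" by (rule swE[OF f])
    fix a b
    have s: "(e x1 * e' y1) *\<^sub>C (x2 \<otimes> y2) = e x1 *\<^sub>C (x2 \<otimes> (e' y1 *\<^sub>C y2))" for x1 x2 y1 y2
      by (simp add: clinear_scale[OF cbilinear_right[OF cbilinear_pure]] scaleC_scaleC)
    have p: "clinear (\<lambda>y2. e x1 *\<^sub>C (x2 \<otimes> y2))" for x1 and x2 :: 'x by simp
    have q: "cbilinear (\<lambda>y1 y2. e' y1 *\<^sub>C y2)" by (rule cbilinear_compose[OF cbilinear_scaleC Y.e_linear clinear_id])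
    show "sweedler2 ?E (\<lambda>x y. te e e' x *\<^sub>C y) (a \<otimes> b) = a \<otimes> b"
      unfolding sweedler2_tD[OF f] te_pure s
      unfolding sweedler2_post[OF p q, symmetric]
      by (simp add: Y.D_counit_left X.sw_counit_left)
  qed simp
  show "sweedler2 ?E (\<lambda>x y. te e e' y *\<^sub>C x) h = h"
  proof (rule tensor_ext[where t = h])
    have f: "cbilinear (\<lambda>(x::('x,'y) tensor) y. te e e' y *\<^sub>C x)"
      by (rule cbilinear_flip[OF cbilinear_compose[OF cbilinear_scaleC clinear_te clinear_id]])
    show "clinear (sweedler2 ?E (\<lambda>x y. te e e' y *\<^sub>C x))" by (rule swE[OF f])
    fix a b
    have s: "(e x1 * e' y1) *\<^sub>C (x2 \<otimes> y2) = e x1 *\<^sub>C (x2 \<otimes> (e' y1 *\<^sub>C y2))" for x1 x2 y1 y2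
      by (simp add: clinear_scale[OF cbilinear_right[OF cbilinear_pure]] scaleC_scaleC)
    have p: "clinear (\<lambda>y2. e x1 *\<^sub>C (x2 \<otimes> y2))" for x1 and x2 :: 'x by simp
    have q: "cbilinear (\<lambda>y2 y1. e' y1 *\<^sub>C y2)"
      by (rule cbilinear_flip[OF cbilinear_compose[OF cbilinear_scaleC Y.e_linear clinear_id]])
    show "sweedler2 ?E (\<lambda>x y. te e e' y *\<^sub>C x) (a \<otimes> b) = a \<otimes> b"
      unfolding sweedler2_tD[OF f] te_pure s
      unfolding sweedler2_post[OF p q, symmetric]
      by (simp add: Y.D_counit_right X.sw_counit_right)
  qed simp
  show "sweedler2 ?E (\<lambda>x y. sweedler2 ?E (\<lambda>x1 x2. x1 \<otimes> (x2 \<otimes> y)) x) h = sweedler2 ?E (\<lambda>x y. x \<otimes> ?E y) h"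
  proof (rule tensor_ext[where t = h])
    have g: "cbilinear (\<lambda>(x1::('x,'y) tensor) (x2::('x,'y) tensor). x1 \<otimes> (x2 \<otimes> y))" for y :: "('x, 'y) tensor"
      by (rule cbilinearI) simp_all
    have f: "cbilinear (\<lambda>(x::('x,'y) tensor) (y::('x,'y) tensor). sweedler2 ?E (\<lambda>x1 x2. x1 \<otimes> (x2 \<otimes> y)) x)"
      by (rule cbilinearI) (rule swE[OF g], rule clinear_sweedler2_param, simp)
    have f': "cbilinear (\<lambda>(x::('x,'y) tensor) y. x \<otimes> ?E y)"
      by (rule cbilinear_compose[OF cbilinear_pure clinear_id clinear_tD])
    show "clinear (sweedler2 ?E (\<lambda>x y. sweedler2 ?E (\<lambda>x1 x2. x1 \<otimes> (x2 \<otimes> y)) x))" by (rule swE[OF f])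
    show "clinear (sweedler2 ?E (\<lambda>x y. x \<otimes> ?E y))" by (rule swE[OF f'])
    fix a b
    define G where "G x1 x2 x3 y1 y2 y3 = (x1 \<otimes> y1) \<otimes> ((x2 \<otimes> y2) \<otimes> (x3 \<otimes> y3))" for x1 x2 x3 :: 'x and y1 y2 y3 :: 'y
    have G: "clinear (\<lambda>x. G x b c d e f)" "clinear (\<lambda>x. G a x c d e f)" "clinear (\<lambda>x. G a b x d e f)"
      "clinear (\<lambda>x. G a b c x e f)" "clinear (\<lambda>x. G a b c d x f)" "clinear (\<lambda>x. G a b c d e x)" for a b c d e f
      by (simp_all add: G_def)
    have T: "ctrilinear (\<lambda>y1 y2 y3. G x1 x2 x3 y1 y2 y3)" for x1 x2 x3
      by (rule ctrilinearI; rule G)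
    have l1: "clinear (\<lambda>x1. sweedler2 D' (\<lambda>y' y3. sweedler2 D' (\<lambda>y1 y2. G x1 x2 x3 y1 y2 y3) y') b)" for x2 x3
      by (rule clinear_sweedler2_param)+ (rule G)
    have l2: "clinear (\<lambda>x2. sweedler2 D' (\<lambda>y' y3. sweedler2 D' (\<lambda>y1 y2. G x1 x2 x3 y1 y2 y3) y') b)" for x1 x3
      by (rule clinear_sweedler2_param)+ (rule G)
    have l3: "clinear (\<lambda>x3. sweedler2 D' (\<lambda>y' y3. sweedler2 D' (\<lambda>y1 y2. G x1 x2 x3 y1 y2 y3) y') b)" for x1 x2
      by (rule clinear_sweedler2_param)+ (rule G)
    have bil: "cbilinear (\<lambda>y' y3. sweedler2 D' (\<lambda>y1 y2. G x1 x2 x3 y1 y2 y3) y')" for x1 x2 x3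
      by (rule cbilinearI, rule clinear_sweedler2[OF Y.D_linear], rule cbilinearI, rule G, rule G,
          rule clinear_sweedler2_param, rule G)
    have bil2: "cbilinear (\<lambda>x1 x2. sweedler2 D' (\<lambda>y1 y2. G x1 x2 x3 y1 y2 y3) y')" for x3 y3 y'
      by (rule cbilinearI) (rule clinear_sweedler2_param, rule G)+
    \<comment> \<open>The coproducts of the two variables are interleaved. They are first sorted by
      variable, then coassociativity is applied to each variable, and finally they are interleaved
      again.\<close>
    have "sweedler2 ?E (\<lambda>x y. sweedler2 ?E (\<lambda>x1 x2. x1 \<otimes> (x2 \<otimes> y)) x) (a \<otimes> b) =
        sweedler2 D (\<lambda>x' x3. sweedler2 D' (\<lambda>y' y3. sweedler2 D (\<lambda>x1 x2. sweedler2 D' (\<lambda>y1 y2. G x1 x2 x3 y1 y2 y3) y') x') b) a"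
      unfolding sweedler2_tD[OF f] sweedler2_tD[OF g] G_def ..
    also have "\<dots> = sweedler2 D (\<lambda>x' x3. sweedler2 D (\<lambda>x1 x2. sweedler2 D' (\<lambda>y' y3. sweedler2 D' (\<lambda>y1 y2. G x1 x2 x3 y1 y2 y3) y') b) x') a"
      by (subst sweedler2_swap[of "\<lambda>y' y3 x1 x2. sweedler2 D' (\<lambda>y1 y2. G x1 x2 _ y1 y2 y3) y'"]) (rule bil2, rule bil, rule refl)
    also have "\<dots> = sweedler2 D (\<lambda>x1 x'. sweedler2 D (\<lambda>x2 x3. sweedler2 D' (\<lambda>y' y3. sweedler2 D' (\<lambda>y1 y2. G x1 x2 x3 y1 y2 y3) y') b) x') a"
      by (rule X.sw_coassoc, rule ctrilinearI) (rule l1, rule l2, rule l3)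
    also have "\<dots> = sweedler2 D (\<lambda>x1 x'. sweedler2 D (\<lambda>x2 x3. sweedler2 D' (\<lambda>y1 y'. sweedler2 D' (\<lambda>y2 y3. G x1 x2 x3 y1 y2 y3) y') b) x') a"
      unfolding Y.sw_coassoc[OF T] ..
    also have "\<dots> = sweedler2 D (\<lambda>x1 x'. sweedler2 D' (\<lambda>y1 y'. sweedler2 D (\<lambda>x2 x3. sweedler2 D' (\<lambda>y2 y3. G x1 x2 x3 y1 y2 y3) y') x') b) a"
    proof (subst sweedler2_swap)
      show "cbilinear (\<lambda>y1 y'. sweedler2 D' (\<lambda>y2 y3. G x1 u v y1 y2 y3) y')" for x1 u v
        by (rule cbilinearI, rule clinear_sweedler2_param, rule G, rule clinear_sweedler2[OF Y.D_linear],
            rule cbilinearI, rule G, rule G)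
      show "cbilinear (\<lambda>x2 x3. sweedler2 D' (\<lambda>y2 y3. G x1 x2 x3 y1 y2 y3) y')" for x1 y1 y'
        by (rule cbilinearI) (rule clinear_sweedler2_param, rule G)+
    qed (rule refl)
    also have "\<dots> = sweedler2 ?E (\<lambda>x y. x \<otimes> ?E y) (a \<otimes> b)"
    proof -
      have b: "cbilinear (\<lambda>y1 y2. (x1 \<otimes> y1) \<otimes> (x2 \<otimes> y2))" for x1 :: 'x and x2 :: 'x
        by (rule cbilinearI) simp_all
      have b2: "cbilinear (\<lambda>x1 x2. sweedler2 D' (\<lambda>y1 y2. (x1 \<otimes> y1) \<otimes> (x2 \<otimes> y2)) y)" for y
        by (rule cbilinearI) (rule clinear_sweedler2_param, simp)+
      have l: "clinear (\<lambda>t. (x::('x, 'y) tensor) \<otimes> (t::(('x, 'y) tensor, ('x, 'y) tensor) tensor))" for x by simp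
      show ?thesis
        unfolding sweedler2_tD[OF f'] tD_pure
        unfolding sweedler2_post[OF l b2] sweedler2_post[OF l b] G_def ..
    qed
    finally show "sweedler2 ?E (\<lambda>x y. sweedler2 ?E (\<lambda>x1 x2. x1 \<otimes> (x2 \<otimes> y)) x) (a \<otimes> b) =
      sweedler2 ?E (\<lambda>x y. x \<otimes> ?E y) (a \<otimes> b)" .
  qed
qed

end

sublocale two_coalgebras \<subseteq> XY: cocomm_coalgebra "tD D D'" "te e e'"
  by (rule cocomm_coalgebra_tD)

section \<open>Points of a cocommutative Hopf algebra\<close>

lemma tlift_pure_id: "tlift pure t = t"
  by (rule tensor_ext[where t = t]) (simp_all add: clinear_tlift tlift_pure)

lemma coalg_map_compose:
  assumes "coalg_map D e D' e' \<alpha>" "coalg_map D' e' D'' e'' \<beta>"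
  shows "coalg_map D e D'' e'' (\<lambda>x. \<beta> (\<alpha> x))"
  using assms cv_pullback[OF assms(1) cbilinear_pure, of \<beta> \<beta>]
  by (simp add: coalg_map_def clinear_compose[of \<beta> \<alpha>])

locale cocomm_hopf = hopf_algebra \<Delta> \<epsilon> S
  for \<Delta> :: "'h::calgebra \<Rightarrow> ('h, 'h) tensor" and \<epsilon> S +
  assumes cocomm: "cocommutative \<Delta>"
begin

lemma cocomm_coalgebra_H: "cocomm_coalgebra \<Delta> \<epsilon>"
  using cocomm
  by (intro cocomm_coalgebra.intro coalgebra.intro cocomm_coalgebra_axioms.intro)
    (simp_all add: comult_linear counit_linear coassoc counit_left counit_right cocommutative_def)

end

sublocale cocomm_hopf \<subseteq> H: cocomm_coalgebra \<Delta> \<epsilon>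
  by (rule cocomm_coalgebra_H)

sublocale cocomm_hopf \<subseteq> H2: two_coalgebras \<Delta> \<epsilon> \<Delta> \<epsilon>
  by (intro two_coalgebras.intro cocomm_coalgebra_H)

sublocale cocomm_hopf \<subseteq> H3: two_coalgebras \<Delta> \<epsilon> "tD \<Delta> \<Delta>" "te \<epsilon> \<epsilon>"
  by (intro two_coalgebras.intro cocomm_coalgebra_H H2.cocomm_coalgebra_tD)

context cocomm_hopf
begin

declare antipode_linear [simp] comult_linear [simp] counit_linear [simp]

text \<open>The product of the algebra H \<otimes> H, for which \<Delta> is multiplicative.\<close>

definition hmul :: "('h, 'h) tensor \<Rightarrow> ('h, 'h) tensor \<Rightarrow> ('h, 'h) tensor" where
  "hmul s t = tlift (\<lambda>a b. tlift (\<lambda>c d. (a * c) \<otimes> (b * d)) t) s"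

lemma hmul_aux: "cbilinear (\<lambda>c d. (a * c) \<otimes> (b * d :: 'h))" for a b :: 'h
  by (rule cbilinear_compose) (simp_all add: cbilinear_right)

lemma hmul_aux2: "cbilinear (\<lambda>a b. tlift (\<lambda>c d. (a * c) \<otimes> (b * d :: 'h)) t)" for t :: "('h, 'h) tensor"
  by (rule cbilinearI; rule clinear_tlift_param) (simp_all add: cbilinear_left)

lemma cbilinear_hmul [simp]: "cbilinear hmul"
  unfolding hmul_def
  by (rule cbilinearI) (rule clinear_tlift[OF hmul_aux2], rule clinear_tlift_param, rule clinear_tlift[OF hmul_aux])

lemma hmul_pure [simp]: "hmul (a \<otimes> b) (c \<otimes> d) = (a * c) \<otimes> (b * d)"
  by (simp only: hmul_def tlift_pure[OF hmul_aux2]) (simp only: tlift_pure[OF hmul_aux])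

lemma hmul_one: "hmul (1 \<otimes> 1) t = t" "hmul t (1 \<otimes> 1) = t"
  by (rule tensor_ext[where t = t]; simp add: cbilinear_right cbilinear_left[OF cbilinear_hmul])+

lemma hmul_assoc: "hmul (hmul r s) t = hmul r (hmul s t)"
proof -
  note l = cbilinear_left[OF cbilinear_hmul] cbilinear_right[OF cbilinear_hmul]
  have 1: "hmul (hmul (a \<otimes> b) (c \<otimes> d)) t = hmul (a \<otimes> b) (hmul (c \<otimes> d) t)" for a b c d
    by (rule tensor_ext[where t = t]) (simp_all add: l clinear_compose[OF l(2) l(2)] mult.assoc)
  have 2: "hmul (hmul (a \<otimes> b) s) t = hmul (a \<otimes> b) (hmul s t)" for a b
    by (rule tensor_ext[where t = s]) (rule clinear_compose[OF l(1) l(2)], rule clinear_compose[OF l(2) l(1)], rule 1)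
  show ?thesis
    by (rule tensor_ext[where t = r]) (rule clinear_compose[OF l(1) l(1)], rule l(1), rule 2)
qed

lemma comult_hmul: "\<Delta> (h * k) = hmul (\<Delta> h) (\<Delta> k)"
  by (simp add: comult_mult hmul_def sweedler2_def)

lemma comult_cv: "\<Delta> h = cv \<Delta> pure (\<lambda>x. x) (\<lambda>x. x) h"
  by (simp add: cv_def sweedler2_def tlift_pure_id)

text \<open>Both sides are convolution inverses of \<Delta> among linear maps from H to H \<otimes>
  H: one because \<Delta> is multiplicative, the other by the middle-four exchange. Cocommutativity
  removes the usual flip.\<close>

lemma comult_antipode: "\<Delta> (S h) = cv \<Delta> pure S S h"
proof -
  let ?I = "\<lambda>h. \<Delta> h" and ?L = "\<lambda>h. \<Delta> (S h)" and ?R = "cv \<Delta> pure S S"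
  have lin: "clinear ?L" "clinear ?R" by (simp_all add: clinear_compose[OF comult_linear])
  have "cv \<Delta> hmul ?L ?I h = \<Delta> (cv \<Delta> (*) S (\<lambda>x. x) h)" for h
    by (subst H.cv_post) (simp_all add: cv_def comult_hmul)
  then have L: "cv \<Delta> hmul ?L ?I = H.cc (1 \<otimes> 1)"
    using antipode_left by (simp add: cv_def comult_one clinear_scale[OF comult_linear] fun_eq_iff)
  have "cv \<Delta> hmul ?I ?R = cv \<Delta> hmul (cv \<Delta> pure (\<lambda>x. x) (\<lambda>x. x)) ?R"
    using comult_cv by (simp add: fun_eq_iff[of "\<lambda>h. \<Delta> h"])
  also have "\<dots> = cv \<Delta> pure (cv \<Delta> (*) (\<lambda>x. x) S) (cv \<Delta> (*) (\<lambda>x. x) S)"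
    by (rule H.cv_interchange) simp_all
  also have "cv \<Delta> (*) (\<lambda>x. x) S = H.cc 1"
    using antipode_right by (simp add: cv_def fun_eq_iff)
  finally have R: "cv \<Delta> hmul ?I ?R = H.cc (1 \<otimes> 1)" by (simp add: H.cv_cc_cc)
  have "?L = cv \<Delta> hmul ?L (H.cc (1 \<otimes> 1))"
    by (simp add: H.cv_cc_right lin hmul_one)
  also have "\<dots> = cv \<Delta> hmul (cv \<Delta> hmul ?L ?I) ?R"
    unfolding R[symmetric] by (rule H.cv_assoc[symmetric]) (simp_all add: lin hmul_assoc)
  also have "\<dots> = ?R" unfolding L by (simp add: H.cv_cc_left lin hmul_one)
  finally show ?thesis by (simp add: fun_eq_iff)
qed

text \<open>Apply \<epsilon> to the antipode identity; as \<epsilon> is the unit of convolution,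
  only \<epsilon> composed with \<open>S\<close> remains on the left.\<close>

lemma counit_antipode: "\<epsilon> (S h) = \<epsilon> h"
proof -
  have "cv \<Delta> (*) (\<lambda>x. \<epsilon> (S x)) \<epsilon> h = \<epsilon> (cv \<Delta> (*) S (\<lambda>x. x) h)"
    by (subst H.cv_post) (simp_all add: cv_def counit_mult)
  also have "\<dots> = \<epsilon> h"
    using antipode_left by (simp add: cv_def clinear_scale[OF counit_linear] counit_one scaleC_complex_def)
  also have "cv \<Delta> (*) (\<lambda>x. \<epsilon> (S x)) \<epsilon> h = cv \<Delta> (*) (\<lambda>x. \<epsilon> (S x)) (H.cc 1) h"
    by (simp add: scaleC_complex_def)
  also have "\<dots> = \<epsilon> (S h)"
    by (simp add: H.cv_cc_right clinear_compose[OF counit_linear])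
  finally show ?thesis .
qed

lemma antipode_one: "S 1 = 1"
proof -
  have b: "cbilinear (\<lambda>x y. S x * y)" by (rule cbilinear_compose[OF cbilinear_mult]) simp_all
  show ?thesis
    using antipode_left[of 1] by (simp add: sweedler2_def comult_one tlift_pure[OF b] counit_one scaleC_one)
qed

end

locale hopf_points = cocomm_hopf \<Delta> \<epsilon> S + X: cocomm_coalgebra D e
  for \<Delta> :: "'h::calgebra \<Rightarrow> ('h, 'h) tensor" and \<epsilon> S
    and D :: "'x::cvector \<Rightarrow> ('x, 'x) tensor" and e
begin

abbreviation pt :: "('x \<Rightarrow> 'h) \<Rightarrow> bool" where "pt \<equiv> coalg_map D e \<Delta> \<epsilon>"

abbreviation conv_mult (infixl "\<star>" 70) where "f \<star> g \<equiv> cv D (*) f g"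

lemma pt_linear: "pt \<alpha> \<Longrightarrow> clinear \<alpha>"
  by (rule coalg_map_linear)

text \<open>The middle-four exchange turns the product of two diagonals into the diagonal of the
  product. This is where points depend on cocommutativity of the parameter coalgebra.\<close>

lemma pt_mult [simp]:
  assumes "pt \<alpha>" "pt \<beta>"
  shows "pt (\<alpha> \<star> \<beta>)"
proof -
  note [simp] = pt_linear[OF assms(1)] pt_linear[OF assms(2)]
  have "\<Delta> ((\<alpha> \<star> \<beta>) x) = cv D pure (\<alpha> \<star> \<beta>) (\<alpha> \<star> \<beta>) x" for x
  proof -
    have "\<Delta> ((\<alpha> \<star> \<beta>) x) = cv D hmul (\<lambda>x. \<Delta> (\<alpha> x)) (\<lambda>x. \<Delta> (\<beta> x)) x"
      by (subst X.cv_post) (simp_all add: cv_def comult_hmul)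
    also have "(\<lambda>x. \<Delta> (\<alpha> x)) = cv D pure \<alpha> \<alpha>" using assms by (simp add: coalg_map_def fun_eq_iff)
    also have "(\<lambda>x. \<Delta> (\<beta> x)) = cv D pure \<beta> \<beta>" using assms by (simp add: coalg_map_def fun_eq_iff)
    also have "cv D hmul (cv D pure \<alpha> \<alpha>) (cv D pure \<beta> \<beta>) = cv D pure (\<alpha> \<star> \<beta>) (\<alpha> \<star> \<beta>)"
      by (rule X.cv_interchange) simp_all
    finally show ?thesis .
  qed
  moreover have "\<epsilon> ((\<alpha> \<star> \<beta>) x) = e x" for x
  proof -
    have "\<epsilon> ((\<alpha> \<star> \<beta>) x) = cv D (*) (\<lambda>x. \<epsilon> (\<alpha> x)) (\<lambda>x. \<epsilon> (\<beta> x)) x"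
      by (subst X.cv_post) (simp_all add: cv_def counit_mult)
    also have "\<dots> = cv D (*) (X.cc 1) e x"
      using assms by (simp add: coalg_map_def scaleC_complex_def)
    also have "\<dots> = e x" by (simp add: X.cv_cc_left X.e_linear)
    finally show ?thesis .
  qed
  ultimately show ?thesis by (simp add: coalg_map_def)
qed

lemma pt_one [simp]: "pt (X.cc 1)"
  by (simp add: coalg_map_def clinear_scale comult_one counit_one X.cv_cc_cc scaleC_complex_def)

lemma pt_antipode [simp]:
  assumes "pt \<alpha>"
  shows "pt (\<lambda>x. S (\<alpha> x))"
proof -
  have "coalg_map \<Delta> \<epsilon> \<Delta> \<epsilon> S"
    by (simp add: coalg_map_def comult_antipode counit_antipode)
  then show ?thesis by (rule coalg_map_compose[OF assms])
qed

lemma antipode_points: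
  assumes "pt \<alpha>"
  shows "\<alpha> \<star> (\<lambda>x. S (\<alpha> x)) = X.cc 1" "(\<lambda>x. S (\<alpha> x)) \<star> \<alpha> = X.cc 1"
proof -
  have "cv \<Delta> (*) (\<lambda>x. x) S h = \<epsilon> h *\<^sub>C 1" "cv \<Delta> (*) S (\<lambda>x. x) h = \<epsilon> h *\<^sub>C 1" for h
    using antipode_left antipode_right by (simp_all add: cv_def)
  then show "\<alpha> \<star> (\<lambda>x. S (\<alpha> x)) = X.cc 1" "(\<lambda>x. S (\<alpha> x)) \<star> \<alpha> = X.cc 1"
    using cv_pullback[OF assms cbilinear_mult, of "\<lambda>x. x" S] cv_pullback[OF assms cbilinear_mult, of S "\<lambda>x. x"]
    by (simp_all add: fun_eq_iff coalg_map_counit[OF assms])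
qed

lemma mult_assoc: "clinear f \<Longrightarrow> clinear g \<Longrightarrow> clinear h \<Longrightarrow> (f \<star> g) \<star> h = f \<star> (g \<star> h)"
  for f g h :: "'x \<Rightarrow> 'v::calgebra"
  by (rule X.cv_assoc) (simp_all add: mult.assoc)

lemma mult_one_left [simp]: "clinear f \<Longrightarrow> X.cc 1 \<star> f = f"
  and mult_one_right [simp]: "clinear f \<Longrightarrow> f \<star> X.cc 1 = f"
  for f :: "'x \<Rightarrow> 'v::calgebra"
  by (simp_all add: X.cv_cc_left X.cv_cc_right)

end

text \<open>The tensor product of two points is a map into the tensor product of coalgebras; its components are
  recovered by the projections \<open>p\<^sub>1 = id \<otimes> \<epsilon>\<close> and \<open>p\<^sub>2 = \<epsilon> \<otimes> id\<close>.\<close>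

context two_coalgebras
begin

definition p1 :: "('x, 'y) tensor \<Rightarrow> 'x" where "p1 = tlift (\<lambda>x y. e' y *\<^sub>C x)"
definition p2 :: "('x, 'y) tensor \<Rightarrow> 'y" where "p2 = tlift (\<lambda>x y. e x *\<^sub>C y)"

lemma p1_bil: "cbilinear (\<lambda>(x::'x) y. e' y *\<^sub>C x)"
  by (rule cbilinear_flip[OF cbilinear_compose[OF cbilinear_scaleC Y.e_linear clinear_id]])

lemma p2_bil: "cbilinear (\<lambda>x (y::'y). e x *\<^sub>C y)"
  by (rule cbilinear_compose[OF cbilinear_scaleC X.e_linear clinear_id])

lemma clinear_p1 [simp]: "clinear p1" and clinear_p2 [simp]: "clinear p2"
  by (simp_all add: p1_def p2_def clinear_tlift p1_bil p2_bil)

lemma p1_pure [simp]: "p1 (x \<otimes> y) = e' y *\<^sub>C x" and p2_pure [simp]: "p2 (x \<otimes> y) = e x *\<^sub>C y"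
  by (simp_all add: p1_def p2_def tlift_pure p1_bil p2_bil)

text \<open>The leg of \<open>y\<close> that meets \<open>p1\<close> is consumed by the counit, so
  only the coproduct of \<open>x\<close> survives.\<close>

lemma cv_p1_left:
  assumes m: "cbilinear m" and f: "clinear f" and g: "clinear g"
  shows "cv (tD D D') m (\<lambda>w. f (p1 w)) g (x \<otimes> y) = sweedler2 D (\<lambda>x1 x2. m (f x1) (g (x2 \<otimes> y))) x"
proof -
  have "clinear (\<lambda>y. m (f x1) (g (x2 \<otimes> y)))" for x1 x2
    by (rule clinear_compose[OF cbilinear_right[OF m] clinear_compose[OF g cbilinear_right[OF cbilinear_pure]]])
  then show ?thesis
    by (simp add: cv_tD[OF m clinear_compose[OF f clinear_p1] g] clinear_scale[OF f]
        clinear_scale[OF cbilinear_left[OF m]] Y.sw_counit_left)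
qed

lemma cv_p1_right:
  assumes m: "cbilinear m" and f: "clinear f" and g: "clinear g"
  shows "cv (tD D D') m g (\<lambda>w. f (p1 w)) (x \<otimes> y) = sweedler2 D (\<lambda>x1 x2. m (g (x1 \<otimes> y)) (f x2)) x"
proof -
  have "clinear (\<lambda>y. m (g (x1 \<otimes> y)) (f x2))" for x1 x2
    by (rule clinear_compose[OF cbilinear_left[OF m] clinear_compose[OF g cbilinear_right[OF cbilinear_pure]]])
  then show ?thesis
    by (simp add: cv_tD[OF m g clinear_compose[OF f clinear_p1]] clinear_scale[OF f]
        clinear_scale[OF cbilinear_right[OF m]] Y.sw_counit_right)
qed

lemma cv_p2_left:
  assumes m: "cbilinear m" and f: "clinear f" and g: "clinear g"
  shows "cv (tD D D') m (\<lambda>w. f (p2 w)) g (x \<otimes> y) = sweedler2 D' (\<lambda>y1 y2. m (f y1) (g (x \<otimes> y2))) y"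
proof -
  have l: "clinear (\<lambda>x. m (f x1) (g (x \<otimes> x2)))" for x1 x2
    by (rule clinear_compose[OF cbilinear_right[OF m] clinear_compose[OF g cbilinear_left[OF cbilinear_pure]]])
  have "clinear (\<lambda>y2. m a (g (x2 \<otimes> y2)))" for x2 a
    by (rule clinear_compose[OF cbilinear_right[OF m] clinear_compose[OF g cbilinear_right[OF cbilinear_pure]]])
  then have b: "cbilinear (\<lambda>y1 y2. m (f y1) (g (x2 \<otimes> y2)))" for x2
    by (intro cbilinearI clinear_compose[OF cbilinear_left[OF m] f])
  have l': "clinear (\<lambda>x2. sweedler2 D' (\<lambda>y1 y2. m (f y1) (g (x2 \<otimes> y2))) y)"
    by (rule clinear_sweedler2_param) (rule l)
  have s: "sweedler2 D' (\<lambda>y1 y2. c *\<^sub>C m (f y1) (g (x2 \<otimes> y2))) y = c *\<^sub>C sweedler2 D' (\<lambda>y1 y2. m (f y1) (g (x2 \<otimes> y2))) y" for c x2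
    by (subst sweedler2_post[OF _ b]) simp_all
  show ?thesis
    by (simp add: cv_tD[OF m clinear_compose[OF f clinear_p2] g] clinear_scale[OF f]
        clinear_scale[OF cbilinear_left[OF m]] s X.sw_counit_left[OF l'])
qed

text \<open>Evaluating a convolution of the two projections at a pure tensor frees the two variables
  from each other. An identity at the pair of projections is thus an identity in two independent
  elements.\<close>

lemma cv_p1_p2:
  assumes m: "cbilinear m" and f: "clinear f" and g: "clinear g"
  shows "cv (tD D D') m (\<lambda>w. f (p1 w)) (\<lambda>w. g (p2 w)) (x \<otimes> y) = m (f x) (g y)"
  using X.sw_counit_right[OF clinear_compose[OF cbilinear_left[OF m] f]]
  by (simp add: cv_p1_left[OF m f clinear_compose[OF g clinear_p2]] clinear_scale[OF g]
      clinear_scale[OF cbilinear_right[OF m]])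

lemma p1_coalg_map: "coalg_map (tD D D') (te e e') D e p1"
proof -
  have "D (p1 w) = cv (tD D D') pure p1 p1 w" for w
  proof (rule tensor_ext[where t = w])
    show "clinear (\<lambda>w. D (p1 w))" by (rule clinear_compose[OF X.D_linear clinear_p1])
    show "D (p1 (a \<otimes> b)) = cv (tD D D') pure p1 p1 (a \<otimes> b)" for a b
    proof -
      have "cv (tD D D') pure p1 p1 (a \<otimes> b) = sweedler2 D (\<lambda>x1 x2. e' b *\<^sub>C (x1 \<otimes> x2)) a"
        using cv_p1_left[OF cbilinear_pure clinear_id clinear_p1] by (simp add: clinear_scale[OF cbilinear_right[OF cbilinear_pure]])
      also have "\<dots> = e' b *\<^sub>C sweedler2 D pure a"
        by (rule sweedler2_post[symmetric]) simp_all
      finally show ?thesis by (simp add: clinear_scale[OF X.D_linear] sweedler2_def tlift_pure_id)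
    qed
  qed simp
  moreover have "e (p1 w) = te e e' w" for w
    by (rule tensor_ext[where t = w])
      (simp_all add: clinear_te clinear_compose[OF X.e_linear clinear_p1] clinear_scale[OF X.e_linear] scaleC_complex_def)
  ultimately show ?thesis by (simp add: coalg_map_def)
qed

lemma p2_coalg_map: "coalg_map (tD D D') (te e e') D' e' p2"
proof -
  have "D' (p2 w) = cv (tD D D') pure p2 p2 w" for w
  proof (rule tensor_ext[where t = w])
    show "clinear (\<lambda>w. D' (p2 w))" by (rule clinear_compose[OF Y.D_linear clinear_p2])
    show "D' (p2 (a \<otimes> b)) = cv (tD D D') pure p2 p2 (a \<otimes> b)" for a b
    proof -
      have "cv (tD D D') pure p2 p2 (a \<otimes> b) = sweedler2 D' (\<lambda>x1 x2. e a *\<^sub>C (x1 \<otimes> x2)) b"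
        using cv_p2_left[OF cbilinear_pure clinear_id clinear_p2] by (simp add: clinear_scale[OF cbilinear_right[OF cbilinear_pure]])
      also have "\<dots> = e a *\<^sub>C sweedler2 D' pure b"
        by (rule sweedler2_post[symmetric]) simp_all
      finally show ?thesis by (simp add: clinear_scale[OF Y.D_linear] sweedler2_def tlift_pure_id)
    qed
  qed simp
  moreover have "e' (p2 w) = te e e' w" for w
    by (rule tensor_ext[where t = w])
      (simp_all add: clinear_te clinear_compose[OF Y.e_linear clinear_p2] clinear_scale[OF Y.e_linear] scaleC_complex_def)
  ultimately show ?thesis by (simp add: coalg_map_def)
qed

end

text \<open>Among cocommutative coalgebras the tensor product is the categorical product: two points
  combine to one point of the product and are recovered from it by the projections.\<close>

lemma coalg_map_pair:
  assumes "cocomm_coalgebra D e" "two_coalgebras D1 e1 D2 e2"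
    and a: "coalg_map D e D1 e1 \<alpha>" and b: "coalg_map D e D2 e2 \<beta>"
  shows "coalg_map D e (tD D1 D2) (te e1 e2) (cv D pure \<alpha> \<beta>)"
    and "two_coalgebras.p1 e2 (cv D pure \<alpha> \<beta> x) = \<alpha> x"
    and "two_coalgebras.p2 e1 (cv D pure \<alpha> \<beta> x) = \<beta> x"
proof -
  interpret X: cocomm_coalgebra D e by fact
  interpret Y: two_coalgebras D1 e1 D2 e2 by fact
  note [simp] = coalg_map_linear[OF a] coalg_map_linear[OF b]
  show "Y.p1 (cv D pure \<alpha> \<beta> x) = \<alpha> x" for x
  proof -
    have "Y.p1 (cv D pure \<alpha> \<beta> x) = cv D (\<lambda>x y. y *\<^sub>C x) \<alpha> (\<lambda>x. e2 (\<beta> x)) x"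
      by (subst X.cv_post) (simp_all add: cv_def)
    also have "(\<lambda>x. e2 (\<beta> x)) = X.cc 1"
      by (simp add: coalg_map_counit[OF b] scaleC_complex_def)
    finally show ?thesis by (simp add: X.cv_cc_right cbilinear_flip[OF cbilinear_scaleC] scaleC_one)
  qed
  show "Y.p2 (cv D pure \<alpha> \<beta> x) = \<beta> x" for x
  proof -
    have "Y.p2 (cv D pure \<alpha> \<beta> x) = cv D (\<lambda>x y. x *\<^sub>C y) (\<lambda>x. e1 (\<alpha> x)) \<beta> x"
      by (subst X.cv_post) (simp_all add: cv_def)
    also have "(\<lambda>x. e1 (\<alpha> x)) = X.cc 1"
      by (simp add: coalg_map_counit[OF a] scaleC_complex_def)
    finally show ?thesis by (simp add: X.cv_cc_left scaleC_one)
  qed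
  \<comment> \<open>\<open>G\<close> is the reshuffling built into the coproduct of a tensor
    product, so that \<open>tD\<close> becomes \<open>G\<close> applied to the two
    coproducts.\<close>
  define G where "G s t = tlift (\<lambda>a b. tlift (\<lambda>c d. (a \<otimes> c) \<otimes> (b \<otimes> d)) t) s"
    for s :: "('b, 'b) tensor" and t :: "('c, 'c) tensor"
  have g1: "cbilinear (\<lambda>c d. (a \<otimes> c) \<otimes> (b \<otimes> d))" for a b :: 'b and c d :: 'c
    by (rule cbilinearI) simp_all
  have g2: "cbilinear (\<lambda>a b. tlift (\<lambda>c d. (a \<otimes> c) \<otimes> (b \<otimes> d)) t)" for t :: "('c, 'c) tensor" and a b :: 'b
    by (rule cbilinearI; rule clinear_tlift_param) simp_all
  have G: "cbilinear G" unfolding G_def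
    by (rule cbilinearI) (rule clinear_tlift[OF g2], rule clinear_tlift_param, rule clinear_tlift[OF g1])
  have Gp: "G (a \<otimes> b) (c \<otimes> d) = (a \<otimes> c) \<otimes> (b \<otimes> d)" for a b c d
    by (simp only: G_def tlift_pure[OF g2]) (simp only: tlift_pure[OF g1])
  have tDG: "tD D1 D2 (x \<otimes> y) = G (D1 x) (D2 y)" for x y
    by (simp add: Y.tD_pure G_def sweedler2_def)
  have "tD D1 D2 (cv D pure \<alpha> \<beta> x) = cv D pure (cv D pure \<alpha> \<beta>) (cv D pure \<alpha> \<beta>) x" for x
  proof -
    have "tD D1 D2 (cv D pure \<alpha> \<beta> x) = cv D G (\<lambda>x. D1 (\<alpha> x)) (\<lambda>x. D2 (\<beta> x)) x"
      by (subst X.cv_post) (simp_all add: cv_def tDG Y.clinear_tD)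
    also have "(\<lambda>x. D1 (\<alpha> x)) = cv D pure \<alpha> \<alpha>" using a by (simp add: coalg_map_def fun_eq_iff)
    also have "(\<lambda>x. D2 (\<beta> x)) = cv D pure \<beta> \<beta>" using b by (simp add: coalg_map_def fun_eq_iff)
    also have "cv D G (cv D pure \<alpha> \<alpha>) (cv D pure \<beta> \<beta>) = cv D pure (cv D pure \<alpha> \<beta>) (cv D pure \<alpha> \<beta>)"
      by (rule X.cv_interchange) (simp_all add: G Gp)
    finally show ?thesis .
  qed
  moreover have "te e1 e2 (cv D pure \<alpha> \<beta> x) = e x" for x
  proof -
    have "te e1 e2 (cv D pure \<alpha> \<beta> x) = cv D (*) (\<lambda>x. e1 (\<alpha> x)) (\<lambda>x. e2 (\<beta> x)) x"
      by (subst X.cv_post) (simp_all add: cv_def Y.clinear_te)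
    also have "\<dots> = cv D (*) (X.cc 1) e x"
      by (simp add: coalg_map_counit[OF a] coalg_map_counit[OF b] scaleC_complex_def)
    also have "\<dots> = e x" by (simp add: X.cv_cc_left X.e_linear)
    finally show ?thesis .
  qed
  ultimately show "coalg_map D e (tD D1 D2) (te e1 e2) (cv D pure \<alpha> \<beta>)"
    by (simp add: coalg_map_def)
qed

section \<open>Crossed products with central cocycle\<close>

lemma clinear_mult_left [simp]: "clinear f \<Longrightarrow> clinear (\<lambda>x. f x * b)"
  and clinear_mult_right [simp]: "clinear f \<Longrightarrow> clinear (\<lambda>x. b * f x)" for b :: "'a::calgebra"
  by (rule clinear_compose[OF cbilinear_left[OF cbilinear_mult]] clinear_compose[OF cbilinear_right[OF cbilinear_mult]], assumption)+

lemma cv_cong: "(\<And>x y. m (f x) (g y) = m' (f' x) (g' y)) \<Longrightarrow> cv D m f g = cv D m' f' g'"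
  by (simp add: cv_def fun_eq_iff)

context two_coalgebras
begin

text \<open>Reads a double triple-Sweedler sum as two nested convolutions over the product
  coalgebra; this is the form in which the twisted module law can be manipulated.\<close>

lemma sweedler3_tD:
  assumes m: "cbilinear m" "cbilinear n" and l: "clinear f" "clinear g" "clinear k"
  shows "sweedler3 D (\<lambda>x1 x2 x3. sweedler3 D' (\<lambda>y1 y2 y3. m (n (f (x1 \<otimes> y1)) (g (x2 \<otimes> y2))) (k (x3 \<otimes> y3))) y) x =
    cv (tD D D') m (cv (tD D D') n f g) k (x \<otimes> y)"
proof -
  let ?F = "\<lambda>x1 x2 x3 y1 y2 y3. m (n (f (x1 \<otimes> y1)) (g (x2 \<otimes> y2))) (k (x3 \<otimes> y3))"
  note pl = cbilinear_left[OF cbilinear_pure] cbilinear_right[OF cbilinear_pure]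
  have F: "clinear (\<lambda>a. ?F a x2 x3 y1 y2 y3)" "clinear (\<lambda>a. ?F x1 a x3 y1 y2 y3)" "clinear (\<lambda>a. ?F x1 x2 a y1 y2 y3)"
    "clinear (\<lambda>a. ?F x1 x2 x3 a y2 y3)" "clinear (\<lambda>a. ?F x1 x2 x3 y1 a y3)" "clinear (\<lambda>a. ?F x1 x2 x3 y1 y2 a)"
    for x1 x2 x3 y1 y2 y3
    by (rule clinear_compose[OF cbilinear_left[OF m(1)] clinear_compose[OF cbilinear_left[OF m(2)] clinear_compose[OF l(1) pl(1)]]]
        clinear_compose[OF cbilinear_left[OF m(1)] clinear_compose[OF cbilinear_right[OF m(2)] clinear_compose[OF l(2) pl(1)]]]
        clinear_compose[OF cbilinear_right[OF m(1)] clinear_compose[OF l(3) pl(1)]]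
        clinear_compose[OF cbilinear_left[OF m(1)] clinear_compose[OF cbilinear_left[OF m(2)] clinear_compose[OF l(1) pl(2)]]]
        clinear_compose[OF cbilinear_left[OF m(1)] clinear_compose[OF cbilinear_right[OF m(2)] clinear_compose[OF l(2) pl(2)]]]
        clinear_compose[OF cbilinear_right[OF m(1)] clinear_compose[OF l(3) pl(2)]])+
  have b1: "cbilinear (\<lambda>y1 y2. ?F x1 x2 x3 y1 y2 y3)" for x1 x2 x3 y3
    by (rule cbilinearI; rule F)
  have b2: "cbilinear (\<lambda>x1 x2. sweedler2 D' (\<lambda>y1 y2. ?F x1 x2 x3 y1 y2 y3) y')" for x3 y3 y'
    by (rule cbilinearI; rule clinear_sweedler2_param, rule F)
  have b3: "cbilinear (\<lambda>y' y3. sweedler2 D' (\<lambda>y1 y2. ?F x1 x2 x3 y1 y2 y3) y')" for x1 x2 x3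
    by (rule cbilinearI) (rule clinear_sweedler2[OF Y.D_linear b1], rule clinear_sweedler2_param, rule F)
  have n1: "cbilinear (\<lambda>y1 y2. n (f (x1 \<otimes> y1)) (g (x2 \<otimes> y2)))" for x1 x2
    by (rule cbilinear_compose[OF m(2)]; rule clinear_compose[OF l(1) pl(2)] clinear_compose[OF l(2) pl(2)])
  have n2: "cbilinear (\<lambda>x1 x2. sweedler2 D' (\<lambda>y1 y2. n (f (x1 \<otimes> y1)) (g (x2 \<otimes> y2))) y)" for y
    by (rule cbilinearI; rule clinear_sweedler2_param,
        rule clinear_compose[OF cbilinear_left[OF m(2)] clinear_compose[OF l(1) pl(1)]]
          clinear_compose[OF cbilinear_right[OF m(2)] clinear_compose[OF l(2) pl(1)]])
  show ?thesis
    unfolding sweedler3_def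
    unfolding sweedler2_swap[OF b3 b2]
    unfolding cv_tD[OF m(1) XY.clinear_cv[OF m(2) l(1,2)] l(3)] cv_tD[OF m(2) l(1,2)]
    unfolding sweedler2_post[OF cbilinear_left[OF m(1)] n2] sweedler2_post[OF cbilinear_left[OF m(1)] n1] ..
qed

lemma cv_p2_p2:
  assumes "cbilinear m" "clinear f" "clinear g"
  shows "cv (tD D D') m (\<lambda>w. f (p2 w)) (\<lambda>w. g (p2 w)) = (\<lambda>w. cv D' m f g (p2 w))"
  using cv_pullback[OF p2_coalg_map assms] by (simp add: fun_eq_iff)

end

locale central_crossed_product = crossed_product \<Delta> \<epsilon> S act \<sigma> \<sigma>'
  for \<Delta> :: "'h::calgebra \<Rightarrow> ('h, 'h) tensor" and \<epsilon> S
    and act :: "'h \<Rightarrow> 'b::calgebra \<Rightarrow> 'b" and \<sigma> \<sigma>' +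
  assumes cocomm: "cocommutative \<Delta>"
    and sigma_central: "\<sigma> h k * b = b * \<sigma> h k"

sublocale central_crossed_product \<subseteq> cocomm_hopf \<Delta> \<epsilon> S
  by (intro cocomm_hopf.intro hopf_algebra_axioms cocomm_hopf_axioms.intro cocomm)

context central_crossed_product
begin

declare act_bilinear [simp] sigma_bilinear [simp] sigma'_bilinear [simp]

lemma clinear_act_left [simp]: "clinear f \<Longrightarrow> clinear (\<lambda>x. act (f x) b)"
  and clinear_act_right [simp]: "clinear g \<Longrightarrow> clinear (\<lambda>x. act h (g x))"
  by (rule clinear_compose[OF cbilinear_left[OF act_bilinear]] clinear_compose[OF cbilinear_right[OF act_bilinear]], assumption)+

abbreviation "E2 \<equiv> tD \<Delta> \<Delta>"
abbreviation "E3 \<equiv> tD \<Delta> E2"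
abbreviation "\<pi>1 \<equiv> H2.p1"
abbreviation "\<pi>2 \<equiv> H2.p2"

text \<open>The cocycle as one linear map on H \<otimes> H, written as a convolution so that it can
  be pulled back along pairs of points.\<close>

abbreviation sg2 :: "('h, 'h) tensor \<Rightarrow> 'b" where "sg2 \<equiv> cv E2 \<sigma> \<pi>1 \<pi>2"
abbreviation sg2' :: "('h, 'h) tensor \<Rightarrow> 'b" where "sg2' \<equiv> cv E2 \<sigma>' \<pi>1 \<pi>2"

lemma sg2_pure [simp]: "sg2 (h \<otimes> k) = \<sigma> h k" and sg2'_pure [simp]: "sg2' (h \<otimes> k) = \<sigma>' h k"
  using H2.cv_p1_p2[OF sigma_bilinear clinear_id clinear_id] H2.cv_p1_p2[OF sigma'_bilinear clinear_id clinear_id]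
  by simp_all

lemma sg2_inverse: "cv E2 (*) sg2 sg2' = H2.XY.cc 1" "cv E2 (*) sg2' sg2 = H2.XY.cc 1"
proof -
  have "cv E2 (*) sg2 sg2' w = H2.XY.cc 1 w" "cv E2 (*) sg2' sg2 w = H2.XY.cc 1 w" for w
    by (rule tensor_ext[where t = w];
        simp add: H2.cv_tD sigma_right_inverse sigma_left_inverse)+
  then show "cv E2 (*) sg2 sg2' = H2.XY.cc 1" "cv E2 (*) sg2' sg2 = H2.XY.cc 1" by auto
qed

lemma sg2_central: "sg2 w * b = b * sg2 w"
  by (rule tensor_ext[where t = w])
    (simp_all add: clinear_compose[OF cbilinear_left[OF cbilinear_mult]]
      clinear_compose[OF cbilinear_right[OF cbilinear_mult]] sigma_central)

text \<open>As \<sigma> is central it commutes past the middle factor of the twisted module law and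
  cancels against its inverse. Hence \<rhd> is an honest action, which the smash product
  requires.\<close>

lemma act_act: "act h (act k b) = act (h * k) b"
proof -
  let ?c = "H2.XY.cc" and ?m = "cv E2 (*) :: (_ \<Rightarrow> 'b) \<Rightarrow> (_ \<Rightarrow> 'b) \<Rightarrow> _"
  define G where "G = (\<lambda>w. act (cv E2 (*) \<pi>1 \<pi>2 w) b)"
  have G: "clinear G" unfolding G_def
    by (rule clinear_compose[OF cbilinear_left[OF act_bilinear]]) simp
  have Gp: "G (h \<otimes> k) = act (h * k) b" for h k
    using H2.cv_p1_p2[OF cbilinear_mult clinear_id clinear_id] by (simp add: G_def)
  have "act h (act k b) = ?m (?m sg2 G) sg2' (h \<otimes> k)"
    unfolding twisted_module
    by (subst H2.sweedler3_tD[symmetric]) (simp_all add: G Gp)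
  also have "?m sg2 G = ?m G sg2"
  proof -
    have "?m sg2 G = cv E2 (\<lambda>a b. b * a) G sg2" by (rule H2.XY.cv_comm) (simp_all add: G)
    also have "\<dots> = ?m G sg2" by (rule cv_cong) (rule sg2_central)
    finally show ?thesis .
  qed
  also have "?m (?m G sg2) sg2' = ?m G (?m sg2 sg2')"
    by (rule H2.XY.cv_assoc) (simp_all add: mult.assoc G)
  also have "\<dots> = G" by (simp add: sg2_inverse H2.XY.cv_cc_right G)
  finally show ?thesis by (simp add: Gp)
qed

abbreviation cmult (infixl "\<bullet>" 70) where "x \<bullet> y \<equiv> crossed_mult \<Delta> act \<sigma> x y"

text \<open>The product of \<open>b \<otimes> h\<close> and \<open>c \<otimes> k\<close> as a linear
  function of \<open>h \<otimes> k\<close>, in convolution form; evaluating it at a pair of points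
  gives the multiplication rule for points.\<close>

definition pure_prod :: "'b \<Rightarrow> 'b \<Rightarrow> ('h, 'h) tensor \<Rightarrow> ('b, 'h) tensor" where
  "pure_prod b c = cv E2 pure
     (cv E2 (*) (cv E2 (*) (H2.XY.cc b) (cv E2 act \<pi>1 (H2.XY.cc c))) sg2) (cv E2 (*) \<pi>1 \<pi>2)"

lemma clinear_pure_prod [simp]: "clinear (pure_prod b c)"
  by (simp add: pure_prod_def)

lemma cbilinear_pure_prod_left: "cbilinear (\<lambda>b. pure_prod b c)"
  unfolding pure_prod_def by simp

lemma cbilinear_pure_prod_right: "cbilinear (pure_prod b)"
  unfolding pure_prod_def[abs_def] by simp

lemmas pure_prod_left = cbilinear_left[OF cbilinear_pure_prod_left]
lemmas pure_prod_right = cbilinear_left[OF cbilinear_pure_prod_right]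

lemma pure_prod_eq:
  "sweedler3 \<Delta> (\<lambda>h1 h2 h3. sweedler2 \<Delta> (\<lambda>k1 k2. (b * act h1 c * \<sigma> h2 k1) \<otimes> (h3 * k2)) k) h =
    pure_prod b c (h \<otimes> k)"
proof -
  have la: "clinear (\<lambda>h. b * act h c)"
    by (rule clinear_compose[OF cbilinear_right[OF cbilinear_mult] cbilinear_left[OF act_bilinear]])
  have t1: "cv E2 (*) (H2.XY.cc b) (cv E2 act \<pi>1 (H2.XY.cc c)) = (\<lambda>w. b * act (\<pi>1 w) c)"
    by (simp add: H2.XY.cv_cc_right H2.XY.cv_cc_left clinear_compose[OF cbilinear_left[OF act_bilinear]])
  have t2: "cv E2 (*) (\<lambda>w. b * act (\<pi>1 w) c) sg2 (h \<otimes> k) = sweedler2 \<Delta> (\<lambda>h1 h2. b * act h1 c * \<sigma> h2 k) h" for h k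
    using H2.cv_p1_left[OF cbilinear_mult la, of sg2] by simp
  have lm: "clinear (\<lambda>w. b * act (\<pi>1 w) c)" by (rule clinear_compose[OF la H2.clinear_p1])
  have t3: "cv E2 (*) \<pi>1 \<pi>2 (h \<otimes> k) = h * k" for h k
    using H2.cv_p1_p2[OF cbilinear_mult clinear_id clinear_id] by simp
  have b: "cbilinear (\<lambda>h1 h2. b * act h1 c * \<sigma> h2 k)" for k
    by (rule cbilinear_compose[OF cbilinear_mult la cbilinear_left[OF sigma_bilinear]])
  have bp: "cbilinear (\<lambda>k1 k2. (b * act h1 c * \<sigma> h2 k1) \<otimes> (h3 * k2))" for h1 h2 h3 :: 'h
    by (rule cbilinearI) (simp_all add: cbilinear_right)
  have lp: "clinear (\<lambda>a. a \<otimes> (h3 * k2))" for h3 k2 :: 'h by simp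
  have bh: "cbilinear (\<lambda>h1 h2. (b * act h1 c * \<sigma> h2 k1) \<otimes> (h3 * k2))" for k1 k2 h3 :: 'h
    by (rule cbilinear_post[OF lp b])
  show ?thesis
    unfolding pure_prod_def t1 H2.cv_tD[OF cbilinear_pure H2.XY.clinear_cv[OF cbilinear_mult lm H2.XY.clinear_cv[OF sigma_bilinear H2.clinear_p1 H2.clinear_p2]] H2.XY.clinear_cv[OF cbilinear_mult H2.clinear_p1 H2.clinear_p2]]
      t2 t3 sweedler3_def sweedler2_post[OF lp b]
    by (subst sweedler2_swap[OF bp bh]) (rule refl)
qed

lemma crossed_mult_aux: "cbilinear (\<lambda>c k. pure_prod b c (h \<otimes> k))"
  by (rule cbilinearI[OF pure_prod_right clinear_compose[OF clinear_pure_prod cbilinear_right[OF cbilinear_pure]]])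

lemma crossed_mult_aux2: "cbilinear (\<lambda>b h. tlift (\<lambda>c k. pure_prod b c (h \<otimes> k)) y)"
  by (rule cbilinearI; rule clinear_tlift_param)
    (rule pure_prod_left, rule clinear_compose[OF clinear_pure_prod cbilinear_left[OF cbilinear_pure]])

lemma cbilinear_crossed_mult [simp]: "cbilinear (crossed_mult \<Delta> act \<sigma>)"
  unfolding crossed_mult_def pure_prod_eq
  by (rule cbilinearI)
    (rule clinear_tlift[OF crossed_mult_aux2], rule clinear_tlift_param, rule clinear_tlift[OF crossed_mult_aux])

lemma crossed_mult_pure: "(b \<otimes> h) \<bullet> (c \<otimes> k) = pure_prod b c (h \<otimes> k)"
  unfolding crossed_mult_def pure_prod_eq
  by (simp only: tlift_pure[OF crossed_mult_aux2]) (simp only: tlift_pure[OF crossed_mult_aux])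

end

section \<open>Action, cocycle and crossed product evaluated at points\<close>

locale crossed_points = central_crossed_product \<Delta> \<epsilon> S act \<sigma> \<sigma>' + hopf_points \<Delta> \<epsilon> S D e
  for \<Delta> :: "'h::calgebra \<Rightarrow> ('h, 'h) tensor" and \<epsilon> S
    and act :: "'h \<Rightarrow> 'b::calgebra \<Rightarrow> 'b" and \<sigma> \<sigma>'
    and D :: "'x::cvector \<Rightarrow> ('x, 'x) tensor" and e
begin

abbreviation conv_act (infixr "\<rhd>" 75) where "\<alpha> \<rhd> f \<equiv> cv D act \<alpha> f"
abbreviation sg where "sg \<equiv> cv D \<sigma>"
abbreviation sg' where "sg' \<equiv> cv D \<sigma>'"

lemma act_one_point: "clinear f \<Longrightarrow> X.cc 1 \<rhd> f = f"
  by (simp add: X.cv_cc_left one_act)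

lemma act_act_points: "clinear \<alpha> \<Longrightarrow> clinear \<beta> \<Longrightarrow> clinear f \<Longrightarrow> \<alpha> \<rhd> \<beta> \<rhd> f = (\<alpha> \<star> \<beta>) \<rhd> f"
  by (rule X.cv_assoc[symmetric]) (simp_all add: act_act)

lemma act_unit_points: "pt \<alpha> \<Longrightarrow> \<alpha> \<rhd> X.cc 1 = X.cc 1"
  by (simp add: X.cv_cc_right pt_linear act_unit coalg_map_counit)

text \<open>For constants this is the measuring axiom pulled back along \<alpha>;
  \<open>X.sub\<close> then replaces the constants by linear functions, one at a time. Most later
  identities at points are obtained by the same two moves.\<close>

lemma act_mult_points:
  assumes "pt \<alpha>" and [simp]: "clinear f" "clinear g"
  shows "\<alpha> \<rhd> (f \<star> g) = (\<alpha> \<rhd> f) \<star> (\<alpha> \<rhd> g)"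
proof -
  note [simp] = pt_linear[OF assms(1)]
  have c: "\<alpha> \<rhd> (X.cc b \<star> X.cc c) = (\<alpha> \<rhd> X.cc b) \<star> (\<alpha> \<rhd> X.cc c)" for b c
  proof
    fix x
    have "act h (b * c) = cv \<Delta> (*) (\<lambda>h. act h b) (\<lambda>h. act h c) h" for h
      by (simp add: cv_def act_mult)
    then show "(\<alpha> \<rhd> (X.cc b \<star> X.cc c)) x = ((\<alpha> \<rhd> X.cc b) \<star> (\<alpha> \<rhd> X.cc c)) x"
      using cv_pullback[OF assms(1) cbilinear_mult, of "\<lambda>h. act h b" "\<lambda>h. act h c"]
      by (simp add: X.cv_cc_cc X.cv_cc_right cbilinear_left)
  qed
  have "X.sub (\<lambda>b. \<alpha> \<rhd> (X.cc b \<star> X.cc c)) f = X.sub (\<lambda>b. (\<alpha> \<rhd> X.cc b) \<star> (\<alpha> \<rhd> X.cc c)) f" for c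
    unfolding c ..
  then have "\<alpha> \<rhd> (f \<star> X.cc c) = (\<alpha> \<rhd> f) \<star> (\<alpha> \<rhd> X.cc c)" for c
    by (simp add: X.sub_left X.sub_right X.sub_cc del: X.cv_cc_cc)
  then have "X.sub (\<lambda>c. \<alpha> \<rhd> (f \<star> X.cc c)) g = X.sub (\<lambda>c. (\<alpha> \<rhd> f) \<star> (\<alpha> \<rhd> X.cc c)) g" by simp
  then show ?thesis by (simp add: X.sub_left X.sub_right X.sub_cc)
qed

lemma pt_pair:
  assumes "pt \<alpha>" "pt \<beta>"
  shows "coalg_map D e E2 (te \<epsilon> \<epsilon>) (cv D pure \<alpha> \<beta>)"
    and "\<pi>1 (cv D pure \<alpha> \<beta> x) = \<alpha> x" "\<pi>2 (cv D pure \<alpha> \<beta> x) = \<beta> x"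
  by (rule coalg_map_pair[OF X.cocomm_coalgebra_axioms H2.two_coalgebras_axioms assms])+

lemma cv_pair:
  assumes "pt \<alpha>" "pt \<beta>" "cbilinear m"
  shows "cv E2 m \<pi>1 \<pi>2 (cv D pure \<alpha> \<beta> x) = cv D m \<alpha> \<beta> x"
  using cv_pullback[OF pt_pair(1)[OF assms(1,2)] assms(3), of \<pi>1 \<pi>2] by (simp add: pt_pair[OF assms(1,2)])

lemma sg_inverse:
  assumes "pt \<alpha>" "pt \<beta>"
  shows "sg \<alpha> \<beta> \<star> sg' \<alpha> \<beta> = X.cc 1" "sg' \<alpha> \<beta> \<star> sg \<alpha> \<beta> = X.cc 1"
proof -
  have "cv E2 (*) sg2 sg2' (cv D pure \<alpha> \<beta> x) = (sg \<alpha> \<beta> \<star> sg' \<alpha> \<beta>) x"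
    "cv E2 (*) sg2' sg2 (cv D pure \<alpha> \<beta> x) = (sg' \<alpha> \<beta> \<star> sg \<alpha> \<beta>) x" for x
    using cv_pullback[OF pt_pair(1)[OF assms] cbilinear_mult, of sg2 sg2']
      cv_pullback[OF pt_pair(1)[OF assms] cbilinear_mult, of sg2' sg2] by (simp_all add: cv_pair assms)
  then show "sg \<alpha> \<beta> \<star> sg' \<alpha> \<beta> = X.cc 1" "sg' \<alpha> \<beta> \<star> sg \<alpha> \<beta> = X.cc 1"
    by (simp_all add: sg2_inverse coalg_map_counit[OF pt_pair(1)[OF assms]] fun_eq_iff)
qed

lemma sg_one [simp]:
  assumes "pt \<alpha>"
  shows "sg \<alpha> (X.cc 1) = X.cc 1" "sg (X.cc 1) \<alpha> = X.cc 1" "sg' \<alpha> (X.cc 1) = X.cc 1" "sg' (X.cc 1) \<alpha> = X.cc 1"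
proof -
  note [simp] = pt_linear[OF assms]
  show 1: "sg \<alpha> (X.cc 1) = X.cc 1" "sg (X.cc 1) \<alpha> = X.cc 1"
    by (simp_all add: X.cv_cc_right X.cv_cc_left sigma_one_left sigma_one_right coalg_map_counit[OF assms])
  \<comment> \<open>The inverse of \<sigma> is normalised because it is inverse to a factor that
    equals the unit.\<close>
  show "sg' \<alpha> (X.cc 1) = X.cc 1" "sg' (X.cc 1) \<alpha> = X.cc 1"
    using sg_inverse(1)[OF assms pt_one] sg_inverse(1)[OF pt_one assms] by (simp_all add: 1)
qed

lemma sg_commute:
  assumes [simp]: "clinear \<alpha>" "clinear \<beta>" "clinear f"
  shows "sg \<alpha> \<beta> \<star> f = f \<star> sg \<alpha> \<beta>"
proof -
  have *: "sg \<alpha> \<beta> x * b = b * sg \<alpha> \<beta> x" for x b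
    by (simp add: X.cv_post[of "\<lambda>a. a * b"] X.cv_post[of "\<lambda>a. b * a"] sigma_central cbilinear_left cbilinear_right)
  have "sg \<alpha> \<beta> \<star> f = cv D (\<lambda>a b. b * a) f (sg \<alpha> \<beta>)"
    by (rule X.cv_comm) simp_all
  also have "\<dots> = f \<star> sg \<alpha> \<beta>"
    by (rule cv_cong) (rule *)
  finally show ?thesis .
qed

text \<open>The identity is first proved at the three projections of H \<otimes> H \<otimes> H,
  where it is the cocycle axiom, and then pulled back along the point \<open>?\<Theta>\<close> with
  components \<alpha>, \<beta>, \<mu>.\<close>

lemma cocycle_points:
  assumes "pt \<alpha>" "pt \<beta>" "pt \<mu>"
  shows "(\<alpha> \<rhd> sg \<beta> \<mu>) \<star> sg \<alpha> (\<beta> \<star> \<mu>) = sg \<alpha> \<beta> \<star> sg (\<alpha> \<star> \<beta>) \<mu>"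
proof -
  let ?\<Theta> = "cv D pure \<alpha> (cv D pure \<beta> \<mu>)"
  let ?a = "H3.p1" and ?b = "\<lambda>w. \<pi>1 (H3.p2 w)" and ?m = "\<lambda>w. \<pi>2 (H3.p2 w)"
  let ?c = "cv E3"
  note pm = pt_linear[OF assms(1)] pt_linear[OF assms(2)] pt_linear[OF assms(3)]
  have \<Theta>: "coalg_map D e E3 (te \<epsilon> (te \<epsilon> \<epsilon>)) ?\<Theta>" "H3.p1 (?\<Theta> x) = \<alpha> x" "H3.p2 (?\<Theta> x) = cv D pure \<beta> \<mu> x" for x
    by (rule coalg_map_pair[OF X.cocomm_coalgebra_axioms H3.two_coalgebras_axioms assms(1) pt_pair(1)[OF assms(2,3)]])+
  have lin [simp]: "clinear ?b" "clinear ?m" "clinear (\<lambda>w. sg2 (H3.p2 w))" "clinear (\<lambda>w. cv E2 (*) \<pi>1 \<pi>2 (H3.p2 w))"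
    by (rule clinear_compose[OF _ H3.clinear_p2]; simp)+
  have eq: "?c (*) (?c act ?a (?c \<sigma> ?b ?m)) (?c \<sigma> ?a (?c (*) ?b ?m)) w = ?c (*) (?c \<sigma> ?a ?b) (?c \<sigma> (?c (*) ?a ?b) ?m) w" for w
  proof (rule tensor_ext[where t = w])
    fix h and u :: "('h, 'h) tensor"
    let ?L = "?c (*) (?c act ?a (?c \<sigma> ?b ?m)) (?c \<sigma> ?a (?c (*) ?b ?m))"
    let ?R = "?c (*) (?c \<sigma> ?a ?b) (?c \<sigma> (?c (*) ?a ?b) ?m)"
    show "?L (h \<otimes> u) = ?R (h \<otimes> u)"
    proof (rule tensor_ext[where t = u])
      show "clinear (\<lambda>u. ?L (h \<otimes> u))" "clinear (\<lambda>u. ?R (h \<otimes> u))"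
        by (rule clinear_compose[OF _ cbilinear_right[OF cbilinear_pure]]; simp)+
      fix k m
      have e1: "?c act ?a (?c \<sigma> ?b ?m) (h \<otimes> w) = act h (sg2 w)" for h w
        using H3.cv_p1_p2[OF act_bilinear clinear_id, of sg2] H3.cv_p2_p2[OF sigma_bilinear, of \<pi>1 \<pi>2] by simp
      have e2: "?c \<sigma> ?a (?c (*) ?b ?m) (h \<otimes> w) = \<sigma> h (cv E2 (*) \<pi>1 \<pi>2 w)" for h w
        using H3.cv_p1_p2[OF sigma_bilinear clinear_id, of "cv E2 (*) \<pi>1 \<pi>2"] H3.cv_p2_p2[OF cbilinear_mult, of \<pi>1 \<pi>2] by simp
      have e3: "?c n ?a ?b (h \<otimes> w) = n h (\<pi>1 w)" if "cbilinear n" for h w and n :: "'h \<Rightarrow> 'h \<Rightarrow> 'z::cvector"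
        using H3.cv_p1_p2[OF that clinear_id, of \<pi>1] by simp
      have m: "cv E2 (*) \<pi>1 \<pi>2 (k \<otimes> m) = k * m" for k m
        using H2.cv_p1_p2[OF cbilinear_mult clinear_id clinear_id] by simp
      have L: "?L (h \<otimes> (k \<otimes> m)) = sweedler2 \<Delta> (\<lambda>h1 h2. sweedler2 \<Delta> (\<lambda>k1 k2. sweedler2 \<Delta> (\<lambda>m1 m2.
          act h1 (\<sigma> k1 m1) * \<sigma> h2 (k2 * m2)) m) k) h"
      proof -
        have b: "cbilinear (\<lambda>u v. act h1 (sg2 u) * \<sigma> h2 (cv E2 (*) \<pi>1 \<pi>2 v))" for h1 h2
          by (rule cbilinear_compose[OF cbilinear_mult clinear_compose[OF cbilinear_right[OF act_bilinear]] clinear_compose[OF cbilinear_right[OF sigma_bilinear]]]) simp_all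
        show ?thesis by (simp add: H3.cv_tD e1 e2 H2.sweedler2_tD[OF b] m)
      qed
      have R: "?R (h \<otimes> (k \<otimes> m)) = sweedler2 \<Delta> (\<lambda>h1 h2. sweedler2 \<Delta> (\<lambda>k1 k2. \<sigma> h1 k1 * \<sigma> (h2 * k2) m) k) h"
      proof -
        have e4: "?c \<sigma> (?c (*) ?a ?b) ?m (h \<otimes> (k \<otimes> m)) = \<sigma> (h * k) m" for h k m
        proof -
          have l1: "clinear (\<lambda>x1. \<sigma> (x1 * k) b)" for b k
            by (rule clinear_compose[OF cbilinear_left[OF sigma_bilinear] cbilinear_left[OF cbilinear_mult]])
          have l2: "clinear (\<lambda>x. \<sigma> (a * x) b)" for a b
            by (rule clinear_compose[OF cbilinear_left[OF sigma_bilinear] cbilinear_right[OF cbilinear_mult]])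
          have s: "sweedler2 E2 (\<lambda>u v. \<sigma> (a * \<pi>1 u) (\<pi>2 v)) (k \<otimes> m) = \<sigma> (a * k) m" for a k m
            using H2.cv_p1_p2[OF sigma_bilinear cbilinear_right[OF cbilinear_mult] clinear_id, of a k m] by (simp add: cv_def)
          have l3: "clinear (\<lambda>x. sweedler2 E2 (\<lambda>u v. \<sigma> (x * \<pi>1 u) (\<pi>2 v)) w)" for w
            by (rule clinear_sweedler2_param) (rule l1)
          have bb: "cbilinear (\<lambda>u v. \<sigma> (a * \<pi>1 u) (\<pi>2 v))" for a
            by (rule cbilinear_compose[OF sigma_bilinear clinear_compose[OF cbilinear_right[OF cbilinear_mult]]]) simp_all
          have "?c \<sigma> (?c (*) ?a ?b) ?m (h \<otimes> (k \<otimes> m)) =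
              sweedler2 \<Delta> (\<lambda>h1 h2. sweedler2 E2 (\<lambda>u v. \<epsilon> h2 *\<^sub>C \<sigma> (h1 * \<pi>1 u) (\<pi>2 v)) (k \<otimes> m)) h"
            by (subst H3.cv_tD[OF sigma_bilinear, of "?c (*) ?a ?b" ?m]) (simp_all add: e3 clinear_scale[OF cbilinear_right[OF sigma_bilinear]]
                clinear_scale[OF H2.clinear_p2])
          also have "\<dots> = sweedler2 \<Delta> (\<lambda>h1 h2. \<epsilon> h2 *\<^sub>C sweedler2 E2 (\<lambda>u v. \<sigma> (h1 * \<pi>1 u) (\<pi>2 v)) (k \<otimes> m)) h"
            by (subst sweedler2_post[OF cbilinear_right[OF cbilinear_scaleC] bb]) (rule refl)
          also have "\<dots> = \<sigma> (h * k) m"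
            unfolding H.sw_counit_right[OF l3] by (rule s)
          finally show ?thesis .
        qed
        have l: "clinear (\<lambda>m. \<sigma> h1 k1 * \<sigma> (h2 * k2) m)" for h1 h2 k1 k2
          by (rule clinear_compose[OF cbilinear_right[OF cbilinear_mult] cbilinear_right[OF sigma_bilinear]])
        have b: "cbilinear (\<lambda>u v. \<sigma> h1 (\<pi>1 u) * ?c \<sigma> (?c (*) ?a ?b) ?m (h2 \<otimes> v))" for h1 h2
          by (rule cbilinear_compose[OF cbilinear_mult clinear_compose[OF cbilinear_right[OF sigma_bilinear]]
               clinear_compose[OF _ cbilinear_right[OF cbilinear_pure]]]) simp_all
        show ?thesis
          by (subst H3.cv_tD[OF cbilinear_mult, of "?c \<sigma> ?a ?b"]) (simp_all add: e3 H2.sweedler2_tD[OF b] e4 clinear_scale[OF cbilinear_right[OF sigma_bilinear]]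
              scaleC_mult_left H.sw_counit_left[OF l])
      qed
      show "?L (h \<otimes> (k \<otimes> m)) = ?R (h \<otimes> (k \<otimes> m))"
        unfolding L R by (rule sigma_cocycle)
    qed
  qed simp_all
  have "?c (*) (?c act ?a (?c \<sigma> ?b ?m)) (?c \<sigma> ?a (?c (*) ?b ?m)) (?\<Theta> x) = ((\<alpha> \<rhd> sg \<beta> \<mu>) \<star> sg \<alpha> (\<beta> \<star> \<mu>)) x"
    "?c (*) (?c \<sigma> ?a ?b) (?c \<sigma> (?c (*) ?a ?b) ?m) (?\<Theta> x) = (sg \<alpha> \<beta> \<star> sg (\<alpha> \<star> \<beta>) \<mu>) x" for x
    by (simp_all add: cv_pullback[OF \<Theta>(1)] \<Theta> pt_pair[OF assms(2,3)])
  then show ?thesis unfolding eq by (simp add: fun_eq_iff)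
qed

abbreviation conv_cmult (infixl "\<bullet>\<^sub>X" 70) where "f \<bullet>\<^sub>X g \<equiv> cv D (crossed_mult \<Delta> act \<sigma>) f g"
abbreviation elt where "elt \<equiv> cv D pure"

text \<open>The multiplication rule with all Sweedler indices erased, as for group-likes. On
  constants it is \<open>pure_prod\<close> at the pair of points; substitution does the
  rest.\<close>

lemma cmult_points:
  assumes pt: "pt \<alpha>" "pt \<beta>" and [simp]: "clinear f" "clinear g"
  shows "elt f \<alpha> \<bullet>\<^sub>X elt g \<beta> = elt (f \<star> (\<alpha> \<rhd> g) \<star> sg \<alpha> \<beta>) (\<alpha> \<star> \<beta>)"
proof -
  note [simp] = pt_linear[OF pt(1)] pt_linear[OF pt(2)]
  have c: "elt (X.cc b) \<alpha> \<bullet>\<^sub>X elt (X.cc c) \<beta> = elt (X.cc b \<star> (\<alpha> \<rhd> X.cc c) \<star> sg \<alpha> \<beta>) (\<alpha> \<star> \<beta>)" for b c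
  proof
    fix x
    have "(elt (X.cc b) \<alpha> \<bullet>\<^sub>X elt (X.cc c) \<beta>) x = pure_prod b c (elt \<alpha> \<beta> x)"
      by (subst X.cv_post) (simp_all add: X.cv_cc_left cv_def crossed_mult_pure)
    also have "\<dots> = elt (X.cc b \<star> (\<alpha> \<rhd> X.cc c) \<star> sg \<alpha> \<beta>) (\<alpha> \<star> \<beta>) x"
      unfolding pure_prod_def
      by (simp add: cv_pullback[OF pt_pair(1)[OF pt]] pt_pair[OF pt] coalg_map_counit[OF pt_pair(1)[OF pt]])
    finally show "(elt (X.cc b) \<alpha> \<bullet>\<^sub>X elt (X.cc c) \<beta>) x = elt (X.cc b \<star> (\<alpha> \<rhd> X.cc c) \<star> sg \<alpha> \<beta>) (\<alpha> \<star> \<beta>) x" .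
  qed
  have "X.sub (\<lambda>b. elt (X.cc b) \<alpha> \<bullet>\<^sub>X elt (X.cc c) \<beta>) f = X.sub (\<lambda>b. elt (X.cc b \<star> (\<alpha> \<rhd> X.cc c) \<star> sg \<alpha> \<beta>) (\<alpha> \<star> \<beta>)) f" for c
    unfolding c ..
  then have "elt f \<alpha> \<bullet>\<^sub>X elt (X.cc c) \<beta> = elt (f \<star> (\<alpha> \<rhd> X.cc c) \<star> sg \<alpha> \<beta>) (\<alpha> \<star> \<beta>)" for c
    by (simp add: X.sub_left X.sub_right X.sub_cc)
  then have "X.sub (\<lambda>c. elt f \<alpha> \<bullet>\<^sub>X elt (X.cc c) \<beta>) g = X.sub (\<lambda>c. elt (f \<star> (\<alpha> \<rhd> X.cc c) \<star> sg \<alpha> \<beta>) (\<alpha> \<star> \<beta>)) g"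
    by simp
  then show ?thesis by (simp add: X.sub_left X.sub_right X.sub_cc)
qed

text \<open>Centrality moves \<open>sg \<alpha> \<beta>\<close> past the action on \<open>k\<close>,
  next to the second cocycle value; the cocycle identity then applies, and the action is
  multiplicative.\<close>

lemma cmult_points_assoc:
  assumes pt: "pt \<alpha>" "pt \<beta>" "pt \<mu>" and [simp]: "clinear f" "clinear g" "clinear k"
  shows "(elt f \<alpha> \<bullet>\<^sub>X elt g \<beta>) \<bullet>\<^sub>X elt k \<mu> = elt f \<alpha> \<bullet>\<^sub>X (elt g \<beta> \<bullet>\<^sub>X elt k \<mu>)"
proof -
  note [simp] = pt pt_linear[OF pt(1)] pt_linear[OF pt(2)] pt_linear[OF pt(3)]
  have "f \<star> (\<alpha> \<rhd> g) \<star> sg \<alpha> \<beta> \<star> ((\<alpha> \<star> \<beta>) \<rhd> k) \<star> sg (\<alpha> \<star> \<beta>) \<mu> =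
      f \<star> (\<alpha> \<rhd> g) \<star> (sg \<alpha> \<beta> \<star> ((\<alpha> \<star> \<beta>) \<rhd> k)) \<star> sg (\<alpha> \<star> \<beta>) \<mu>"
    by (simp add: mult_assoc)
  also have "\<dots> = f \<star> (\<alpha> \<rhd> g) \<star> ((\<alpha> \<star> \<beta>) \<rhd> k) \<star> (sg \<alpha> \<beta> \<star> sg (\<alpha> \<star> \<beta>) \<mu>)"
    by (subst sg_commute) (simp_all add: mult_assoc)
  also have "\<dots> = f \<star> (\<alpha> \<rhd> (g \<star> (\<beta> \<rhd> k) \<star> sg \<beta> \<mu>)) \<star> sg \<alpha> (\<beta> \<star> \<mu>)"
    unfolding cocycle_points[OF pt, symmetric]
    by (simp add: mult_assoc act_mult_points act_act_points)
  finally show ?thesis by (simp add: cmult_points mult_assoc)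
qed

end

text \<open>The calculus is instantiated at H, H \<otimes> H and H \<otimes> H \<otimes> H. Their
  projections are the universal points for identities in one, two and three variables.\<close>

sublocale central_crossed_product \<subseteq> H: crossed_points \<Delta> \<epsilon> S act \<sigma> \<sigma>' \<Delta> \<epsilon>
  by (intro crossed_points.intro hopf_points.intro central_crossed_product_axioms cocomm_hopf_axioms
      cocomm_coalgebra_H)

sublocale central_crossed_product \<subseteq> HH: crossed_points \<Delta> \<epsilon> S act \<sigma> \<sigma>' "tD \<Delta> \<Delta>" "te \<epsilon> \<epsilon>"
  by (intro crossed_points.intro hopf_points.intro central_crossed_product_axioms cocomm_hopf_axioms
      H2.cocomm_coalgebra_tD)

sublocale central_crossed_product \<subseteq> HHH: crossed_points \<Delta> \<epsilon> S act \<sigma> \<sigma>' "tD \<Delta> (tD \<Delta> \<Delta>)" "te \<epsilon> (te \<epsilon> \<epsilon>)"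
  by (intro crossed_points.intro hopf_points.intro central_crossed_product_axioms cocomm_hopf_axioms
      H3.cocomm_coalgebra_tD)

context central_crossed_product
begin

lemma pt_id [simp]: "H.pt (\<lambda>x. x)"
  by (simp add: coalg_map_def comult_cv)

lemma pt_pi [simp]: "HH.pt \<pi>1" "HH.pt \<pi>2"
  by (rule H2.p1_coalg_map H2.p2_coalg_map)+

text \<open>Associativity at the three universal points becomes associativity of three pure elements
  when evaluated at \<open>h \<otimes> (k \<otimes> l)\<close>; linearity extends it.\<close>

lemma cmult_assoc: "(x \<bullet> y) \<bullet> z = x \<bullet> (y \<bullet> z)"
proof -
  note b = cbilinear_left[OF cbilinear_crossed_mult] cbilinear_right[OF cbilinear_crossed_mult]
  have pure3: "((b \<otimes> h) \<bullet> (c \<otimes> k)) \<bullet> (d \<otimes> l) = (b \<otimes> h) \<bullet> ((c \<otimes> k) \<bullet> (d \<otimes> l))" for b c d h k l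
  proof -
    let ?a = "H3.p1" and ?b = "\<lambda>w. \<pi>1 (H3.p2 w)" and ?m = "\<lambda>w. \<pi>2 (H3.p2 w)"
    let ?M = "crossed_mult \<Delta> act \<sigma>"
    have pts: "HHH.pt ?a" "HHH.pt ?b" "HHH.pt ?m"
      by (rule H3.p1_coalg_map coalg_map_compose[OF H3.p2_coalg_map] H2.p1_coalg_map H2.p2_coalg_map)+
    note lin [simp] = HHH.pt_linear[OF pts(1)] HHH.pt_linear[OF pts(2)] HHH.pt_linear[OF pts(3)]
    have e2: "cv E2 ?M (\<lambda>w. c \<otimes> \<pi>1 w) (\<lambda>w. d \<otimes> \<pi>2 w) (k \<otimes> l) = (c \<otimes> k) \<bullet> (d \<otimes> l)"
      using H2.cv_p1_p2[OF cbilinear_crossed_mult cbilinear_right[OF cbilinear_pure] cbilinear_right[OF cbilinear_pure]] .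
    have R: "cv E3 ?M (\<lambda>w. b \<otimes> ?a w) (cv E3 ?M (\<lambda>w. c \<otimes> ?b w) (\<lambda>w. d \<otimes> ?m w)) (h \<otimes> (k \<otimes> l)) = (b \<otimes> h) \<bullet> ((c \<otimes> k) \<bullet> (d \<otimes> l))"
      using H3.cv_p1_p2[OF cbilinear_crossed_mult cbilinear_right[OF cbilinear_pure], of "cv E2 ?M (\<lambda>w. c \<otimes> \<pi>1 w) (\<lambda>w. d \<otimes> \<pi>2 w)" b h "k \<otimes> l"]
        H3.cv_p2_p2[OF cbilinear_crossed_mult, of "\<lambda>w. c \<otimes> \<pi>1 w" "\<lambda>w. d \<otimes> \<pi>2 w"]
      by (simp add: e2)
    \<comment> \<open>\<open>N\<close> re-nests the left-bracketed product to the right, since the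
      projections are evaluated along the right-nested tensor product.\<close>
    define N where "N x t = tlift (\<lambda>y z. (x \<bullet> y) \<bullet> z) t" for x t
    have bN: "cbilinear (\<lambda>y z. (x \<bullet> y) \<bullet> z)" for x
      by (rule cbilinear_compose[OF cbilinear_crossed_mult b(2) clinear_id])
    have N: "cbilinear N" unfolding N_def
      by (rule cbilinear_tlift[OF bN]) (rule clinear_compose[OF b(1) b(1)])
    have "cv E3 ?M (cv E3 ?M (\<lambda>w. b \<otimes> ?a w) (\<lambda>w. c \<otimes> ?b w)) (\<lambda>w. d \<otimes> ?m w) =
        cv E3 N (\<lambda>w. b \<otimes> ?a w) (cv E3 pure (\<lambda>w. c \<otimes> ?b w) (\<lambda>w. d \<otimes> ?m w))"
      by (rule H3.XY.cv_assoc) (simp_all add: N N_def tlift_pure[OF bN])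
    also have "\<dots> = cv E3 N (\<lambda>w. b \<otimes> ?a w) (\<lambda>w. cv E2 pure (\<lambda>w. c \<otimes> \<pi>1 w) (\<lambda>w. d \<otimes> \<pi>2 w) (H3.p2 w))"
      using H3.cv_p2_p2[OF cbilinear_pure, of "\<lambda>w. c \<otimes> \<pi>1 w" "\<lambda>w. d \<otimes> \<pi>2 w"] by simp
    finally have L: "cv E3 ?M (cv E3 ?M (\<lambda>w. b \<otimes> ?a w) (\<lambda>w. c \<otimes> ?b w)) (\<lambda>w. d \<otimes> ?m w) (h \<otimes> (k \<otimes> l)) = ((b \<otimes> h) \<bullet> (c \<otimes> k)) \<bullet> (d \<otimes> l)"
      using H3.cv_p1_p2[OF N cbilinear_right[OF cbilinear_pure], of "cv E2 pure (\<lambda>w. c \<otimes> \<pi>1 w) (\<lambda>w. d \<otimes> \<pi>2 w)" b h "k \<otimes> l"]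
        H2.cv_p1_p2[OF cbilinear_pure cbilinear_right[OF cbilinear_pure] cbilinear_right[OF cbilinear_pure], of c d k l]
      by (simp add: N_def tlift_pure[OF bN])
    have "cv E3 ?M (cv E3 ?M (\<lambda>w. b \<otimes> ?a w) (\<lambda>w. c \<otimes> ?b w)) (\<lambda>w. d \<otimes> ?m w) =
      cv E3 ?M (\<lambda>w. b \<otimes> ?a w) (cv E3 ?M (\<lambda>w. c \<otimes> ?b w) (\<lambda>w. d \<otimes> ?m w))"
      using HHH.cmult_points_assoc[OF pts, of "H3.XY.cc b" "H3.XY.cc c" "H3.XY.cc d"]
      by (simp add: H3.XY.cv_cc_left)
    then show ?thesis using L R by simp
  qed
  have 1: "((b \<otimes> h) \<bullet> (c \<otimes> k)) \<bullet> z = (b \<otimes> h) \<bullet> ((c \<otimes> k) \<bullet> z)" for b h c k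
    by (rule tensor_ext[where t = z]) (rule b(2), rule clinear_compose[OF b(2) b(2)], rule pure3)
  have 2: "((b \<otimes> h) \<bullet> y) \<bullet> z = (b \<otimes> h) \<bullet> (y \<bullet> z)" for b h
    by (rule tensor_ext[where t = y]) (rule clinear_compose[OF b(1) b(2)], rule clinear_compose[OF b(2) b(1)], rule 1)
  show ?thesis
    by (rule tensor_ext[where t = x]) (rule clinear_compose[OF b(1) b(1)], rule b(1), rule 2)
qed

section \<open>The cleaving map and its convolution inverse\<close>

abbreviation emb :: "'b \<Rightarrow> ('b, 'h) tensor" where "emb b \<equiv> b \<otimes> 1"
abbreviation cleave :: "'h \<Rightarrow> ('b, 'h) tensor" where "cleave h \<equiv> 1 \<otimes> h"
text \<open>The inverse of the cleaving map, with the inverse cocycle evaluated at an element and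
  its antipode. Its legs are ordered differently from the usual formula, which is equivalent by
  cocommutativity.\<close>

definition cleave_inv :: "'h \<Rightarrow> ('b, 'h) tensor" where
  "cleave_inv = cv \<Delta> pure (cv \<Delta> \<sigma>' S (\<lambda>x. x)) S"

lemma clinear_cleave_inv [simp]: "clinear cleave_inv"
  by (simp add: cleave_inv_def)

end

context crossed_points
begin

lemma emb_point: "clinear f \<Longrightarrow> (\<lambda>x. emb (f x)) = elt f (X.cc 1)"
  by (simp add: X.cv_cc_right)

lemma cleave_point: "clinear \<alpha> \<Longrightarrow> (\<lambda>x. cleave (\<alpha> x)) = elt (X.cc 1) \<alpha>"
  by (simp add: X.cv_cc_left)

lemma cleave_inv_point:
  assumes pt: "pt \<alpha>"
  shows "(\<lambda>x. cleave_inv (\<alpha> x)) = elt (sg' (\<lambda>x. S (\<alpha> x)) \<alpha>) (\<lambda>x. S (\<alpha> x))"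
  by (simp add: cleave_inv_def fun_eq_iff cv_pullback[OF pt])

lemma clinear_S_point [simp]: "pt \<alpha> \<Longrightarrow> clinear (\<lambda>x. S (\<alpha> x))"
  using pt_antipode pt_linear by blast

lemma cmult_cv_assoc: "clinear f \<Longrightarrow> clinear g \<Longrightarrow> clinear k \<Longrightarrow> (f \<bullet>\<^sub>X g) \<bullet>\<^sub>X k = f \<bullet>\<^sub>X (g \<bullet>\<^sub>X k)"
  by (rule X.cv_assoc) (simp_all add: cmult_assoc)

end

context central_crossed_product
begin

lemma cmult_one [simp]: "emb 1 \<bullet> x = x" "x \<bullet> emb 1 = x"
proof -
  have "cv \<Delta> (crossed_mult \<Delta> act \<sigma>) (H.elt (H.cc 1) (H.cc 1)) (H.elt (H.cc b) (\<lambda>x. x)) = H.elt (H.cc b) (\<lambda>x. x)"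
    "cv \<Delta> (crossed_mult \<Delta> act \<sigma>) (H.elt (H.cc b) (\<lambda>x. x)) (H.elt (H.cc 1) (H.cc 1)) = H.elt (H.cc b) (\<lambda>x. x)" for b
    by (simp_all add: H.cmult_points H.act_unit_points H.act_one_point)
  then have 1: "emb 1 \<bullet> (b \<otimes> h) = b \<otimes> h" "(b \<otimes> h) \<bullet> emb 1 = b \<otimes> h" for b h
    by (simp_all add: H.cv_cc_cc H.cv_cc_left H.cv_cc_right fun_eq_iff)
  show "emb 1 \<bullet> x = x" "x \<bullet> emb 1 = x"
    by (rule tensor_ext[where t = x], simp_all add: 1 cbilinear_right cbilinear_left[OF cbilinear_crossed_mult])+
qed

lemma emb_cmult_pure: "emb b \<bullet> (c \<otimes> h) = (b * c) \<otimes> h"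
proof -
  have "cv \<Delta> (crossed_mult \<Delta> act \<sigma>) (H.elt (H.cc b) (H.cc 1)) (H.elt (H.cc c) (\<lambda>x. x)) = H.elt (H.cc (b * c)) (\<lambda>x. x)"
    by (subst H.cmult_points) (simp_all add: one_act H.cv_cc_cc)
  then show ?thesis by (simp add: H.cv_cc_cc H.cv_cc_left fun_eq_iff)
qed

lemma emb_cleave: "emb b \<bullet> cleave h = b \<otimes> h"
  by (simp add: emb_cmult_pure)

lemma emb_mult: "emb b \<bullet> emb c = emb (b * c)"
  by (rule emb_cmult_pure)

end

context crossed_points
begin

lemma cmult_one_left [simp]: "clinear f \<Longrightarrow> X.cc (emb 1) \<bullet>\<^sub>X f = f"
  and cmult_one_right [simp]: "clinear f \<Longrightarrow> f \<bullet>\<^sub>X X.cc (emb 1) = f"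
  by (simp_all add: X.cv_cc_left X.cv_cc_right)

abbreviation \<gamma> where "\<gamma> \<alpha> \<equiv> \<lambda>x. cleave (\<alpha> x)"
abbreviation \<gamma>i where "\<gamma>i \<alpha> \<equiv> \<lambda>x. cleave_inv (\<alpha> x)"
abbreviation em where "em f \<equiv> \<lambda>x. emb (f x)"

lemma clinear_gamma [simp]: "clinear \<alpha> \<Longrightarrow> clinear (\<gamma>i \<alpha>)"
  by (rule clinear_compose[OF clinear_cleave_inv])

text \<open>The left inverse is immediate. For the right inverse, \<alpha> acts on the inverse
  cocycle, and the cocycle identity is needed to see that the result cancels
  \<open>sg \<alpha> ?s\<close>.\<close>

lemma gamma_inv:
  assumes pt: "pt \<alpha>"
  shows "\<gamma>i \<alpha> \<bullet>\<^sub>X \<gamma> \<alpha> = X.cc (emb 1)" "\<gamma> \<alpha> \<bullet>\<^sub>X \<gamma>i \<alpha> = X.cc (emb 1)"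
proof -
  note [simp] = pt pt_linear[OF pt]
  let ?s = "\<lambda>x. S (\<alpha> x)"
  show "\<gamma>i \<alpha> \<bullet>\<^sub>X \<gamma> \<alpha> = X.cc (emb 1)"
    by (simp add: cleave_inv_point cleave_point cmult_points act_unit_points sg_inverse antipode_points X.cv_cc_cc)
  \<comment> \<open>The cocycle identity at \<alpha>, its inverse and \<alpha> again: all other
    factors involve the unit point and are trivial.\<close>
  have "\<alpha> \<rhd> sg ?s \<alpha> = sg \<alpha> ?s"
    using cocycle_points[of \<alpha> ?s \<alpha>] by (simp add: antipode_points)
  moreover have "(\<alpha> \<rhd> sg' ?s \<alpha>) \<star> (\<alpha> \<rhd> sg ?s \<alpha>) = X.cc 1"
    by (subst act_mult_points[symmetric]) (simp_all add: sg_inverse act_unit_points)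
  ultimately have "(\<alpha> \<rhd> sg' ?s \<alpha>) \<star> sg \<alpha> ?s = X.cc 1" by simp
  then show "\<gamma> \<alpha> \<bullet>\<^sub>X \<gamma>i \<alpha> = X.cc (emb 1)"
    by (simp add: cleave_inv_point cleave_point cmult_points antipode_points X.cv_cc_cc)
qed

lemma gamma_emb:
  assumes pt: "pt \<alpha>" and [simp]: "clinear f"
  shows "\<gamma> \<alpha> \<bullet>\<^sub>X em f = em (\<alpha> \<rhd> f) \<bullet>\<^sub>X \<gamma> \<alpha>"
proof -
  note [simp] = pt pt_linear[OF pt]
  show ?thesis
    by (simp add: cleave_point emb_point cmult_points act_one_point act_unit_points)
qed

text \<open>Obtained from \<open>gamma_emb\<close> by multiplying with the inverse of \<gamma> on
  both sides.\<close>

lemma emb_gamma_inv: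
  assumes pt: "pt \<alpha>" and [simp]: "clinear f"
  shows "em f \<bullet>\<^sub>X \<gamma>i \<alpha> = \<gamma>i \<alpha> \<bullet>\<^sub>X em (\<alpha> \<rhd> f)"
proof -
  note [simp] = pt pt_linear[OF pt]
  have "em f \<bullet>\<^sub>X \<gamma>i \<alpha> = \<gamma>i \<alpha> \<bullet>\<^sub>X (\<gamma> \<alpha> \<bullet>\<^sub>X em f) \<bullet>\<^sub>X \<gamma>i \<alpha>"
    by (simp add: cmult_cv_assoc[symmetric] gamma_inv)
  also have "\<dots> = \<gamma>i \<alpha> \<bullet>\<^sub>X em (\<alpha> \<rhd> f) \<bullet>\<^sub>X (\<gamma> \<alpha> \<bullet>\<^sub>X \<gamma>i \<alpha>)"
    unfolding gamma_emb[OF assms] by (simp add: cmult_cv_assoc)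
  finally show ?thesis by (simp add: gamma_inv)
qed

lemma gamma_mult:
  assumes pt: "pt \<alpha>" "pt \<beta>"
  shows "\<gamma> \<alpha> \<bullet>\<^sub>X \<gamma> \<beta> = em (sg \<alpha> \<beta>) \<bullet>\<^sub>X \<gamma> (\<alpha> \<star> \<beta>)"
proof -
  note [simp] = pt pt_linear[OF pt(1)] pt_linear[OF pt(2)]
  show ?thesis
    by (simp add: cleave_point emb_point cmult_points act_one_point act_unit_points)
qed

lemma em_mult: "clinear f \<Longrightarrow> clinear g \<Longrightarrow> em f \<bullet>\<^sub>X em g = em (f \<star> g)"
  by (simp add: emb_point cmult_points act_one_point)

lemma em_cc: "em (X.cc b) = X.cc (emb b)"
  by (simp add: clinear_scale[OF cbilinear_left[OF cbilinear_pure]])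

text \<open>Inverts \<open>gamma_mult\<close>: the inverse reverses the two factors, so the inverse
  cocycle appears on the right.\<close>

lemma gamma_inv_mult:
  assumes pt: "pt \<alpha>" "pt \<beta>"
  shows "\<gamma>i \<beta> \<bullet>\<^sub>X \<gamma>i \<alpha> = \<gamma>i (\<alpha> \<star> \<beta>) \<bullet>\<^sub>X em (sg' \<alpha> \<beta>)"
proof -
  note [simp] = pt pt_linear[OF pt(1)] pt_linear[OF pt(2)]
  let ?c = "\<gamma>i (\<alpha> \<star> \<beta>)"
  have 1: "\<gamma> (\<alpha> \<star> \<beta>) = em (sg' \<alpha> \<beta>) \<bullet>\<^sub>X (\<gamma> \<alpha> \<bullet>\<^sub>X \<gamma> \<beta>)"
    unfolding gamma_mult[OF pt] by (simp add: cmult_cv_assoc[symmetric] em_mult sg_inverse em_cc)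
  have 2: "(\<gamma> \<alpha> \<bullet>\<^sub>X \<gamma> \<beta>) \<bullet>\<^sub>X (\<gamma>i \<beta> \<bullet>\<^sub>X \<gamma>i \<alpha>) = X.cc (emb 1)"
  proof -
    have "(\<gamma> \<alpha> \<bullet>\<^sub>X \<gamma> \<beta>) \<bullet>\<^sub>X (\<gamma>i \<beta> \<bullet>\<^sub>X \<gamma>i \<alpha>) = \<gamma> \<alpha> \<bullet>\<^sub>X (\<gamma> \<beta> \<bullet>\<^sub>X \<gamma>i \<beta>) \<bullet>\<^sub>X \<gamma>i \<alpha>"
      by (simp add: cmult_cv_assoc)
    then show ?thesis by (simp add: gamma_inv)
  qed
  have "\<gamma>i \<beta> \<bullet>\<^sub>X \<gamma>i \<alpha> = (?c \<bullet>\<^sub>X \<gamma> (\<alpha> \<star> \<beta>)) \<bullet>\<^sub>X (\<gamma>i \<beta> \<bullet>\<^sub>X \<gamma>i \<alpha>)"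
    by (simp add: gamma_inv)
  also have "\<dots> = ?c \<bullet>\<^sub>X em (sg' \<alpha> \<beta>) \<bullet>\<^sub>X ((\<gamma> \<alpha> \<bullet>\<^sub>X \<gamma> \<beta>) \<bullet>\<^sub>X (\<gamma>i \<beta> \<bullet>\<^sub>X \<gamma>i \<alpha>))"
    unfolding 1 by (simp add: cmult_cv_assoc)
  finally show ?thesis by (simp add: 2)
qed

end

section \<open>Coordinates on the Ehresmann--Schauenburg bialgebroid\<close>

abbreviation (input) tri :: "'a::cvector \<Rightarrow> 'b::cvector \<Rightarrow> 'c::cvector \<Rightarrow> (('a, 'b) tensor, 'c) tensor" where
  "tri a b c \<equiv> (a \<otimes> b) \<otimes> c"

lemma clinear_tri [simp]: "clinear (\<lambda>a. tri a b c)" "clinear (\<lambda>b. tri a b c)" "clinear (\<lambda>c. tri a b c)"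
  by simp_all

lemma tri_ext:
  assumes "clinear f" "clinear g" "\<And>a b c. f (tri a b c) = g (tri a b c)"
  shows "f t = g t"
proof (rule tensor_ext[where t = t, OF assms(1,2)])
  fix s c
  show "f (s \<otimes> c) = g (s \<otimes> c)"
    by (rule tensor_ext[where t = s]) (rule clinear_compose[OF assms(1)], simp, rule clinear_compose[OF assms(2)], simp, rule assms(3))
qed

definition mlift :: "('a::cvector \<Rightarrow> 'b::cvector \<Rightarrow> 'c::cvector \<Rightarrow> 'd::cvector) \<Rightarrow>
    (('a, 'b) tensor, 'c) tensor \<Rightarrow> 'd" where
  "mlift F = tlift (\<lambda>s c. tlift (\<lambda>a b. F a b c) s)"

lemma mlift_aux:
  assumes "ctrilinear F"
  shows "cbilinear (\<lambda>a b. F a b c)" "cbilinear (\<lambda>s c. tlift (\<lambda>a b. F a b c) s)"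
proof -
  show 1: "cbilinear (\<lambda>a b. F a b c)" for c
    by (rule cbilinearI) (rule ctrilinear_1[OF assms], rule ctrilinear_2[OF assms])
  show "cbilinear (\<lambda>s c. tlift (\<lambda>a b. F a b c) s)"
    by (rule cbilinearI) (rule clinear_tlift[OF 1], rule clinear_tlift_param, rule ctrilinear_3[OF assms])
qed

lemma clinear_mlift: "ctrilinear F \<Longrightarrow> clinear (mlift F)"
  unfolding mlift_def by (rule clinear_tlift) (rule mlift_aux)

lemma mlift_tri: "ctrilinear F \<Longrightarrow> mlift F (tri a b c) = F a b c"
  unfolding mlift_def by (simp only: tlift_pure[OF mlift_aux(2)]) (simp only: tlift_pure[OF mlift_aux(1)])

lemma clinear_mlift_param: "(\<And>a b c. clinear (\<lambda>x. F x a b c)) \<Longrightarrow> clinear (\<lambda>x. mlift (F x) t)"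
  unfolding mlift_def by (rule clinear_tlift_param)+

lemma cbilinear_mlift:
  "(\<And>x. ctrilinear (F x)) \<Longrightarrow> (\<And>a b c. clinear (\<lambda>x. F x a b c)) \<Longrightarrow> cbilinear (\<lambda>x. mlift (F x))"
  by (intro cbilinearI clinear_mlift_param clinear_mlift)

context cocomm_coalgebra
begin

abbreviation Tp where "Tp f g \<alpha> \<equiv> cv D pure (cv D pure f g) \<alpha>"

lemma tri_point: "clinear \<alpha> \<Longrightarrow> (\<lambda>x. tri b c (\<alpha> x)) = Tp (cc b) (cc c) \<alpha>"
  by (simp add: cv_cc_cc cv_cc_left)

lemma tri_point_apply: "clinear \<alpha> \<Longrightarrow> Tp (cc b) (cc c) \<alpha> x = tri b c (\<alpha> x)"
  by (simp add: cv_cc_cc cv_cc_left)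

lemma sub_post:
  assumes "clinear L" "cbilinear E" "clinear f"
  shows "sub (\<lambda>b x. L (E b x)) f x = L (sub E f x)"
  unfolding sub_eq_cv by (subst cv_post[OF assms(1)]) (simp_all add: assms)

text \<open>Reduces a trilinear map at a general triple to its values at constants, into which
  \<open>sub\<close> reinserts \<open>f\<close> and \<open>g\<close>.\<close>

lemma mlift_point:
  assumes F: "ctrilinear F" and [simp]: "clinear f" "clinear g" "clinear \<alpha>"
  shows "(\<lambda>x. mlift F (Tp f g \<alpha> x)) = sub (\<lambda>b. sub (\<lambda>c x. F b c (\<alpha> x)) g) f"
proof -
  have c: "F b c (\<alpha> x) = mlift F (Tp (cc b) (cc c) \<alpha> x)" for b c x
    by (simp add: tri_point[symmetric] mlift_tri[OF F])
  have "sub (\<lambda>c x. F b c (\<alpha> x)) g = (\<lambda>x. mlift F (Tp (cc b) g \<alpha> x))" for b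
    unfolding c
    by (rule ext, subst sub_post[OF clinear_mlift[OF F]]) (simp_all add: sub_left sub_right sub_cc)
  then have "sub (\<lambda>b. sub (\<lambda>c x. F b c (\<alpha> x)) g) f = sub (\<lambda>b x. mlift F (Tp (cc b) g \<alpha> x)) f"
    by simp
  also have "\<dots> = (\<lambda>x. mlift F (Tp f g \<alpha> x))"
    by (rule ext, subst sub_post[OF clinear_mlift[OF F]]) (simp_all add: sub_left sub_right sub_cc)
  finally show ?thesis ..
qed

end

abbreviation pi_A :: "('h::cvector \<Rightarrow> complex) \<Rightarrow> ('b::cvector, 'h) tensor \<Rightarrow> 'b" where
  "pi_A \<epsilon> \<equiv> tlift (\<lambda>b h. \<epsilon> h *\<^sub>C b)"

context central_crossed_product
begin

abbreviation "pr \<equiv> pi_A \<epsilon> :: ('b, 'h) tensor \<Rightarrow> 'b"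

lemma pr_bil: "cbilinear (\<lambda>(b::'b) h. \<epsilon> h *\<^sub>C b)"
  by (rule cbilinear_flip[OF cbilinear_compose[OF cbilinear_scaleC counit_linear clinear_id]])

lemma clinear_pr [simp]: "clinear pr"
  by (rule clinear_tlift[OF pr_bil])

lemma pr_pure [simp]: "pr (b \<otimes> h) = \<epsilon> h *\<^sub>C b"
  by (rule tlift_pure[OF pr_bil])

lemma pr_emb: "pr (emb b \<bullet> x) = b * pr x"
proof (rule tensor_ext[where t = x])
  show "clinear (\<lambda>x. pr (emb b \<bullet> x))"
    by (rule clinear_compose[OF clinear_pr]) (simp add: cbilinear_right)
qed (simp_all add: emb_cmult_pure scaleC_mult_right)

definition psi0 :: "'b \<Rightarrow> 'b \<Rightarrow> 'h \<Rightarrow> (('b, 'h) tensor, ('b, 'h) tensor) tensor" where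
  "psi0 b b' h = cv \<Delta> pure (H.elt (H.cc b) (\<lambda>x. x)) (H.conv_cmult (H.\<gamma>i (\<lambda>x. x)) (H.elt (H.cc b') (H.cc 1))) h"

lemma psi0_tri: "ctrilinear psi0"
proof (rule ctrilinearI)
  have "cbilinear (\<lambda>b. cv \<Delta> pure (H.elt (H.cc b) (\<lambda>x. x)) (H.conv_cmult (H.\<gamma>i (\<lambda>x. x)) (H.elt (H.cc b') (H.cc 1))))" for b'
    by simp
  from cbilinear_left[OF this] show "clinear (\<lambda>b. psi0 b b' h)" for b' h unfolding psi0_def .
  have "cbilinear (\<lambda>b'. cv \<Delta> pure (H.elt (H.cc b) (\<lambda>x. x)) (H.conv_cmult (H.\<gamma>i (\<lambda>x. x)) (H.elt (H.cc b') (H.cc 1))))" for b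
    by simp
  from cbilinear_left[OF this] show "clinear (\<lambda>b'. psi0 b b' h)" for b h unfolding psi0_def .
  show "clinear (psi0 b b')" for b b' unfolding psi0_def[abs_def] by simp
qed

definition psi :: "(('b, 'b) tensor, 'h) tensor \<Rightarrow> (('b, 'h) tensor, ('b, 'h) tensor) tensor" where
  "psi = mlift psi0"

lemma clinear_psi [simp]: "clinear psi"
  by (simp add: psi_def clinear_mlift psi0_tri)

lemma psi_tri: "psi (tri b b' h) = psi0 b b' h"
  by (simp add: psi_def mlift_tri psi0_tri)

text \<open>Designed to undo \<open>psi0\<close>: if the second leg is the inverse of \<gamma> at
  \<open>h\<close> times \<open>b'\<close>, multiplication by \<gamma> leaves \<open>b'\<close>,
  which \<open>pr\<close> reads off. It is defined on all of A \<otimes> A, not only on the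
  carrier.\<close>

definition rho0 :: "'b \<Rightarrow> 'h \<Rightarrow> ('b, 'h) tensor \<Rightarrow> (('b, 'b) tensor, 'h) tensor" where
  "rho0 b h a = cv \<Delta> pure (cv \<Delta> pure (H.cc b) (\<lambda>x. pr (cleave x \<bullet> a))) (\<lambda>x. x) h"

lemma rho0_lin: "clinear (\<lambda>b. rho0 b h a)" "clinear (\<lambda>h. rho0 b h a)" "clinear (rho0 b h)"
proof -
  have [simp]: "clinear (\<lambda>x. pr (cleave x \<bullet> a))" "clinear (\<lambda>a. pr (cleave x \<bullet> a))" for a x
    by (rule clinear_compose[OF clinear_pr], rule clinear_compose[OF cbilinear_left[OF cbilinear_crossed_mult]] cbilinear_right[OF cbilinear_crossed_mult], simp?)+
  have "cbilinear (\<lambda>b. cv \<Delta> pure (cv \<Delta> pure (H.cc b) (\<lambda>x. pr (cleave x \<bullet> a))) (\<lambda>x. x))" by simp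
  from cbilinear_left[OF this] show "clinear (\<lambda>b. rho0 b h a)" unfolding rho0_def .
  show "clinear (\<lambda>h. rho0 b h a)" unfolding rho0_def[abs_def] by simp
  have "cbilinear (\<lambda>a x. pr (cleave x \<bullet> a))" by (rule cbilinearI) simp_all
  then have "cbilinear (\<lambda>a. cv \<Delta> pure (cv \<Delta> pure (H.cc b) (\<lambda>x. pr (cleave x \<bullet> a))) (\<lambda>x. x))" by simp
  from cbilinear_left[OF this] show "clinear (rho0 b h)" unfolding rho0_def .
qed

definition rho :: "(('b, 'h) tensor, ('b, 'h) tensor) tensor \<Rightarrow> (('b, 'b) tensor, 'h) tensor" where
  "rho = mlift rho0"

lemma rho0_tri: "ctrilinear rho0"
  by (rule ctrilinearI) (rule rho0_lin)+

lemma clinear_rho [simp]: "clinear rho"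
  by (simp add: rho_def clinear_mlift rho0_tri)

lemma rho_pure: "rho ((b \<otimes> h) \<otimes> a) = rho0 b h a"
  by (simp add: rho_def mlift_tri rho0_tri)

end

context crossed_points
begin

lemma psi_point:
  assumes pt: "pt \<alpha>" and [simp]: "clinear f" "clinear g"
  shows "(\<lambda>x. psi (X.Tp f g \<alpha> x)) = cv D pure (elt f \<alpha>) (\<gamma>i \<alpha> \<bullet>\<^sub>X em g)"
proof -
  note [simp] = pt pt_linear[OF pt]
  have "(\<lambda>x. psi0 b c (\<alpha> x)) = cv D pure (elt (X.cc b) \<alpha>) (\<gamma>i \<alpha> \<bullet>\<^sub>X elt (X.cc c) (X.cc 1))" for b c
    by (simp add: psi0_def fun_eq_iff cv_pullback[OF pt] coalg_map_counit[OF pt])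
  then show ?thesis
    unfolding psi_def X.mlift_point[OF psi0_tri assms(2,3) pt_linear[OF pt]]
    by (simp add: X.sub_left X.sub_right X.sub_cc emb_point)
qed

lemma rho_point:
  assumes pt: "pt \<alpha>" and [simp]: "clinear f" "clinear w"
  shows "(\<lambda>x. rho (cv D pure (elt f \<alpha>) w x)) = X.Tp f (\<lambda>x. pr ((\<gamma> \<alpha> \<bullet>\<^sub>X w) x)) \<alpha>"
proof -
  note [simp] = pt pt_linear[OF pt]
  have lin [simp]: "clinear (\<lambda>x. pr (cleave x \<bullet> a))" for a
    by (rule clinear_compose[OF clinear_pr clinear_compose[OF cbilinear_left[OF cbilinear_crossed_mult]]]) simp
  have c: "(\<lambda>x. rho0 b (\<alpha> x) a) = X.Tp (X.cc b) (\<lambda>x. pr ((\<gamma> \<alpha> \<bullet>\<^sub>X X.cc a) x)) \<alpha>" for b a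
    by (simp add: rho0_def fun_eq_iff cv_pullback[OF pt] coalg_map_counit[OF pt] X.cv_cc_right)
  have c': "rho (cv D pure (elt (X.cc b) \<alpha>) (X.cc a) x) = rho0 b (\<alpha> x) a" for b a x
    by (simp add: X.cv_cc_left X.cv_cc_right rho_pure)
  have 1: "X.sub (\<lambda>b x. rho (cv D pure (elt (X.cc b) \<alpha>) (X.cc a) x)) f = (\<lambda>x. rho (cv D pure (elt f \<alpha>) (X.cc a) x))" for a
    by (rule ext, subst X.sub_post[OF clinear_rho]) (simp_all add: X.sub_left X.sub_cc)
  have bb: "cbilinear (\<lambda>a x. pr ((\<gamma> \<alpha> \<bullet>\<^sub>X X.cc a) x))"
    by (rule cbilinear_post[OF clinear_pr]) simp
  have 2: "(\<lambda>x. rho (cv D pure (elt f \<alpha>) (X.cc a) x)) = X.Tp f (\<lambda>x. pr ((\<gamma> \<alpha> \<bullet>\<^sub>X X.cc a) x)) \<alpha>" for a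
    unfolding 1[symmetric] c' c
    using cbilinear_right[OF bb] by (simp add: X.sub_left X.sub_right X.sub_cc)
  have 3: "X.sub (\<lambda>a x. rho (cv D pure (elt f \<alpha>) (X.cc a) x)) w = (\<lambda>x. rho (cv D pure (elt f \<alpha>) w x))"
    by (rule ext, subst X.sub_post[OF clinear_rho]) (simp_all add: X.sub_right X.sub_cc)
  have 4: "X.sub (\<lambda>a x. pr ((\<gamma> \<alpha> \<bullet>\<^sub>X X.cc a) x)) w = (\<lambda>x. pr ((\<gamma> \<alpha> \<bullet>\<^sub>X w) x))"
    by (rule ext, subst X.sub_post[OF clinear_pr]) (simp_all add: X.sub_right X.sub_cc)
  show ?thesis
    unfolding 3[symmetric] 2
    by (simp add: X.sub_left X.sub_right 4 bb)
qed

lemma rho_psi_point: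
  assumes pt: "pt \<alpha>" and [simp]: "clinear f" "clinear g"
  shows "(\<lambda>x. rho (psi (X.Tp f g \<alpha> x))) = X.Tp f g \<alpha>"
proof -
  note [simp] = pt pt_linear[OF pt]
  have [simp]: "clinear (em g)" by simp
  have "\<gamma> \<alpha> \<bullet>\<^sub>X (\<gamma>i \<alpha> \<bullet>\<^sub>X em g) = em g"
    by (simp add: cmult_cv_assoc[symmetric] gamma_inv)
  then show ?thesis
    unfolding fun_cong[OF psi_point[OF assms]]
    by (subst rho_point) (simp_all add: counit_one scaleC_one)
qed

end

context central_crossed_product
begin

lemma rho_psi [simp]: "rho (psi t) = t"
proof (rule tri_ext[where t = t])
  show "clinear (\<lambda>t. rho (psi t))" by (rule clinear_compose[OF clinear_rho clinear_psi])
  show "rho (psi (tri b c h)) = tri b c h" for b c h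
    using fun_cong[OF H.rho_psi_point[OF pt_id H.clinear_cc H.clinear_cc], of b c h]
    by (simp add: H.tri_point[symmetric])
qed simp

lemma inj_psi: "inj psi"
  by (metis injI rho_psi)

abbreviation "ext \<equiv> crossed_extension \<Delta> act \<sigma>"

lemma ext_simps [simp]: "ext_mul ext = crossed_mult \<Delta> act \<sigma>" "ext_one ext = 1 \<otimes> 1" "ext_emb ext b = emb b"
  by (simp_all add: crossed_extension_def)

abbreviation "esm \<equiv> es_mult ext"

lemma esm_aux: "cbilinear (\<lambda>a' c'. (a \<bullet> a') \<otimes> (c' \<bullet> c))" "cbilinear (\<lambda>a c. tlift (\<lambda>a' c'. (a \<bullet> a') \<otimes> (c' \<bullet> c)) y)"
proof -
  note b = cbilinear_left[OF cbilinear_crossed_mult] cbilinear_right[OF cbilinear_crossed_mult]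
  show "cbilinear (\<lambda>a' c'. (a \<bullet> a') \<otimes> (c' \<bullet> c))"
    by (rule cbilinear_compose[OF cbilinear_pure b(2) b(1)])
  show "cbilinear (\<lambda>a c. tlift (\<lambda>a' c'. (a \<bullet> a') \<otimes> (c' \<bullet> c)) y)"
  proof (rule cbilinearI)
    show "clinear (\<lambda>a. tlift (\<lambda>a' c'. (a \<bullet> a') \<otimes> (c' \<bullet> c)) y)" for c
      by (rule clinear_tlift_param) (rule clinear_compose[OF cbilinear_left[OF cbilinear_pure] b(1)])
    show "clinear (\<lambda>c. tlift (\<lambda>a' c'. (a \<bullet> a') \<otimes> (c' \<bullet> c)) y)" for a
      by (rule clinear_tlift_param) (rule clinear_compose[OF cbilinear_right[OF cbilinear_pure] b(2)])
  qed
qed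

lemma cbilinear_esm [simp]: "cbilinear esm"
  unfolding es_mult_def[abs_def] ext_simps
  by (rule cbilinearI) (rule clinear_tlift[OF esm_aux(2)], rule clinear_tlift_param, rule clinear_tlift[OF esm_aux(1)])

lemma esm_pure: "esm (a \<otimes> c) (a' \<otimes> c') = (a \<bullet> a') \<otimes> (c' \<bullet> c)"
  unfolding es_mult_def ext_simps by (simp only: tlift_pure[OF esm_aux(2)]) (simp only: tlift_pure[OF esm_aux(1)])

lemma esm_assoc: "esm (esm x y) z = esm x (esm y z)"
proof -
  note b = cbilinear_left[OF cbilinear_esm] cbilinear_right[OF cbilinear_esm]
  have 0: "esm (esm (a \<otimes> c) (a' \<otimes> c')) z = esm (a \<otimes> c) (esm (a' \<otimes> c') z)" for a c a' c'
    by (rule tensor_ext[where t = z]) (rule b(2), rule clinear_compose[OF b(2) b(2)], simp add: esm_pure cmult_assoc)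
  have 1: "esm (esm (a \<otimes> c) y) z = esm (a \<otimes> c) (esm y z)" for a c
    by (rule tensor_ext[where t = y]) (rule clinear_compose[OF b(1) b(2)], rule clinear_compose[OF b(2) b(1)], rule 0)
  show ?thesis
    by (rule tensor_ext[where t = x]) (rule clinear_compose[OF b(1) b(1)], rule b(1), rule 1)
qed

text \<open>The product is transported along \<open>psi\<close> and its left inverse. That
  \<open>psi\<close> is multiplicative for it requires the image of \<open>psi\<close> to be closed
  under products, which is shown below.\<close>

definition mm :: "(('b, 'b) tensor, 'h) tensor \<Rightarrow> (('b, 'b) tensor, 'h) tensor \<Rightarrow> (('b, 'b) tensor, 'h) tensor" where
  "mm x y = rho (esm (psi x) (psi y))"

lemma cbilinear_mm [simp]: "cbilinear mm"
  unfolding mm_def[abs_def]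
  by (rule cbilinear_post[OF clinear_rho cbilinear_compose[OF cbilinear_esm clinear_psi clinear_psi]])

end

context crossed_points
begin

lemma esm_point_pure:
  assumes [simp]: "clinear u" "clinear v" "clinear u'" "clinear v'"
  shows "cv D esm (cv D pure u v) (cv D pure u' v') = cv D pure (u \<bullet>\<^sub>X u') (v' \<bullet>\<^sub>X v)"
proof -
  have f: "cbilinear (\<lambda>b d. d \<bullet> b)" by (rule cbilinear_flip) simp
  have "cv D esm (cv D pure u v) (cv D pure u' v') = cv D pure (u \<bullet>\<^sub>X u') (cv D (\<lambda>b d. d \<bullet> b) v v')"
    by (rule X.cv_interchange) (simp_all add: f esm_pure)
  also have "cv D (\<lambda>b d. d \<bullet> b) v v' = v' \<bullet>\<^sub>X v"
    using X.cv_comm[OF f, of v v'] by simp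
  finally show ?thesis .
qed

text \<open>The second legs multiply in reverse order. Moving \<open>g'\<close> past the inverse of
  \<gamma> at \<alpha> produces \<open>\<alpha> \<rhd> g'\<close>, and merging the two inverses of
  \<gamma> produces the inverse cocycle.\<close>

lemma esm_point:
  assumes pt: "pt \<alpha>" "pt \<beta>" and [simp]: "clinear f" "clinear f'" "clinear g" "clinear g'"
  shows "cv D esm (\<lambda>x. psi (X.Tp f f' \<alpha> x)) (\<lambda>x. psi (X.Tp g g' \<beta> x)) =
    (\<lambda>x. psi (X.Tp (f \<star> (\<alpha> \<rhd> g) \<star> sg \<alpha> \<beta>) (sg' \<alpha> \<beta> \<star> (\<alpha> \<rhd> g') \<star> f') (\<alpha> \<star> \<beta>) x))"
proof -
  note [simp] = pt pt_linear[OF pt(1)] pt_linear[OF pt(2)]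
  have "\<gamma>i \<beta> \<bullet>\<^sub>X em g' \<bullet>\<^sub>X (\<gamma>i \<alpha> \<bullet>\<^sub>X em f') = \<gamma>i \<beta> \<bullet>\<^sub>X (em g' \<bullet>\<^sub>X \<gamma>i \<alpha>) \<bullet>\<^sub>X em f'"
    by (simp add: cmult_cv_assoc)
  also have "\<dots> = (\<gamma>i \<beta> \<bullet>\<^sub>X \<gamma>i \<alpha>) \<bullet>\<^sub>X (em (\<alpha> \<rhd> g') \<bullet>\<^sub>X em f')"
    unfolding emb_gamma_inv[OF pt(1) assms(6)] by (simp add: cmult_cv_assoc)
  also have "\<dots> = \<gamma>i (\<alpha> \<star> \<beta>) \<bullet>\<^sub>X (em (sg' \<alpha> \<beta>) \<bullet>\<^sub>X em ((\<alpha> \<rhd> g') \<star> f'))"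
    unfolding gamma_inv_mult[OF pt] by (simp add: cmult_cv_assoc em_mult)
  also have "\<dots> = \<gamma>i (\<alpha> \<star> \<beta>) \<bullet>\<^sub>X em (sg' \<alpha> \<beta> \<star> (\<alpha> \<rhd> g') \<star> f')"
    by (simp add: em_mult mult_assoc)
  finally have 1: "\<gamma>i \<beta> \<bullet>\<^sub>X em g' \<bullet>\<^sub>X (\<gamma>i \<alpha> \<bullet>\<^sub>X em f') = \<gamma>i (\<alpha> \<star> \<beta>) \<bullet>\<^sub>X em (sg' \<alpha> \<beta> \<star> (\<alpha> \<rhd> g') \<star> f')" .
  show ?thesis
    by (simp add: psi_point esm_point_pure cmult_points 1)
qed

end

context central_crossed_product
begin

text \<open>At the universal pair of points the product is visibly a value of \<open>psi\<close>,
  and on such values \<open>psi\<close> after \<open>rho\<close> is the identity.\<close>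

lemma psi_mm: "psi (mm x y) = esm (psi x) (psi y)"
proof -
  note b = cbilinear_left[OF cbilinear_esm] cbilinear_right[OF cbilinear_esm]
  note bm = cbilinear_left[OF cbilinear_mm] cbilinear_right[OF cbilinear_mm]
  have 1: "psi (mm (tri b b' h) (tri c c' g)) = esm (psi (tri b b' h)) (psi (tri c c' g))" for b b' h c c' g
  proof -
    have tp: "H2.XY.Tp (H2.XY.cc b) (H2.XY.cc b') \<pi>1 w = tri b b' (\<pi>1 w)"
      "H2.XY.Tp (H2.XY.cc b) (H2.XY.cc b') \<pi>2 w = tri b b' (\<pi>2 w)" for b b' :: 'b and w
      by (rule H2.XY.tri_point_apply, simp)+
    have l: "clinear (\<lambda>h. psi (tri b b' h))" for b b' by (rule clinear_compose[OF clinear_psi]) simp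
    note e = HH.esm_point[OF pt_pi H2.XY.clinear_cc H2.XY.clinear_cc H2.XY.clinear_cc H2.XY.clinear_cc, of b b' c c', unfolded tp]
    obtain m where m: "cv E2 esm (\<lambda>w. psi (tri b b' (\<pi>1 w))) (\<lambda>w. psi (tri c c' (\<pi>2 w))) (h \<otimes> g) = psi m"
      unfolding e by metis
    have "esm (psi (tri b b' h)) (psi (tri c c' g)) = psi m"
      unfolding m[symmetric] by (rule H2.cv_p1_p2[OF cbilinear_esm l l, symmetric])
    then show ?thesis by (simp add: mm_def)
  qed
  have 2: "psi (mm (tri b b' h) y) = esm (psi (tri b b' h)) (psi y)" for b b' h
    by (rule tri_ext[where t = y]) (rule clinear_compose[OF clinear_psi bm(2)], rule clinear_compose[OF b(2) clinear_psi], rule 1)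
  show ?thesis
    by (rule tri_ext[where t = x]) (rule clinear_compose[OF clinear_psi bm(1)], rule clinear_compose[OF b(1) clinear_psi], rule 2)
qed

lemma mm_assoc: "mm (mm x y) z = mm x (mm y z)"
  by (rule injD[OF inj_psi]) (simp add: psi_mm esm_assoc)

end

context crossed_points
begin

lemma mm_point:
  assumes pt: "pt \<alpha>" "pt \<beta>" and [simp]: "clinear f" "clinear f'" "clinear g" "clinear g'"
  shows "cv D mm (X.Tp f f' \<alpha>) (X.Tp g g' \<beta>) =
    X.Tp (f \<star> (\<alpha> \<rhd> g) \<star> sg \<alpha> \<beta>) (sg' \<alpha> \<beta> \<star> (\<alpha> \<rhd> g') \<star> f') (\<alpha> \<star> \<beta>)"
proof -
  note [simp] = pt_linear[OF pt(1)] pt_linear[OF pt(2)]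
  have [simp]: "clinear (\<lambda>x. psi (X.Tp f f' \<alpha> x))" if "clinear f" "clinear f'" "clinear \<alpha>" for f f' \<alpha>
    by (rule clinear_compose[OF clinear_psi]) (simp add: that)
  have "cv D mm (X.Tp f f' \<alpha>) (X.Tp g g' \<beta>) =
      (\<lambda>x. rho (cv D esm (\<lambda>x. psi (X.Tp f f' \<alpha> x)) (\<lambda>x. psi (X.Tp g g' \<beta> x)) x))"
    by (rule ext, subst X.cv_post[OF clinear_rho], simp_all) (simp add: cv_def mm_def)
  then show ?thesis unfolding esm_point[OF assms] by simp
qed

end

section \<open>Source and target multiplication and the balancing relation in coordinates\<close>

definition smul :: "'b::calgebra \<Rightarrow> (('b, 'b) tensor, 'h::cvector) tensor \<Rightarrow> (('b, 'b) tensor, 'h) tensor" where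
  "smul c = mlift (\<lambda>b b' h. tri (c * b) b' h)"

definition tmul :: "'b::calgebra \<Rightarrow> (('b, 'b) tensor, 'h::cvector) tensor \<Rightarrow> (('b, 'b) tensor, 'h) tensor" where
  "tmul c = mlift (\<lambda>b b' h. tri b (b' * c) h)"

lemma smul_tri_aux: "ctrilinear (\<lambda>b b' h. tri (c * b) b' h)"
  and tmul_tri_aux: "ctrilinear (\<lambda>b b' h. tri b (b' * c) h)" for c :: "'b::calgebra"
  by (rule ctrilinearI; simp)+

lemma smul_tri [simp]: "smul c (tri b b' h) = tri (c * b) b' h"
  and tmul_tri [simp]: "tmul c (tri b b' h) = tri b (b' * c) h"
  by (simp_all add: smul_def tmul_def mlift_tri smul_tri_aux tmul_tri_aux)

lemma cbilinear_smul [simp]: "cbilinear smul" and cbilinear_tmul [simp]: "cbilinear tmul"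
  unfolding smul_def tmul_def
  by (rule cbilinear_mlift; simp add: smul_tri_aux tmul_tri_aux)+

lemma clinear_smul [simp]: "clinear (smul c)" and clinear_tmul [simp]: "clinear (tmul c)"
  by (simp_all add: cbilinear_right)

lemma smul_smul: "smul c (smul d x) = smul (c * d) x"
  by (rule tri_ext[where t = x]) (rule clinear_compose[OF clinear_smul clinear_smul], simp_all add: mult.assoc)

lemma tmul_tmul: "tmul c (tmul d x) = tmul (d * c) x"
  by (rule tri_ext[where t = x]) (rule clinear_compose[OF clinear_tmul clinear_tmul], simp_all add: mult.assoc)

lemma smul_tmul: "smul c (tmul d x) = tmul d (smul c x)"
  by (rule tri_ext[where t = x])
    (rule clinear_compose[OF clinear_smul clinear_tmul], rule clinear_compose[OF clinear_tmul clinear_smul], simp)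

text \<open>A normal form for the tensor product over B: the first B-component of the right factor
  is moved into the left factor, leaving 1 in its place.\<close>

definition QQ :: "(('b::calgebra, 'b) tensor, 'h::cvector) tensor \<Rightarrow> (('b, 'b) tensor, 'h) tensor \<Rightarrow>
    ((('b, 'b) tensor, 'h) tensor, (('b, 'b) tensor, 'h) tensor) tensor" where
  "QQ x = mlift (\<lambda>c c' g. tmul c x \<otimes> tri 1 c' g)"

lemma QQ_aux: "ctrilinear (\<lambda>c c' g. tmul c x \<otimes> tri 1 c' g)"
  by (rule ctrilinearI; simp add: cbilinear_left)

lemma QQ_tri: "QQ x (tri c c' g) = tmul c x \<otimes> tri 1 c' g"
  by (simp add: QQ_def mlift_tri QQ_aux)

lemma cbilinear_QQ [simp]: "cbilinear QQ"
  unfolding QQ_def by (rule cbilinear_mlift[OF QQ_aux]) simp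

text \<open>The balancing relation is expressed by \<open>smul\<close> and \<open>tmul\<close>,
  which do not involve \<sigma>; so it is literally the same for the smash product, its twist and
  the crossed product.\<close>

definition mbal :: "((('b::calgebra, 'b) tensor, 'h::cvector) tensor, (('b, 'b) tensor, 'h) tensor) tensor set" where
  "mbal = cvec.span {tmul b x \<otimes> y - x \<otimes> smul b y | x b y. True}"

lemma subspace_mbal [simp]: "cvec.subspace mbal"
  unfolding mbal_def by (rule cvec.subspace_span)

lemma mbal_base: "tmul b x \<otimes> y - x \<otimes> smul b y \<in> mbal"
  unfolding mbal_def by (rule cvec.span_base) blast

lemma QQ_mod_mbal: "z - tlift QQ z \<in> mbal"
proof (induction z rule: tensor_induct)
  case (pure x y)
  have "x \<otimes> t - QQ x t \<in> mbal" for t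
  proof (induction t rule: tensor_induct)
    case (pure s g)
    show ?case
    proof (induction s rule: tensor_induct)
      case (pure c c')
      show ?case
        using cvec.subspace_neg[OF subspace_mbal mbal_base[of c x "tri 1 c' g"]] by (simp add: QQ_tri)
    next
      case (add s s')
      have eq: "x \<otimes> ((s + s') \<otimes> g) - QQ x ((s + s') \<otimes> g) = (x \<otimes> (s \<otimes> g) - QQ x (s \<otimes> g)) + (x \<otimes> (s' \<otimes> g) - QQ x (s' \<otimes> g))"
        by (simp add: clinear_add[OF cbilinear_left[OF cbilinear_pure]] clinear_add[OF cbilinear_right[OF cbilinear_pure]]
            clinear_add[OF cbilinear_right[OF cbilinear_QQ]])
      show ?case unfolding eq by (rule cvec.subspace_add[OF subspace_mbal add])
    qed
  next
    case (add t t')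
    have eq: "x \<otimes> (t + t') - QQ x (t + t') = (x \<otimes> t - QQ x t) + (x \<otimes> t' - QQ x t')"
      by (simp add: clinear_add[OF cbilinear_right[OF cbilinear_pure]] clinear_add[OF cbilinear_right[OF cbilinear_QQ]])
    show ?case unfolding eq by (rule cvec.subspace_add[OF subspace_mbal add])
  qed
  then show ?case by (simp add: tlift_pure)
next
  case (add z z')
  have eq: "(z + z') - tlift QQ (z + z') = (z - tlift QQ z) + (z' - tlift QQ z')"
    by (simp add: clinear_add[OF clinear_tlift[OF cbilinear_QQ]])
  show ?case unfolding eq by (rule cvec.subspace_add[OF subspace_mbal add])
qed

text \<open>Every tensor is congruent to its normal form, so equality of normal forms decides
  congruence modulo balancing.\<close>

lemma mbalI: "tlift QQ z = tlift QQ z' \<Longrightarrow> z - z' \<in> mbal"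
  using cvec.subspace_diff[OF subspace_mbal QQ_mod_mbal[of z] QQ_mod_mbal[of z']] by simp

text \<open>Used with \<open>W\<close> zero for well-defined values and with \<open>W\<close> a
  balancing subspace for classes of tensors.\<close>

lemma tlift_mbal:
  assumes "n \<in> mbal" "cbilinear F" "cvec.subspace W" "\<And>b x y. F (tmul b x) y - F x (smul b y) \<in> W"
  shows "tlift F n \<in> W"
  using assms(1) unfolding mbal_def
proof (induction rule: cvec.span_induct_alt)
  case base
  show ?case by (simp add: clinear_zero[OF clinear_tlift[OF assms(2)]] cvec.subspace_0[OF assms(3)])
next
  case (step c w z)
  note l = clinear_tlift[OF assms(2)]
  have "tlift F w \<in> W"
    using step(1) assms(4) by (auto simp: clinear_diff[OF l] tlift_pure[OF assms(2)])
  then show ?case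
    using step(2) by (simp add: clinear_add[OF l] clinear_scale[OF l] cvec.subspace_add[OF assms(3)] cvec.subspace_scale[OF assms(3)])
qed

context cocomm_coalgebra
begin

lemma smul_point:
  assumes [simp]: "clinear f" "clinear f'" "clinear g" "clinear \<alpha>"
  shows "cv D smul g (Tp f f' \<alpha>) = Tp (cv D (*) g f) f' \<alpha>"
proof -
  have c: "cv D smul g (Tp (cc b) (cc b') \<alpha>) = Tp (cv D (*) g (cc b)) (cc b') \<alpha>" for b b'
  proof -
    have "cv D smul g (Tp (cc b) (cc b') \<alpha>) = cv D pure (\<lambda>u. (g u * b) \<otimes> b') \<alpha>"
      by (rule cv_cong) (simp add: tri_point_apply)
    then show ?thesis by (simp add: cv_cc_right)
  qed
  have "sub (\<lambda>b. cv D smul g (Tp (cc b) (cc b') \<alpha>)) f = sub (\<lambda>b. Tp (cv D (*) g (cc b)) (cc b') \<alpha>) f" for b'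
    unfolding c ..
  then have "cv D smul g (Tp f (cc b') \<alpha>) = Tp (cv D (*) g f) (cc b') \<alpha>" for b'
    by (simp add: sub_left sub_right sub_cc)
  then have "sub (\<lambda>b'. cv D smul g (Tp f (cc b') \<alpha>)) f' = sub (\<lambda>b'. Tp (cv D (*) g f) (cc b') \<alpha>) f'"
    by simp
  then show ?thesis by (simp add: sub_left sub_right sub_cc)
qed

lemma tmul_point:
  assumes [simp]: "clinear f" "clinear f'" "clinear g" "clinear \<alpha>"
  shows "cv D tmul g (Tp f f' \<alpha>) = Tp f (cv D (*) f' g) \<alpha>"
proof -
  have c: "cv D tmul (cc d) (Tp (cc b) (cc b') \<alpha>) = Tp (cc b) (cv D (*) (cc b') (cc d)) \<alpha>" for b b' d
    by (rule ext) (simp add: cv_cc_left[OF cbilinear_tmul] tri_point_apply cv_cc_cc[OF cbilinear_mult])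
  have "sub (\<lambda>b. cv D tmul (cc d) (Tp (cc b) (cc b') \<alpha>)) f = sub (\<lambda>b. Tp (cc b) (cv D (*) (cc b') (cc d)) \<alpha>) f" for b' d
    unfolding c ..
  then have "cv D tmul (cc d) (Tp f (cc b') \<alpha>) = Tp f (cv D (*) (cc b') (cc d)) \<alpha>" for b' d
    by (simp add: sub_left sub_right sub_cc)
  then have "sub (\<lambda>b'. cv D tmul (cc d) (Tp f (cc b') \<alpha>)) f' = sub (\<lambda>b'. Tp f (cv D (*) (cc b') (cc d)) \<alpha>) f'" for d
    by simp
  then have "cv D tmul (cc d) (Tp f f' \<alpha>) = Tp f (cv D (*) f' (cc d)) \<alpha>" for d
    by (simp add: sub_left sub_right sub_cc)
  then have "sub (\<lambda>d. cv D tmul (cc d) (Tp f f' \<alpha>)) g = sub (\<lambda>d. Tp f (cv D (*) f' (cc d)) \<alpha>) g"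
    by simp
  then show ?thesis by (simp add: sub_left sub_right sub_cc)
qed

lemma QQ_point:
  assumes [simp]: "clinear f" "clinear f'" "clinear g" "clinear g'" "clinear \<alpha>" "clinear \<beta>"
  shows "cv D QQ (Tp f f' \<alpha>) (Tp g g' \<beta>) = cv D pure (Tp f (cv D (*) f' g) \<alpha>) (Tp (cc 1) g' \<beta>)"
proof -
  let ?u = "Tp f f' \<alpha>"
  have c: "cv D QQ ?u (Tp (cc c) (cc c') \<beta>) = cv D pure (cv D tmul (cc c) ?u) (Tp (cc 1) (cc c') \<beta>)" for c c'
  proof -
    have "cv D QQ ?u (Tp (cc c) (cc c') \<beta>) = cv D pure (\<lambda>x. tmul c (?u x)) (Tp (cc 1) (cc c') \<beta>)"
      by (rule cv_cong) (simp add: tri_point_apply QQ_tri)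
    then show ?thesis by (simp add: cv_cc_left)
  qed
  have "sub (\<lambda>c. cv D QQ ?u (Tp (cc c) (cc c') \<beta>)) g = sub (\<lambda>c. cv D pure (cv D tmul (cc c) ?u) (Tp (cc 1) (cc c') \<beta>)) g" for c'
    unfolding c ..
  then have "cv D QQ ?u (Tp g (cc c') \<beta>) = cv D pure (cv D tmul g ?u) (Tp (cc 1) (cc c') \<beta>)" for c'
    by (simp add: sub_left sub_right sub_cc)
  then have "sub (\<lambda>c'. cv D QQ ?u (Tp g (cc c') \<beta>)) g' = sub (\<lambda>c'. cv D pure (cv D tmul g ?u) (Tp (cc 1) (cc c') \<beta>)) g'"
    by simp
  then show ?thesis by (simp add: sub_left sub_right sub_cc tmul_point)
qed

end

section \<open>Coproduct and counit in coordinates\<close>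

context cocomm_hopf
begin

text \<open>Inserting the translation map between the two legs of a carrier element splits it into
  two carrier elements, with units at the cut; the cocycle drops out.\<close>

definition dd :: "(('b::calgebra, 'b) tensor, 'h) tensor \<Rightarrow> ((('b, 'b) tensor, 'h) tensor, (('b, 'b) tensor, 'h) tensor) tensor" where
  "dd = mlift (\<lambda>b b' h. cv \<Delta> pure (H.Tp (H.cc b) (H.cc 1) (\<lambda>x. x)) (H.Tp (H.cc 1) (H.cc b') (\<lambda>x. x)) h)"

text \<open>Multiplying the two legs of a carrier element cancels \<gamma> against its inverse,
  leaving \<epsilon> and the product in B.\<close>

definition ee :: "(('b::calgebra, 'b) tensor, 'h) tensor \<Rightarrow> 'b" where
  "ee = mlift (\<lambda>b b' h. \<epsilon> h *\<^sub>C (b * b'))"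

lemma dd_aux: "ctrilinear (\<lambda>b b' h. cv \<Delta> pure (H.Tp (H.cc b) (H.cc 1) (\<lambda>x. x)) (H.Tp (H.cc 1) (H.cc b') (\<lambda>x. x)) h)"
proof (rule ctrilinearI)
  have 1: "cbilinear (\<lambda>b. cv \<Delta> pure (H.Tp (H.cc b) (H.cc 1) (\<lambda>x. x)) (H.Tp (H.cc 1) (H.cc b') (\<lambda>x. x)))" for b'
    by simp
  have 2: "cbilinear (\<lambda>b'. cv \<Delta> pure (H.Tp (H.cc b) (H.cc 1) (\<lambda>x. x)) (H.Tp (H.cc 1) (H.cc b') (\<lambda>x. x)))" for b
    by simp
  show "clinear (\<lambda>b. cv \<Delta> pure (H.Tp (H.cc b) (H.cc 1) (\<lambda>x. x)) (H.Tp (H.cc 1) (H.cc b') (\<lambda>x. x)) h)" for b' h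
    by (rule cbilinear_left[OF 1])
  show "clinear (\<lambda>b'. cv \<Delta> pure (H.Tp (H.cc b) (H.cc 1) (\<lambda>x. x)) (H.Tp (H.cc 1) (H.cc b') (\<lambda>x. x)) h)" for b h
    by (rule cbilinear_left[OF 2])
qed simp

lemma ee_aux: "ctrilinear (\<lambda>(b::'b::calgebra) b' h. \<epsilon> h *\<^sub>C (b * b'))"
  by (rule ctrilinearI) simp_all

lemma clinear_dd [simp]: "clinear dd" and clinear_ee [simp]: "clinear ee"
  by (simp_all add: dd_def ee_def clinear_mlift dd_aux ee_aux)

lemma ee_tri [simp]: "ee (tri b b' h) = \<epsilon> h *\<^sub>C (b * b')"
  by (simp add: ee_def mlift_tri ee_aux)

lemma dd_tri: "dd (tri b b' h) = cv \<Delta> pure (H.Tp (H.cc b) (H.cc 1) (\<lambda>x. x)) (H.Tp (H.cc 1) (H.cc b') (\<lambda>x. x)) h"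
  unfolding dd_def by (rule mlift_tri[OF dd_aux])

lemma tlift_dd_tri:
  assumes "cbilinear F"
  shows "tlift F (dd (tri b b' h)) = cv \<Delta> F (H.Tp (H.cc b) (H.cc 1) (\<lambda>x. x)) (H.Tp (H.cc 1) (H.cc b') (\<lambda>x. x)) h"
  unfolding dd_tri by (subst H.cv_post[OF clinear_tlift[OF assms]]) (simp_all add: tlift_pure[OF assms])

lemma tlift_dd_tri': "cbilinear F \<Longrightarrow> tlift F (dd (tri b b' h)) = sweedler2 \<Delta> (\<lambda>h1 h2. F (tri b 1 h1) (tri 1 b' h2)) h"
  by (simp only: tlift_dd_tri) (simp add: cv_def[of _ F] H.tri_point_apply)

lemma dd_one: "dd (tri 1 1 1) = tri 1 1 1 \<otimes> tri 1 1 1"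
proof -
  have b: "cbilinear (\<lambda>h1 h2. tri 1 1 h1 \<otimes> tri 1 1 h2)"
    by (rule cbilinear_compose[OF cbilinear_pure]) simp_all
  have "dd (tri 1 1 1) = tlift pure (dd (tri 1 1 1))" by (rule tlift_pure_id[symmetric])
  also have "\<dots> = tri 1 1 1 \<otimes> tri 1 1 1"
    by (simp add: tlift_dd_tri' sweedler2_def comult_one tlift_pure[OF b])
  finally show ?thesis .
qed

end

context hopf_points
begin

lemma dd_point:
  assumes pt: "pt \<alpha>" and [simp]: "clinear f" "clinear g"
  shows "(\<lambda>x. dd (X.Tp f g \<alpha> x)) = cv D pure (X.Tp f (X.cc 1) \<alpha>) (X.Tp (X.cc 1) g \<alpha>)"
proof -
  note [simp] = pt pt_linear[OF pt]
  have c: "(\<lambda>x. cv \<Delta> pure (H.Tp (H.cc b) (H.cc 1) (\<lambda>x. x)) (H.Tp (H.cc 1) (H.cc c) (\<lambda>x. x)) (\<alpha> x)) =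
      cv D pure (X.Tp (X.cc b) (X.cc 1) \<alpha>) (X.Tp (X.cc 1) (X.cc c) \<alpha>)" for b c
    by (simp add: fun_eq_iff cv_pullback[OF pt] coalg_map_counit[OF pt])
  show ?thesis
    unfolding dd_def X.mlift_point[OF dd_aux assms(2,3) pt_linear[OF pt]] c
    by (simp add: X.sub_left X.sub_right X.sub_cc)
qed

lemma ee_point:
  fixes f g :: "'x \<Rightarrow> 'v::calgebra"
  assumes pt: "pt \<alpha>" and [simp]: "clinear f" "clinear g"
  shows "(\<lambda>x. ee (X.Tp f g \<alpha> x)) = f \<star> g"
proof -
  have c: "(\<lambda>x. \<epsilon> (\<alpha> x) *\<^sub>C (b * c)) = X.cc b \<star> X.cc c" for b c :: 'v
    by (simp add: coalg_map_counit[OF pt] X.cv_cc_cc)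
  show ?thesis
    unfolding ee_def X.mlift_point[OF ee_aux assms(2,3) pt_linear[OF pt]] c
    by (simp add: X.sub_left X.sub_right X.sub_cc)
qed

end

context crossed_points
begin

lemma cc_tri: "X.cc (tri b c h) = X.Tp (X.cc b) (X.cc c) (X.cc h)"
  by (simp add: X.cv_cc_cc)

lemma mm_src_point:
  assumes pt: "pt \<alpha>" and [simp]: "clinear f" "clinear f'" "clinear g"
  shows "cv D mm (X.Tp f f' \<alpha>) (X.Tp g (X.cc 1) (X.cc 1)) = X.Tp (f \<star> (\<alpha> \<rhd> g)) f' \<alpha>"
    and "cv D mm (X.Tp f f' \<alpha>) (X.Tp (X.cc 1) g (X.cc 1)) = X.Tp f ((\<alpha> \<rhd> g) \<star> f') \<alpha>"
    and "cv D mm (X.Tp g (X.cc 1) (X.cc 1)) (X.Tp f f' \<alpha>) = X.Tp (g \<star> f) f' \<alpha>"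
    and "cv D mm (X.Tp (X.cc 1) g (X.cc 1)) (X.Tp f f' \<alpha>) = X.Tp f (f' \<star> g) \<alpha>"
proof -
  note [simp] = pt pt_linear[OF pt]
  show "cv D mm (X.Tp f f' \<alpha>) (X.Tp g (X.cc 1) (X.cc 1)) = X.Tp (f \<star> (\<alpha> \<rhd> g)) f' \<alpha>"
    "cv D mm (X.Tp f f' \<alpha>) (X.Tp (X.cc 1) g (X.cc 1)) = X.Tp f ((\<alpha> \<rhd> g) \<star> f') \<alpha>"
    "cv D mm (X.Tp g (X.cc 1) (X.cc 1)) (X.Tp f f' \<alpha>) = X.Tp (g \<star> f) f' \<alpha>"
    "cv D mm (X.Tp (X.cc 1) g (X.cc 1)) (X.Tp f f' \<alpha>) = X.Tp f (f' \<star> g) \<alpha>"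
    by (simp_all add: mm_point act_unit_points act_one_point)
qed

lemma mm_src_point_const:
  assumes pt: "pt \<alpha>" and [simp]: "clinear f" "clinear f'"
  shows "(\<lambda>x. mm (X.Tp f f' \<alpha> x) (tri c 1 1)) = X.Tp (f \<star> (\<alpha> \<rhd> X.cc c)) f' \<alpha>"
    and "(\<lambda>x. mm (X.Tp f f' \<alpha> x) (tri 1 c 1)) = X.Tp f ((\<alpha> \<rhd> X.cc c) \<star> f') \<alpha>"
    and "(\<lambda>x. mm (tri c 1 1) (X.Tp f f' \<alpha> x)) = X.Tp (X.cc c \<star> f) f' \<alpha>"
    and "(\<lambda>x. mm (tri 1 c 1) (X.Tp f f' \<alpha> x)) = X.Tp f (f' \<star> X.cc c) \<alpha>"
proof -
  note [simp] = pt pt_linear[OF pt]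
  show "(\<lambda>x. mm (X.Tp f f' \<alpha> x) (tri c 1 1)) = X.Tp (f \<star> (\<alpha> \<rhd> X.cc c)) f' \<alpha>"
    "(\<lambda>x. mm (X.Tp f f' \<alpha> x) (tri 1 c 1)) = X.Tp f ((\<alpha> \<rhd> X.cc c) \<star> f') \<alpha>"
    by (subst mm_src_point[OF pt assms(2,3) X.clinear_cc, symmetric];
        simp only: cc_tri[symmetric]; rule X.cv_cc_right[symmetric]; simp)+
  show "(\<lambda>x. mm (tri c 1 1) (X.Tp f f' \<alpha> x)) = X.Tp (X.cc c \<star> f) f' \<alpha>"
    "(\<lambda>x. mm (tri 1 c 1) (X.Tp f f' \<alpha> x)) = X.Tp f (f' \<star> X.cc c) \<alpha>"
    by (subst mm_src_point[OF pt assms(2,3) X.clinear_cc, symmetric];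
        simp only: cc_tri[symmetric]; rule X.cv_cc_left[symmetric]; simp)+
qed

end

context cocomm_hopf
begin

abbreviation gen1 where "gen1 b b' \<equiv> H2.XY.Tp (H2.XY.cc b) (H2.XY.cc b') H2.p1"
abbreviation gen2 where "gen2 b b' \<equiv> H2.XY.Tp (H2.XY.cc b) (H2.XY.cc b') H2.p2"
abbreviation gen where "gen b b' \<equiv> H.Tp (H.cc b) (H.cc b') (\<lambda>x. x)"

lemma eval_gen2: "cbilinear K \<Longrightarrow> cv (tD \<Delta> \<Delta>) K (gen1 b b') (gen2 c c') (h \<otimes> g) = K (tri b b' h) (tri c c' g)"
  using H2.cv_p1_p2[of K "\<lambda>h. tri b b' h" "\<lambda>h. tri c c' h" h g]
  by (simp add: H2.XY.tri_point[OF H2.clinear_p1] H2.XY.tri_point[OF H2.clinear_p2])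

text \<open>A bilinear identity in coordinates need only be checked at the universal pair of points
  over H \<otimes> H, with constant B-components.\<close>

lemma bil_ext:
  assumes K: "cbilinear K" "cbilinear K'"
    and eq: "\<And>b b' c c'. cv (tD \<Delta> \<Delta>) K (gen1 b b') (gen2 c c') = cv (tD \<Delta> \<Delta>) K' (gen1 b b') (gen2 c c')"
  shows "K x y = K' x y"
proof (rule tri_ext[where t = x, OF cbilinear_left[OF K(1)] cbilinear_left[OF K(2)]])
  fix b b' h
  show "K (tri b b' h) y = K' (tri b b' h) y"
  proof (rule tri_ext[where t = y, OF cbilinear_right[OF K(1)] cbilinear_right[OF K(2)]])
    fix c c' g
    show "K (tri b b' h) (tri c c' g) = K' (tri b b' h) (tri c c' g)"
      using eq[of b b' c c'] eval_gen2[OF K(1), of b b' c c' h g] eval_gen2[OF K(2), of b b' c c' h g] by simp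
  qed
qed

lemma gen_ext:
  assumes "clinear f" "clinear g" "\<And>b b'. (\<lambda>h. f (gen b b' h)) = (\<lambda>h. g (gen b b' h))"
  shows "f x = g x"
  by (rule tri_ext[OF assms(1,2)]) (use fun_cong[OF assms(3)] in \<open>simp add: H.tri_point_apply\<close>)

lemma tlift_dd_gen:
  "cbilinear F \<Longrightarrow> (\<lambda>h. tlift F (dd (gen b b' h))) = cv \<Delta> F (gen b 1) (gen 1 b')"
  by (simp add: H.tri_point_apply tlift_dd_tri fun_eq_iff)

lemma ee_smul: "ee (smul c x) = c * ee x" and ee_tmul: "ee (tmul c x) = ee x * c"
proof -
  have l: "clinear (\<lambda>x. ee (smul c x))" "clinear (\<lambda>x. ee (tmul c x))"
    by (rule clinear_compose[OF clinear_ee]; simp)+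
  show "ee (smul c x) = c * ee x" "ee (tmul c x) = ee x * c"
    by (rule tri_ext[where t = x], simp_all add: l mult.assoc scaleC_mult_right scaleC_mult_left)+
qed

lemma smul_point_const:
  assumes [simp]: "clinear f" "clinear f'" "clinear \<alpha>"
  shows "(\<lambda>x. smul c (H.Tp f f' \<alpha> x)) = H.Tp (cv \<Delta> (*) (H.cc c) f) f' \<alpha>"
    and "(\<lambda>x. tmul c (H.Tp f f' \<alpha> x)) = H.Tp f (cv \<Delta> (*) f' (H.cc c)) \<alpha>"
  using H.cv_cc_left[OF cbilinear_smul, of "H.Tp f f' \<alpha>" c] H.smul_point[of f f' "H.cc c" \<alpha>]
    H.cv_cc_left[OF cbilinear_tmul, of "H.Tp f f' \<alpha>" c] H.tmul_point[of f f' "H.cc c" \<alpha>]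
  by simp_all

end

section \<open>The bialgebroid identities in coordinates\<close>

context central_crossed_product
begin

lemma mm_src_left: "mm (tri c 1 1) x = smul c x" and mm_tgt_left: "mm (tri 1 c 1) x = tmul c x"
proof -
  note l = cbilinear_right[OF cbilinear_mm]
  show "mm (tri c 1 1) x = smul c x"
    by (rule gen_ext[OF l clinear_smul]) (simp add: H.mm_src_point_const smul_point_const)
  show "mm (tri 1 c 1) x = tmul c x"
    by (rule gen_ext[OF l clinear_tmul]) (simp add: H.mm_src_point_const smul_point_const)
qed

lemma smul_one [simp]: "smul 1 x = x" and tmul_one [simp]: "tmul 1 x = x" for x :: "(('b, 'b) tensor, 'h) tensor"
  by (rule tri_ext[where t = x], simp_all)+

lemma mm_one [simp]: "mm (tri 1 1 1) x = x" "mm x (tri 1 1 1) = x"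
proof -
  show "mm (tri 1 1 1) x = x" by (simp add: mm_src_left)
  show "mm x (tri 1 1 1) = x"
    by (rule gen_ext[OF cbilinear_left[OF cbilinear_mm] clinear_id])
      (simp add: H.mm_src_point_const H.act_unit_points)
qed

lemma mm_smul: "mm (smul c x) y = smul c (mm x y)" and mm_tmul: "mm (tmul c x) y = tmul c (mm x y)"
  unfolding mm_src_left[symmetric] mm_tgt_left[symmetric] by (rule mm_assoc)+

lemma bil_pure_left: "clinear f \<Longrightarrow> cbilinear (\<lambda>x y. f x \<otimes> y)"
  and bil_pure_right: "clinear f \<Longrightarrow> cbilinear (\<lambda>x y. x \<otimes> f y)"
  by (rule cbilinear_compose[OF cbilinear_pure]; simp)+

lemma dd_smul: "dd (smul c x) = tlift (\<lambda>x1 x2. smul c x1 \<otimes> x2) (dd x)"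
proof (rule gen_ext[where x = x])
  note B = bil_pure_left[OF clinear_smul]
  show "clinear (\<lambda>x. dd (smul c x))" by (rule clinear_compose[OF clinear_dd clinear_smul])
  show "clinear (\<lambda>x. tlift (\<lambda>x1 x2. smul c x1 \<otimes> x2) (dd x))" by (rule clinear_compose[OF clinear_tlift[OF B] clinear_dd])
  fix b b'
  have "(\<lambda>h. dd (smul c (gen b b' h))) = (\<lambda>h. dd (H.Tp (cv \<Delta> (*) (H.cc c) (H.cc b)) (H.cc b') (\<lambda>x. x) h))"
    using fun_cong[OF smul_point_const(1)[OF H.clinear_cc H.clinear_cc clinear_id, of c b b']] by simp
  also have "\<dots> = cv \<Delta> pure (\<lambda>h. smul c (gen b 1 h)) (gen 1 b')"
    by (simp add: H.dd_point smul_point_const)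
  also have "\<dots> = (\<lambda>h. tlift (\<lambda>x1 x2. smul c x1 \<otimes> x2) (dd (gen b b' h)))"
    unfolding tlift_dd_gen[OF B] by (rule cv_cong) simp
  finally show "(\<lambda>h. dd (smul c (gen b b' h))) = (\<lambda>h. tlift (\<lambda>x1 x2. smul c x1 \<otimes> x2) (dd (gen b b' h)))" .
qed

lemma dd_tmul: "dd (tmul c x) = tlift (\<lambda>x1 x2. x1 \<otimes> tmul c x2) (dd x)"
proof (rule gen_ext[where x = x])
  note B = bil_pure_right[OF clinear_tmul]
  show "clinear (\<lambda>x. dd (tmul c x))" by (rule clinear_compose[OF clinear_dd clinear_tmul])
  show "clinear (\<lambda>x. tlift (\<lambda>x1 x2. x1 \<otimes> tmul c x2) (dd x))" by (rule clinear_compose[OF clinear_tlift[OF B] clinear_dd])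
  fix b b'
  have "(\<lambda>h. dd (tmul c (gen b b' h))) = (\<lambda>h. dd (H.Tp (H.cc b) (cv \<Delta> (*) (H.cc b') (H.cc c)) (\<lambda>x. x) h))"
    using fun_cong[OF smul_point_const(2)[OF H.clinear_cc H.clinear_cc clinear_id, of c b b']] by simp
  also have "\<dots> = cv \<Delta> pure (gen b 1) (\<lambda>h. tmul c (gen 1 b' h))"
    by (simp add: H.dd_point smul_point_const)
  also have "\<dots> = (\<lambda>h. tlift (\<lambda>x1 x2. x1 \<otimes> tmul c x2) (dd (gen b b' h)))"
    unfolding tlift_dd_gen[OF B] by (rule cv_cong) simp
  finally show "(\<lambda>h. dd (tmul c (gen b b' h))) = (\<lambda>h. tlift (\<lambda>x1 x2. x1 \<otimes> tmul c x2) (dd (gen b b' h)))" .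
qed

lemma dd_counit_left: "tlift (\<lambda>x y. smul (ee x) y) (dd a) = a"
  and dd_counit_right: "tlift (\<lambda>x y. tmul (ee y) x) (dd a) = a" for a :: "(('b, 'b) tensor, 'h) tensor"
proof -
  have B: "cbilinear (\<lambda>x y. smul (ee x) y)" by (rule cbilinear_compose[OF cbilinear_smul]) simp_all
  have B': "cbilinear (\<lambda>x y. tmul (ee y) x)"
    by (rule cbilinear_flip[OF cbilinear_compose[OF cbilinear_tmul]]) simp_all
  show "tlift (\<lambda>x y. smul (ee x) y) (dd a) = a"
  proof (rule gen_ext[where x = a])
    fix b b' :: 'b
    have "cv \<Delta> (\<lambda>x y. smul (ee x) y) (gen b 1) (gen 1 b') = cv \<Delta> smul (\<lambda>h. ee (gen b 1 h)) (gen 1 b')"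
      by (rule cv_cong) simp
    also have "\<dots> = gen b b'"
      by (simp add: H.ee_point H.smul_point)
    finally show "(\<lambda>h. tlift (\<lambda>x y. smul (ee x) y) (dd (gen b b' h))) = (\<lambda>h. gen b b' h)"
      unfolding tlift_dd_gen[OF B] by simp
  qed (rule clinear_compose[OF clinear_tlift[OF B] clinear_dd], simp)
  show "tlift (\<lambda>x y. tmul (ee y) x) (dd a) = a"
  proof (rule gen_ext[where x = a])
    fix b b' :: 'b
    have "cv \<Delta> (\<lambda>x y. tmul (ee y) x) (gen b 1) (gen 1 b') = cv \<Delta> (\<lambda>y x. tmul (ee y) x) (gen 1 b') (gen b 1)"
      by (rule H.cv_comm) (simp_all add: B')
    also have "\<dots> = cv \<Delta> tmul (\<lambda>h. ee (gen 1 b' h)) (gen b 1)"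
      by (rule cv_cong) simp
    also have "\<dots> = gen b b'"
      by (simp add: H.ee_point H.tmul_point)
    finally show "(\<lambda>h. tlift (\<lambda>x y. tmul (ee y) x) (dd (gen b b' h))) = (\<lambda>h. gen b b' h)"
      unfolding tlift_dd_gen[OF B'] by simp
  qed (rule clinear_compose[OF clinear_tlift[OF B'] clinear_dd], simp)
qed

text \<open>This holds before passing to the quotient: both iterated coproducts place
  \<open>b\<close> in the first factor, \<open>b'\<close> in the last and units elsewhere.\<close>

lemma dd_coassoc:
  fixes a :: "(('b, 'b) tensor, 'h) tensor"
  shows "tlift (\<lambda>x y. tlift (\<lambda>x1 x2. x1 \<otimes> (x2 \<otimes> y)) (dd x)) (dd a) =
    tlift (\<lambda>x y. tlift (\<lambda>y1 y2. x \<otimes> (y1 \<otimes> y2)) (dd y)) (dd a)"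
proof -
  let ?A = "\<lambda>t (y :: (('b, 'b) tensor, 'h) tensor). tlift (\<lambda>(x1 :: (('b, 'b) tensor, 'h) tensor) (x2 :: (('b, 'b) tensor, 'h) tensor). x1 \<otimes> (x2 \<otimes> y)) t"
  have a1: "cbilinear (\<lambda>(x1 :: (('b, 'b) tensor, 'h) tensor) (x2 :: (('b, 'b) tensor, 'h) tensor). x1 \<otimes> (x2 \<otimes> y))" for y :: "(('b, 'b) tensor, 'h) tensor"
    by (rule cbilinearI) simp_all
  have A: "cbilinear ?A"
    by (rule cbilinearI) (rule clinear_tlift[OF a1], rule clinear_tlift_param, simp)
  have B1: "cbilinear (\<lambda>x y. ?A (dd x) y)" by (rule cbilinear_compose[OF A]) simp_all
  have B2: "cbilinear (\<lambda>(x :: (('b, 'b) tensor, 'h) tensor) (y :: (('b, 'b) tensor, 'h) tensor). x \<otimes> dd y)" by (rule cbilinear_compose[OF cbilinear_pure]) simp_all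
  have p: "(\<lambda>x y. tlift (\<lambda>y1 y2. x \<otimes> (y1 \<otimes> y2)) (dd y)) = (\<lambda>(x :: (('b, 'b) tensor, 'h) tensor) (y :: (('b, 'b) tensor, 'h) tensor). x \<otimes> dd y)"
  proof (intro ext)
    fix x y :: "(('b, 'b) tensor, 'h) tensor"
    have "x \<otimes> tlift pure (dd y) = tlift (\<lambda>y1 y2. x \<otimes> (y1 \<otimes> y2)) (dd y)"
      by (rule tlift_post[OF cbilinear_right[OF cbilinear_pure] cbilinear_pure])
    then show "tlift (\<lambda>y1 y2. x \<otimes> (y1 \<otimes> y2)) (dd y) = x \<otimes> dd y"
      by (simp add: tlift_pure_id)
  qed
  have L1: "clinear (\<lambda>a. tlift (\<lambda>x y. ?A (dd x) y) (dd a))" by (rule clinear_compose[OF clinear_tlift[OF B1] clinear_dd])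
  have L2: "clinear (\<lambda>a :: (('b, 'b) tensor, 'h) tensor. tlift (\<lambda>x y. tlift (\<lambda>y1 y2. x \<otimes> (y1 \<otimes> y2)) (dd y)) (dd a))"
    unfolding p by (rule clinear_compose[OF clinear_tlift[OF B2] clinear_dd])
  have e: "(\<lambda>h. tlift (\<lambda>x y. ?A (dd x) y) (dd (gen b b' h))) = (\<lambda>h. tlift (\<lambda>x y. tlift (\<lambda>y1 y2. x \<otimes> (y1 \<otimes> y2)) (dd y)) (dd (gen b b' h)))" for b b' :: 'b
  proof -
  have "cv \<Delta> (\<lambda>x y. ?A (dd x) y) (gen b 1) (gen 1 b') = cv \<Delta> ?A (\<lambda>h. dd (gen b 1 h)) (gen 1 b')"
    by (rule cv_cong) simp
  also have "\<dots> = cv \<Delta> ?A (cv \<Delta> pure (gen b 1) (gen 1 1)) (gen 1 b')"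
    by (simp add: H.dd_point)
  also have "\<dots> = cv \<Delta> pure (gen b 1) (cv \<Delta> pure (gen 1 1) (gen 1 b'))"
    by (rule H.cv_assoc[OF A]) (simp_all add: tlift_pure[OF a1])
  also have "\<dots> = cv \<Delta> pure (gen b 1) (\<lambda>h. dd (gen 1 b' h))"
    by (simp add: H.dd_point)
  also have "\<dots> = cv \<Delta> (\<lambda>x y. x \<otimes> dd y) (gen b 1) (gen 1 b')"
    by (rule cv_cong) simp
  finally show ?thesis
    unfolding p tlift_dd_gen[OF B1] tlift_dd_gen[OF B2] .
  qed
  show ?thesis by (rule gen_ext[OF L1 L2 e])
qed

text \<open>Right multiplication by a target in the first factor, or by a source in the second,
  inserts the same element, the action of a leg of \<open>h\<close> on \<open>c\<close>, at the cut;
  the normal forms therefore agree.\<close>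

lemma dd_takeuchi:
  "tlift (\<lambda>x y. mm x (tri 1 c 1) \<otimes> y) (dd a) - tlift (\<lambda>x y. x \<otimes> mm y (tri c 1 1)) (dd a) \<in> mbal"
proof (rule mbalI)
  note l = cbilinear_left[OF cbilinear_mm]
  note B1 = bil_pure_left[OF l] and B2 = bil_pure_right[OF l]
  have C1: "cbilinear (\<lambda>x y. QQ (mm x (tri 1 c 1)) y)" by (rule cbilinear_compose[OF cbilinear_QQ l clinear_id])
  have C2: "cbilinear (\<lambda>x y. QQ x (mm y (tri c 1 1)))" by (rule cbilinear_compose[OF cbilinear_QQ clinear_id l])
  have q1: "tlift QQ (tlift (\<lambda>x y. mm x (tri 1 c 1) \<otimes> y) t) = tlift (\<lambda>x y. QQ (mm x (tri 1 c 1)) y) t" for t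
    by (simp add: tlift_post[OF clinear_tlift[OF cbilinear_QQ] B1] tlift_pure)
  have q2: "tlift QQ (tlift (\<lambda>x y. x \<otimes> mm y (tri c 1 1)) t) = tlift (\<lambda>x y. QQ x (mm y (tri c 1 1))) t" for t
    by (simp add: tlift_post[OF clinear_tlift[OF cbilinear_QQ] B2] tlift_pure)
  show "tlift QQ (tlift (\<lambda>x y. mm x (tri 1 c 1) \<otimes> y) (dd a)) = tlift QQ (tlift (\<lambda>x y. x \<otimes> mm y (tri c 1 1)) (dd a))"
    unfolding q1 q2
  proof (rule gen_ext[where x = a])
    fix b b' :: 'b
    have "cv \<Delta> (\<lambda>x y. QQ (mm x (tri 1 c 1)) y) (gen b 1) (gen 1 b') = cv \<Delta> QQ (\<lambda>h. mm (gen b 1 h) (tri 1 c 1)) (gen 1 b')"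
      by (rule cv_cong) simp
    also have "\<dots> = cv \<Delta> QQ (gen b 1) (\<lambda>h. mm (gen 1 b' h) (tri c 1 1))"
      by (simp add: H.mm_src_point_const H.QQ_point)
    also have "\<dots> = cv \<Delta> (\<lambda>x y. QQ x (mm y (tri c 1 1))) (gen b 1) (gen 1 b')"
      by (rule cv_cong) simp
    finally show "(\<lambda>h. tlift (\<lambda>x y. QQ (mm x (tri 1 c 1)) y) (dd (gen b b' h))) = (\<lambda>h. tlift (\<lambda>x y. QQ x (mm y (tri c 1 1))) (dd (gen b b' h)))"
      unfolding tlift_dd_gen[OF C1] tlift_dd_gen[OF C2] .
  qed (rule clinear_compose[OF clinear_tlift[OF C1] clinear_dd], rule clinear_compose[OF clinear_tlift[OF C2] clinear_dd])
qed

text \<open>The form in which the Takeuchi property is used: it lets balanced sums over the second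
  of two coproducts be evaluated.\<close>

lemma takeuchi_balanced:
  assumes K: "cbilinear K" and W: "cvec.subspace W" and bal: "\<And>b x y. K (tmul b x) y - K x (smul b y) \<in> W"
  shows "tlift (\<lambda>x y. K (mm x (tri 1 c 1)) y) (dd a) - tlift (\<lambda>x y. K x (mm y (tri c 1 1))) (dd a) \<in> W"
proof -
  note l = cbilinear_left[OF cbilinear_mm]
  note B1 = bil_pure_left[OF l] and B2 = bil_pure_right[OF l]
  have q1: "tlift K (tlift (\<lambda>x y. mm x (tri 1 c 1) \<otimes> y) t) = tlift (\<lambda>x y. K (mm x (tri 1 c 1)) y) t" for t
    by (simp add: tlift_post[OF clinear_tlift[OF K] B1] tlift_pure[OF K])
  have q2: "tlift K (tlift (\<lambda>x y. x \<otimes> mm y (tri c 1 1)) t) = tlift (\<lambda>x y. K x (mm y (tri c 1 1))) t" for t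
    by (simp add: tlift_post[OF clinear_tlift[OF K] B2] tlift_pure[OF K])
  show ?thesis
    using tlift_mbal[OF dd_takeuchi K W bal, of c a] by (simp add: clinear_diff[OF clinear_tlift[OF K]] q1 q2)
qed

text \<open>In the counit of a product the cocycle meets its inverse and cancels. What remains
  depends on \<open>a'\<close> only through the product of its two B-components, since the action is
  multiplicative.\<close>

lemma ee_mm_src: "ee (mm a (tri (ee a') 1 1)) = ee (mm a a')"
  and ee_mm_tgt: "ee (mm a (tri 1 (ee a') 1)) = ee (mm a a')"
proof -
  have K: "cbilinear (\<lambda>a a'. ee (mm a a'))" by (rule cbilinear_post[OF clinear_ee cbilinear_mm])
  have K1: "cbilinear (\<lambda>a a'. ee (mm a (tri (ee a') 1 1)))" "cbilinear (\<lambda>a a'. ee (mm a (tri 1 (ee a') 1)))"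
    by (rule cbilinear_compose[OF K clinear_id]; simp)+
  note pt_pi [simp] HH.pt_linear[OF pt_pi(1), simp] HH.pt_linear[OF pt_pi(2), simp]
  have eeg: "(\<lambda>w. ee (gen2 c c' w)) = HH.conv_mult (H2.XY.cc c) (H2.XY.cc c')" for c c'
    by (rule HH.ee_point) simp_all
  have M: "cv E2 (\<lambda>a a'. ee (mm a a')) (gen1 b b') (gen2 c c') =
      HH.conv_mult (HH.conv_mult (H2.XY.cc b) (HH.conv_act \<pi>1 (HH.conv_mult (H2.XY.cc c) (H2.XY.cc c')))) (H2.XY.cc b')" for b b' c c'
  proof -
    have "cv E2 (\<lambda>a a'. ee (mm a a')) (gen1 b b') (gen2 c c') = (\<lambda>w. ee (cv E2 mm (gen1 b b') (gen2 c c') w))"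
      by (rule ext, subst H2.XY.cv_post[OF clinear_ee]) simp_all
    also have "\<dots> = HH.conv_mult (HH.conv_mult (HH.conv_mult (H2.XY.cc b) (HH.conv_act \<pi>1 (H2.XY.cc c))) (HH.sg \<pi>1 \<pi>2))
        (HH.conv_mult (HH.conv_mult (HH.sg' \<pi>1 \<pi>2) (HH.conv_act \<pi>1 (H2.XY.cc c'))) (H2.XY.cc b'))"
      by (simp add: HH.mm_point HH.ee_point)
    also have "\<dots> = HH.conv_mult (HH.conv_mult (H2.XY.cc b) (HH.conv_act \<pi>1 (H2.XY.cc c)))
        (HH.conv_mult (HH.conv_mult (HH.sg \<pi>1 \<pi>2) (HH.sg' \<pi>1 \<pi>2)) (HH.conv_mult (HH.conv_act \<pi>1 (H2.XY.cc c')) (H2.XY.cc b')))"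
      by (simp add: HH.mult_assoc)
    also have "\<dots> = HH.conv_mult (HH.conv_mult (H2.XY.cc b) (HH.conv_act \<pi>1 (HH.conv_mult (H2.XY.cc c) (H2.XY.cc c')))) (H2.XY.cc b')"
      unfolding HH.sg_inverse[OF pt_pi] by (simp add: HH.mult_assoc HH.act_mult_points)
    finally show ?thesis .
  qed
  have M1: "cv E2 (\<lambda>a a'. ee (mm a (tri (ee a') 1 1))) (gen1 b b') (gen2 c c') =
      HH.conv_mult (HH.conv_mult (H2.XY.cc b) (HH.conv_act \<pi>1 (HH.conv_mult (H2.XY.cc c) (H2.XY.cc c')))) (H2.XY.cc b')" for b b' c c'
  proof -
    have "cv E2 (\<lambda>a a'. ee (mm a (tri (ee a') 1 1))) (gen1 b b') (gen2 c c') =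
        cv E2 (\<lambda>a d. ee (mm a (tri d 1 1))) (gen1 b b') (\<lambda>w. ee (gen2 c c' w))"
      by (rule cv_cong) simp
    also have "\<dots> = (\<lambda>w. ee (cv E2 mm (gen1 b b') (H2.XY.Tp (HH.conv_mult (H2.XY.cc c) (H2.XY.cc c')) (H2.XY.cc 1) (H2.XY.cc 1)) w))"
      unfolding eeg
      by (rule ext, subst H2.XY.cv_post[OF clinear_ee]) (simp_all add: H2.XY.cv_cc_right H2.XY.cv_cc_cc H2.XY.cv_cc_left, simp add: cv_def)
    finally show ?thesis
      by (simp add: HH.mm_src_point HH.ee_point)
  qed
  have M2: "cv E2 (\<lambda>a a'. ee (mm a (tri 1 (ee a') 1))) (gen1 b b') (gen2 c c') =
      HH.conv_mult (HH.conv_mult (H2.XY.cc b) (HH.conv_act \<pi>1 (HH.conv_mult (H2.XY.cc c) (H2.XY.cc c')))) (H2.XY.cc b')" for b b' c c'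
  proof -
    have "cv E2 (\<lambda>a a'. ee (mm a (tri 1 (ee a') 1))) (gen1 b b') (gen2 c c') =
        cv E2 (\<lambda>a d. ee (mm a (tri 1 d 1))) (gen1 b b') (\<lambda>w. ee (gen2 c c' w))"
      by (rule cv_cong) simp
    also have "\<dots> = (\<lambda>w. ee (cv E2 mm (gen1 b b') (H2.XY.Tp (H2.XY.cc 1) (HH.conv_mult (H2.XY.cc c) (H2.XY.cc c')) (H2.XY.cc 1)) w))"
      unfolding eeg
      by (rule ext, subst H2.XY.cv_post[OF clinear_ee]) (simp_all add: H2.XY.cv_cc_right H2.XY.cv_cc_cc H2.XY.cv_cc_left, simp add: cv_def)
    finally show ?thesis
      by (simp add: HH.mm_src_point HH.ee_point HH.mult_assoc)
  qed
  show "ee (mm a (tri (ee a') 1 1)) = ee (mm a a')"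
    by (rule bil_ext[OF K1(1) K]) (simp add: M M1)
  show "ee (mm a (tri 1 (ee a') 1)) = ee (mm a a')"
    by (rule bil_ext[OF K1(2) K]) (simp add: M M2)
qed

definition mmt where "mmt s t = tlift (\<lambda>x' y'. tlift (\<lambda>x y. mm x x' \<otimes> mm y y') s) t"

lemma mmt_aux: "cbilinear (\<lambda>x y. mm x x' \<otimes> mm y y')" "cbilinear (\<lambda>x' y'. tlift (\<lambda>x y. mm x x' \<otimes> mm y y') s)"
proof -
  note l = cbilinear_left[OF cbilinear_mm] cbilinear_right[OF cbilinear_mm]
  show "cbilinear (\<lambda>x y. mm x x' \<otimes> mm y y')"
    by (rule cbilinear_compose[OF cbilinear_pure l(1) l(1)])
  show "cbilinear (\<lambda>x' y'. tlift (\<lambda>x y. mm x x' \<otimes> mm y y') s)"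
    by (rule cbilinearI)
      (rule clinear_tlift_param, rule clinear_compose[OF cbilinear_left[OF cbilinear_pure] l(2)],
       rule clinear_tlift_param, rule clinear_compose[OF cbilinear_right[OF cbilinear_pure] l(2)])
qed

lemma cbilinear_mmt: "cbilinear mmt"
  unfolding mmt_def[abs_def]
  by (rule cbilinearI) (rule clinear_tlift_param, rule clinear_tlift[OF mmt_aux(1)], rule clinear_tlift[OF mmt_aux(2)])

lemma mmt_pure: "mmt (x \<otimes> y) (x' \<otimes> y') = mm x x' \<otimes> mm y y'"
  unfolding mmt_def by (simp only: tlift_pure[OF mmt_aux(2)]) (simp only: tlift_pure[OF mmt_aux(1)])

text \<open>The factorwise product carries the inverse cocycle at the end of the left factor and the
  cocycle at the start of the right one. They cancel only across the balanced tensor product, hence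
  the congruence.\<close>

lemma dd_mult: "mmt (dd a) (dd a') - dd (mm a a') \<in> mbal"
proof (rule mbalI)
  note l = clinear_tlift[OF cbilinear_QQ]
  note pt_pi [simp] HH.pt_linear[OF pt_pi(1), simp] HH.pt_linear[OF pt_pi(2), simp]
  have Km: "cbilinear (\<lambda>s t. tlift QQ (mmt s t))" by (rule cbilinear_post[OF l cbilinear_mmt])
  have K: "cbilinear (\<lambda>a a'. tlift QQ (mmt (dd a) (dd a')))"
    by (rule cbilinear_compose[OF Km]) simp_all
  have K': "cbilinear (\<lambda>a a'. tlift QQ (dd (mm a a')))"
    by (rule cbilinear_post[OF clinear_compose[OF l clinear_dd] cbilinear_mm])
  show "tlift QQ (mmt (dd a) (dd a')) = tlift QQ (dd (mm a a'))"
  proof (rule bil_ext[OF K K'])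
    fix b b' c c' :: 'b
    let ?u = "HH.conv_mult (HH.conv_mult (H2.XY.cc b) (HH.conv_act \<pi>1 (H2.XY.cc c))) (HH.sg \<pi>1 \<pi>2)"
    let ?v = "HH.conv_mult (HH.conv_mult (HH.sg' \<pi>1 \<pi>2) (HH.conv_act \<pi>1 (H2.XY.cc c'))) (H2.XY.cc b')"
    let ?p = "HH.conv_mult \<pi>1 \<pi>2"
    have "cv E2 (\<lambda>a a'. tlift QQ (mmt (dd a) (dd a'))) (gen1 b b') (gen2 c c') =
        cv E2 (\<lambda>s t. tlift QQ (mmt s t)) (\<lambda>w. dd (gen1 b b' w)) (\<lambda>w. dd (gen2 c c' w))"
      by (rule cv_cong) simp
    also have "\<dots> = (\<lambda>w. tlift QQ (cv E2 mmt (cv E2 pure (gen1 b 1) (gen1 1 b')) (cv E2 pure (gen2 c 1) (gen2 1 c')) w))"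
      by (simp add: HH.dd_point H2.XY.cv_post[OF l cbilinear_mmt])
    also have "cv E2 mmt (cv E2 pure (gen1 b 1) (gen1 1 b')) (cv E2 pure (gen2 c 1) (gen2 1 c')) =
        cv E2 pure (cv E2 mm (gen1 b 1) (gen2 c 1)) (cv E2 mm (gen1 1 b') (gen2 1 c'))"
      by (rule H2.XY.cv_interchange) (simp_all add: cbilinear_mmt mmt_pure)
    also have "\<dots> = cv E2 pure (H2.XY.Tp ?u (HH.sg' \<pi>1 \<pi>2) ?p) (H2.XY.Tp (HH.sg \<pi>1 \<pi>2) ?v ?p)"
      by (simp add: HH.mm_point HH.act_unit_points)
    also have "(\<lambda>w. tlift QQ (cv E2 pure (H2.XY.Tp ?u (HH.sg' \<pi>1 \<pi>2) ?p) (H2.XY.Tp (HH.sg \<pi>1 \<pi>2) ?v ?p) w)) =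
        cv E2 QQ (H2.XY.Tp ?u (HH.sg' \<pi>1 \<pi>2) ?p) (H2.XY.Tp (HH.sg \<pi>1 \<pi>2) ?v ?p)"
      by (rule ext, subst H2.XY.cv_post[OF l cbilinear_pure]) (simp_all add: tlift_pure)
    also have "\<dots> = cv E2 QQ (H2.XY.Tp ?u (H2.XY.cc 1) ?p) (H2.XY.Tp (H2.XY.cc 1) ?v ?p)"
      by (simp add: H2.XY.QQ_point HH.sg_inverse)
    also have "\<dots> = (\<lambda>w. tlift QQ (cv E2 pure (H2.XY.Tp ?u (H2.XY.cc 1) ?p) (H2.XY.Tp (H2.XY.cc 1) ?v ?p) w))"
      by (rule ext, subst H2.XY.cv_post[OF l cbilinear_pure]) (simp_all add: tlift_pure)
    also have "\<dots> = (\<lambda>w. tlift QQ (dd (H2.XY.Tp ?u ?v ?p w)))"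
      using fun_cong[OF HH.dd_point[of ?p ?u ?v]] by simp
    also have "\<dots> = (\<lambda>w. tlift QQ (dd (cv E2 mm (gen1 b b') (gen2 c c') w)))"
      by (simp add: HH.mm_point)
    also have "\<dots> = cv E2 (\<lambda>a a'. tlift QQ (dd (mm a a'))) (gen1 b b') (gen2 c c')"
      by (rule ext, subst H2.XY.cv_post[OF clinear_compose[OF l clinear_dd] cbilinear_mm]) simp_all
    finally show "cv E2 (\<lambda>a a'. tlift QQ (mmt (dd a) (dd a'))) (gen1 b b') (gen2 c c') =
        cv E2 (\<lambda>a a'. tlift QQ (dd (mm a a'))) (gen1 b b') (gen2 c c')" .
  qed
qed

end

section \<open>Bialgebroids in coordinates\<close>

text \<open>\<open>P\<close> parametrises the carrier and \<open>R\<close> is a left inverse of it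
  on the whole ambient space; the structure is required to be the one written in coordinates for
  \<sigma>. Two bialgebroids presented with the same data are isomorphic, so the comparison reduces
  to presenting both sides.\<close>

locale presented_bialgebroid = central_crossed_product \<Delta> \<epsilon> S act \<sigma> \<sigma>'
  for \<Delta> :: "'h::calgebra \<Rightarrow> ('h, 'h) tensor" and \<epsilon> S
    and act :: "'h \<Rightarrow> 'b::calgebra \<Rightarrow> 'b" and \<sigma> \<sigma>' +
  fixes L :: "('b, 'l::cvector) bialgebroid"
    and P :: "(('b, 'b) tensor, 'h) tensor \<Rightarrow> 'l" and R :: "'l \<Rightarrow> (('b, 'b) tensor, 'h) tensor"
  assumes P_linear [simp]: "clinear P" and R_linear [simp]: "clinear R" and RP [simp]: "R (P t) = t"
    and carrier: "bcar L = range P"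
    and mul: "bmul L (P x) (P y) = P (mm x y)"
    and one: "bone L = P (tri 1 1 1)"
    and src: "src L b = P (tri b 1 1)"
    and tgt: "tgt L b = P (tri 1 b 1)"
    and comul: "comul L (P t) = coset (bbalancing L) (tlift (\<lambda>x y. P x \<otimes> P y) (dd t))"
    and counit: "counit L (P t) = ee t"
begin

abbreviation "PP \<equiv> tlift (\<lambda>x y. P x \<otimes> P y)"

lemma PP_bil: "cbilinear (\<lambda>x y. P x \<otimes> P y)"
  by (rule cbilinear_compose[OF cbilinear_pure P_linear P_linear])

lemma RR_bil: "cbilinear (\<lambda>x y. R x \<otimes> R y)"
  by (rule cbilinear_compose[OF cbilinear_pure R_linear R_linear])

lemma clinear_PP [simp]: "clinear PP"
  by (rule clinear_tlift[OF PP_bil])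

lemma src_mul: "bmul L (src L b) (P x) = P (smul b x)" and tgt_mul: "bmul L (tgt L b) (P x) = P (tmul b x)"
  by (simp_all add: src tgt mul mm_src_left mm_tgt_left)

lemma subspace_bbalancing [simp]: "cvec.subspace (bbalancing L)"
  unfolding bbalancing_def balancing_def by (rule cvec.subspace_span)

lemma bbalancing_eq: "bbalancing L = cvec.span {P (tmul b x) \<otimes> P y - P x \<otimes> P (smul b y) | x b y. True}"
proof -
  have "{bmul L (tgt L b) x \<otimes> y - x \<otimes> bmul L (src L b) y | x b y. x \<in> range P \<and> y \<in> range P} =
      {P (tmul b x) \<otimes> P y - P x \<otimes> P (smul b y) | x b y. True}"
  proof (intro equalityI subsetI)
    fix z assume "z \<in> {P (tmul b x) \<otimes> P y - P x \<otimes> P (smul b y) | x b y. True}"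
    then obtain x b y where "z = bmul L (tgt L b) (P x) \<otimes> P y - P x \<otimes> bmul L (src L b) (P y)"
      by (auto simp: src_mul tgt_mul)
    then show "z \<in> {bmul L (tgt L b) x \<otimes> y - x \<otimes> bmul L (src L b) y | x b y. x \<in> range P \<and> y \<in> range P}"
      by blast
  qed (auto simp: src_mul tgt_mul, blast)
  then show ?thesis by (simp add: bbalancing_def balancing_def carrier)
qed

lemma bbalancing_base: "P (tmul b x) \<otimes> P y - P x \<otimes> P (smul b y) \<in> bbalancing L"
  unfolding bbalancing_eq by (rule cvec.span_base) blast

lemma PP_mbal: "n \<in> mbal \<Longrightarrow> PP n \<in> bbalancing L"
  by (rule tlift_mbal[OF _ PP_bil]) (simp_all add: bbalancing_base)

lemma RR_bbalancing:
  assumes "n \<in> bbalancing L"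
  shows "tlift (\<lambda>x y. R x \<otimes> R y) n \<in> mbal"
  using assms unfolding bbalancing_eq
proof (induction rule: cvec.span_induct_alt)
  case base
  show ?case by (simp add: clinear_zero[OF clinear_tlift[OF RR_bil]] cvec.subspace_0[OF subspace_mbal])
next
  case (step c w z)
  note l = clinear_tlift[OF RR_bil]
  have "tlift (\<lambda>x y. R x \<otimes> R y) w \<in> mbal"
    using step(1) by (auto simp: clinear_diff[OF l] tlift_pure[OF RR_bil] mbal_base)
  then show ?case
    using step(2) by (simp add: clinear_add[OF l] clinear_scale[OF l] cvec.subspace_add[OF subspace_mbal] cvec.subspace_scale[OF subspace_mbal])
qed

lemma RR_PP [simp]: "tlift (\<lambda>x y. R x \<otimes> R y) (PP t) = t"
proof (rule tensor_ext[where t = t])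
  show "clinear (\<lambda>t. tlift (\<lambda>x y. R x \<otimes> R y) (PP t))"
    by (rule clinear_compose[OF clinear_tlift[OF RR_bil] clinear_PP])
qed (simp_all add: tlift_pure[OF RR_bil] tlift_pure[OF PP_bil])

lemma bclass_eqI: "z - z' \<in> bbalancing L \<Longrightarrow> bclass L z = bclass L z'"
  by (simp add: bclass_def coset_eq_iff)

lemma PP_tensor_span: "PP t \<in> tensor_span (bcar L) (bcar L)"
  unfolding tensor_span_def carrier
  by (rule tlift_in_subspace[OF cvec.subspace_span PP_bil]) (rule cvec.span_base, blast)

lemma subspace_carrier: "cvec.subspace (range P)"
proof (rule cvec.subspaceI)
  show "0 \<in> range P" using clinear_zero[OF P_linear] by (metis rangeI)
  fix x y c assume "x \<in> range P"
  then obtain u where u: "x = P u" by blast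
  show "c *\<^sub>C x \<in> range P" by (simp add: u flip: clinear_scale[OF P_linear])
  assume "y \<in> range P"
  then obtain v where v: "y = P v" by blast
  show "x + y \<in> range P" by (simp add: u v flip: clinear_add[OF P_linear])
qed

text \<open>The list picked by \<open>cop\<close> consists of carrier elements, so it can be pulled
  back through \<open>R\<close>; its sum agrees with \<open>dd\<close> up to the balancing
  relation.\<close>

lemma cop_coordinates:
  obtains xs where "cop L (P t) = map (\<lambda>(x, y). (P x, P y)) xs" "(\<Sum>(x, y)\<leftarrow>xs. x \<otimes> y) - dd t \<in> mbal"
proof -
  let ?Q = "\<lambda>xs. set xs \<subseteq> bcar L \<times> bcar L \<and> (\<Sum>(x, y)\<leftarrow>xs. x \<otimes> y) \<in> comul L (P t)"
  obtain ys where ys: "set ys \<subseteq> bcar L \<times> bcar L" "PP (dd t) = (\<Sum>(x, y)\<leftarrow>ys. x \<otimes> y)"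
    using tensor_span_list[OF PP_tensor_span, of "dd t"] subspace_carrier carrier by metis
  have "PP (dd t) \<in> comul L (P t)"
    unfolding comul mem_coset_iff[OF subspace_bbalancing] using cvec.subspace_0[OF subspace_bbalancing] by simp
  then have "?Q ys" using ys by simp
  then have Q: "?Q (cop L (P t))" unfolding cop_def by (rule someI)
  define xs where "xs = map (\<lambda>(x, y). (R x, R y)) (cop L (P t))"
  have m: "cop L (P t) = map (\<lambda>(x, y). (P x, P y)) xs"
    using Q unfolding xs_def carrier by (force simp: o_def case_prod_unfold intro: map_idI[symmetric])
  have "(\<Sum>(x, y)\<leftarrow>cop L (P t). x \<otimes> y) - PP (dd t) \<in> bbalancing L"
    using Q unfolding comul mem_coset_iff[OF subspace_bbalancing] by simp
  from RR_bbalancing[OF this] have "(\<Sum>(x, y)\<leftarrow>cop L (P t). R x \<otimes> R y) - dd t \<in> mbal"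
    by (simp add: clinear_diff[OF clinear_tlift[OF RR_bil]] tlift_sum_list[OF RR_bil])
  moreover have "(\<Sum>(x, y)\<leftarrow>xs. x \<otimes> y) = (\<Sum>(x, y)\<leftarrow>cop L (P t). R x \<otimes> R y)"
    unfolding xs_def by (simp add: o_def case_prod_unfold)
  ultimately show ?thesis using that m by simp
qed

text \<open>The arbitrary choice in \<open>cop\<close> disappears: a summand that is balanced modulo
  \<open>W\<close> may be summed over the explicit coproduct \<open>dd\<close>.\<close>

lemma cop_sum_mod:
  assumes "cbilinear (\<lambda>x y. F (P x) (P y))" "cvec.subspace W"
    "\<And>b x y. F (P (tmul b x)) (P y) - F (P x) (P (smul b y)) \<in> W"
  shows "(\<Sum>(x, y)\<leftarrow>cop L (P t). F x y) - tlift (\<lambda>x y. F (P x) (P y)) (dd t) \<in> W"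
proof -
  obtain xs where xs: "cop L (P t) = map (\<lambda>(x, y). (P x, P y)) xs" "(\<Sum>(x, y)\<leftarrow>xs. x \<otimes> y) - dd t \<in> mbal"
    by (rule cop_coordinates)
  have "(\<Sum>(x, y)\<leftarrow>cop L (P t). F x y) = tlift (\<lambda>x y. F (P x) (P y)) (\<Sum>(x, y)\<leftarrow>xs. x \<otimes> y)"
    unfolding tlift_sum_list[OF assms(1)] xs(1) by (simp add: o_def case_prod_unfold)
  then show ?thesis
    using tlift_mbal[OF xs(2) assms(1,2,3)] by (simp add: clinear_diff[OF clinear_tlift[OF assms(1)]])
qed

lemma cop_sum:
  assumes "cbilinear (\<lambda>x y. F (P x) (P y))" "\<And>b x y. F (P (tmul b x)) (P y) = F (P x) (P (smul b y))"
  shows "(\<Sum>(x, y)\<leftarrow>cop L (P t). F x y) = tlift (\<lambda>x y. F (P x) (P y)) (dd t)"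
  using cop_sum_mod[of F "{0}" t] assms by (simp add: cvec.subspace_single_0)

lemma cop_pure_mod: "(\<Sum>(x, y)\<leftarrow>cop L (P t). x \<otimes> y) - PP (dd t) \<in> bbalancing L"
  by (rule cop_sum_mod[OF PP_bil subspace_bbalancing bbalancing_base])

lemma linear_on_P:
  assumes "\<And>x y. f (P (x + y)) = f (P x) + f (P y)" "\<And>c x. f (P (c *\<^sub>C x)) = c *\<^sub>C f (P x)"
  shows "linear_on (range P) f"
  using assms unfolding linear_on_def
  by (auto simp flip: clinear_add[OF P_linear] clinear_scale[OF P_linear])

lemma linear_on_P': "clinear (\<lambda>x. f (P x)) \<Longrightarrow> linear_on (range P) f"
  by (rule linear_on_P) (simp_all add: clinear_add[of "\<lambda>x. f (P x)"] clinear_scale[of "\<lambda>x. f (P x)"])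

end

lemma sum_list_swap: "(\<Sum>x\<leftarrow>xs. \<Sum>y\<leftarrow>ys. f x y) = (\<Sum>y\<leftarrow>ys. \<Sum>x\<leftarrow>xs. f x y :: 'a::comm_monoid_add)"
  by (induction xs) (simp_all add: sum_list_addf)

lemma sum_list_diff_subspace:
  assumes "cvec.subspace W" "\<And>x. x \<in> set xs \<Longrightarrow> f x - g x \<in> W"
  shows "(\<Sum>x\<leftarrow>xs. f x) - (\<Sum>x\<leftarrow>xs. g x) \<in> W"
  using assms(2)
proof (induction xs)
  case Nil
  then show ?case by (simp add: cvec.subspace_0[OF assms(1)])
next
  case (Cons x xs)
  have "(f x - g x) + ((\<Sum>x\<leftarrow>xs. f x) - (\<Sum>x\<leftarrow>xs. g x)) \<in> W"
    using Cons by (intro cvec.subspace_add[OF assms(1)]) auto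
  then show ?case by (simp add: algebra_simps)
qed

lemma subspace_trans:
  assumes "cvec.subspace W" "x - y \<in> W" "y - z \<in> W"
  shows "x - z \<in> W"
  using cvec.subspace_add[OF assms] by simp

section \<open>Sums over two coproducts and the bialgebroid axioms\<close>

context presented_bialgebroid
begin

text \<open>The summand need not be balanced separately in the second coproduct. A scalar there
  turns into right multiplication on \<open>x\<close> or \<open>y\<close>, by a target or a source,
  and the Takeuchi property of the first coproduct identifies the two.\<close>

lemma cop_sum2_mod:
  assumes bil: "\<And>x' y'. cbilinear (\<lambda>x y. F (P x) (P y) (P x') (P y'))"
    "\<And>x y. cbilinear (\<lambda>x' y'. F (P x) (P y) (P x') (P y'))"
    and W: "cvec.subspace W"
    and bal: "\<And>b x y x' y'. F (P (tmul b x)) (P y) (P x') (P y') - F (P x) (P (smul b y)) (P x') (P y') \<in> W"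
    and inner: "\<And>b x y x' y'. F (P x) (P y) (P (tmul b x')) (P y') = F (P (mm x (tri 1 b 1))) (P y) (P x') (P y')"
      "\<And>b x y x' y'. F (P x) (P y) (P x') (P (smul b y')) = F (P x) (P (mm y (tri b 1 1))) (P x') (P y')"
  shows "(\<Sum>(x, y)\<leftarrow>cop L (P a). \<Sum>(x', y')\<leftarrow>cop L (P a'). F x y x' y') -
    tlift (\<lambda>x' y'. tlift (\<lambda>x y. F (P x) (P y) (P x') (P y')) (dd a)) (dd a') \<in> W"
proof -
  let ?F' = "\<lambda>x' y'. tlift (\<lambda>x y. F (P x) (P y) x' y') (dd a)"
  have s: "(\<Sum>(x, y)\<leftarrow>cop L (P a). \<Sum>(x', y')\<leftarrow>cop L (P a'). F x y x' y') =
      (\<Sum>(x', y')\<leftarrow>cop L (P a'). \<Sum>(x, y)\<leftarrow>cop L (P a). F x y x' y')"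
    using sum_list_swap[of "\<lambda>p q. F (fst p) (snd p) (fst q) (snd q)" "cop L (P a')" "cop L (P a)"]
    by (simp add: case_prod_unfold)
  have 1: "(\<Sum>(x', y')\<leftarrow>cop L (P a'). \<Sum>(x, y)\<leftarrow>cop L (P a). F x y x' y') - (\<Sum>(x', y')\<leftarrow>cop L (P a'). ?F' x' y') \<in> W"
  proof (rule sum_list_diff_subspace[OF W])
    fix p assume p: "p \<in> set (cop L (P a'))"
    obtain xs where xs: "cop L (P a') = map (\<lambda>(x, y). (P x, P y)) xs" by (rule cop_coordinates)
    then obtain u v where u: "p = (P u, P v)" using p by auto
    have "(\<Sum>(x, y)\<leftarrow>cop L (P a). F x y (P u) (P v)) - ?F' (P u) (P v) \<in> W"
      by (rule cop_sum_mod) (rule bil, rule W, rule bal)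
    then show "(case p of (x', y') \<Rightarrow> \<Sum>(x, y)\<leftarrow>cop L (P a). F x y x' y') - (case p of (x', y') \<Rightarrow> ?F' x' y') \<in> W"
      by (simp add: u)
  qed
  have 2: "(\<Sum>(x', y')\<leftarrow>cop L (P a'). ?F' x' y') - tlift (\<lambda>x' y'. ?F' (P x') (P y')) (dd a') \<in> W"
  proof (rule cop_sum_mod[OF _ W])
    show "cbilinear (\<lambda>x' y'. ?F' (P x') (P y'))"
    proof (rule cbilinearI)
      show "clinear (\<lambda>x'. ?F' (P x') (P y'))" for y'
        by (rule clinear_tlift_param) (rule cbilinear_left[OF bil(2)])
      show "clinear (\<lambda>y'. ?F' (P x') (P y'))" for x'
        by (rule clinear_tlift_param) (rule cbilinear_right[OF bil(2)])
    qed
    show "?F' (P (tmul b x')) (P y') - ?F' (P x') (P (smul b y')) \<in> W" for b x' y'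
      unfolding inner by (rule takeuchi_balanced[OF bil(1) W bal])
  qed
  show ?thesis unfolding s by (rule subspace_trans[OF W 1 2])
qed

lemma cop_sum2:
  assumes bil: "\<And>x' y'. cbilinear (\<lambda>x y. F (P x) (P y) (P x') (P y'))"
    "\<And>x y. cbilinear (\<lambda>x' y'. F (P x) (P y) (P x') (P y'))"
    and bal: "\<And>b x y x' y'. F (P (tmul b x)) (P y) (P x') (P y') = F (P x) (P (smul b y)) (P x') (P y')"
    and inner: "\<And>b x y x' y'. F (P x) (P y) (P (tmul b x')) (P y') = F (P (mm x (tri 1 b 1))) (P y) (P x') (P y')"
      "\<And>b x y x' y'. F (P x) (P y) (P x') (P (smul b y')) = F (P x) (P (mm y (tri b 1 1))) (P x') (P y')"
  shows "(\<Sum>(x, y)\<leftarrow>cop L (P a). \<Sum>(x', y')\<leftarrow>cop L (P a'). F x y x' y') =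
    tlift (\<lambda>x' y'. tlift (\<lambda>x y. F (P x) (P y) (P x') (P y')) (dd a)) (dd a')"
  using cop_sum2_mod[OF bil, where W = "{0}" and a = a and a' = a'] bal inner by (simp add: cvec.subspace_single_0)

lemma P_add: "P x + P y = P (x + y)" and P_scale: "c *\<^sub>C P x = P (c *\<^sub>C x)"
  by (simp_all add: clinear_add clinear_scale)

lemma PP_post:
  assumes "cbilinear F"
  shows "PP (tlift F t) = tlift (\<lambda>x y. PP (F x y)) t"
  by (rule tlift_post[OF clinear_PP assms])

lemma PP_pure: "PP (x \<otimes> y) = P x \<otimes> P y"
  by (rule tlift_pure[OF PP_bil])

lemma subspace_bbalancing3: "cvec.subspace (bbalancing3 L)"
  unfolding bbalancing3_def by (rule cvec.subspace_span)

lemma bbalancing3_base: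
  "P (tmul b x) \<otimes> (P y \<otimes> P z) - P x \<otimes> (P (smul b y) \<otimes> P z) \<in> bbalancing3 L"
  "P x \<otimes> (P (tmul b y) \<otimes> P z) - P x \<otimes> (P y \<otimes> P (smul b z)) \<in> bbalancing3 L"
  unfolding bbalancing3_def carrier src_mul[symmetric] tgt_mul[symmetric]
  by (rule cvec.span_base, blast)+

lemma coassoc_left:
  "(\<Sum>(x, y)\<leftarrow>cop L (P a). \<Sum>(x1, x2)\<leftarrow>cop L x. x1 \<otimes> (x2 \<otimes> y)) -
    tlift (\<lambda>x y. tlift (\<lambda>x1 x2. P x1 \<otimes> (P x2 \<otimes> P y)) (dd x)) (dd a) \<in> bbalancing3 L"
proof -
  note W = subspace_bbalancing3
  have b: "cbilinear (\<lambda>x1 x2. P x1 \<otimes> (P x2 \<otimes> v))" for v :: 'l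
    by (rule cbilinear_compose[OF cbilinear_pure P_linear]) simp
  \<comment> \<open>The inner coproduct is replaced by the explicit one, read through
    \<open>R\<close>; this gives a function on carrier elements to which the rule for the outer sum
    applies.\<close>
  let ?G = "\<lambda>x y. tlift (\<lambda>x1 x2. P x1 \<otimes> (P x2 \<otimes> y)) (dd (R x))"
  have 1: "(\<Sum>(x, y)\<leftarrow>cop L (P a). \<Sum>(x1, x2)\<leftarrow>cop L x. x1 \<otimes> (x2 \<otimes> y)) - (\<Sum>(x, y)\<leftarrow>cop L (P a). ?G x y) \<in> bbalancing3 L"
  proof (rule sum_list_diff_subspace[OF W])
    fix p assume p: "p \<in> set (cop L (P a))"
    obtain xs where xs: "cop L (P a) = map (\<lambda>(x, y). (P x, P y)) xs" by (rule cop_coordinates)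
    then obtain u v where u: "p = (P u, P v)" using p by auto
    have "(\<Sum>(x1, x2)\<leftarrow>cop L (P u). x1 \<otimes> (x2 \<otimes> P v)) - ?G (P u) (P v) \<in> bbalancing3 L"
      unfolding RP by (rule cop_sum_mod[OF b W]) (rule bbalancing3_base)
    then show "(case p of (x, y) \<Rightarrow> \<Sum>(x1, x2)\<leftarrow>cop L x. x1 \<otimes> (x2 \<otimes> y)) - (case p of (x, y) \<Rightarrow> ?G x y) \<in> bbalancing3 L"
      by (simp add: u)
  qed
  have l: "clinear (\<lambda>y. P x1 \<otimes> (P x2 \<otimes> P y))" for x1 x2 by simp
  have c1: "cbilinear (\<lambda>x1 x2. P x1 \<otimes> (P (tmul c x2) \<otimes> v))" for c and v :: 'l
    by (rule cbilinear_compose[OF cbilinear_pure P_linear]) (simp add: clinear_compose[OF P_linear clinear_tmul])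
  have 2: "(\<Sum>(x, y)\<leftarrow>cop L (P a). ?G x y) - tlift (\<lambda>x y. ?G (P x) (P y)) (dd a) \<in> bbalancing3 L"
  proof (rule cop_sum_mod[OF _ W])
    show "cbilinear (\<lambda>x y. ?G (P x) (P y))"
    proof (rule cbilinearI)
      show "clinear (\<lambda>x. ?G (P x) (P y))" for y
        unfolding RP by (rule clinear_compose[OF clinear_tlift[OF b] clinear_dd])
      show "clinear (\<lambda>y. ?G (P x) (P y))" for x
        by (rule clinear_tlift_param) (rule l)
    qed
    show "?G (P (tmul c x)) (P y) - ?G (P x) (P (smul c y)) \<in> bbalancing3 L" for c x y
    proof -
      have "?G (P (tmul c x)) (P y) - ?G (P x) (P (smul c y)) =
          tlift (\<lambda>x1 x2. P x1 \<otimes> (P (tmul c x2) \<otimes> P y) - P x1 \<otimes> (P x2 \<otimes> P (smul c y))) (dd x)"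
      proof -
        have d: "cbilinear (\<lambda>x1 x2. P x1 \<otimes> (P (tmul c x2) \<otimes> P y) - P x1 \<otimes> (P x2 \<otimes> P (smul c y)))"
          by (rule cbilinearI; rule clinear_minus; rule cbilinear_left[OF c1] cbilinear_left[OF b] cbilinear_right[OF c1] cbilinear_right[OF b])
        have e: "?G (P (tmul c x)) (P y) = tlift (\<lambda>x1 x2. P x1 \<otimes> (P (tmul c x2) \<otimes> P y)) (dd x)"
          unfolding RP dd_tmul tlift_post[OF clinear_tlift[OF b] bil_pure_right[OF clinear_tmul]] tlift_pure[OF b] ..
        show ?thesis unfolding e unfolding RP
        proof (rule tensor_ext[where t = "dd x"])
          show "clinear (\<lambda>t. tlift (\<lambda>x1 x2. P x1 \<otimes> (P (tmul c x2) \<otimes> P y)) t - tlift (\<lambda>x1 x2. P x1 \<otimes> (P x2 \<otimes> P (smul c y))) t)"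
            by (rule clinear_minus[OF clinear_tlift[OF c1] clinear_tlift[OF b]])
          show "clinear (tlift (\<lambda>x1 x2. P x1 \<otimes> (P (tmul c x2) \<otimes> P y) - P x1 \<otimes> (P x2 \<otimes> P (smul c y))))"
            by (rule clinear_tlift[OF d])
        qed (simp add: tlift_pure[OF c1] tlift_pure[OF b] tlift_pure[OF d])
      qed
      also have "\<dots> \<in> bbalancing3 L"
        by (rule tlift_in_subspace[OF W], rule cbilinearI; (rule clinear_minus; rule cbilinear_left[OF c1] cbilinear_left[OF b] cbilinear_right[OF c1] cbilinear_right[OF b])?)
          (rule bbalancing3_base)
      finally show ?thesis .
    qed
  qed
  show ?thesis using subspace_trans[OF W 1 2] by simp
qed

text \<open>The mirror image of \<open>coassoc_left\<close>: here the scalar is carried into the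
  inner coproduct by the source, on its left factor.\<close>

lemma coassoc_right:
  "(\<Sum>(x, y)\<leftarrow>cop L (P a). \<Sum>(y1, y2)\<leftarrow>cop L y. x \<otimes> (y1 \<otimes> y2)) -
    tlift (\<lambda>x y. tlift (\<lambda>y1 y2. P x \<otimes> (P y1 \<otimes> P y2)) (dd y)) (dd a) \<in> bbalancing3 L"
proof -
  note W = subspace_bbalancing3
  have b: "cbilinear (\<lambda>y1 y2. v \<otimes> (P y1 \<otimes> P y2))" for v :: 'l
    by (rule cbilinear_post[OF _ PP_bil]) simp
  let ?G = "\<lambda>x y. tlift (\<lambda>y1 y2. x \<otimes> (P y1 \<otimes> P y2)) (dd (R y))"
  have 1: "(\<Sum>(x, y)\<leftarrow>cop L (P a). \<Sum>(y1, y2)\<leftarrow>cop L y. x \<otimes> (y1 \<otimes> y2)) - (\<Sum>(x, y)\<leftarrow>cop L (P a). ?G x y) \<in> bbalancing3 L"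
  proof (rule sum_list_diff_subspace[OF W])
    fix p assume p: "p \<in> set (cop L (P a))"
    obtain xs where xs: "cop L (P a) = map (\<lambda>(x, y). (P x, P y)) xs" by (rule cop_coordinates)
    then obtain u v where u: "p = (P u, P v)" using p by auto
    have "(\<Sum>(y1, y2)\<leftarrow>cop L (P v). P u \<otimes> (y1 \<otimes> y2)) - ?G (P u) (P v) \<in> bbalancing3 L"
      unfolding RP by (rule cop_sum_mod[OF b W]) (rule bbalancing3_base)
    then show "(case p of (x, y) \<Rightarrow> \<Sum>(y1, y2)\<leftarrow>cop L y. x \<otimes> (y1 \<otimes> y2)) - (case p of (x, y) \<Rightarrow> ?G x y) \<in> bbalancing3 L"
      by (simp add: u)
  qed
  have c1: "cbilinear (\<lambda>y1 y2. v \<otimes> (P (smul c y1) \<otimes> P y2))" for c and v :: 'l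
    by (rule cbilinear_post[OF _ cbilinear_compose[OF cbilinear_pure clinear_compose[OF P_linear clinear_smul] P_linear]]) simp
  have 2: "(\<Sum>(x, y)\<leftarrow>cop L (P a). ?G x y) - tlift (\<lambda>x y. ?G (P x) (P y)) (dd a) \<in> bbalancing3 L"
  proof (rule cop_sum_mod[OF _ W])
    show "cbilinear (\<lambda>x y. ?G (P x) (P y))"
    proof (rule cbilinearI)
      show "clinear (\<lambda>y. ?G (P x) (P y))" for x
        unfolding RP by (rule clinear_compose[OF clinear_tlift[OF b] clinear_dd])
      show "clinear (\<lambda>x. ?G (P x) (P y))" for y
        by (rule clinear_tlift_param) simp
    qed
    show "?G (P (tmul c x)) (P y) - ?G (P x) (P (smul c y)) \<in> bbalancing3 L" for c x y
    proof -
      have d: "cbilinear (\<lambda>y1 y2. P (tmul c x) \<otimes> (P y1 \<otimes> P y2) - P x \<otimes> (P (smul c y1) \<otimes> P y2))"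
        by (rule cbilinearI; rule clinear_minus; rule cbilinear_left[OF c1] cbilinear_left[OF b] cbilinear_right[OF c1] cbilinear_right[OF b])
      have e: "?G (P x) (P (smul c y)) = tlift (\<lambda>y1 y2. P x \<otimes> (P (smul c y1) \<otimes> P y2)) (dd y)"
        unfolding RP dd_smul tlift_post[OF clinear_tlift[OF b] bil_pure_left[OF clinear_smul]] tlift_pure[OF b] ..
      have "?G (P (tmul c x)) (P y) - ?G (P x) (P (smul c y)) =
          tlift (\<lambda>y1 y2. P (tmul c x) \<otimes> (P y1 \<otimes> P y2) - P x \<otimes> (P (smul c y1) \<otimes> P y2)) (dd y)"
        unfolding e unfolding RP
      proof (rule tensor_ext[where t = "dd y"])
        show "clinear (\<lambda>t. tlift (\<lambda>y1 y2. P (tmul c x) \<otimes> (P y1 \<otimes> P y2)) t - tlift (\<lambda>y1 y2. P x \<otimes> (P (smul c y1) \<otimes> P y2)) t)"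
          by (rule clinear_minus[OF clinear_tlift[OF b] clinear_tlift[OF c1]])
        show "clinear (tlift (\<lambda>y1 y2. P (tmul c x) \<otimes> (P y1 \<otimes> P y2) - P x \<otimes> (P (smul c y1) \<otimes> P y2)))"
          by (rule clinear_tlift[OF d])
      qed (simp add: tlift_pure[OF c1] tlift_pure[OF b] tlift_pure[OF d])
      also have "\<dots> \<in> bbalancing3 L"
        by (rule tlift_in_subspace[OF W d]) (rule bbalancing3_base)
      finally show ?thesis .
    qed
  qed
  show ?thesis using subspace_trans[OF W 1 2] by simp
qed

lemma PPP_coassoc:
  "tlift (\<lambda>x y. tlift (\<lambda>x1 x2. P x1 \<otimes> (P x2 \<otimes> P y)) (dd x)) (dd a) =
   tlift (\<lambda>x y. tlift (\<lambda>y1 y2. P x \<otimes> (P y1 \<otimes> P y2)) (dd y)) (dd a)"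
proof -
  define P3 where "P3 = tlift (\<lambda>(x :: (('b, 'b) tensor, 'h) tensor) t. P x \<otimes> PP t)"
  have b: "cbilinear (\<lambda>(x :: (('b, 'b) tensor, 'h) tensor) t. P x \<otimes> PP t)" by (rule cbilinear_compose[OF cbilinear_pure]) simp_all
  have l: "clinear P3" unfolding P3_def by (rule clinear_tlift[OF b])
  have p: "P3 (x \<otimes> (y \<otimes> z)) = P x \<otimes> (P y \<otimes> P z)" for x y z
    by (simp add: P3_def tlift_pure[OF b] PP_pure)
  have i1: "cbilinear (\<lambda>(x1 :: (('b, 'b) tensor, 'h) tensor) (x2 :: (('b, 'b) tensor, 'h) tensor). x1 \<otimes> (x2 \<otimes> y))" for y :: "(('b, 'b) tensor, 'h) tensor"
    by (rule cbilinearI) simp_all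
  have i2: "cbilinear (\<lambda>(y1 :: (('b, 'b) tensor, 'h) tensor) (y2 :: (('b, 'b) tensor, 'h) tensor). x \<otimes> (y1 \<otimes> y2))" for x :: "(('b, 'b) tensor, 'h) tensor"
    by (rule cbilinearI) simp_all
  have o1: "cbilinear (\<lambda>(x :: (('b, 'b) tensor, 'h) tensor) (y :: (('b, 'b) tensor, 'h) tensor). tlift (\<lambda>x1 x2. x1 \<otimes> (x2 \<otimes> y)) (dd x))"
    by (rule cbilinearI) (rule clinear_compose[OF clinear_tlift[OF i1] clinear_dd], rule clinear_tlift_param, simp)
  have o2: "cbilinear (\<lambda>(x :: (('b, 'b) tensor, 'h) tensor) (y :: (('b, 'b) tensor, 'h) tensor). tlift (\<lambda>y1 y2. x \<otimes> (y1 \<otimes> y2)) (dd y))"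
    by (rule cbilinearI) (rule clinear_tlift_param, simp, rule clinear_compose[OF clinear_tlift[OF i2] clinear_dd])
  have "P3 (tlift (\<lambda>x y. tlift (\<lambda>x1 x2. x1 \<otimes> (x2 \<otimes> y)) (dd x)) (dd a)) =
      P3 (tlift (\<lambda>x y. tlift (\<lambda>y1 y2. x \<otimes> (y1 \<otimes> y2)) (dd y)) (dd a))"
    by (simp only: dd_coassoc)
  then show ?thesis
    unfolding tlift_post[OF l o1] tlift_post[OF l o2] tlift_post[OF l i1] tlift_post[OF l i2] p .
qed

lemma clinear_P_tri: "clinear (\<lambda>b. P (tri b c h))" "clinear (\<lambda>b. P (tri c b h))"
  by (rule clinear_compose[OF P_linear]; simp)+

lemma eta: "eta L b b' = P (tri b b' 1)"
  by (simp add: eta_def src tgt mul mm_src_left)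

lemma eta_mul: "bmul L (eta L b b') (P x) = P (smul b (tmul b' x))"
proof -
  have "mm (tri b b' 1) x = smul b (tmul b' x)"
    using mm_assoc[of "tri b 1 1" "tri 1 b' 1" x] by (simp add: mm_src_left mm_tgt_left)
  then show ?thesis by (simp add: eta mul)
qed

lemma P_mm_bil: "cbilinear (\<lambda>x y. P (mm x y))"
  by (rule cbilinear_post[OF P_linear cbilinear_mm])

lemma comul_bclass: "comul L (P t) = bclass L (PP (dd t))"
  by (simp add: comul bclass_def)

text \<open>Every axiom about \<open>cop\<close> is reduced to explicit coordinates by the summation
  rules and then follows from the matching identity for \<open>mm\<close>, \<open>dd\<close> and
  \<open>ee\<close>.\<close>

theorem left_bialgebroid: "left_bialgebroid L"
proof (rule left_bialgebroid.intro)
  note W = subspace_bbalancing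
  note mml = cbilinear_left[OF cbilinear_mm] cbilinear_right[OF cbilinear_mm]
  show "algebra_on (bcar L) (bmul L) (bone L)"
    unfolding algebra_on_def carrier
    by (auto simp: subspace_carrier one mul mm_assoc intro!: linear_on_P'
        cbilinear_left[OF P_mm_bil] cbilinear_right[OF P_mm_bil])
  show "src L b \<in> bcar L" "tgt L b \<in> bcar L" for b
    by (simp_all add: src tgt carrier)
  have "src L = (\<lambda>b. P (tri b 1 1))" "tgt L = (\<lambda>b. P (tri 1 b 1))"
    by (simp_all add: src tgt fun_eq_iff)
  then show "clinear (src L)" "clinear (tgt L)" by (simp_all add: clinear_P_tri)
  show "src L 1 = bone L" "tgt L 1 = bone L" by (simp_all add: src tgt one)
  show "src L (b * b') = bmul L (src L b) (src L b')" "tgt L (b * b') = bmul L (tgt L b') (tgt L b)" for b b'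
    by (simp_all add: src_mul tgt_mul src[of b'] src[of "b * b'"] tgt[of b] tgt[of "b * b'"])
  show "bmul L (src L b) (tgt L b') = bmul L (tgt L b') (src L b)" for b b'
    by (simp add: src_mul[of b "tri 1 b' 1", folded tgt] tgt_mul[of b' "tri b 1 1", folded src])
  show "linear_on (bcar L) (bialgebroid.counit L)"
    unfolding carrier by (rule linear_on_P') (simp add: counit)
  show "bialgebroid.counit L (bone L) = 1"
    by (simp add: one counit counit_one scaleC_one)
  show "bialgebroid.comul L (bone L) = bclass L (bone L \<otimes> bone L)"
    by (simp add: one comul_bclass dd_one PP_pure)

  fix a assume "a \<in> bcar L"
  then obtain t where a: "a = P t" by (auto simp: carrier)
  show "bialgebroid.comul L a \<in> btensor L"
    unfolding a comul btensor_def balanced_tensor_def bbalancing_def[symmetric]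
    using PP_tensor_span by blast
  show "bialgebroid.comul L (c *\<^sub>C a) = bclass L (c *\<^sub>C (\<Sum>(x, y)\<leftarrow>cop L a. x \<otimes> y))" for c
    unfolding a P_scale comul_bclass
  proof (rule bclass_eqI)
    show "PP (dd (c *\<^sub>C t)) - c *\<^sub>C (\<Sum>(x, y)\<leftarrow>cop L (P t). x \<otimes> y) \<in> bbalancing L"
      using cvec.subspace_neg[OF W cvec.subspace_scale[OF W cop_pure_mod, of c t]]
      by (simp add: clinear_scale[OF clinear_dd] clinear_scale[OF clinear_PP] cvec.scale_right_diff_distrib)
  qed
  show "bialgebroid.comul L (bmul L (eta L b b') a) =
      bclass L (\<Sum>(x, y)\<leftarrow>cop L a. bmul L (src L b) x \<otimes> bmul L (tgt L b') y)" for b b'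
    unfolding a eta_mul comul_bclass
  proof (rule bclass_eqI)
    let ?F = "\<lambda>x y. bmul L (src L b) x \<otimes> bmul L (tgt L b') y"
    have F: "cbilinear (\<lambda>x y. P (smul b x) \<otimes> P (tmul b' y))"
      by (rule cbilinear_compose[OF PP_bil]) simp_all
    have B: "cbilinear (\<lambda>x y. smul b x \<otimes> y)" "cbilinear (\<lambda>x y. x \<otimes> tmul b' y)"
      by (rule bil_pure_left[OF clinear_smul] bil_pure_right[OF clinear_tmul])+
    have "(\<Sum>(x, y)\<leftarrow>cop L (P t). ?F x y) - tlift (\<lambda>x y. ?F (P x) (P y)) (dd t) \<in> bbalancing L"
      by (rule cop_sum_mod[OF _ W]) (simp_all add: src_mul tgt_mul F smul_tmul[of b] smul_tmul[of _ b', symmetric] bbalancing_base)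
    moreover have "PP (dd (smul b (tmul b' t))) = tlift (\<lambda>x y. ?F (P x) (P y)) (dd t)"
    proof -
      have "dd (smul b (tmul b' t)) = tlift (\<lambda>x y. smul b x \<otimes> tmul b' y) (dd t)"
        unfolding dd_smul dd_tmul tlift_post[OF clinear_tlift[OF B(1)] B(2)]
        by (simp add: tlift_pure[OF B(1)])
      moreover have "cbilinear (\<lambda>x y. smul b x \<otimes> tmul b' y :: ((('b, 'b) tensor, 'h) tensor, (('b, 'b) tensor, 'h) tensor) tensor)"
        by (rule cbilinear_compose[OF cbilinear_pure]) simp_all
      ultimately show ?thesis by (simp add: PP_post PP_pure src_mul tgt_mul)
    qed
    ultimately show "PP (dd (smul b (tmul b' t))) - (\<Sum>(x, y)\<leftarrow>cop L (P t). ?F x y) \<in> bbalancing L"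
      using cvec.subspace_neg[OF W] by fastforce
  qed
  show "bialgebroid.counit L (bmul L (eta L b b') a) = b * bialgebroid.counit L a * b'" for b b'
    unfolding a eta_mul by (simp add: counit ee_smul ee_tmul mult.assoc)
  show "(\<Sum>(x, y)\<leftarrow>cop L a. \<Sum>(x1, x2)\<leftarrow>cop L x. x1 \<otimes> (x2 \<otimes> y)) -
      (\<Sum>(x, y)\<leftarrow>cop L a. \<Sum>(y1, y2)\<leftarrow>cop L y. x \<otimes> (y1 \<otimes> y2)) \<in> bbalancing3 L"
    unfolding a
    using cvec.subspace_diff[OF subspace_bbalancing3 coassoc_left coassoc_right, of t t] PPP_coassoc[of t]
    by simp
  show "(\<Sum>(x, y)\<leftarrow>cop L a. bmul L (src L (bialgebroid.counit L x)) y) = a"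
  proof -
    have B: "cbilinear (\<lambda>x y. smul (ee x) y :: (('b, 'b) tensor, 'h) tensor)" by (rule cbilinear_compose[OF cbilinear_smul]) simp_all
    have "(\<Sum>(x, y)\<leftarrow>cop L a. bmul L (src L (bialgebroid.counit L x)) y) = tlift (\<lambda>x y. P (smul (ee x) y)) (dd t)"
      unfolding a
      by (subst cop_sum) (simp_all add: counit src_mul ee_tmul smul_smul cbilinear_post[OF P_linear B])
    also have "\<dots> = P t"
      unfolding tlift_post[OF P_linear B, symmetric] dd_counit_left ..
    finally show ?thesis unfolding a .
  qed
  show "(\<Sum>(x, y)\<leftarrow>cop L a. bmul L (tgt L (bialgebroid.counit L y)) x) = a"
  proof -
    have B: "cbilinear (\<lambda>x y. tmul (ee y) x :: (('b, 'b) tensor, 'h) tensor)"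
      by (rule cbilinear_flip[OF cbilinear_compose[OF cbilinear_tmul]]) simp_all
    have "(\<Sum>(x, y)\<leftarrow>cop L a. bmul L (tgt L (bialgebroid.counit L y)) x) = tlift (\<lambda>x y. P (tmul (ee y) x)) (dd t)"
      unfolding a
      by (subst cop_sum) (simp_all add: counit tgt_mul ee_smul tmul_tmul cbilinear_post[OF P_linear B])
    also have "\<dots> = P t"
      unfolding tlift_post[OF P_linear B, symmetric] dd_counit_right ..
    finally show ?thesis unfolding a .
  qed
  show "bclass L (\<Sum>(x, y)\<leftarrow>cop L a. bmul L x (tgt L b) \<otimes> y) = bclass L (\<Sum>(x, y)\<leftarrow>cop L a. x \<otimes> bmul L y (src L b))" for b
    unfolding a
  proof (rule bclass_eqI)
    have B1: "cbilinear (\<lambda>x y. P (mm x (tri 1 b 1)) \<otimes> P y)"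
      by (rule cbilinear_compose[OF PP_bil mml(1) clinear_id])
    have B2: "cbilinear (\<lambda>x y. P x \<otimes> P (mm y (tri b 1 1)))"
      by (rule cbilinear_compose[OF PP_bil clinear_id mml(1)])
    have 1: "(\<Sum>(x, y)\<leftarrow>cop L (P t). bmul L x (tgt L b) \<otimes> y) - tlift (\<lambda>x y. bmul L (P x) (tgt L b) \<otimes> P y) (dd t) \<in> bbalancing L"
      by (rule cop_sum_mod[OF _ W]) (simp_all add: tgt mul B1 mm_tmul bbalancing_base)
    have 2: "(\<Sum>(x, y)\<leftarrow>cop L (P t). x \<otimes> bmul L y (src L b)) - tlift (\<lambda>x y. P x \<otimes> bmul L (P y) (src L b)) (dd t) \<in> bbalancing L"
      by (rule cop_sum_mod[OF _ W]) (simp_all add: src mul B2 mm_smul bbalancing_base)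
    have 3: "tlift (\<lambda>x y. bmul L (P x) (tgt L b) \<otimes> P y) (dd t) - tlift (\<lambda>x y. P x \<otimes> bmul L (P y) (src L b)) (dd t) \<in> bbalancing L"
      unfolding src tgt mul by (rule takeuchi_balanced[OF PP_bil W bbalancing_base])
    show "(\<Sum>(x, y)\<leftarrow>cop L (P t). bmul L x (tgt L b) \<otimes> y) - (\<Sum>(x, y)\<leftarrow>cop L (P t). x \<otimes> bmul L y (src L b)) \<in> bbalancing L"
      using cvec.subspace_diff[OF W subspace_trans[OF W 1 3] 2] by simp
  qed
  show "bialgebroid.counit L (bmul L (src L b) a) = b * bialgebroid.counit L a" for b
    by (simp add: a src_mul counit ee_smul)

  fix a' assume "a' \<in> bcar L"
  then obtain t' where a': "a' = P t'" by (auto simp: carrier)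
  show "bialgebroid.comul L (a + a') = bclass L ((\<Sum>(x, y)\<leftarrow>cop L a. x \<otimes> y) + (\<Sum>(x, y)\<leftarrow>cop L a'. x \<otimes> y))"
    unfolding a a' P_add comul_bclass
  proof (rule bclass_eqI)
    show "PP (dd (t + t')) - ((\<Sum>(x, y)\<leftarrow>cop L (P t). x \<otimes> y) + (\<Sum>(x, y)\<leftarrow>cop L (P t'). x \<otimes> y)) \<in> bbalancing L"
      using cvec.subspace_neg[OF W cvec.subspace_add[OF W cop_pure_mod[of t] cop_pure_mod[of t']]]
      by (simp add: clinear_add[OF clinear_dd] clinear_add[OF clinear_PP] algebra_simps)
  qed
  show "bialgebroid.counit L (bmul L a (src L (bialgebroid.counit L a'))) = bialgebroid.counit L (bmul L a a')"
    "bialgebroid.counit L (bmul L a (tgt L (bialgebroid.counit L a'))) = bialgebroid.counit L (bmul L a a')"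
    by (simp_all add: a a' src tgt mul counit ee_mm_src ee_mm_tgt)
  show "bialgebroid.comul L (bmul L a a') =
      bclass L (\<Sum>(x, y)\<leftarrow>cop L a. \<Sum>(x', y')\<leftarrow>cop L a'. bmul L x x' \<otimes> bmul L y y')"
    unfolding a a' mul comul_bclass
  proof (rule bclass_eqI)
    have b1: "cbilinear (\<lambda>x y. P (mm x x') \<otimes> P (mm y y'))" for x' y'
      by (rule cbilinear_compose[OF PP_bil mml(1) mml(1)])
    have b2: "cbilinear (\<lambda>x' y'. P (mm x x') \<otimes> P (mm y y'))" for x y
      by (rule cbilinear_compose[OF PP_bil mml(2) mml(2)])
    have i: "mm x (tmul b x') = mm (mm x (tri 1 b 1)) x'" "mm x (smul b x') = mm (mm x (tri b 1 1)) x'" for x b x'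
      by (simp_all add: mm_assoc mm_src_left mm_tgt_left)
    have e1: "(\<Sum>(x, y)\<leftarrow>cop L (P t). \<Sum>(x', y')\<leftarrow>cop L (P t'). bmul L x x' \<otimes> bmul L y y') -
        tlift (\<lambda>x' y'. tlift (\<lambda>x y. bmul L (P x) (P x') \<otimes> bmul L (P y) (P y')) (dd t)) (dd t') \<in> bbalancing L"
      by (rule cop_sum2_mod[OF _ _ W]) (simp_all add: mul b1 b2 mm_tmul mm_smul i bbalancing_base)
    have e2: "PP (mmt (dd t) (dd t')) = tlift (\<lambda>x' y'. tlift (\<lambda>x y. bmul L (P x) (P x') \<otimes> bmul L (P y) (P y')) (dd t)) (dd t')"
      unfolding mmt_def PP_post[OF mmt_aux(2)] PP_post[OF mmt_aux(1)] PP_pure mul ..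
    have e3: "PP (mmt (dd t) (dd t')) - PP (dd (mm t t')) \<in> bbalancing L"
      using PP_mbal[OF dd_mult[of t t']] by (simp add: clinear_diff[OF clinear_PP])
    show "PP (dd (mm t t')) - (\<Sum>(x, y)\<leftarrow>cop L (P t). \<Sum>(x', y')\<leftarrow>cop L (P t'). bmul L x x' \<otimes> bmul L y y') \<in> bbalancing L"
      using cvec.subspace_neg[OF W subspace_trans[OF W e1[folded e2] e3]] unfolding minus_diff_eq .
  qed
qed

end

section \<open>The Ehresmann--Schauenburg bialgebroid of a crossed product\<close>

context central_crossed_product
begin

lemmas cmult_linear = cbilinear_left[OF cbilinear_crossed_mult] cbilinear_right[OF cbilinear_crossed_mult]

lemma clinear_cmult_left [simp]: "clinear f \<Longrightarrow> clinear (\<lambda>x. f x \<bullet> b)"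
  and clinear_cmult_right [simp]: "clinear f \<Longrightarrow> clinear (\<lambda>x. a \<bullet> f x)"
  by (rule clinear_compose[OF cmult_linear(1)] clinear_compose[OF cmult_linear(2)], assumption)+

definition coact :: "('b, 'h) tensor \<Rightarrow> (('b, 'h) tensor, 'h) tensor" where
  "coact = tlift (\<lambda>b. cv \<Delta> pure (\<lambda>x. b \<otimes> x) (\<lambda>x. x))"

lemma ext_coact [simp]: "ext_coact ext = coact"
  by (simp add: crossed_extension_def coact_def cv_def[abs_def] eta_contract_eq)

lemma coact_bil: "cbilinear (\<lambda>b. cv \<Delta> pure (\<lambda>x. (b::'b) \<otimes> x) (\<lambda>x. x))"
  by (rule cbilinearI) (simp add: cv_def clinear_sweedler2_param, simp)

lemma clinear_coact [simp]: "clinear coact"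
  unfolding coact_def by (rule clinear_tlift[OF coact_bil])

lemma coact_pure: "coact (b \<otimes> h) = cv \<Delta> pure (H.elt (H.cc b) (\<lambda>x. x)) (\<lambda>x. x) h"
  by (simp add: coact_def tlift_pure[OF coact_bil] H.cv_cc_left)

lemma coact_point: "(\<lambda>h. coact (H.elt (H.cc b) (\<lambda>x. x) h)) = cv \<Delta> pure (H.elt (H.cc b) (\<lambda>x. x)) (\<lambda>x. x)"
  by (rule ext) (simp only: coact_pure[symmetric], simp add: H.cv_cc_left)

lemma tlift_coact:
  assumes "cbilinear F"
  shows "tlift F (coact (b \<otimes> h)) = cv \<Delta> F (H.elt (H.cc b) (\<lambda>x. x)) (\<lambda>x. x) h"
  unfolding coact_pure by (subst H.cv_post[OF clinear_tlift[OF assms]]) (simp_all add: tlift_pure[OF assms])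

section \<open>The canonical map and its inverse\<close>

definition chi2 :: "('b, 'h) tensor \<Rightarrow> (('b, 'h) tensor, 'h) tensor \<Rightarrow> (('b, 'h) tensor, 'h) tensor" where
  "chi2 a = tlift (\<lambda>a0 a1. (a \<bullet> a0) \<otimes> a1)"

lemma chi2_aux: "cbilinear (\<lambda>a0 (a1::'h). (a \<bullet> a0) \<otimes> a1)"
  by (rule cbilinearI) simp_all

lemma cbilinear_chi2 [simp]: "cbilinear chi2"
  unfolding chi2_def by (rule cbilinear_tlift[OF chi2_aux]) simp

lemma chi2_pure [simp]: "chi2 a (a0 \<otimes> a1) = (a \<bullet> a0) \<otimes> a1"
  by (simp add: chi2_def tlift_pure[OF chi2_aux])

definition chi :: "(('b, 'h) tensor, ('b, 'h) tensor) tensor \<Rightarrow> (('b, 'h) tensor, 'h) tensor" where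
  "chi = tlift (\<lambda>a a'. chi2 a (coact a'))"

lemma chi_aux: "cbilinear (\<lambda>a a'. chi2 a (coact a'))"
  by (rule cbilinear_compose) simp_all

lemma clinear_chi [simp]: "clinear chi"
  unfolding chi_def by (rule clinear_tlift[OF chi_aux])

lemma chi_pure: "chi (a \<otimes> a') = chi2 a (coact a')"
  by (simp add: chi_def tlift_pure[OF chi_aux])

text \<open>The inverse of the canonical map for a cleft extension, before passing to the quotient:
  split \<open>h\<close>, multiply \<open>v\<close> by the inverse of \<gamma> on one leg, and put
  \<gamma> of the other leg on the right.\<close>

definition kap :: "(('b, 'h) tensor, 'h) tensor \<Rightarrow> (('b, 'h) tensor, ('b, 'h) tensor) tensor" where
  "kap = tlift (\<lambda>v. cv \<Delta> pure (\<lambda>x. v \<bullet> cleave_inv x) cleave)"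

lemma clinear_cleave [simp]: "clinear cleave"
  by (rule cbilinear_right[OF cbilinear_pure])

lemma kap_aux: "cbilinear (\<lambda>v. cv \<Delta> pure (\<lambda>x. v \<bullet> cleave_inv x) cleave)"
  by (rule cbilinearI) (simp add: cv_def clinear_sweedler2_param, simp)

lemma clinear_kap [simp]: "clinear kap"
  unfolding kap_def by (rule clinear_tlift[OF kap_aux])

lemma kap_pure: "kap (v \<otimes> h) = cv \<Delta> pure (cv \<Delta> (crossed_mult \<Delta> act \<sigma>) (H.cc v) cleave_inv) cleave h"
  by (simp add: kap_def tlift_pure[OF kap_aux] H.cv_cc_left)

lemma gamma_inv_H: "cv \<Delta> (crossed_mult \<Delta> act \<sigma>) cleave_inv cleave = H.cc (emb 1)"
  "cv \<Delta> (crossed_mult \<Delta> act \<sigma>) cleave cleave_inv = H.cc (emb 1)"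
  using H.gamma_inv[OF pt_id] by simp_all

text \<open>The element \<gamma> of one leg of \<open>h\<close> meets its inverse on the next leg
  and cancels; only the B-component \<open>b\<close> is transferred to the left factor.\<close>

lemma kap_chi2:
  "kap (chi2 u (coact (b \<otimes> h))) = (u \<bullet> emb b) \<otimes> cleave h"
proof -
  let ?M = "crossed_mult \<Delta> act \<sigma>"
  define kb where "kb = (\<lambda>v h. kap (v \<otimes> h))"
  have kb: "cbilinear kb" unfolding kb_def
    by (rule cbilinear_post[OF clinear_kap cbilinear_pure])
  have "(\<lambda>h. kap (chi2 u (coact (b \<otimes> h)))) = cv \<Delta> kb (\<lambda>h. u \<bullet> H.elt (H.cc b) (\<lambda>x. x) h) (\<lambda>x. x)"
  proof
    fix h
    have l: "clinear (\<lambda>t. kap (chi2 u t))"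
      by (rule clinear_compose[OF clinear_kap cbilinear_right[OF cbilinear_chi2]])
    show "kap (chi2 u (coact (b \<otimes> h))) = cv \<Delta> kb (\<lambda>h. u \<bullet> H.elt (H.cc b) (\<lambda>x. x) h) (\<lambda>x. x) h"
      unfolding coact_pure
      by (subst H.cv_post[OF l]) (simp_all, simp add: cv_def kb_def)
  qed
  also have "(\<lambda>h. u \<bullet> H.elt (H.cc b) (\<lambda>x. x) h) = cv \<Delta> ?M (H.cc (u \<bullet> emb b)) cleave"
    by (simp add: H.cv_cc_left cmult_assoc emb_cleave)
  also have "cv \<Delta> kb (cv \<Delta> ?M (H.cc (u \<bullet> emb b)) cleave) (\<lambda>x. x) =
      cv \<Delta> pure (H.cc (u \<bullet> emb b)) cleave"
  proof -
    \<comment> \<open>\<open>kap\<close> is known for constant \<open>v\<close>; substitution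
      extends the formula to a function \<open>w\<close>.\<close>
    have k: "cv \<Delta> kb w (\<lambda>x. x) = cv \<Delta> pure (cv \<Delta> ?M w cleave_inv) cleave" if [simp]: "clinear w" for w
    proof -
      have "cv \<Delta> kb (H.cc v) (\<lambda>x. x) = cv \<Delta> pure (cv \<Delta> ?M (H.cc v) cleave_inv) cleave" for v
        by (simp add: H.cv_cc_left[OF kb]) (simp add: kb_def kap_pure fun_eq_iff)
      then have "H.sub (\<lambda>v. cv \<Delta> kb (H.cc v) (\<lambda>x. x)) w = H.sub (\<lambda>v. cv \<Delta> pure (cv \<Delta> ?M (H.cc v) cleave_inv) cleave) w"
        by simp
      then show ?thesis by (simp add: H.sub_left H.sub_right H.sub_cc kb)
    qed
    have "cv \<Delta> ?M (cv \<Delta> ?M (H.cc (u \<bullet> emb b)) cleave) cleave_inv = H.cc (u \<bullet> emb b)"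
      by (simp add: H.cmult_cv_assoc gamma_inv_H)
    then show ?thesis by (subst k) simp_all
  qed
  finally show ?thesis by (simp add: H.cv_cc_left fun_eq_iff)
qed

abbreviation "NB \<equiv> ext_balancing ext"

lemma NB_def: "NB = cvec.span {(a \<bullet> emb b) \<otimes> a' - a \<otimes> (emb b \<bullet> a') | a b a'. True}"
  by (simp add: ext_balancing_def balancing_def)

lemma subspace_NB [simp]: "cvec.subspace NB"
  unfolding NB_def by (rule cvec.subspace_span)

lemma NB_base: "(a \<bullet> emb b) \<otimes> a' - a \<otimes> (emb b \<bullet> a') \<in> NB"
  unfolding NB_def by (rule cvec.span_base) blast

lemma span_induct_linear:
  assumes "x \<in> cvec.span G" "clinear f" "cvec.subspace W" "\<And>g. g \<in> G \<Longrightarrow> f g \<in> W"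
  shows "f x \<in> W"
  using assms(1)
proof (induction rule: cvec.span_induct_alt)
  case base
  show ?case by (simp add: clinear_zero[OF assms(2)] cvec.subspace_0[OF assms(3)])
next
  case (step c g z)
  then show ?case
    by (simp add: clinear_add[OF assms(2)] clinear_scale[OF assms(2)] cvec.subspace_add[OF assms(3)] cvec.subspace_scale[OF assms(3)] assms(4))
qed

lemma tlift_NB:
  assumes "n \<in> NB" "cbilinear F" "cvec.subspace W" "\<And>a b a'. F (a \<bullet> emb b) a' - F a (emb b \<bullet> a') \<in> W"
  shows "tlift F n \<in> W"
  using assms(1) unfolding NB_def
  by (rule span_induct_linear[OF _ clinear_tlift[OF assms(2)] assms(3)])
    (auto simp: clinear_diff[OF clinear_tlift[OF assms(2)]] tlift_pure[OF assms(2)] assms(4))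

lemma chi2_emb: "chi2 (a \<bullet> emb b) (coact a') = chi2 a (coact (emb b \<bullet> a'))"
proof (rule tensor_ext[where t = a'])
  have l: "clinear (chi2 a)" for a by (rule cbilinear_right[OF cbilinear_chi2])
  show "clinear (\<lambda>a'. chi2 (a \<bullet> emb b) (coact a'))" by (rule clinear_compose[OF l clinear_coact])
  show "clinear (\<lambda>a'. chi2 a (coact (emb b \<bullet> a')))" by (rule clinear_compose[OF l clinear_compose[OF clinear_coact cmult_linear(2)]])
  fix c h
  show "chi2 (a \<bullet> emb b) (coact (c \<otimes> h)) = chi2 a (coact (emb b \<bullet> (c \<otimes> h)))"
    unfolding emb_cmult_pure chi2_def tlift_coact[OF chi2_aux]
    by (rule fun_cong[OF cv_cong]) (simp add: H.cv_cc_left cmult_assoc emb_cmult_pure)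
qed

lemma chi_NB: "n \<in> NB \<Longrightarrow> chi n = 0"
  using tlift_NB[OF _ chi_aux cvec.subspace_single_0, of n] by (simp add: chi_def chi2_emb)

lemma kap_chi_mod: "x - kap (chi x) \<in> NB"
proof (induction x rule: tensor_induct)
  case (pure u v)
  show ?case unfolding chi_pure
  proof (induction v rule: tensor_induct)
    case (pure b h)
    show ?case
      using cvec.subspace_neg[OF subspace_NB NB_base[of u b "cleave h"]] by (simp add: kap_chi2 emb_cleave)
  next
    case (add v v')
    have eq: "u \<otimes> (v + v') - kap (chi2 u (coact (v + v'))) = (u \<otimes> v - kap (chi2 u (coact v))) + (u \<otimes> v' - kap (chi2 u (coact v')))"
      by (simp add: clinear_add[OF cbilinear_right[OF cbilinear_pure]] clinear_add[OF clinear_coact]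
          clinear_add[OF cbilinear_right[OF cbilinear_chi2]] clinear_add[OF clinear_kap])
    show ?case unfolding eq by (rule cvec.subspace_add[OF subspace_NB add])
  qed
next
  case (add x y)
  have eq: "x + y - kap (chi (x + y)) = (x - kap (chi x)) + (y - kap (chi y))"
    by (simp add: clinear_add[OF clinear_chi] clinear_add[OF clinear_kap])
  show ?case unfolding eq by (rule cvec.subspace_add[OF subspace_NB add])
qed

text \<open>Since \<open>kap\<close> inverts \<open>chi\<close> modulo balancing, the kernel of
  \<open>chi\<close> is exactly the balancing subspace; hence the canonical map is injective on the
  quotient.\<close>

lemma chi_eq_0_iff: "chi x = 0 \<longleftrightarrow> x \<in> NB"
  using kap_chi_mod[of x] chi_NB[of x] by (auto simp: clinear_zero[OF clinear_kap])

text \<open>An explicit linear representative of the translation map, the image of 1 \<otimes> h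
  under \<open>kap\<close>.\<close>

definition Tr :: "'h \<Rightarrow> (('b, 'h) tensor, ('b, 'h) tensor) tensor" where
  "Tr = cv \<Delta> pure cleave_inv cleave"

lemma clinear_Tr [simp]: "clinear Tr"
  by (simp add: Tr_def)

lemma cleave_elt: "cleave = H.elt (H.cc 1) (\<lambda>x. x)"
  by (simp add: H.cv_cc_left)

lemma chi_Tr: "chi (Tr h) = emb 1 \<otimes> h"
proof -
  have "chi (Tr h) = cv \<Delta> chi2 cleave_inv (\<lambda>h. coact (cleave h)) h"
    unfolding Tr_def by (subst H.cv_post[OF clinear_chi], simp_all) (simp add: cv_def chi_pure)
  also have "(\<lambda>h. coact (cleave h)) = cv \<Delta> pure cleave (\<lambda>x. x)"
    unfolding cleave_elt by (rule coact_point)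
  also have "cv \<Delta> chi2 cleave_inv (cv \<Delta> pure cleave (\<lambda>x. x)) = cv \<Delta> pure (cv \<Delta> (crossed_mult \<Delta> act \<sigma>) cleave_inv cleave) (\<lambda>x. x)"
    by (rule H.cv_assoc[symmetric]) simp_all
  also have "\<dots> h = emb 1 \<otimes> h"
    by (simp add: gamma_inv_H H.cv_cc_left)
  finally show ?thesis .
qed

lemma tensor_span_UNIV: "tensor_span UNIV UNIV = UNIV"
proof -
  have "x \<in> tensor_span UNIV UNIV" for x :: "('u::cvector, 'v::cvector) tensor"
    unfolding tensor_span_def
    by (induction x rule: tensor_induct) (auto intro: cvec.span_base cvec.span_add)
  then show ?thesis by blast
qed

lemma ext_tensor_eq: "ext_tensor ext = range (coset NB)"
  by (simp add: ext_tensor_def balanced_tensor_def ext_balancing_def tensor_span_UNIV)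

lemma canonical_map_coset: "canonical_map ext (coset NB x) = chi x"
proof -
  have "x \<in> coset NB x" using mem_coset_iff[OF subspace_NB, of x x] cvec.subspace_0[OF subspace_NB] by simp
  then have "(SOME y. y \<in> coset NB x) \<in> coset NB x" by (rule someI)
  then have "chi ((SOME y. y \<in> coset NB x) - x) = 0"
    by (simp add: mem_coset_iff chi_eq_0_iff)
  then show ?thesis
    by (simp add: canonical_map_def chi_def[symmetric] chi2_def[symmetric] clinear_diff)
qed

lemma translation_map_eq: "translation_map ext h = coset NB (Tr h)"
  unfolding translation_map_def
proof (rule inv_into_f_eq)
  show "inj_on (canonical_map ext) (ext_tensor ext)"
    unfolding ext_tensor_eq
    by (auto simp: inj_on_def canonical_map_coset coset_eq_iff chi_eq_0_iff[symmetric] clinear_diff)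
qed (simp_all add: ext_tensor_eq canonical_map_coset chi_Tr)

abbreviation "trep \<equiv> translation_rep ext"

text \<open>\<open>Tr\<close> shows that a linear choice of representatives exists; any two choices
  differ by elements of the balancing subspace.\<close>

lemma trep: "clinear trep" "trep h - Tr h \<in> NB"
proof -
  have "clinear Tr \<and> (\<forall>h. Tr h \<in> translation_map ext h)"
    using cvec.subspace_0[OF subspace_NB] by (simp add: translation_map_eq mem_coset_iff)
  then have "\<exists>f. clinear f \<and> (\<forall>h. f h \<in> translation_map ext h)" by blast
  from someI_ex[OF this] have "clinear trep \<and> (\<forall>h. trep h \<in> translation_map ext h)"
    by (simp add: translation_rep_def)
  then show "clinear trep" "trep h - Tr h \<in> NB"
    by (simp_all add: translation_map_eq mem_coset_iff)
qed

section \<open>The carrier: coinvariant tensors are the image of \<open>psi\<close>\<close>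

abbreviation cmul_op where "cmul_op \<equiv> crossed_mult \<Delta> act \<sigma>"

abbreviation wleg where "wleg b \<equiv> cv \<Delta> cmul_op cleave_inv (H.elt (H.cc b) (H.cc 1))"

lemma psi_tri_eq: "psi (tri b b' h) = cv \<Delta> pure (H.elt (H.cc b) (\<lambda>x. x)) (wleg b') h"
  by (simp add: psi_tri psi0_def)

lemma cleave_wleg: "cv \<Delta> cmul_op cleave (wleg b) = H.cc (emb b)"
  by (simp add: H.cmult_cv_assoc[symmetric] gamma_inv_H) (simp add: H.cv_cc_cc)

lemma tlift_psi_tri:
  assumes "cbilinear F"
  shows "tlift F (psi (tri b b' h)) = cv \<Delta> F (H.elt (H.cc b) (\<lambda>x. x)) (wleg b') h"
  unfolding psi_tri_eq by (subst H.cv_post[OF clinear_tlift[OF assms]]) (simp_all add: tlift_pure[OF assms])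

definition rmul :: "(('b, 'h) tensor, ('b, 'h) tensor) tensor \<Rightarrow> ('b, 'h) tensor \<Rightarrow> (('b, 'h) tensor, ('b, 'h) tensor) tensor" where
  "rmul s a' = tlift (\<lambda>u v. u \<otimes> (v \<bullet> a')) s"

lemma rmul_aux: "cbilinear (\<lambda>(u::('b, 'h) tensor) v. u \<otimes> (v \<bullet> a'))"
  by (rule cbilinearI) simp_all

lemma cbilinear_rmul [simp]: "cbilinear rmul"
  unfolding rmul_def[abs_def]
  by (rule cbilinearI) (rule clinear_tlift[OF rmul_aux], rule clinear_tlift_param, simp)

lemma rmul_pure [simp]: "rmul (u \<otimes> v) a' = u \<otimes> (v \<bullet> a')"
  by (simp add: rmul_def tlift_pure[OF rmul_aux])

lemma rmul_NB: "n \<in> NB \<Longrightarrow> rmul n a' \<in> NB"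
  unfolding rmul_def by (rule tlift_NB[OF _ rmul_aux subspace_NB]) (simp_all add: cmult_assoc NB_base)

text \<open>One side of the coinvariance condition, with the translation representative as a
  parameter, so that the chosen one can be replaced by \<open>Tr\<close>.\<close>

definition Lam where
  "Lam T a a' = tlift (\<lambda>a0 a1. (a0 :: ('b, 'h) tensor) \<otimes> rmul (T a1) a') (coact a)"

lemma Lam_aux:
  assumes [simp]: "clinear T"
  shows "cbilinear (\<lambda>a0 a1. (a0 :: ('b, 'h) tensor) \<otimes> rmul (T a1) a')" "cbilinear (Lam T)"
proof -
  have r [simp]: "clinear (\<lambda>a1. rmul (T a1) a')" "clinear (rmul s)" for a' s
    by (rule clinear_compose[OF cbilinear_left[OF cbilinear_rmul] assms] cbilinear_right[OF cbilinear_rmul])+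
  show 1: "cbilinear (\<lambda>a0 a1. (a0 :: ('b, 'h) tensor) \<otimes> rmul (T a1) a')" for a'
    by (rule cbilinear_compose[OF cbilinear_pure]) simp_all
  show "cbilinear (Lam T)"
    unfolding Lam_def[abs_def]
    by (rule cbilinearI) (rule clinear_compose[OF clinear_tlift[OF 1] clinear_coact], rule clinear_tlift_param, simp)
qed

abbreviation "WB \<equiv> cvec.span {(a :: ('b, 'h) tensor) \<otimes> n | a n. n \<in> NB}"

lemma WB_base: "n \<in> NB \<Longrightarrow> a \<otimes> n \<in> WB"
  by (rule cvec.span_base) blast

lemma Lam_trep: "Lam trep a a' - Lam Tr a a' \<in> WB"
proof -
  have d: "clinear (\<lambda>h. trep h - Tr h)" by (rule clinear_minus[OF trep(1) clinear_Tr])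
  note B = Lam_aux(1)[OF d, of a'] and B1 = Lam_aux(1)[OF trep(1), of a'] and B2 = Lam_aux(1)[OF clinear_Tr, of a']
  have "Lam trep a a' - Lam Tr a a' = tlift (\<lambda>a0 a1. a0 \<otimes> rmul (trep a1 - Tr a1) a') (coact a)"
    unfolding Lam_def
  proof (rule tensor_ext[where t = "coact a"])
    show "clinear (\<lambda>t. tlift (\<lambda>a0 a1. (a0 :: ('b, 'h) tensor) \<otimes> rmul (trep a1) a') t - tlift (\<lambda>a0 a1. a0 \<otimes> rmul (Tr a1) a') t)"
      by (rule clinear_minus[OF clinear_tlift[OF B1] clinear_tlift[OF B2]])
    show "clinear (tlift (\<lambda>a0 a1. (a0 :: ('b, 'h) tensor) \<otimes> rmul (trep a1 - Tr a1) a'))" by (rule clinear_tlift[OF B])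
  qed (simp only: tlift_pure[OF B] tlift_pure[OF B1] tlift_pure[OF B2],
      simp only: clinear_diff[OF cbilinear_left[OF cbilinear_rmul]] clinear_diff[OF cbilinear_right[OF cbilinear_pure]])
  also have "\<dots> \<in> WB"
    by (rule tlift_in_subspace[OF cvec.subspace_span B]) (rule WB_base[OF rmul_NB[OF trep(2)]])
  finally show ?thesis .
qed

lemma tlift_Lam_trep: "tlift (Lam trep) x - tlift (Lam Tr) x \<in> WB"
proof -
  note B1 = Lam_aux(2)[OF trep(1)] and B2 = Lam_aux(2)[OF clinear_Tr]
  have B: "cbilinear (\<lambda>a a'. Lam trep a a' - Lam Tr a a')"
    by (rule cbilinearI; rule clinear_minus; rule cbilinear_left[OF B1] cbilinear_left[OF B2] cbilinear_right[OF B1] cbilinear_right[OF B2])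
  have "tlift (Lam trep) x - tlift (Lam Tr) x = tlift (\<lambda>a a'. Lam trep a a' - Lam Tr a a') x"
    by (rule tensor_ext[where t = x, OF clinear_minus[OF clinear_tlift[OF B1] clinear_tlift[OF B2]] clinear_tlift[OF B]])
      (simp add: tlift_pure[OF B] tlift_pure[OF B1] tlift_pure[OF B2])
  also have "\<dots> \<in> WB" by (rule tlift_in_subspace[OF cvec.subspace_span B Lam_trep])
  finally show ?thesis .
qed

lemma es_carrier_iff: "x \<in> es_carrier ext \<longleftrightarrow> tlift (Lam Tr) x - tlift (\<lambda>a a'. a \<otimes> (a' \<otimes> emb 1)) x \<in> WB"
proof -
  have "x \<in> es_carrier ext \<longleftrightarrow> tlift (Lam trep) x - tlift (\<lambda>a a'. a \<otimes> (a' \<otimes> emb 1)) x \<in> WB"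
    by (simp add: es_carrier_def Lam_def[abs_def] rmul_def)
  also have "\<dots> \<longleftrightarrow> tlift (Lam Tr) x - tlift (\<lambda>a a'. a \<otimes> (a' \<otimes> emb 1)) x \<in> WB"
    using cvec.span_add[OF tlift_Lam_trep[of x]] cvec.span_diff[OF _ tlift_Lam_trep[of x]] by fastforce
  finally show ?thesis .
qed

text \<open>A contraction that kills the balancing relation, because \<open>pr\<close> is left
  B-linear. Applied to the translation leg it rebuilds the second leg of \<open>psi\<close> from the
  coordinates found by \<open>rho\<close>.\<close>

definition Kc :: "(('b, 'h) tensor, ('b, 'h) tensor) tensor \<Rightarrow> ('b, 'h) tensor" where
  "Kc = tlift (\<lambda>u v. u \<bullet> emb (pr v))"

lemma Kc_aux: "cbilinear (\<lambda>u v. u \<bullet> emb (pr v))"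
  by (rule cbilinear_compose[OF cbilinear_crossed_mult]) simp_all

lemma clinear_Kc [simp]: "clinear Kc"
  unfolding Kc_def by (rule clinear_tlift[OF Kc_aux])

lemma Kc_pure: "Kc (u \<otimes> v) = u \<bullet> emb (pr v)"
  by (simp add: Kc_def tlift_pure[OF Kc_aux])

lemma Kc_NB: "n \<in> NB \<Longrightarrow> Kc n = 0"
  using tlift_NB[OF _ Kc_aux cvec.subspace_single_0, of n]
  by (simp add: Kc_def pr_emb emb_mult[symmetric] cmult_assoc)

definition KK :: "(('b, 'h) tensor, (('b, 'h) tensor, ('b, 'h) tensor) tensor) tensor \<Rightarrow> (('b, 'h) tensor, ('b, 'h) tensor) tensor" where
  "KK = tlift (\<lambda>a s. a \<otimes> Kc s)"

lemma KK_aux: "cbilinear (\<lambda>(a :: ('b, 'h) tensor) s. a \<otimes> Kc s)"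
  by (rule cbilinear_compose[OF cbilinear_pure]) simp_all

lemma clinear_KK [simp]: "clinear KK"
  unfolding KK_def by (rule clinear_tlift[OF KK_aux])

lemma KK_pure [simp]: "KK (a \<otimes> s) = a \<otimes> Kc s"
  by (simp add: KK_def tlift_pure[OF KK_aux])

lemma KK_WB:
  assumes "w \<in> WB"
  shows "KK w = 0"
proof -
  have "KK w \<in> {0}"
    by (rule span_induct_linear[OF assms clinear_KK cvec.subspace_single_0])
      (auto simp: Kc_NB clinear_zero[OF cbilinear_right[OF cbilinear_pure]])
  then show ?thesis by simp
qed

lemma KK_Lam: "KK (tlift (Lam Tr) x) = psi (rho x)"
proof -
  note B = Lam_aux(2)[OF clinear_Tr]
  have 1: "KK (Lam Tr (b \<otimes> h) a') = psi (rho0 b h a')" for b h a'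
  proof -
    define w where "w = (\<lambda>x. pr (cleave x \<bullet> a'))"
    have w [simp]: "clinear w" unfolding w_def by (rule clinear_compose[OF clinear_pr]) simp
    have b: "cbilinear (\<lambda>(a0 :: ('b, 'h) tensor) a1. a0 \<otimes> Kc (rmul (Tr a1) a'))"
      by (rule cbilinear_compose[OF cbilinear_pure clinear_id clinear_compose[OF clinear_Kc clinear_compose[OF cbilinear_left[OF cbilinear_rmul] clinear_Tr]]])
    have k: "(\<lambda>a1. Kc (rmul (Tr a1) a')) = cv \<Delta> cmul_op cleave_inv (\<lambda>x. emb (w x))"
    proof
      fix a1
      have l: "clinear (\<lambda>s. Kc (rmul s a'))" by (rule clinear_compose[OF clinear_Kc cbilinear_left[OF cbilinear_rmul]])
      show "Kc (rmul (Tr a1) a') = cv \<Delta> cmul_op cleave_inv (\<lambda>x. emb (w x)) a1"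
        unfolding Tr_def by (subst H.cv_post[OF l], simp_all) (simp add: cv_def Kc_pure w_def)
    qed
    have "KK (Lam Tr (b \<otimes> h) a') = tlift (\<lambda>a0 a1. a0 \<otimes> Kc (rmul (Tr a1) a')) (coact (b \<otimes> h))"
      unfolding Lam_def tlift_post[OF clinear_KK Lam_aux(1)[OF clinear_Tr]] KK_pure ..
    also have "\<dots> = cv \<Delta> pure (H.elt (H.cc b) (\<lambda>x. x)) (\<lambda>a1. Kc (rmul (Tr a1) a')) h"
      unfolding tlift_coact[OF b] by (rule fun_cong[OF cv_cong]) simp
    also have "\<dots> = psi (H.Tp (H.cc b) w (\<lambda>x. x) h)"
      unfolding k using fun_cong[OF H.psi_point[OF pt_id H.clinear_cc w], of b h] by simp
    finally show ?thesis by (simp add: rho0_def w_def)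
  qed
  note l1 = clinear_compose[OF clinear_KK clinear_tlift[OF B]] and l2 = clinear_compose[OF clinear_psi clinear_rho]
  show ?thesis
  proof (rule tri_ext[where t = x, OF l1 l2])
    show "KK (tlift (Lam Tr) (tri b h a')) = psi (rho (tri b h a'))" for b h a'
      by (simp add: tlift_pure[OF B] 1 rho_pure)
  qed
qed

lemma one_leg_aux: "cbilinear (\<lambda>(a :: ('b, 'h) tensor) (a' :: ('b, 'h) tensor). a \<otimes> (a' \<otimes> emb 1))"
  by (rule cbilinearI) simp_all

text \<open>Apply \<open>KK\<close> to the coinvariance condition: one side becomes
  \<open>psi (rho x)\<close> by \<open>KK_Lam\<close>, the other becomes \<open>x\<close>.\<close>

lemma psi_rho: "x \<in> es_carrier ext \<Longrightarrow> psi (rho x) = x"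
proof -
  assume "x \<in> es_carrier ext"
  then have "KK (tlift (Lam Tr) x - tlift (\<lambda>a a'. a \<otimes> (a' \<otimes> emb 1)) x) = 0"
    unfolding es_carrier_iff by (rule KK_WB)
  moreover have "KK (tlift (\<lambda>a a'. a \<otimes> (a' \<otimes> emb 1)) x) = tlift pure x"
    by (subst tlift_post[OF clinear_KK one_leg_aux]) (simp add: Kc_pure counit_one scaleC_one)
  ultimately show ?thesis by (simp add: clinear_diff[OF clinear_KK] KK_Lam tlift_pure_id)
qed

text \<open>Coassociativity of the coaction in convolution form: the two legs of the coacted element
  are separated and the second joins \<open>w\<close>.\<close>

lemma coact_assoc_leg:
  assumes G: "cbilinear G" and F: "\<And>a'. cbilinear (\<lambda>a0 a1. F a0 a1 a')" "\<And>a0 a1. clinear (F a0 a1)"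
    and bm: "cbilinear m" "cbilinear n" and w: "clinear w"
    and eq: "\<And>a a'. G a a' = tlift (\<lambda>a0 a1. F a0 a1 a') (coact a)" "\<And>a0 a1 a'. F a0 a1 a' = m a0 (n a1 a')"
  shows "cv \<Delta> G (H.elt (H.cc b) (\<lambda>x. x)) w = cv \<Delta> m (H.elt (H.cc b) (\<lambda>x. x)) (cv \<Delta> n (\<lambda>x. x) w)"
proof -
  define G' where "G' t a' = tlift (\<lambda>a0 a1. F a0 a1 a') t" for t a'
  have G': "cbilinear G'" unfolding G'_def
    by (rule cbilinearI) (rule clinear_tlift[OF F(1)], rule clinear_tlift_param, rule F(2))
  have "cv \<Delta> G (H.elt (H.cc b) (\<lambda>x. x)) w = cv \<Delta> G' (\<lambda>h. coact (H.elt (H.cc b) (\<lambda>x. x) h)) w"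
    by (rule cv_cong) (simp add: eq(1) G'_def)
  also have "\<dots> = cv \<Delta> m (H.elt (H.cc b) (\<lambda>x. x)) (cv \<Delta> n (\<lambda>x. x) w)"
    unfolding coact_point
    by (rule H.cv_assoc) (simp_all add: G' bm w G'_def tlift_pure[OF F(1)] eq(2)[symmetric])
  finally show ?thesis .
qed

lemma cv_Tr_leg:
  assumes "cbilinear n" "cbilinear n'" "clinear w" "cbilinear m"
    "\<And>u v a'. n (u \<otimes> v) a' = m u (n' v a')"
  shows "cv \<Delta> n Tr w = cv \<Delta> m cleave_inv (cv \<Delta> n' cleave w)"
  unfolding Tr_def by (rule H.cv_assoc) (simp_all add: assms)

text \<open>The second half of the translation map cancels the inverse of \<gamma> in the second leg
  and leaves \<open>b'\<close> alone. Moving \<open>b'\<close> across the balanced tensor product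
  yields the coinvariance condition.\<close>

lemma psi_in_carrier_tri: "psi (tri b b' h) \<in> es_carrier ext"
proof -
  note B = Lam_aux(2)[OF clinear_Tr]
  have r: "cbilinear (\<lambda>a1 a'. rmul (Tr a1) a')" by (rule cbilinear_compose[OF cbilinear_rmul]) simp_all
  have "tlift (Lam Tr) (psi (tri b b' h)) = cv \<Delta> (Lam Tr) (H.elt (H.cc b) (\<lambda>x. x)) (wleg b') h"
    by (rule tlift_psi_tri[OF B])
  also have "cv \<Delta> (Lam Tr) (H.elt (H.cc b) (\<lambda>x. x)) (wleg b') = cv \<Delta> pure (H.elt (H.cc b) (\<lambda>x. x)) (cv \<Delta> (\<lambda>a1 a'. rmul (Tr a1) a') (\<lambda>x. x) (wleg b'))"
    by (rule coact_assoc_leg[OF B, where F = "\<lambda>a0 a1 a'. a0 \<otimes> rmul (Tr a1) a'"])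
      (simp_all add: Lam_aux(1) cbilinear_right r Lam_def)
  also have "cv \<Delta> (\<lambda>a1 a'. rmul (Tr a1) a') (\<lambda>x. x) (wleg b') = cv \<Delta> rmul Tr (wleg b')"
    by (rule cv_cong) simp
  also have "\<dots> = cv \<Delta> pure cleave_inv (cv \<Delta> cmul_op cleave (wleg b'))"
    by (rule cv_Tr_leg) simp_all
  also have "\<dots> = (\<lambda>x. cleave_inv x \<otimes> emb b')"
    unfolding cleave_wleg by (simp add: H.cv_cc_right)
  finally have 1: "tlift (Lam Tr) (psi (tri b b' h)) = cv \<Delta> pure (H.elt (H.cc b) (\<lambda>x. x)) (\<lambda>x. cleave_inv x \<otimes> emb b') h" .
  have wl: "wleg b' = (\<lambda>x. cleave_inv x \<bullet> emb b')"
    by (simp add: H.cv_cc_cc H.cv_cc_right)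
  have "tlift (\<lambda>a a'. a \<otimes> (a' \<otimes> emb 1)) (psi (tri b b' h)) =
      cv \<Delta> (\<lambda>a a'. a \<otimes> (a' \<otimes> emb 1)) (H.elt (H.cc b) (\<lambda>x. x)) (wleg b') h"
    by (rule tlift_psi_tri[OF one_leg_aux])
  also have "cv \<Delta> (\<lambda>a a'. a \<otimes> (a' \<otimes> emb 1)) (H.elt (H.cc b) (\<lambda>x. x)) (wleg b') =
      cv \<Delta> pure (H.elt (H.cc b) (\<lambda>x. x)) (\<lambda>x. (cleave_inv x \<bullet> emb b') \<otimes> emb 1)"
    by (rule cv_cong) (simp add: wl)
  finally have 2: "tlift (\<lambda>a a'. a \<otimes> (a' \<otimes> emb 1)) (psi (tri b b' h)) =
      cv \<Delta> pure (H.elt (H.cc b) (\<lambda>x. x)) (\<lambda>x. (cleave_inv x \<bullet> emb b') \<otimes> emb 1) h" .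
  \<comment> \<open>The difference of the two sides, one convolution leg at a time; each value is an
    instance of the balancing relation.\<close>
  let ?d = "\<lambda>x. cleave_inv x \<otimes> emb b' - (cleave_inv x \<bullet> emb b') \<otimes> emb 1"
  have d: "?d x \<in> NB" for x
    using cvec.subspace_neg[OF subspace_NB NB_base[of "cleave_inv x" b' "emb 1"]] by simp
  have ld: "clinear ?d" by (rule clinear_minus) simp_all
  have "cv \<Delta> pure (H.elt (H.cc b) (\<lambda>x. x)) ?d h \<in> WB"
    by (rule H.cv_flip_subspace[OF cvec.subspace_span cbilinear_pure _ ld]) (simp, rule WB_base[OF d])
  moreover have "cv \<Delta> pure (H.elt (H.cc b) (\<lambda>x. x)) ?d h = tlift (Lam Tr) (psi (tri b b' h)) - tlift (\<lambda>a a'. a \<otimes> (a' \<otimes> emb 1)) (psi (tri b b' h))"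
  proof -
    have bb: "cbilinear (\<lambda>t x. t \<otimes> (cleave_inv x \<otimes> emb b'))" "cbilinear (\<lambda>t x. t \<otimes> ((cleave_inv x \<bullet> emb b') \<otimes> emb 1))" "cbilinear (\<lambda>t x. t \<otimes> ?d x)"
      for t :: "('b, 'h) tensor"
      by (rule cbilinearI; simp add: ld)+
    have e: "cv \<Delta> pure f g h = tlift (\<lambda>x y. f x \<otimes> g y) (\<Delta> h)" for f :: "'h \<Rightarrow> ('b, 'h) tensor" and g :: "'h \<Rightarrow> (('b, 'h) tensor, ('b, 'h) tensor) tensor"
      by (simp add: cv_def sweedler2_def)
    have c: "cbilinear (\<lambda>x y. H.elt (H.cc b) (\<lambda>x. x) x \<otimes> (cleave_inv y \<otimes> emb b'))"
      "cbilinear (\<lambda>x y. H.elt (H.cc b) (\<lambda>x. x) x \<otimes> ((cleave_inv y \<bullet> emb b') \<otimes> emb 1))"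
      "cbilinear (\<lambda>x y. H.elt (H.cc b) (\<lambda>x. x) x \<otimes> ?d y)"
      by (rule cbilinear_compose[OF cbilinear_pure]; simp add: ld)+
    show ?thesis unfolding 1 2 e
      by (rule tensor_ext[where t = "\<Delta> h", OF clinear_tlift[OF c(3)] clinear_minus[OF clinear_tlift[OF c(1)] clinear_tlift[OF c(2)]]])
        (simp only: tlift_pure[OF c(1)] tlift_pure[OF c(2)] tlift_pure[OF c(3)], simp only: clinear_diff[OF cbilinear_right[OF cbilinear_pure]])
  qed
  ultimately show ?thesis unfolding es_carrier_iff by simp
qed

lemma subspace_es_carrier: "cvec.subspace (es_carrier ext)"
proof -
  let ?f = "\<lambda>x. tlift (Lam Tr) x - tlift (\<lambda>a a'. a \<otimes> (a' \<otimes> emb 1)) x"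
  have l: "clinear ?f"
    by (rule clinear_minus[OF clinear_tlift[OF Lam_aux(2)[OF clinear_Tr]] clinear_tlift[OF one_leg_aux]])
  have "es_carrier ext = {x. ?f x \<in> WB}" using es_carrier_iff by blast
  then show ?thesis
    by (intro cvec.subspaceI)
      (simp_all only: mem_Collect_eq clinear_zero[OF l] clinear_add[OF l] clinear_scale[OF l] cvec.span_zero cvec.span_add cvec.span_scale)
qed

lemma es_carrier_eq: "es_carrier ext = range psi"
proof -
  have "psi t \<in> es_carrier ext" for t
  proof (induction t rule: tensor_induct)
    case (pure s h)
    show ?case
    proof (induction s rule: tensor_induct)
      case (pure b b')
      show ?case by (rule psi_in_carrier_tri)
    next
      case (add s s')
      then show ?case
        using cvec.subspace_add[OF subspace_es_carrier]
        by (simp add: clinear_add[OF cbilinear_left[OF cbilinear_pure]] clinear_add[OF clinear_psi])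
    qed
  next
    case (add t t')
    then show ?case
      using cvec.subspace_add[OF subspace_es_carrier] by (simp add: clinear_add[OF clinear_psi])
  qed
  moreover have "x \<in> range psi" if "x \<in> es_carrier ext" for x
    using psi_rho[OF that] by (metis rangeI)
  ultimately show ?thesis by blast
qed

lemma cleave_inv_one: "cleave_inv 1 = emb 1"
proof -
  have s1: "\<sigma>' 1 1 = 1"
  proof -
    have "sg2' (1 \<otimes> 1) * sg2 (1 \<otimes> 1) = 1"
    proof -
      have b: "cbilinear (\<lambda>k1 k2. \<sigma>' h1 k1 * \<sigma> h2 k2)" for h1 h2
        by (rule cbilinear_compose[OF cbilinear_mult]) (simp_all add: cbilinear_right)
      have b2: "cbilinear (\<lambda>h1 h2. \<sigma>' h1 1 * \<sigma> h2 1)"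
        by (rule cbilinear_compose[OF cbilinear_mult]) (simp_all add: cbilinear_left)
      show ?thesis
        using sigma_left_inverse[of 1 1]
        by (simp add: sweedler2_def comult_one tlift_pure[OF b] tlift_pure[OF b2] counit_one scaleC_one)
    qed
    then show ?thesis by (simp add: sigma_one_left counit_one scaleC_one)
  qed
  have b: "cbilinear (\<lambda>u v. \<sigma>' (S u) v)" by (rule cbilinear_compose[OF sigma'_bilinear]) simp_all
  have b2: "cbilinear (\<lambda>u v. (cv \<Delta> \<sigma>' S (\<lambda>x. x) u) \<otimes> S v)" by (rule cbilinear_compose[OF cbilinear_pure]) simp_all
  show ?thesis
    unfolding cleave_inv_def cv_def[of _ pure] sweedler2_def comult_one tlift_pure[OF b2]
    unfolding cv_def sweedler2_def comult_one tlift_pure[OF b]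
    by (simp add: antipode_one s1)
qed

lemma psi_tri_one: "psi (tri b b' 1) = emb b \<otimes> emb b'"
proof -
  have wl: "wleg b' = (\<lambda>x. cleave_inv x \<bullet> emb b')"
    by (simp add: H.cv_cc_cc H.cv_cc_right)
  have b2: "cbilinear (\<lambda>u v. (b \<otimes> u) \<otimes> (cleave_inv v \<bullet> emb b'))" by (rule cbilinearI) simp_all
  show ?thesis
    unfolding psi_tri_eq wl
    by (simp add: H.cv_cc_left cv_def sweedler2_def comult_one tlift_pure[OF b2] cleave_inv_one)
qed

lemma es_src_eq: "es_src ext b = psi (tri b 1 1)" and es_tgt_eq: "es_tgt ext b = psi (tri 1 b 1)"
  by (simp_all add: es_src_def es_tgt_def psi_tri_one)

lemma esm_src: "esm (es_src ext b) (psi x) = psi (smul b x)" and esm_tgt: "esm (es_tgt ext b) (psi x) = psi (tmul b x)"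
  by (simp_all add: es_src_eq es_tgt_eq psi_mm[symmetric] mm_src_left mm_tgt_left)

text \<open>Multiplying the legs cancels \<gamma> against its inverse. The result lies in the
  embedded copy of B, and the embedding is injective because \<open>pr\<close> is a left inverse of
  it.\<close>

lemma es_counit_psi: "es_counit ext (psi t) = ee t"
proof -
  have "tlift cmul_op (psi t) = emb (ee t)"
  proof (rule tri_ext[where t = t])
    show "clinear (\<lambda>t. tlift cmul_op (psi t))"
      by (rule clinear_compose[OF clinear_tlift[OF cbilinear_crossed_mult] clinear_psi])
    show "clinear (\<lambda>t. emb (ee t))" by simp
    fix b b' h
    have "tlift cmul_op (psi (tri b b' h)) = cv \<Delta> cmul_op (H.elt (H.cc b) (\<lambda>x. x)) (wleg b') h"
      by (rule tlift_psi_tri) simp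
    also have "H.elt (H.cc b) (\<lambda>x. x) = cv \<Delta> cmul_op (H.cc (emb b)) cleave"
      by (simp add: H.cv_cc_left emb_cleave)
    also have "cv \<Delta> cmul_op (cv \<Delta> cmul_op (H.cc (emb b)) cleave) (wleg b') = cv \<Delta> cmul_op (H.cc (emb b)) (cv \<Delta> cmul_op cleave (wleg b'))"
      by (rule H.cmult_cv_assoc) simp_all
    also have "\<dots> = H.cc (emb (b * b'))"
      unfolding cleave_wleg by (simp add: H.cv_cc_cc emb_mult)
    finally show "tlift cmul_op (psi (tri b b' h)) = emb (ee (tri b b' h))"
      by (simp add: clinear_scale[OF cbilinear_left[OF cbilinear_pure]])
  qed
  moreover have "inj emb"
    by (rule inj_on_inverseI[where g = pr]) (simp add: counit_one scaleC_one)
  ultimately show ?thesis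
    using inv_f_f[of emb "ee t"] by (simp add: es_counit_def crossed_extension_def)
qed

section \<open>The coproduct of the carrier\<close>

abbreviation "BC \<equiv> balancing (es_carrier ext) (es_carrier ext) (\<lambda>u b. esm (es_tgt ext b) u) (\<lambda>b u. esm (es_src ext b) u)"
abbreviation "BU \<equiv> balancing UNIV UNIV (\<lambda>u b. esm (es_tgt ext b) u) (\<lambda>b u. esm (es_src ext b) u)"

lemma subspace_BC [simp]: "cvec.subspace BC" and subspace_BU [simp]: "cvec.subspace BU"
  unfolding balancing_def by (rule cvec.subspace_span)+

lemma BC_base: "psi (tmul b x) \<otimes> psi y - psi x \<otimes> psi (smul b y) \<in> BC"
  unfolding balancing_def es_carrier_eq esm_src[symmetric] esm_tgt[symmetric]
  by (rule cvec.span_base) blast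

lemma BU_base: "esm (es_tgt ext b) x \<otimes> y - x \<otimes> esm (es_src ext b) y \<in> BU"
  unfolding balancing_def by (rule cvec.span_base) blast

lemma BC_BU: "BC \<subseteq> BU"
  unfolding balancing_def by (rule cvec.span_mono) blast

lemma es_tgt_pure: "esm (es_tgt ext b) (a \<otimes> a') = a \<otimes> (a' \<bullet> emb b)"
  and es_src_pure: "esm (es_src ext b) (a \<otimes> a') = (emb b \<bullet> a) \<otimes> a'"
  by (simp_all add: es_tgt_def es_src_def esm_pure)

lemma es_tgt_mult: "esm (es_tgt ext c) (esm (es_tgt ext b) x) = esm (es_tgt ext (b * c)) x"
  unfolding esm_assoc[symmetric]
  by (simp add: es_tgt_def[of ext c] es_tgt_pure es_tgt_def[of ext b] esm_pure emb_mult) (simp add: es_tgt_def)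

text \<open>\<open>Q2\<close> moves the \<open>B\<close>-component of the second factor to the first one and projects the second factor
  to the carrier. It shows that the map from the tensor product of the carrier with itself to the
  ambient balanced tensor product is injective.\<close>

definition Q2 where
  "Q2 x = mlift (\<lambda>c g a'. esm (es_tgt ext c) x \<otimes> psi (rho0 1 g a'))"

lemma es_tgt_linear: "clinear (\<lambda>c. esm (es_tgt ext c) x)"
  by (rule clinear_compose[OF cbilinear_left[OF cbilinear_esm]]) (simp add: es_tgt_def[abs_def])

lemma Q2_aux: "ctrilinear (\<lambda>c g a'. esm (es_tgt ext c) x \<otimes> psi (rho0 1 g a'))"
proof (rule ctrilinearI)
  show "clinear (\<lambda>c. esm (es_tgt ext c) x \<otimes> psi (rho0 1 g a'))" for g a'
    using es_tgt_linear by simp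
  show "clinear (\<lambda>g. esm (es_tgt ext c) x \<otimes> psi (rho0 1 g a'))" for c a'
    by (rule clinear_compose[OF cbilinear_right[OF cbilinear_pure] clinear_compose[OF clinear_psi rho0_lin(2)]])
  show "clinear (\<lambda>a'. esm (es_tgt ext c) x \<otimes> psi (rho0 1 g a'))" for c g
    by (rule clinear_compose[OF cbilinear_right[OF cbilinear_pure] clinear_compose[OF clinear_psi rho0_lin(3)]])
qed

lemma cbilinear_Q2: "cbilinear Q2"
  unfolding Q2_def
  by (rule cbilinear_mlift[OF Q2_aux])
    (rule clinear_compose[OF cbilinear_left[OF cbilinear_pure] cbilinear_right[OF cbilinear_esm]])

lemma Q2_tri: "Q2 x (tri c g a') = esm (es_tgt ext c) x \<otimes> psi (rho0 1 g a')"
  by (simp add: Q2_def mlift_tri[OF Q2_aux])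

lemma Q2_balanced: "Q2 (esm (es_tgt ext b) x) y = Q2 x (esm (es_src ext b) y)"
proof (rule tri_ext[where t = y])
  show "clinear (Q2 (esm (es_tgt ext b) x))" by (rule cbilinear_right[OF cbilinear_Q2])
  show "clinear (\<lambda>y. Q2 x (esm (es_src ext b) y))"
    by (rule clinear_compose[OF cbilinear_right[OF cbilinear_Q2] cbilinear_right[OF cbilinear_esm]])
qed (simp add: es_src_pure Q2_tri emb_cmult_pure es_tgt_mult)

text \<open>On carrier elements \<open>Q2\<close> acts as the normal form \<open>QQ\<close> does in
  coordinates: only \<open>c\<close> moves, since the projection fixes what remains.\<close>

lemma Q2_psi: "Q2 x (psi (tri c c' g)) = esm (es_tgt ext c) x \<otimes> psi (tri 1 c' g)"
proof -
  note q = cbilinear_right[OF cbilinear_Q2]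
  have l: "clinear (\<lambda>z. esm (es_tgt ext c) x \<otimes> psi (rho z))"
    by (rule clinear_compose[OF cbilinear_right[OF cbilinear_pure] clinear_compose[OF clinear_psi clinear_rho]])
  have "Q2 x (psi (tri c c' g)) = cv \<Delta> (\<lambda>a b. Q2 x (a \<otimes> b)) (H.elt (H.cc c) (\<lambda>x. x)) (wleg c') g"
    unfolding psi_tri_eq by (rule H.cv_post[OF q]) simp_all
  also have "\<dots> = cv \<Delta> (\<lambda>a b. esm (es_tgt ext c) x \<otimes> psi (rho (a \<otimes> b))) (H.elt (H.cc 1) (\<lambda>x. x)) (wleg c') g"
    by (rule fun_cong[OF cv_cong]) (simp add: H.cv_cc_left Q2_tri rho_pure)
  also have "\<dots> = esm (es_tgt ext c) x \<otimes> psi (rho (psi (tri 1 c' g)))"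
    unfolding psi_tri_eq by (rule H.cv_post[OF l, symmetric]) simp_all
  finally show ?thesis by simp
qed

lemma Q2_BU: "n \<in> BU \<Longrightarrow> tlift Q2 n = 0"
proof -
  assume n: "n \<in> BU"
  note l = clinear_tlift[OF cbilinear_Q2]
  have "tlift Q2 n \<in> {0}"
    by (rule span_induct_linear[OF n[unfolded balancing_def] l cvec.subspace_single_0])
      (auto simp: clinear_diff[OF l] tlift_pure[OF cbilinear_Q2] Q2_balanced)
  then show ?thesis by simp
qed

lemma Q2_mod:
  assumes "z \<in> tensor_span (es_carrier ext) (es_carrier ext)"
  shows "z - tlift Q2 z \<in> BC"
proof -
  note l = clinear_tlift[OF cbilinear_Q2]
  have 1: "psi t \<otimes> psi s - Q2 (psi t) (psi s) \<in> BC" for t s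
  proof -
    have b: "clinear (\<lambda>s. psi t \<otimes> psi s - Q2 (psi t) (psi s))"
      by (rule clinear_minus[OF clinear_compose[OF cbilinear_right[OF cbilinear_pure] clinear_psi]
          clinear_compose[OF cbilinear_right[OF cbilinear_Q2] clinear_psi]])
    show ?thesis
    proof (induction s rule: tensor_induct)
      case (pure p g)
      show ?case
      proof (induction p rule: tensor_induct)
        case (pure c c')
        show ?case
          using cvec.subspace_neg[OF subspace_BC BC_base[of c t "tri 1 c' g"]] by (simp add: Q2_psi esm_tgt)
      next
        case (add p q)
        then show ?case
          using cvec.subspace_add[OF subspace_BC add]
          by (simp add: clinear_add[OF cbilinear_left[OF cbilinear_pure]] clinear_add[OF b])
      qed
    next
      case (add s s')
      show ?case unfolding clinear_add[OF b] by (rule cvec.subspace_add[OF subspace_BC add])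
    qed
  qed
  have m: "clinear (\<lambda>z. z - tlift Q2 z)" by (rule clinear_minus[OF clinear_id l])
  show ?thesis
    by (rule span_induct_linear[OF assms[unfolded tensor_span_def] m subspace_BC])
      (auto simp: tlift_pure[OF cbilinear_Q2] es_carrier_eq 1[unfolded es_carrier_eq])
qed

text \<open>A tensor of carrier elements differs from its normal form by the balancing relation of
  the carrier, and the normal form of an element of the ambient relation is zero.\<close>

lemma BU_carrier: "z \<in> tensor_span (es_carrier ext) (es_carrier ext) \<Longrightarrow> z \<in> BU \<Longrightarrow> z \<in> BC"
  using Q2_mod[of z] Q2_BU[of z] by simp

abbreviation "PPsi \<equiv> tlift (\<lambda>x y. psi x \<otimes> psi y)"

lemma PPsi_bil: "cbilinear (\<lambda>x y. psi x \<otimes> psi y)"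
  by (rule cbilinear_compose[OF cbilinear_pure]) simp_all

lemma PPsi_tensor_span: "PPsi t \<in> tensor_span (es_carrier ext) (es_carrier ext)"
  unfolding tensor_span_def es_carrier_eq
  by (rule tlift_in_subspace[OF cvec.subspace_span PPsi_bil]) (rule cvec.span_base, blast)

text \<open>Splices a translation representative between two outer legs, giving an element of (A
  \<otimes> A) \<otimes> (A \<otimes> A).\<close>

definition mid :: "('b, 'h) tensor \<Rightarrow> (('b, 'h) tensor, ('b, 'h) tensor) tensor \<Rightarrow> ('b, 'h) tensor \<Rightarrow> _" where
  "mid a0 s a' = tlift (\<lambda>u v. (a0 \<otimes> u) \<otimes> (v \<otimes> a')) s"

lemma mid_aux: "cbilinear (\<lambda>u v. ((a0 :: ('b, 'h) tensor) \<otimes> (u :: ('b, 'h) tensor)) \<otimes> ((v :: ('b, 'h) tensor) \<otimes> (a' :: ('b, 'h) tensor)))"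
  by (rule cbilinear_compose[OF cbilinear_pure]) simp_all

lemma mid_linear: "clinear (\<lambda>a0. mid a0 s a')" "clinear (\<lambda>s. mid a0 s a')" "clinear (mid a0 s)"
  unfolding mid_def[abs_def]
  by (rule clinear_tlift_param, simp, rule clinear_tlift[OF mid_aux], rule clinear_tlift_param, simp)

lemma mid_pure: "mid a0 (u \<otimes> v) a' = (a0 \<otimes> u) \<otimes> (v \<otimes> a')"
  by (simp add: mid_def tlift_pure[OF mid_aux])

lemma mid_NB: "n \<in> NB \<Longrightarrow> mid a0 n a' \<in> BU"
  unfolding mid_def
proof (rule tlift_NB[OF _ mid_aux subspace_BU])
  show "(a0 \<otimes> (a \<bullet> emb b)) \<otimes> (v \<otimes> a') - (a0 \<otimes> a) \<otimes> ((emb b \<bullet> v) \<otimes> a') \<in> BU" for a b v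
    using BU_base[of b "a0 \<otimes> a" "v \<otimes> a'"] by (simp add: es_tgt_pure es_src_pure)
qed

definition Yc where "Yc T a a' = tlift (\<lambda>a0 a1. mid a0 (T a1) a') (coact a)"

lemma Yc_aux:
  assumes [simp]: "clinear T"
  shows "cbilinear (\<lambda>a0 a1. mid a0 (T a1) a')" "cbilinear (Yc T)"
proof -
  show 1: "cbilinear (\<lambda>a0 a1. mid a0 (T a1) a')" for a'
    by (rule cbilinearI) (rule mid_linear, rule clinear_compose[OF mid_linear(2) assms])
  show "cbilinear (Yc T)"
    unfolding Yc_def[abs_def]
    by (rule cbilinearI) (rule clinear_compose[OF clinear_tlift[OF 1] clinear_coact], rule clinear_tlift_param, rule mid_linear)
qed

lemma Yc_trep: "tlift (Yc trep) x - tlift (Yc Tr) x \<in> BU"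
proof -
  have d: "clinear (\<lambda>h. trep h - Tr h)" by (rule clinear_minus[OF trep(1) clinear_Tr])
  have 1: "Yc trep a a' - Yc Tr a a' \<in> BU" for a a'
  proof -
    note B = Yc_aux(1)[OF d, of a'] and B1 = Yc_aux(1)[OF trep(1), of a'] and B2 = Yc_aux(1)[OF clinear_Tr, of a']
    have "Yc trep a a' - Yc Tr a a' = tlift (\<lambda>a0 a1. mid a0 (trep a1 - Tr a1) a') (coact a)"
      unfolding Yc_def
      by (rule tensor_ext[where t = "coact a", OF clinear_minus[OF clinear_tlift[OF B1] clinear_tlift[OF B2]] clinear_tlift[OF B]])
        (simp only: tlift_pure[OF B] tlift_pure[OF B1] tlift_pure[OF B2], simp only: clinear_diff[OF mid_linear(2)])
    also have "\<dots> \<in> BU"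
      by (rule tlift_in_subspace[OF subspace_BU B]) (rule mid_NB[OF trep(2)])
    finally show ?thesis .
  qed
  note B1 = Yc_aux(2)[OF trep(1)] and B2 = Yc_aux(2)[OF clinear_Tr]
  have B: "cbilinear (\<lambda>a a'. Yc trep a a' - Yc Tr a a')"
    by (rule cbilinearI; rule clinear_minus; rule cbilinear_left[OF B1] cbilinear_left[OF B2] cbilinear_right[OF B1] cbilinear_right[OF B2])
  have "tlift (Yc trep) x - tlift (Yc Tr) x = tlift (\<lambda>a a'. Yc trep a a' - Yc Tr a a') x"
    by (rule tensor_ext[where t = x, OF clinear_minus[OF clinear_tlift[OF B1] clinear_tlift[OF B2]] clinear_tlift[OF B]])
      (simp add: tlift_pure[OF B] tlift_pure[OF B1] tlift_pure[OF B2])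
  also have "\<dots> \<in> BU" by (rule tlift_in_subspace[OF subspace_BU B 1])
  finally show ?thesis .
qed

text \<open>The two halves of the translation map complete the outer legs: the inverse of \<gamma>
  closes the first pair, and \<gamma> opens the second. Both pairs are then values of
  \<open>psi\<close>.\<close>

lemma Yc_psi: "tlift (Yc Tr) (psi t) = PPsi (dd t)"
proof (rule tri_ext[where t = t])
  show "clinear (\<lambda>t. tlift (Yc Tr) (psi t))"
    by (rule clinear_compose[OF clinear_tlift[OF Yc_aux(2)[OF clinear_Tr]] clinear_psi])
  show "clinear (\<lambda>t. PPsi (dd t))" by (rule clinear_compose[OF clinear_tlift[OF PPsi_bil] clinear_dd])
  fix b b' :: 'b and h :: 'h
  \<comment> \<open>\<open>n3\<close> and \<open>m'\<close> only rebracket: they let the four legs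
    be convolved from the right, after which associativity groups them in pairs.\<close>
  define n3 where "n3 u k = tlift (\<lambda>v a'. ((u :: ('b, 'h) tensor) \<otimes> (v :: ('b, 'h) tensor)) \<otimes> (a' :: ('b, 'h) tensor)) k" for u k
  have n3_aux: "cbilinear (\<lambda>v a'. ((u :: ('b, 'h) tensor) \<otimes> (v :: ('b, 'h) tensor)) \<otimes> (a' :: ('b, 'h) tensor))" for u
    by (rule cbilinearI) simp_all
  have n3: "cbilinear n3" unfolding n3_def
    by (rule cbilinearI) (rule clinear_tlift_param, simp, rule clinear_tlift[OF n3_aux])
  have n3p: "n3 u (v \<otimes> a') = (u \<otimes> v) \<otimes> a'" for u v a'
    by (simp add: n3_def tlift_pure[OF n3_aux])
  define m' where "m' a0 q = tlift (\<lambda>s a'. mid a0 s a') q" for a0 q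
  have m'_aux: "cbilinear (\<lambda>s a'. mid a0 s a')" for a0 by (rule cbilinearI) (rule mid_linear)+
  have m': "cbilinear m'" unfolding m'_def
    by (rule cbilinearI) (rule clinear_tlift_param, rule mid_linear, rule clinear_tlift[OF m'_aux])
  have m'p: "m' a0 (s \<otimes> a') = mid a0 s a'" for a0 s a'
    by (simp add: m'_def tlift_pure[OF m'_aux])
  let ?e = "H.elt (H.cc b) (\<lambda>x. x)" and ?K = "cv \<Delta> pure cleave (wleg b')"
  have "tlift (Yc Tr) (psi (tri b b' h)) = cv \<Delta> (Yc Tr) ?e (wleg b') h"
    by (rule tlift_psi_tri[OF Yc_aux(2)[OF clinear_Tr]])
  also have "cv \<Delta> (Yc Tr) ?e (wleg b') = cv \<Delta> m' ?e (cv \<Delta> (\<lambda>a1 a'. Tr a1 \<otimes> a') (\<lambda>x. x) (wleg b'))"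
    by (rule coact_assoc_leg[where F = "\<lambda>a0 a1 a'. mid a0 (Tr a1) a'"])
      (simp_all add: Yc_aux mid_linear m' m'p Yc_def cbilinear_compose[OF cbilinear_pure clinear_Tr clinear_id])
  also have "cv \<Delta> (\<lambda>a1 a'. Tr a1 \<otimes> a') (\<lambda>x. x) (wleg b') = cv \<Delta> pure Tr (wleg b')"
    by (rule cv_cong) simp
  also have "\<dots> = cv \<Delta> n3 cleave_inv ?K"
    by (rule cv_Tr_leg) (simp_all add: n3 n3p)
  also have "cv \<Delta> m' ?e (cv \<Delta> n3 cleave_inv ?K) = cv \<Delta> pure (cv \<Delta> pure ?e cleave_inv) ?K"
  proof (rule H.cv_assoc[symmetric, OF cbilinear_pure cbilinear_pure m' n3])
    show "(a \<otimes> u) \<otimes> k = m' a (n3 u k)" for a u :: "('b, 'h) tensor" and k :: "(('b, 'h) tensor, ('b, 'h) tensor) tensor"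
    proof (rule tensor_ext[where t = k])
      show "clinear (\<lambda>k. m' a (n3 u k))"
        by (rule clinear_compose[OF cbilinear_right[OF m'] cbilinear_right[OF n3]])
    qed (simp_all add: n3p m'p mid_pure)
  qed simp_all
  also have "cv \<Delta> pure ?e cleave_inv = (\<lambda>h. psi (gen b 1 h))"
    unfolding H.psi_point[OF pt_id H.clinear_cc H.clinear_cc] H.em_cc by simp
  also have "?K = (\<lambda>h. psi (gen 1 b' h))"
    unfolding H.psi_point[OF pt_id H.clinear_cc H.clinear_cc] by (simp add: H.emb_point cleave_elt)
  also have "cv \<Delta> pure (\<lambda>h. psi (gen b 1 h)) (\<lambda>h. psi (gen 1 b' h)) h = PPsi (dd (tri b b' h))"
    unfolding tlift_dd_tri[OF PPsi_bil] by (rule fun_cong[OF cv_cong]) simp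
  finally show "tlift (Yc Tr) (psi (tri b b' h)) = PPsi (dd (tri b b' h))" .
qed

text \<open>The explicit class satisfies the description. Any other candidate differs from it by a
  tensor of carrier elements in the ambient relation, which already lies in the relation of the
  carrier.\<close>

lemma es_comul_psi: "es_comul ext (psi t) = coset BC (PPsi (dd t))"
proof -
  let ?Y = "tlift (\<lambda>a a'. tlift (\<lambda>a0 a1. tlift (\<lambda>u v. (a0 \<otimes> u) \<otimes> (v \<otimes> a')) (trep a1)) (ext_coact ext a)) (psi t)"
  let ?BT = "balanced_tensor (es_carrier ext) (es_carrier ext) (\<lambda>u b. esm (es_tgt ext b) u) (\<lambda>b u. esm (es_src ext b) u)"
  have Y: "?Y = tlift (Yc trep) (psi t)" by (simp add: Yc_def[abs_def] mid_def)
  have y: "?Y - PPsi (dd t) \<in> BU"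
    unfolding Y Yc_psi[symmetric] by (rule Yc_trep)
  show ?thesis
    unfolding es_comul_def
  proof (rule the_equality)
    show "coset BC (PPsi (dd t)) \<in> ?BT \<and> coset BC (PPsi (dd t)) \<subseteq> coset BU ?Y"
    proof
      show "coset BC (PPsi (dd t)) \<in> ?BT"
        unfolding balanced_tensor_def using PPsi_tensor_span by blast
      show "coset BC (PPsi (dd t)) \<subseteq> coset BU ?Y"
      proof
        fix z assume "z \<in> coset BC (PPsi (dd t))"
        then have "z - PPsi (dd t) \<in> BU" using BC_BU by (auto simp: mem_coset_iff)
        from cvec.subspace_diff[OF subspace_BU this y] show "z \<in> coset BU ?Y"
          by (simp add: mem_coset_iff)
      qed
    qed
    fix Z assume "Z \<in> ?BT \<and> Z \<subseteq> coset BU ?Y"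
    then obtain z where z: "Z = coset BC z" "z \<in> tensor_span (es_carrier ext) (es_carrier ext)" "Z \<subseteq> coset BU ?Y"
      unfolding balanced_tensor_def by blast
    have "z \<in> Z" unfolding z(1) mem_coset_iff[OF subspace_BC] using cvec.subspace_0[OF subspace_BC] by simp
    then have "z - ?Y \<in> BU" using z(3) by (auto simp: mem_coset_iff)
    from cvec.subspace_add[OF subspace_BU this y] have "z - PPsi (dd t) \<in> BU" by simp
    moreover have "z - PPsi (dd t) \<in> tensor_span (es_carrier ext) (es_carrier ext)"
      using z(2) PPsi_tensor_span[of "dd t"] unfolding tensor_span_def by (rule cvec.span_diff)
    ultimately show "Z = coset BC (PPsi (dd t))"
      unfolding z(1) by (simp add: coset_eq_iff BU_carrier)
  qed
qed

theorem presented_ES: "presented_bialgebroid \<Delta> \<epsilon> S act \<sigma> \<sigma>' (ES ext) psi rho"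
proof (intro presented_bialgebroid.intro presented_bialgebroid_axioms.intro)
  show "central_crossed_product \<Delta> \<epsilon> S act \<sigma> \<sigma>'" by (rule central_crossed_product_axioms)
qed (simp_all add: ES_def es_carrier_eq psi_mm es_src_eq es_tgt_eq es_counit_psi psi_tri_one es_comul_psi bbalancing_def)

end

section \<open>The cocycle on the bialgebroid of the smash product\<close>

context cocomm_hopf
begin

text \<open>The common shape of convolution, the left twisted product and the full twisted product:
  \<open>n\<close> is applied to the first legs of the two coproducts, \<open>p\<close> to the
  second legs, and \<open>m\<close> combines the results.\<close>

definition quad where
  "quad m n p s t = tlift (\<lambda>x' y'. tlift (\<lambda>x y. m (n x x') (p y y')) s) t"

lemma quad_aux:
  assumes "cbilinear m" "cbilinear n" "cbilinear p"
  shows "cbilinear (\<lambda>x y. m (n x x') (p y y'))" "cbilinear (\<lambda>x' y'. m (n x x') (p y y'))"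
    "cbilinear (\<lambda>x' y'. tlift (\<lambda>x y. m (n x x') (p y y')) s)"
proof -
  show "cbilinear (\<lambda>x y. m (n x x') (p y y'))"
    by (rule cbilinear_compose[OF assms(1) cbilinear_left[OF assms(2)] cbilinear_left[OF assms(3)]])
  show 1: "cbilinear (\<lambda>x' y'. m (n x x') (p y y'))" for x y
    by (rule cbilinear_compose[OF assms(1) cbilinear_right[OF assms(2)] cbilinear_right[OF assms(3)]])
  show "cbilinear (\<lambda>x' y'. tlift (\<lambda>x y. m (n x x') (p y y')) s)"
    by (rule cbilinearI) (rule clinear_tlift_param, rule cbilinear_left[OF 1], rule clinear_tlift_param, rule cbilinear_right[OF 1])
qed

lemma cbilinear_quad:
  assumes "cbilinear m" "cbilinear n" "cbilinear p"
  shows "cbilinear (quad m n p)"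
  unfolding quad_def[abs_def]
  by (rule cbilinearI)
    (rule clinear_tlift_param, rule clinear_tlift[OF quad_aux(1)[OF assms]], rule clinear_tlift[OF quad_aux(3)[OF assms]])

lemma quad_pure:
  assumes "cbilinear m" "cbilinear n" "cbilinear p"
  shows "quad m n p (x \<otimes> y) (x' \<otimes> y') = m (n x x') (p y y')"
  unfolding quad_def
  by (simp only: tlift_pure[OF quad_aux(3)[OF assms]]) (simp only: tlift_pure[OF quad_aux(1)[OF assms]])

definition qdd where "qdd m n p a a' = quad m n p (dd a) (dd a')"

lemma cbilinear_qdd: "cbilinear m \<Longrightarrow> cbilinear n \<Longrightarrow> cbilinear p \<Longrightarrow> cbilinear (qdd m n p)"
  unfolding qdd_def[abs_def] by (rule cbilinear_compose[OF cbilinear_quad]) simp_all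

end

context hopf_points
begin

text \<open>Both coproducts split into a pair with units at the cut, and the middle-four exchange
  collects the first and the second halves.\<close>

lemma qdd_point:
  assumes pt: "pt \<alpha>" "pt \<beta>" and [simp]: "clinear f" "clinear f'" "clinear g" "clinear g'"
    and bil [simp]: "cbilinear m" "cbilinear n" "cbilinear p"
  shows "cv D (qdd m n p) (X.Tp f f' \<alpha>) (X.Tp g g' \<beta>) =
    cv D m (cv D n (X.Tp f (X.cc 1) \<alpha>) (X.Tp g (X.cc 1) \<beta>)) (cv D p (X.Tp (X.cc 1) f' \<alpha>) (X.Tp (X.cc 1) g' \<beta>))"
proof -
  note [simp] = pt pt_linear[OF pt(1)] pt_linear[OF pt(2)]
  have "cv D (qdd m n p) (X.Tp f f' \<alpha>) (X.Tp g g' \<beta>) =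
      cv D (quad m n p) (\<lambda>x. dd (X.Tp f f' \<alpha> x)) (\<lambda>x. dd (X.Tp g g' \<beta> x))"
    by (rule cv_cong) (simp add: qdd_def)
  also have "\<dots> = cv D m (cv D n (X.Tp f (X.cc 1) \<alpha>) (X.Tp g (X.cc 1) \<beta>)) (cv D p (X.Tp (X.cc 1) f' \<alpha>) (X.Tp (X.cc 1) g' \<beta>))"
    unfolding dd_point[OF pt(1) assms(3,4)] dd_point[OF pt(2) assms(5,6)]
    by (rule X.cv_interchange) (simp_all add: cbilinear_quad quad_pure)
  finally show ?thesis .
qed

end

context central_crossed_product
begin

text \<open>In coordinates the generator \<open>b # h\<^sub>1 \<otimes> b' # S(h\<^sub>2)\<close> is \<open>b \<otimes> (h\<^sub>1 \<rhd> b') \<otimes> h\<^sub>2\<close>, so that the formula for the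
  cocycle becomes \<open>b (h\<^sub>1 \<rhd> c) s(h\<^sub>2, g) (h\<^sub>3 \<rhd> c') b'\<close>; \<open>s\<close> is \<open>\<sigma>\<close> or its inverse.\<close>

definition stg :: "('h \<Rightarrow> 'h \<Rightarrow> 'b) \<Rightarrow> 'b \<Rightarrow> 'b \<Rightarrow> 'b \<Rightarrow> 'b \<Rightarrow> ('h, 'h) tensor \<Rightarrow> 'b" where
  "stg s b b' c c' = HH.conv_mult (HH.conv_mult (HH.conv_mult (HH.conv_mult (H2.XY.cc b)
     (HH.conv_act \<pi>1 (H2.XY.cc c))) (cv E2 s \<pi>1 \<pi>2)) (HH.conv_act \<pi>1 (H2.XY.cc c'))) (H2.XY.cc b')"

lemma stg_linear:
  assumes [simp]: "cbilinear s"
  shows "clinear (stg s b b' c c')" "clinear (\<lambda>b. stg s b b' c c' w)" "clinear (\<lambda>b'. stg s b b' c c' w)"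
    "clinear (\<lambda>c. stg s b b' c c' w)" "clinear (\<lambda>c'. stg s b b' c c' w)"
proof -
  have "cbilinear (\<lambda>b. stg s b b' c c')" "cbilinear (\<lambda>b'. stg s b b' c c')" "cbilinear (\<lambda>c. stg s b b' c c')"
    "cbilinear (\<lambda>c'. stg s b b' c c')"
    by (simp_all add: stg_def)
  note this[THEN cbilinear_left]
  then show "clinear (\<lambda>b. stg s b b' c c' w)" "clinear (\<lambda>b'. stg s b b' c c' w)"
    "clinear (\<lambda>c. stg s b b' c c' w)" "clinear (\<lambda>c'. stg s b b' c c' w)" by this+
  show "clinear (stg s b b' c c')" by (simp add: stg_def)
qed

definition stv :: "('h \<Rightarrow> 'h \<Rightarrow> 'b) \<Rightarrow> (('b, 'b) tensor, 'h) tensor \<Rightarrow> (('b, 'b) tensor, 'h) tensor \<Rightarrow> 'b" where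
  "stv s x y = mlift (\<lambda>b b' h. mlift (\<lambda>c c' g. stg s b b' c c' (h \<otimes> g)) y) x"

lemma stv_aux:
  assumes "cbilinear s"
  shows "ctrilinear (\<lambda>c c' g. stg s b b' c c' (h \<otimes> g))"
    "ctrilinear (\<lambda>b b' h. mlift (\<lambda>c c' g. stg s b b' c c' (h \<otimes> g)) y)"
proof -
  note l = stg_linear[OF assms]
  show "ctrilinear (\<lambda>c c' g. stg s b b' c c' (h \<otimes> g))"
    by (rule ctrilinearI) (rule l(4), rule l(5), rule clinear_compose[OF l(1) cbilinear_right[OF cbilinear_pure]])
  show "ctrilinear (\<lambda>b b' h. mlift (\<lambda>c c' g. stg s b b' c c' (h \<otimes> g)) y)"
    by (rule ctrilinearI)
      (rule clinear_mlift_param, rule l(2), rule clinear_mlift_param, rule l(3),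
       rule clinear_mlift_param, rule clinear_compose[OF l(1) cbilinear_left[OF cbilinear_pure]])
qed

lemma cbilinear_stv [simp]: "cbilinear s \<Longrightarrow> cbilinear (stv s)"
  unfolding stv_def[abs_def]
  by (rule cbilinearI) (rule clinear_mlift[OF stv_aux(2)], assumption, rule clinear_mlift_param, rule clinear_mlift[OF stv_aux(1)])

lemma stv_tri: "cbilinear s \<Longrightarrow> stv s (tri b b' h) (tri c c' g) = stg s b b' c c' (h \<otimes> g)"
  unfolding stv_def by (simp only: mlift_tri[OF stv_aux(2)]) (simp only: mlift_tri[OF stv_aux(1)])

end

context crossed_points
begin

lemma stv_point:
  assumes pt: "pt \<alpha>" "pt \<beta>" and [simp]: "clinear f" "clinear f'" "clinear g" "clinear g'" and s [simp]: "cbilinear s"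
  shows "cv D (stv s) (X.Tp f f' \<alpha>) (X.Tp g g' \<beta>) =
    f \<star> (\<alpha> \<rhd> g) \<star> cv D s \<alpha> \<beta> \<star> (\<alpha> \<rhd> g') \<star> f'"
proof -
  note [simp] = pt pt_linear[OF pt(1)] pt_linear[OF pt(2)]
  let ?st = "cv D (stv s)" and ?T = "\<lambda>f f' g g'. f \<star> (\<alpha> \<rhd> g) \<star> cv D s \<alpha> \<beta> \<star> (\<alpha> \<rhd> g') \<star> f'"
  have c: "?st (X.Tp (X.cc b) (X.cc b') \<alpha>) (X.Tp (X.cc c) (X.cc c') \<beta>) = ?T (X.cc b) (X.cc b') (X.cc c) (X.cc c')" for b b' c c'
  proof
    fix x
    have "?st (X.Tp (X.cc b) (X.cc b') \<alpha>) (X.Tp (X.cc c) (X.cc c') \<beta>) x = cv D (\<lambda>u v. stg s b b' c c' (u \<otimes> v)) \<alpha> \<beta> x"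
      by (rule fun_cong[OF cv_cong]) (simp add: X.tri_point_apply stv_tri)
    also have "\<dots> = stg s b b' c c' (elt \<alpha> \<beta> x)"
      by (rule X.cv_post[OF stg_linear(1)[OF s], symmetric]) simp_all
    also have "\<dots> = ?T (X.cc b) (X.cc b') (X.cc c) (X.cc c') x"
      unfolding stg_def
      by (simp add: cv_pullback[OF pt_pair(1)[OF pt]] pt_pair[OF pt] coalg_map_counit[OF pt_pair(1)[OF pt]])
    finally show "?st (X.Tp (X.cc b) (X.cc b') \<alpha>) (X.Tp (X.cc c) (X.cc c') \<beta>) x = ?T (X.cc b) (X.cc b') (X.cc c) (X.cc c') x" .
  qed
  have "X.sub (\<lambda>b. ?st (X.Tp (X.cc b) (X.cc b') \<alpha>) (X.Tp (X.cc c) (X.cc c') \<beta>)) f = X.sub (\<lambda>b. ?T (X.cc b) (X.cc b') (X.cc c) (X.cc c')) f" for b' c c'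
    unfolding c ..
  then have "?st (X.Tp f (X.cc b') \<alpha>) (X.Tp (X.cc c) (X.cc c') \<beta>) = ?T f (X.cc b') (X.cc c) (X.cc c')" for b' c c'
    by (simp add: X.sub_left X.sub_right X.sub_cc)
  then have "X.sub (\<lambda>b'. ?st (X.Tp f (X.cc b') \<alpha>) (X.Tp (X.cc c) (X.cc c') \<beta>)) f' = X.sub (\<lambda>b'. ?T f (X.cc b') (X.cc c) (X.cc c')) f'" for c c'
    by simp
  then have "?st (X.Tp f f' \<alpha>) (X.Tp (X.cc c) (X.cc c') \<beta>) = ?T f f' (X.cc c) (X.cc c')" for c c'
    by (simp add: X.sub_left X.sub_right X.sub_cc)
  then have "X.sub (\<lambda>c. ?st (X.Tp f f' \<alpha>) (X.Tp (X.cc c) (X.cc c') \<beta>)) g = X.sub (\<lambda>c. ?T f f' (X.cc c) (X.cc c')) g" for c'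
    by simp
  then have "?st (X.Tp f f' \<alpha>) (X.Tp g (X.cc c') \<beta>) = ?T f f' g (X.cc c')" for c'
    by (simp add: X.sub_left X.sub_right X.sub_cc)
  then have "X.sub (\<lambda>c'. ?st (X.Tp f f' \<alpha>) (X.Tp g (X.cc c') \<beta>)) g' = X.sub (\<lambda>c'. ?T f f' g (X.cc c')) g'"
    by simp
  then show ?thesis
    by (simp add: X.sub_left X.sub_right X.sub_cc)
qed

end

section \<open>The trivial cocycle and the smash product\<close>

context central_crossed_product
begin

definition tr :: "'h \<Rightarrow> 'h \<Rightarrow> 'b" where "tr h k = (\<epsilon> h * \<epsilon> k) *\<^sub>C 1"

lemma cbilinear_tr: "cbilinear tr"
proof -
  have "clinear (\<lambda>z :: complex. z *\<^sub>C (1 :: 'b))" by (rule cbilinear_left[OF cbilinear_scaleC])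
  then show ?thesis
    unfolding tr_def[abs_def]
    by (rule cbilinear_post[OF _ cbilinear_compose[OF cbilinear_mult counit_linear counit_linear]])
qed

text \<open>The twisted module law for the trivial cocycle says that \<rhd> is an action; that is
  \<open>act_act\<close>, and so relies on the centrality of \<sigma>. The remaining laws are counit
  computations.\<close>

lemma trivial_crossed_product: "crossed_product \<Delta> \<epsilon> S act tr tr"
proof (intro crossed_product.intro crossed_product_axioms.intro)
  show "hopf_algebra \<Delta> \<epsilon> S" by (rule hopf_algebra_axioms)
  have e: "sweedler2 \<Delta> (\<lambda>h1 h2. sweedler2 \<Delta> (\<lambda>k1 k2. tr h1 k1 * tr h2 k2) k) h = (\<epsilon> h * \<epsilon> k) *\<^sub>C 1" for h k
  proof -
    have "sweedler2 \<Delta> (\<lambda>k1 k2. tr h1 k1 * tr h2 k2) k = \<epsilon> h1 *\<^sub>C (tr h2 k)" for h1 h2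
      using H.sw_counit_left[OF clinear_scaleC[OF cbilinear_right[OF cbilinear_tr, of h2], of "\<epsilon> h1"], of k]
      by (simp add: tr_def scaleC_mult_left scaleC_scaleC mult_ac)
    then show ?thesis
      using H.sw_counit_left[OF cbilinear_left[OF cbilinear_tr]] by (simp add: tr_def)
  qed
  show "sweedler2 \<Delta> (\<lambda>h1 h2. sweedler2 \<Delta> (\<lambda>k1 k2. tr h1 k1 * tr h2 k2) k) h = (\<epsilon> h * \<epsilon> k) *\<^sub>C 1" for h k
    by (rule e)
  show "sweedler2 \<Delta> (\<lambda>h1 h2. sweedler2 \<Delta> (\<lambda>k1 k2. tr h1 k1 * tr h2 k2) k) h = (\<epsilon> h * \<epsilon> k) *\<^sub>C 1" for h k
    by (rule e)
  show "act h (act k b) = sweedler3 \<Delta> (\<lambda>h1 h2 h3. sweedler3 \<Delta> (\<lambda>k1 k2 k3. tr h1 k1 * act (h2 * k2) b * tr h3 k3) k) h" for h k b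
  proof -
    have l: "clinear (\<lambda>k. act (h * k) b)" "clinear (\<lambda>h. act (h * k) b)" for h k by simp_all
    have 1: "sweedler3 \<Delta> (\<lambda>k1 k2 k3. tr h1 k1 * act (h2 * k2) b * tr h3 k3) k = \<epsilon> h3 *\<^sub>C \<epsilon> h1 *\<^sub>C act (h2 * k) b" for h1 h2 h3 k
    proof -
      have e: "tr h1 k1 * act (h2 * k2) b * tr h3 k3 = \<epsilon> k1 *\<^sub>C ((\<epsilon> h1 * \<epsilon> h3 * \<epsilon> k3) *\<^sub>C act (h2 * k2) b)" for k1 k2 k3
        by (simp add: tr_def scaleC_mult_left scaleC_mult_right scaleC_scaleC mult_ac)
      have i: "sweedler2 \<Delta> (\<lambda>k1 k2. \<epsilon> k1 *\<^sub>C ((\<epsilon> h1 * \<epsilon> h3 * \<epsilon> k3) *\<^sub>C act (h2 * k2) b)) x =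
          \<epsilon> k3 *\<^sub>C ((\<epsilon> h1 * \<epsilon> h3) *\<^sub>C act (h2 * x) b)" for x k3
        by (subst H.sw_counit_left) (simp_all add: scaleC_scaleC mult_ac)
      have "sweedler3 \<Delta> (\<lambda>k1 k2 k3. tr h1 k1 * act (h2 * k2) b * tr h3 k3) k =
          sweedler2 \<Delta> (\<lambda>x k3. \<epsilon> k3 *\<^sub>C ((\<epsilon> h1 * \<epsilon> h3) *\<^sub>C act (h2 * x) b)) k"
        unfolding sweedler3_def e i ..
      also have "\<dots> = (\<epsilon> h1 * \<epsilon> h3) *\<^sub>C act (h2 * k) b"
        by (rule H.sw_counit_right) simp
      finally show ?thesis by (simp add: scaleC_scaleC mult_ac)
    qed
    have 2: "sweedler2 \<Delta> (\<lambda>h1 h2. \<epsilon> h3 *\<^sub>C \<epsilon> h1 *\<^sub>C act (h2 * k) b) x = \<epsilon> h3 *\<^sub>C act (x * k) b" for h3 x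
      using H.sw_counit_left[OF clinear_scaleC[OF l(2), of "\<epsilon> h3" k]] by (simp add: scaleC_scaleC mult_ac)
    show ?thesis
      unfolding sweedler3_def[of \<Delta> _ h] 1 2 H.sw_counit_right[OF l(2)] by (rule act_act)
  qed
  show "sweedler2 \<Delta> (\<lambda>h1 h2. sweedler2 \<Delta> (\<lambda>k1 k2. sweedler2 \<Delta> (\<lambda>m1 m2. act h1 (tr k1 m1) * tr h2 (k2 * m2)) m) k) h =
      sweedler2 \<Delta> (\<lambda>h1 h2. sweedler2 \<Delta> (\<lambda>k1 k2. tr h1 k1 * tr (h2 * k2) m) k) h" for h k m
  proof -
    have lt: "clinear (\<lambda>k. tr h k)" "clinear (\<lambda>h. tr h k)" for h k
      using cbilinear_left[OF cbilinear_tr] cbilinear_right[OF cbilinear_tr] by simp_all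
    have 1: "sweedler2 \<Delta> (\<lambda>m1 m2. act h1 (tr k1 m1) * tr h2 (k2 * m2)) m = \<epsilon> k1 *\<^sub>C (\<epsilon> h1 *\<^sub>C (\<epsilon> m *\<^sub>C tr h2 k2))" for h1 h2 k1 k2 m
      using H.sw_counit_left[OF clinear_scaleC[OF H.clinear_cc[of "1 :: 'b"], of "\<epsilon> k1 * \<epsilon> h1 * \<epsilon> h2 * \<epsilon> k2"], of m]
      by (simp add: tr_def counit_mult clinear_scale[OF cbilinear_right[OF act_bilinear]] act_unit scaleC_mult_left scaleC_scaleC mult_ac)
    have 2: "sweedler2 \<Delta> (\<lambda>k1 k2. \<epsilon> k1 *\<^sub>C (\<epsilon> h1 *\<^sub>C (\<epsilon> m *\<^sub>C tr h2 k2))) k = \<epsilon> h1 *\<^sub>C (\<epsilon> m *\<^sub>C tr h2 k)" for h1 h2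
      by (rule H.sw_counit_left) (simp add: lt)
    have 3: "sweedler2 \<Delta> (\<lambda>k1 k2. tr h1 k1 * tr (h2 * k2) m) k = \<epsilon> h1 *\<^sub>C (\<epsilon> m *\<^sub>C tr h2 k)" for h1 h2
      using H.sw_counit_left[OF clinear_scaleC[OF H.clinear_cc[of "1 :: 'b"], of "\<epsilon> h1 * \<epsilon> h2 * \<epsilon> m"], of k]
      by (simp add: tr_def counit_mult scaleC_mult_left scaleC_scaleC mult_ac)
    show ?thesis unfolding 1 2 3 ..
  qed
qed (simp_all add: cbilinear_tr act_mult act_unit one_act tr_def counit_one)

lemma trivial_central: "central_crossed_product \<Delta> \<epsilon> S act tr tr"
  by (intro central_crossed_product.intro central_crossed_product_axioms.intro trivial_crossed_product cocomm)
    (simp add: tr_def scaleC_mult_left scaleC_mult_right)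

lemma smash_extension_eq: "smash_extension \<Delta> act = crossed_extension \<Delta> act tr"
proof -
  have "sweedler3 \<Delta> (\<lambda>h1 h2 h3. sweedler2 \<Delta> (\<lambda>k1 k2. (b * act h1 b' * tr h2 k1) \<otimes> (h3 * k2)) k) h =
      sweedler2 \<Delta> (\<lambda>h1 h2. (b * act h1 b') \<otimes> (h2 * k)) h" for b b' h k
  proof -
    have s: "(b * act h1 b' * tr h2 k1) \<otimes> (h3 * k2) = \<epsilon> k1 *\<^sub>C (\<epsilon> h2 *\<^sub>C ((b * act h1 b') \<otimes> (h3 * k2)))" for h1 h2 h3 k1 k2
      by (simp add: tr_def scaleC_mult_right clinear_scale[OF cbilinear_left[OF cbilinear_pure]] scaleC_scaleC mult_ac)
    have 1: "sweedler2 \<Delta> (\<lambda>k1 k2. \<epsilon> k1 *\<^sub>C (\<epsilon> h2 *\<^sub>C ((b * act h1 b') \<otimes> (h3 * k2)))) k = \<epsilon> h2 *\<^sub>C ((b * act h1 b') \<otimes> (h3 * k))" for h1 h2 h3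
      by (rule H.sw_counit_left) simp
    have 2: "sweedler2 \<Delta> (\<lambda>h1 h2. \<epsilon> h2 *\<^sub>C ((b * act h1 b') \<otimes> (h3 * k))) x = (b * act x b') \<otimes> (h3 * k)" for h3 x
      by (rule H.sw_counit_right) simp
    show ?thesis unfolding sweedler3_def s 1 2 ..
  qed
  then have "smash_mult \<Delta> act = crossed_mult \<Delta> act tr"
    by (simp add: fun_eq_iff smash_mult_def crossed_mult_def)
  then show ?thesis by (simp add: smash_extension_def crossed_extension_def)
qed

end

context crossed_points
begin

lemma tr_point:
  assumes "pt \<alpha>" "pt \<beta>"
  shows "cv D tr \<alpha> \<beta> = X.cc 1"
proof
  fix x
  have "cv D tr \<alpha> \<beta> x = sweedler2 D (\<lambda>u v. e u *\<^sub>C (e v *\<^sub>C (1::'b))) x"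
    by (simp add: cv_def tr_def coalg_map_counit[OF assms(1)] coalg_map_counit[OF assms(2)] scaleC_scaleC)
  then show "cv D tr \<alpha> \<beta> x = e x *\<^sub>C 1"
    using X.sw_counit_left[OF X.clinear_cc[of 1], of x] by simp
qed

end

context cocomm_hopf
begin

abbreviation "pa \<equiv> H3.p1"
abbreviation "pb \<equiv> \<lambda>w. H2.p1 (H3.p2 w)"
abbreviation "pc \<equiv> \<lambda>w. H2.p2 (H3.p2 w)"

lemma clinear_pb [simp]: "clinear pb" and clinear_pc [simp]: "clinear pc"
  by (rule clinear_compose[OF _ H3.clinear_p2]; simp)+

lemma eval3_right:
  assumes "cbilinear m" "cbilinear n" "clinear f" "clinear g" "clinear k"
  shows "cv (tD \<Delta> (tD \<Delta> \<Delta>)) m (\<lambda>w. f (pa w)) (cv (tD \<Delta> (tD \<Delta> \<Delta>)) n (\<lambda>w. g (pb w)) (\<lambda>w. k (pc w))) (x \<otimes> (y \<otimes> z)) =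
    m (f x) (n (g y) (k z))"
proof -
  note [simp] = clinear_compose[OF assms(4) H2.clinear_p1] clinear_compose[OF assms(5) H2.clinear_p2]
  have "cv (tD \<Delta> (tD \<Delta> \<Delta>)) n (\<lambda>w. g (pb w)) (\<lambda>w. k (pc w)) = (\<lambda>w. cv (tD \<Delta> \<Delta>) n (\<lambda>w. g (H2.p1 w)) (\<lambda>w. k (H2.p2 w)) (H3.p2 w))"
    by (rule H3.cv_p2_p2[OF assms(2)]) simp_all
  then show ?thesis
    using H3.cv_p1_p2[OF assms(1,3), of "cv (tD \<Delta> \<Delta>) n (\<lambda>w. g (H2.p1 w)) (\<lambda>w. k (H2.p2 w))" x "y \<otimes> z"]
    by (simp add: assms H2.cv_p1_p2[OF assms(2,4,5)])
qed

lemma eval3_left: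
  assumes "cbilinear m" "cbilinear n" "clinear f" "clinear g" "clinear k"
  shows "cv (tD \<Delta> (tD \<Delta> \<Delta>)) m (cv (tD \<Delta> (tD \<Delta> \<Delta>)) n (\<lambda>w. f (pa w)) (\<lambda>w. g (pb w))) (\<lambda>w. k (pc w)) (x \<otimes> (y \<otimes> z)) =
    m (n (f x) (g y)) (k z)"
proof -
  note l = clinear_compose[OF assms(3) H3.clinear_p1] clinear_compose[OF assms(4) clinear_pb] clinear_compose[OF assms(5) clinear_pc]
  define N where "N x t = tlift (\<lambda>y z. m (n x y) z) t" for x t
  have bN: "cbilinear (\<lambda>y z. m (n x y) z)" for x
    by (rule cbilinear_compose[OF assms(1) cbilinear_right[OF assms(2)] clinear_id])
  have N: "cbilinear N" unfolding N_def
    by (rule cbilinear_tlift[OF bN]) (rule clinear_compose[OF cbilinear_left[OF assms(1)] cbilinear_left[OF assms(2)]])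
  have "cv (tD \<Delta> (tD \<Delta> \<Delta>)) m (cv (tD \<Delta> (tD \<Delta> \<Delta>)) n (\<lambda>w. f (pa w)) (\<lambda>w. g (pb w))) (\<lambda>w. k (pc w)) =
      cv (tD \<Delta> (tD \<Delta> \<Delta>)) N (\<lambda>w. f (pa w)) (cv (tD \<Delta> (tD \<Delta> \<Delta>)) pure (\<lambda>w. g (pb w)) (\<lambda>w. k (pc w)))"
    by (rule H3.XY.cv_assoc) (simp_all add: assms N l N_def tlift_pure[OF bN])
  then show ?thesis
    using eval3_right[OF N cbilinear_pure assms(3,4,5), of x y z] by (simp add: N_def tlift_pure[OF bN])
qed

text \<open>The three-variable analogue of \<open>bil_ext\<close>: an associativity-type identity is
  tested at the universal triple of points.\<close>

lemma assoc_ext: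
  assumes bil: "cbilinear m" "cbilinear n" "cbilinear m'" "cbilinear n'"
    and eq: "\<And>b b' c c' d d'.
      cv (tD \<Delta> (tD \<Delta> \<Delta>)) m (cv (tD \<Delta> (tD \<Delta> \<Delta>)) n (\<lambda>w. tri b b' (pa w)) (\<lambda>w. tri c c' (pb w))) (\<lambda>w. tri d d' (pc w)) =
      cv (tD \<Delta> (tD \<Delta> \<Delta>)) m' (\<lambda>w. tri b b' (pa w)) (cv (tD \<Delta> (tD \<Delta> \<Delta>)) n' (\<lambda>w. tri c c' (pb w)) (\<lambda>w. tri d d' (pc w)))"
  shows "m (n x y) z = m' x (n' y z)"
proof -
  note l = cbilinear_left[OF bil(1)] cbilinear_right[OF bil(1)] cbilinear_left[OF bil(2)] cbilinear_right[OF bil(2)]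
    cbilinear_left[OF bil(3)] cbilinear_right[OF bil(3)] cbilinear_left[OF bil(4)] cbilinear_right[OF bil(4)]
  have 0: "m (n (tri b b' h) (tri c c' k)) (tri d d' q) = m' (tri b b' h) (n' (tri c c' k) (tri d d' q))" for b b' h c c' k d d' q
    using fun_cong[OF eq[of b b' c c' d d'], of "h \<otimes> (k \<otimes> q)"]
    unfolding eval3_left[OF bil(1,2) clinear_tri(3) clinear_tri(3) clinear_tri(3)]
      eval3_right[OF bil(3,4) clinear_tri(3) clinear_tri(3) clinear_tri(3)] .
  have 1: "m (n (tri b b' h) (tri c c' k)) z = m' (tri b b' h) (n' (tri c c' k) z)" for b b' h c c' k
    by (rule tri_ext[where t = z]) (rule l(2), rule clinear_compose[OF l(6) l(8)], rule 0)
  have 2: "m (n (tri b b' h) y) z = m' (tri b b' h) (n' y z)" for b b' h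
    by (rule tri_ext[where t = y]) (rule clinear_compose[OF l(1) l(4)], rule clinear_compose[OF l(6) l(7)], rule 1)
  show ?thesis
    by (rule tri_ext[where t = x]) (rule clinear_compose[OF l(1) l(3)], rule l(5), rule 2)
qed

end

section \<open>The candidate cocycle and the twisted product in coordinates\<close>

context central_crossed_product
begin

abbreviation "tmm \<equiv> central_crossed_product.mm \<Delta> \<epsilon> S act tr tr"
abbreviation "tpsi \<equiv> central_crossed_product.psi \<Delta> \<epsilon> S act tr tr"
abbreviation "trho \<equiv> central_crossed_product.rho \<Delta> \<epsilon> act tr"

lemmas tmm_src_left = central_crossed_product.mm_src_left[OF trivial_central]
  and tmm_tgt_left = central_crossed_product.mm_tgt_left[OF trivial_central]

text \<open>The left half of the twisted product, in which the cocycle has been applied through the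
  source but its inverse not yet through the target.\<close>

definition ltm where "ltm = qdd smul (stv \<sigma>) tmm"

lemmas cbilinear_tmm [simp] = central_crossed_product.cbilinear_mm[OF trivial_central]

lemma cbilinear_ltm [simp]: "cbilinear ltm"
  unfolding ltm_def by (rule cbilinear_qdd) simp_all

end

context crossed_points
begin

lemmas trivial_points = crossed_points.intro[OF trivial_central hopf_points_axioms]

lemma tmm_point:
  assumes pt: "pt \<alpha>" "pt \<beta>" and [simp]: "clinear f" "clinear f'" "clinear g" "clinear g'"
  shows "cv D tmm (X.Tp f f' \<alpha>) (X.Tp g g' \<beta>) = X.Tp (f \<star> (\<alpha> \<rhd> g)) ((\<alpha> \<rhd> g') \<star> f') (\<alpha> \<star> \<beta>)"
proof -
  note [simp] = pt pt_linear[OF pt(1)] pt_linear[OF pt(2)]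
  show ?thesis
    using crossed_points.mm_point[OF trivial_points assms] by (simp add: tr_point)
qed

lemma ltm_point:
  assumes pt: "pt \<alpha>" "pt \<beta>" and [simp]: "clinear f" "clinear f'" "clinear g" "clinear g'"
  shows "cv D ltm (X.Tp f f' \<alpha>) (X.Tp g g' \<beta>) = X.Tp (f \<star> (\<alpha> \<rhd> g) \<star> sg \<alpha> \<beta>) ((\<alpha> \<rhd> g') \<star> f') (\<alpha> \<star> \<beta>)"
proof -
  note [simp] = pt pt_linear[OF pt(1)] pt_linear[OF pt(2)]
  show ?thesis
    unfolding ltm_def
    by (subst qdd_point) (simp_all add: tmm_point stv_point act_unit_points X.smul_point)
qed

end

context central_crossed_product
begin

abbreviation "st \<equiv> stv \<sigma>"
abbreviation "st' \<equiv> stv \<sigma>'"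

lemma tmm_point_const:
  "(\<lambda>w. tmm (gen1 b b' w) (tri c 1 1)) = H2.XY.Tp (HH.conv_mult (H2.XY.cc b) (HH.conv_act \<pi>1 (H2.XY.cc c))) (H2.XY.cc b') \<pi>1"
  "(\<lambda>w. tmm (gen1 b b' w) (tri 1 c 1)) = H2.XY.Tp (H2.XY.cc b) (HH.conv_mult (HH.conv_act \<pi>1 (H2.XY.cc c)) (H2.XY.cc b')) \<pi>1"
  using crossed_points.mm_src_point_const(1,2)[OF HH.trivial_points pt_pi(1) H2.XY.clinear_cc H2.XY.clinear_cc, of b b' c] by simp_all

lemma stv_smul_left:
  assumes [simp]: "cbilinear s"
  shows "stv s (smul c x) y = c * stv s x y"
proof (rule bil_ext[where x = x and y = y])
  show "cbilinear (\<lambda>x y. stv s (smul c x) y)" by (rule cbilinear_compose) simp_all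
  show "cbilinear (\<lambda>x y. c * stv s x y)" by (rule cbilinear_post[of "\<lambda>z. c * z"]) simp_all
  fix b b' d d'
  have "cv (tD \<Delta> \<Delta>) (\<lambda>x y. stv s (smul c x) y) (gen1 b b') (gen2 d d') = cv (tD \<Delta> \<Delta>) (stv s) (gen1 (c * b) b') (gen2 d d')"
    by (rule cv_cong) (simp add: H2.XY.tri_point_apply)
  also have "\<dots> = (\<lambda>w. c * cv (tD \<Delta> \<Delta>) (stv s) (gen1 b b') (gen2 d d') w)"
  proof -
    let ?R = "HH.conv_mult (HH.conv_act \<pi>1 (H2.XY.cc d)) (HH.conv_mult (cv (tD \<Delta> \<Delta>) s \<pi>1 \<pi>2)
      (HH.conv_mult (HH.conv_act \<pi>1 (H2.XY.cc d')) (H2.XY.cc b')))"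
    have [simp]: "clinear ?R" by (simp add: HH.pt_linear)
    have "cv (tD \<Delta> \<Delta>) (stv s) (gen1 b b') (gen2 d d') = HH.conv_mult (H2.XY.cc b) ?R" for b
      by (simp add: HH.stv_point HH.mult_assoc HH.pt_linear)
    then show ?thesis by (simp only:) (simp add: H2.XY.cv_cc_left mult.assoc)
  qed
  also have "\<dots> = cv (tD \<Delta> \<Delta>) (\<lambda>x y. c * stv s x y) (gen1 b b') (gen2 d d')"
    by (rule ext, rule H2.XY.cv_post) simp_all
  finally show "cv (tD \<Delta> \<Delta>) (\<lambda>x y. stv s (smul c x) y) (gen1 b b') (gen2 d d') = cv (tD \<Delta> \<Delta>) (\<lambda>x y. c * stv s x y) (gen1 b b') (gen2 d d')" .
qed

lemma stv_tmul_left: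
  assumes [simp]: "cbilinear s"
  shows "stv s (tmul c x) y = stv s x y * c"
proof (rule bil_ext[where x = x and y = y])
  show "cbilinear (\<lambda>x y. stv s (tmul c x) y)" by (rule cbilinear_compose) simp_all
  show "cbilinear (\<lambda>x y. stv s x y * c)" by (rule cbilinear_post[of "\<lambda>z. z * c"]) simp_all
  fix b b' d d'
  have "cv (tD \<Delta> \<Delta>) (\<lambda>x y. stv s (tmul c x) y) (gen1 b b') (gen2 d d') = cv (tD \<Delta> \<Delta>) (stv s) (gen1 b (b' * c)) (gen2 d d')"
    by (rule cv_cong) (simp add: H2.XY.tri_point_apply)
  also have "\<dots> = (\<lambda>w. cv (tD \<Delta> \<Delta>) (stv s) (gen1 b b') (gen2 d d') w * c)"
  proof -
    have "HH.conv_mult X (H2.XY.cc (b' * c)) = (\<lambda>w. HH.conv_mult X (H2.XY.cc b') w * c)" if "clinear X" for X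
      using that by (simp add: H2.XY.cv_cc_right mult.assoc)
    then show ?thesis by (simp add: HH.stv_point HH.pt_linear)
  qed
  also have "\<dots> = cv (tD \<Delta> \<Delta>) (\<lambda>x y. stv s x y * c) (gen1 b b') (gen2 d d')"
    by (rule ext, rule H2.XY.cv_post) simp_all
  finally show "cv (tD \<Delta> \<Delta>) (\<lambda>x y. stv s (tmul c x) y) (gen1 b b') (gen2 d d') = cv (tD \<Delta> \<Delta>) (\<lambda>x y. stv s x y * c) (gen1 b b') (gen2 d d')" .
qed

text \<open>Right multiplication of the first argument by a source or target inserts the action of
  its point on \<open>c\<close>; acting on the corresponding component of the second argument gives
  the same factor by multiplicativity of the action.\<close>

lemma stv_right:
  assumes s [simp]: "cbilinear s"
  shows "stv s x (smul c y) = stv s (tmm x (tri c 1 1)) y" "stv s x (tmul c y) = stv s (tmm x (tri 1 c 1)) y"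
proof -
  note [simp] = HH.pt_linear[OF pt_pi(1)] HH.pt_linear[OF pt_pi(2)]
  note l = cbilinear_tmm[THEN cbilinear_left]
  have 1: "cv (tD \<Delta> \<Delta>) (\<lambda>x y. stv s x (smul c y)) (gen1 b b') (gen2 d d') =
      cv (tD \<Delta> \<Delta>) (\<lambda>x y. stv s (tmm x (tri c 1 1)) y) (gen1 b b') (gen2 d d')" for b b' d d'
  proof -
    have "cv (tD \<Delta> \<Delta>) (\<lambda>x y. stv s x (smul c y)) (gen1 b b') (gen2 d d') =
        cv (tD \<Delta> \<Delta>) (stv s) (gen1 b b') (H2.XY.Tp (HH.conv_mult (H2.XY.cc c) (H2.XY.cc d)) (H2.XY.cc d') \<pi>2)"
      by (rule cv_cong) (simp add: H2.XY.tri_point_apply H2.XY.cv_cc_cc[OF cbilinear_mult])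
    also have "\<dots> = cv (tD \<Delta> \<Delta>) (stv s) (\<lambda>w. tmm (gen1 b b' w) (tri c 1 1)) (gen2 d d')"
      unfolding tmm_point_const by (simp add: HH.stv_point HH.act_mult_points HH.mult_assoc)
    also have "\<dots> = cv (tD \<Delta> \<Delta>) (\<lambda>x y. stv s (tmm x (tri c 1 1)) y) (gen1 b b') (gen2 d d')"
      by (rule cv_cong) simp
    finally show ?thesis .
  qed
  have 2: "cv (tD \<Delta> \<Delta>) (\<lambda>x y. stv s x (tmul c y)) (gen1 b b') (gen2 d d') =
      cv (tD \<Delta> \<Delta>) (\<lambda>x y. stv s (tmm x (tri 1 c 1)) y) (gen1 b b') (gen2 d d')" for b b' d d'
  proof -
    have "cv (tD \<Delta> \<Delta>) (\<lambda>x y. stv s x (tmul c y)) (gen1 b b') (gen2 d d') =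
        cv (tD \<Delta> \<Delta>) (stv s) (gen1 b b') (H2.XY.Tp (H2.XY.cc d) (HH.conv_mult (H2.XY.cc d') (H2.XY.cc c)) \<pi>2)"
      by (rule cv_cong) (simp add: H2.XY.tri_point_apply H2.XY.cv_cc_cc[OF cbilinear_mult])
    also have "\<dots> = cv (tD \<Delta> \<Delta>) (stv s) (\<lambda>w. tmm (gen1 b b' w) (tri 1 c 1)) (gen2 d d')"
      unfolding tmm_point_const by (simp add: HH.stv_point HH.act_mult_points HH.mult_assoc)
    also have "\<dots> = cv (tD \<Delta> \<Delta>) (\<lambda>x y. stv s (tmm x (tri 1 c 1)) y) (gen1 b b') (gen2 d d')"
      by (rule cv_cong) simp
    finally show ?thesis .
  qed
  show "stv s x (smul c y) = stv s (tmm x (tri c 1 1)) y"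
    by (rule bil_ext[where x = x and y = y, OF cbilinear_compose[OF cbilinear_stv[OF s] clinear_id clinear_smul]
        cbilinear_compose[OF cbilinear_stv[OF s] l clinear_id] 1])
  show "stv s x (tmul c y) = stv s (tmm x (tri 1 c 1)) y"
    by (rule bil_ext[where x = x and y = y, OF cbilinear_compose[OF cbilinear_stv[OF s] clinear_id clinear_tmul]
        cbilinear_compose[OF cbilinear_stv[OF s] l clinear_id] 2])
qed

lemma ltm_tmul_left: "ltm (tmul c x) y = tmul c (ltm x y)"
proof (rule bil_ext[where x = x and y = y])
  note [simp] = HH.pt_linear[OF pt_pi(1)] HH.pt_linear[OF pt_pi(2)]
  show "cbilinear (\<lambda>x y. ltm (tmul c x) y)" by (rule cbilinear_compose) simp_all
  show "cbilinear (\<lambda>x y. tmul c (ltm x y))" by (rule cbilinear_post[OF clinear_tmul cbilinear_ltm])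
  fix b b' d d'
  let ?X = "HH.conv_mult (HH.conv_mult (H2.XY.cc b) (HH.conv_act \<pi>1 (H2.XY.cc d))) (HH.sg \<pi>1 \<pi>2)"
  let ?Y = "HH.conv_mult (HH.conv_act \<pi>1 (H2.XY.cc d')) (H2.XY.cc b')"
  have "cv (tD \<Delta> \<Delta>) (\<lambda>x y. ltm (tmul c x) y) (gen1 b b') (gen2 d d') =
      cv (tD \<Delta> \<Delta>) ltm (H2.XY.Tp (H2.XY.cc b) (HH.conv_mult (H2.XY.cc b') (H2.XY.cc c)) \<pi>1) (gen2 d d')"
    by (rule cv_cong) (simp add: H2.XY.tri_point_apply H2.XY.cv_cc_cc[OF cbilinear_mult])
  also have "\<dots> = H2.XY.Tp ?X (HH.conv_mult ?Y (H2.XY.cc c)) (HH.conv_mult \<pi>1 \<pi>2)"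
    by (simp add: HH.ltm_point HH.mult_assoc)
  also have "\<dots> = cv (tD \<Delta> \<Delta>) tmul (H2.XY.cc c) (cv (tD \<Delta> \<Delta>) ltm (gen1 b b') (gen2 d d'))"
    by (simp add: HH.ltm_point H2.XY.tmul_point)
  also have "\<dots> = (\<lambda>w. tmul c (cv (tD \<Delta> \<Delta>) ltm (gen1 b b') (gen2 d d') w))"
    by (rule H2.XY.cv_cc_left) simp_all
  also have "\<dots> = cv (tD \<Delta> \<Delta>) (\<lambda>x y. tmul c (ltm x y)) (gen1 b b') (gen2 d d')"
    by (rule ext, rule H2.XY.cv_post) simp_all
  finally show "cv (tD \<Delta> \<Delta>) (\<lambda>x y. ltm (tmul c x) y) (gen1 b b') (gen2 d d') = cv (tD \<Delta> \<Delta>) (\<lambda>x y. tmul c (ltm x y)) (gen1 b b') (gen2 d d')" .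
qed

lemma ltm_tmul_right: "ltm x (tmul c y) = ltm (tmm x (tri 1 c 1)) y"
proof (rule bil_ext[where x = x and y = y])
  note [simp] = HH.pt_linear[OF pt_pi(1)] HH.pt_linear[OF pt_pi(2)]
  show "cbilinear (\<lambda>x y. ltm x (tmul c y))" by (rule cbilinear_compose) simp_all
  show "cbilinear (\<lambda>x y. ltm (tmm x (tri 1 c 1)) y)"
    by (rule cbilinear_compose[OF cbilinear_ltm cbilinear_left[OF cbilinear_tmm] clinear_id])
  fix b b' d d'
  have "cv (tD \<Delta> \<Delta>) (\<lambda>x y. ltm x (tmul c y)) (gen1 b b') (gen2 d d') =
      cv (tD \<Delta> \<Delta>) ltm (gen1 b b') (H2.XY.Tp (H2.XY.cc d) (HH.conv_mult (H2.XY.cc d') (H2.XY.cc c)) \<pi>2)"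
    by (rule cv_cong) (simp add: H2.XY.tri_point_apply H2.XY.cv_cc_cc[OF cbilinear_mult])
  also have "\<dots> = cv (tD \<Delta> \<Delta>) ltm (\<lambda>w. tmm (gen1 b b' w) (tri 1 c 1)) (gen2 d d')"
    unfolding tmm_point_const by (simp add: HH.ltm_point HH.act_mult_points HH.mult_assoc)
  also have "\<dots> = cv (tD \<Delta> \<Delta>) (\<lambda>x y. ltm (tmm x (tri 1 c 1)) y) (gen1 b b') (gen2 d d')"
    by (rule cv_cong) simp
  finally show "cv (tD \<Delta> \<Delta>) (\<lambda>x y. ltm x (tmul c y)) (gen1 b b') (gen2 d d') = cv (tD \<Delta> \<Delta>) (\<lambda>x y. ltm (tmm x (tri 1 c 1)) y) (gen1 b b') (gen2 d d')" .
qed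

text \<open>The left half contributes \<sigma> to the first B-component. The target of the inverse
  form contributes the inverse cocycle together with both right-hand components to the second. This
  is the product of the crossed product.\<close>

lemma twisted_product: "qdd (\<lambda>z p. tmul p z) ltm st' a a' = mm a a'"
proof (rule bil_ext[where x = a and y = a'])
  note [simp] = HH.pt_linear[OF pt_pi(1)] HH.pt_linear[OF pt_pi(2)]
  have f [simp]: "cbilinear (\<lambda>z p. tmul p z)" by (rule cbilinear_flip) simp
  show "cbilinear (qdd (\<lambda>z p. tmul p z) ltm st')" by (rule cbilinear_qdd) simp_all
  show "cbilinear mm" by simp
  fix b b' d d'
  have c: "cv (tD \<Delta> \<Delta>) (\<lambda>z p. tmul p z) u v = cv (tD \<Delta> \<Delta>) tmul v u" if "clinear u" "clinear v" for u v
    using H2.XY.cv_comm[OF f that] by simp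
  show "cv (tD \<Delta> \<Delta>) (qdd (\<lambda>z p. tmul p z) ltm st') (gen1 b b') (gen2 d d') = cv (tD \<Delta> \<Delta>) mm (gen1 b b') (gen2 d d')"
    by (subst HH.qdd_point) (simp_all add: c HH.ltm_point HH.stv_point HH.act_unit_points H2.XY.tmul_point HH.mm_point)
qed

text \<open>Splitting both arguments puts the factor \<open>s\<close> at the end of the first value
  and \<open>s'\<close> at the start of the second, so they are adjacent and cancel.\<close>

lemma stv_conv:
  assumes s [simp]: "cbilinear s" "cbilinear s'" and inv: "HH.conv_mult (cv (tD \<Delta> \<Delta>) s \<pi>1 \<pi>2) (cv (tD \<Delta> \<Delta>) s' \<pi>1 \<pi>2) = H2.XY.cc 1"
  shows "qdd (*) (stv s) (stv s') a a' = ee (tmm a a')"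
proof (rule bil_ext[where x = a and y = a'])
  note [simp] = HH.pt_linear[OF pt_pi(1)] HH.pt_linear[OF pt_pi(2)]
  show "cbilinear (qdd (*) (stv s) (stv s'))" by (rule cbilinear_qdd) simp_all
  show "cbilinear (\<lambda>a a'. ee (tmm a a'))" by (rule cbilinear_post[OF clinear_ee cbilinear_tmm])
  fix b b' d d'
  let ?s = "cv (tD \<Delta> \<Delta>) s \<pi>1 \<pi>2" and ?s' = "cv (tD \<Delta> \<Delta>) s' \<pi>1 \<pi>2"
  let ?u = "HH.conv_mult (H2.XY.cc b) (HH.conv_act \<pi>1 (H2.XY.cc d))" and ?v = "HH.conv_mult (HH.conv_act \<pi>1 (H2.XY.cc d')) (H2.XY.cc b')"
  have "cv (tD \<Delta> \<Delta>) (qdd (*) (stv s) (stv s')) (gen1 b b') (gen2 d d') = HH.conv_mult (HH.conv_mult ?u ?s) (HH.conv_mult ?s' ?v)"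
    by (subst HH.qdd_point) (simp_all add: HH.stv_point HH.act_unit_points HH.mult_assoc)
  also have "\<dots> = HH.conv_mult (HH.conv_mult ?u (HH.conv_mult ?s ?s')) ?v"
    by (simp add: HH.mult_assoc)
  also have "\<dots> = HH.conv_mult ?u ?v" by (simp add: inv)
  also have "\<dots> = (\<lambda>w. ee (cv (tD \<Delta> \<Delta>) tmm (gen1 b b') (gen2 d d') w))"
    by (simp add: HH.tmm_point HH.ee_point)
  also have "\<dots> = cv (tD \<Delta> \<Delta>) (\<lambda>a a'. ee (tmm a a')) (gen1 b b') (gen2 d d')"
    by (rule ext, rule H2.XY.cv_post) simp_all
  finally show "cv (tD \<Delta> \<Delta>) (qdd (*) (stv s) (stv s')) (gen1 b b') (gen2 d d') = cv (tD \<Delta> \<Delta>) (\<lambda>a a'. ee (tmm a a')) (gen1 b b') (gen2 d d')" .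
qed

text \<open>The computation is that for associativity of the crossed product, with the second
  B-components as further factors on the right; these match because the action is
  multiplicative.\<close>

lemma st_cocycle: "st (ltm x y) z = st x (ltm y z)"
proof (rule assoc_ext[where m = st and n = ltm and m' = st and n' = ltm])
  fix b b' c c' d d' :: 'b
  have pts [simp]: "HHH.pt pa" "HHH.pt pb" "HHH.pt pc"
    by (rule H3.p1_coalg_map coalg_map_compose[OF H3.p2_coalg_map] H2.p1_coalg_map H2.p2_coalg_map)+
  note lin [simp] = pts[THEN HHH.pt_linear]
  have "cv E3 st (cv E3 ltm (H3.XY.Tp (H3.XY.cc b) (H3.XY.cc b') pa) (H3.XY.Tp (H3.XY.cc c) (H3.XY.cc c') pb)) (H3.XY.Tp (H3.XY.cc d) (H3.XY.cc d') pc) =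
      cv E3 st (H3.XY.Tp (H3.XY.cc b) (H3.XY.cc b') pa) (cv E3 ltm (H3.XY.Tp (H3.XY.cc c) (H3.XY.cc c') pb) (H3.XY.Tp (H3.XY.cc d) (H3.XY.cc d') pc))"
  proof -
    let ?m = "HHH.conv_mult" and ?a = "HHH.conv_act" and ?c = "H3.XY.cc" and ?s = "HHH.sg"
    have "?m (?m (?m (?m (?m (?m (?c b) (?a pa (?c c))) (?s pa pb)) (?a (?m pa pb) (?c d))) (?s (?m pa pb) pc)) (?a (?m pa pb) (?c d'))) (?m (?a pa (?c c')) (?c b')) =
        ?m (?m (?m (?m (?m (?m (?c b) (?a pa (?c c))) (?a (?m pa pb) (?c d))) (?s pa pb)) (?s (?m pa pb) pc)) (?a (?m pa pb) (?c d'))) (?m (?a pa (?c c')) (?c b'))"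
    proof -
      \<comment> \<open>Centrality of \<sigma> is used here, to bring the two cocycle values next to
        each other for the cocycle identity.\<close>
      have "?m (?s pa pb) (?a (?m pa pb) (?c d)) = ?m (?a (?m pa pb) (?c d)) (?s pa pb)"
        by (rule HHH.sg_commute) simp_all
      then show ?thesis by (simp add: HHH.mult_assoc[of "?m (?c b) (?a pa (?c c))" "?s pa pb"]
          HHH.mult_assoc[of "?m (?c b) (?a pa (?c c))" "?a (?m pa pb) (?c d)"])
    qed
    also have "\<dots> = ?m (?m (?m (?m (?c b) (?a pa (?c c))) (?a (?m pa pb) (?c d))) (?m (?s pa pb) (?s (?m pa pb) pc))) (?m (?a (?m pa pb) (?c d')) (?m (?a pa (?c c')) (?c b')))"
      by (simp add: HHH.mult_assoc)
    also have "?m (?s pa pb) (?s (?m pa pb) pc) = ?m (?a pa (?s pb pc)) (?s pa (?m pb pc))"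
      by (rule HHH.cocycle_points[symmetric]) simp_all
    finally show ?thesis
      by (simp add: HHH.ltm_point HHH.stv_point HHH.mult_assoc HHH.act_mult_points HHH.act_act_points)
  qed
  then show "cv E3 st (cv E3 ltm (\<lambda>w. tri b b' (pa w)) (\<lambda>w. tri c c' (pb w))) (\<lambda>w. tri d d' (pc w)) =
      cv E3 st (\<lambda>w. tri b b' (pa w)) (cv E3 ltm (\<lambda>w. tri c c' (pb w)) (\<lambda>w. tri d d' (pc w)))"
    by (simp only: H3.XY.tri_point[OF lin(1)] H3.XY.tri_point[OF lin(2)] H3.XY.tri_point[OF lin(3)])
qed simp_all

lemma st_one: "st (tri 1 1 1) x = ee x" "st x (tri 1 1 1) = ee x"
proof -
  have 1: "(\<lambda>h. st (tri 1 1 1) (gen b b' h)) = (\<lambda>h. ee (gen b b' h))" for b b'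
  proof -
    have "(\<lambda>h. st (tri 1 1 1) (gen b b' h)) = cv \<Delta> st (H.cc (tri 1 1 1)) (gen b b')"
      by (rule H.cv_cc_left[symmetric]) simp_all
    also have "\<dots> = (\<lambda>h. ee (gen b b' h))"
      unfolding H.cc_tri by (simp add: H.stv_point H.ee_point H.act_one_point)
    finally show ?thesis .
  qed
  have 2: "(\<lambda>h. st (gen b b' h) (tri 1 1 1)) = (\<lambda>h. ee (gen b b' h))" for b b'
  proof -
    have "(\<lambda>h. st (gen b b' h) (tri 1 1 1)) = cv \<Delta> st (gen b b') (H.cc (tri 1 1 1))"
      by (rule H.cv_cc_right[symmetric]) simp_all
    also have "\<dots> = (\<lambda>h. ee (gen b b' h))"
      unfolding H.cc_tri by (simp add: H.stv_point H.ee_point H.act_unit_points)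
    finally show ?thesis .
  qed
  show "st (tri 1 1 1) x = ee x" by (rule gen_ext[OF _ clinear_ee 1]) (simp add: cbilinear_right)
  show "st x (tri 1 1 1) = ee x" by (rule gen_ext[OF _ clinear_ee 2]) (simp add: cbilinear_left)
qed

end

section \<open>Twisting in coordinates\<close>

lemma sum_list_concat_map: "(\<Sum>x\<leftarrow>concat xss. f x) = (\<Sum>xs\<leftarrow>xss. \<Sum>x\<leftarrow>xs. f x)"
  by (induction xss) simp_all

lemma sum_list_cop3:
  "(\<Sum>(a1, a2, a3)\<leftarrow>cop3 L a. f a1 a2 a3) = (\<Sum>(x, y)\<leftarrow>cop L a. \<Sum>(x1, x2)\<leftarrow>cop L x. f x1 x2 y)"
  unfolding cop3_def by (simp add: sum_list_concat_map o_def case_prod_unfold)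

context presented_bialgebroid
begin

text \<open>The conditions of \<open>bihom\<close> in coordinates, with source and target treated
  one at a time.\<close>

definition balanced :: "((('b, 'b) tensor, 'h) tensor \<Rightarrow> (('b, 'b) tensor, 'h) tensor \<Rightarrow> 'b) \<Rightarrow> bool" where
  "balanced F \<longleftrightarrow> cbilinear F \<and>
    (\<forall>c x y. F (smul c x) y = c * F x y) \<and> (\<forall>c x y. F (tmul c x) y = F x y * c) \<and>
    (\<forall>c x y. F x (smul c y) = F (mm x (tri c 1 1)) y) \<and> (\<forall>c x y. F x (tmul c y) = F (mm x (tri 1 c 1)) y)"

lemma balanced_simps:
  assumes "balanced F"
  shows "cbilinear F" "F (smul c x) y = c * F x y" "F (tmul c x) y = F x y * c"
    "F x (smul c y) = F (mm x (tri c 1 1)) y" "F x (tmul c y) = F (mm x (tri 1 c 1)) y"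
  using assms by (simp_all add: balanced_def)

lemma smul_tmul_mm: "smul b (tmul b' x) = mm (tri b b' 1) x"
  using mm_assoc[of "tri b 1 1" "tri 1 b' 1" x] by (simp add: mm_src_left mm_tgt_left)

lemma bihom_of_balanced:
  assumes F: "balanced F" and f: "\<And>x y. f (P x) (P y) = F x y"
  shows "bihom L f"
proof -
  note F' = balanced_simps[OF F]
  have "F (mm x (tri b b' 1)) y = F x (smul b (tmul b' y))" for b b' x y
  proof -
    have "mm x (tri b b' 1) = mm (mm x (tri b 1 1)) (tri 1 b' 1)"
      by (simp add: mm_assoc mm_src_left)
    then show ?thesis by (simp add: F')
  qed
  then show ?thesis
    unfolding bihom_def carrier
    by (auto simp: f eta_mul F' mult.assoc[symmetric] intro!: linear_on_P' cbilinear_left[OF F'(1)] cbilinear_right[OF F'(1)])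
      (simp_all add: eta mul f)
qed

lemma balanced_of_bihom:
  assumes g: "bihom L g"
  shows "balanced (\<lambda>x y. g (P x) (P y))"
proof -
  have e: "eta L b 1 = P (tri b 1 1)" "eta L 1 b = P (tri 1 b 1)" for b
    by (simp_all add: eta)
  have c: "cbilinear (\<lambda>x y. g (P x) (P y))"
  proof (rule cbilinearI; rule clinearI)
    fix x y z c
    show "g (P (x + y)) (P z) = g (P x) (P z) + g (P y) (P z)" "g (P z) (P (x + y)) = g (P z) (P x) + g (P z) (P y)"
      "g (P (c *\<^sub>C x)) (P z) = c *\<^sub>C g (P x) (P z)" "g (P z) (P (c *\<^sub>C x)) = c *\<^sub>C g (P z) (P x)"
      using g unfolding bihom_def linear_on_def carrier
      by (auto simp flip: P_add P_scale)
  qed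
  have r: "g (P (mm x (tri b b' 1))) (P y) = g (P x) (P (smul b (tmul b' y)))" for b b' x y
    using g by (simp add: bihom_def carrier eta mul smul_tmul_mm)
  have l: "g (P (smul b (tmul b' x))) (P y) = b * g (P x) (P y) * b'" for b b' x y
    using g by (simp add: bihom_def carrier eta mul smul_tmul_mm)
  show ?thesis
    unfolding balanced_def
    using c l[of _ 1] l[of 1] r[of _ _ 1] r[of _ 1] by simp
qed

lemma qdd_eq: "qdd m n p a a' = tlift (\<lambda>x' y'. tlift (\<lambda>x y. m (n x x') (p y y')) (dd a)) (dd a')"
  by (simp add: qdd_def quad_def)

lemma conv_coordinates:
  assumes F: "balanced F" and G: "balanced G" and f: "\<And>x y. f (P x) (P y) = F x y" and g: "\<And>x y. g (P x) (P y) = G x y"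
  shows "conv L f g (P a) (P a') = qdd (*) F G a a'"
proof -
  note F' = balanced_simps[OF F] and G' = balanced_simps[OF G]
  show ?thesis
    unfolding conv_def qdd_eq
    by (subst cop_sum2)
      (simp_all add: f g F' G' mult.assoc cbilinear_compose[OF cbilinear_mult] cbilinear_left[OF F'(1)] cbilinear_left[OF G'(1)]
        cbilinear_right[OF F'(1)] cbilinear_right[OF G'(1)])
qed

lemma P_smul_mm_bil:
  assumes F: "cbilinear F"
  shows "cbilinear (\<lambda>x y. P (smul (F x x') (mm y y')))" "cbilinear (\<lambda>x' y'. P (smul (F x x') (mm y y')))"
  by (rule cbilinear_post[OF P_linear], rule cbilinear_compose[OF cbilinear_smul],
      rule cbilinear_left[OF F] cbilinear_right[OF F], rule cbilinear_left[OF cbilinear_mm] cbilinear_right[OF cbilinear_mm])+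

lemma left_twisted_mult_coordinates:
  assumes F: "balanced F" and f: "\<And>x y. f (P x) (P y) = F x y"
  shows "left_twisted_mult L f (P a) (P a') = P (qdd smul F mm a a')"
proof -
  note F' = balanced_simps[OF F]
  note B = P_smul_mm_bil[OF F'(1)]
  have i: "mm x (smul b x') = mm (mm x (tri b 1 1)) x'" for x b x'
    by (simp add: mm_assoc mm_src_left)
  have "left_twisted_mult L f (P a) (P a') = tlift (\<lambda>x' y'. tlift (\<lambda>x y. P (smul (F x x') (mm y y'))) (dd a)) (dd a')"
    unfolding left_twisted_mult_def
    by (subst cop_sum2) (simp_all add: f mul src_mul F' B i mm_smul smul_smul)
  also have "\<dots> = P (qdd smul F mm a a')"
  proof -
    have b1: "cbilinear (\<lambda>x y. smul (F x x') (mm y y'))" for x' y'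
      by (rule cbilinear_compose[OF cbilinear_smul cbilinear_left[OF F'(1)] cbilinear_left[OF cbilinear_mm]])
    have b2: "cbilinear (\<lambda>x' y'. tlift (\<lambda>x y. smul (F x x') (mm y y')) (dd a))"
      by (rule cbilinearI; rule clinear_tlift_param)
        (rule clinear_compose[OF cbilinear_left[OF cbilinear_smul] cbilinear_right[OF F'(1)]],
         rule clinear_compose[OF cbilinear_right[OF cbilinear_smul] cbilinear_right[OF cbilinear_mm]])
    show ?thesis unfolding qdd_eq tlift_post[OF P_linear b2] tlift_post[OF P_linear b1] ..
  qed
  finally show ?thesis .
qed

text \<open>B-components of the first argument come out by bilinearity; those of the second are
  shifted to the right of the first. A balanced form is thus determined on 1 \<otimes> 1 \<otimes>
  H.\<close>

lemma balanced_ext: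
  assumes F: "balanced F" and G: "balanced G" and eq: "\<And>h k. F (tri 1 1 h) (tri 1 1 k) = G (tri 1 1 h) (tri 1 1 k)"
  shows "F x y = G x y"
proof -
  note F' = balanced_simps[OF F] and G' = balanced_simps[OF G]
  have t: "tri b b' h = smul b (tmul b' (tri 1 1 h))" for b b' :: 'b and h :: 'h by simp
  have 1: "F x (tri 1 1 k) = G x (tri 1 1 k)" for x k
  proof (rule tri_ext[where t = x, OF cbilinear_left[OF F'(1)] cbilinear_left[OF G'(1)]])
    fix b b' h
    show "F (tri b b' h) (tri 1 1 k) = G (tri b b' h) (tri 1 1 k)"
      unfolding t[of b b'] by (simp only: F' G' eq)
  qed
  show ?thesis
  proof (rule tri_ext[where t = y, OF cbilinear_right[OF F'(1)] cbilinear_right[OF G'(1)]])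
    fix b b' h
    show "F x (tri b b' h) = G x (tri b b' h)"
      unfolding t[of b b'] by (simp only: F' G' 1)
  qed
qed

abbreviation restr :: "((('b, 'b) tensor, 'h) tensor \<Rightarrow> (('b, 'b) tensor, 'h) tensor \<Rightarrow> 'b) \<Rightarrow> ('h, 'h) tensor \<Rightarrow> 'b" where
  "restr F \<equiv> cv E2 F (gen1 1 1) (gen2 1 1)"

text \<open>Restriction turns convolution over the bialgebroid into ordinary convolution of maps
  from H \<otimes> H to B, where associativity is available.\<close>

lemma restr_qdd:
  assumes [simp]: "cbilinear F" "cbilinear G"
  shows "restr (qdd (*) F G) = HH.conv_mult (restr F) (restr G)"
  by (rule HH.qdd_point) simp_all

lemma restr_unit: "restr (\<lambda>a a'. ee (mm a a')) = H2.XY.cc 1"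
proof -
  note [simp] = HH.pt_linear[OF pt_pi(1)] HH.pt_linear[OF pt_pi(2)]
  have "restr (\<lambda>a a'. ee (mm a a')) = (\<lambda>w. ee (cv E2 mm (gen1 1 1) (gen2 1 1) w))"
    by (rule ext, rule H2.XY.cv_post[symmetric]) simp_all
  also have "\<dots> = H2.XY.cc 1"
    by (simp add: HH.mm_point HH.ee_point HH.act_unit_points HH.sg_inverse)
  finally show ?thesis .
qed

text \<open>A left inverse equals a right inverse in the convolution algebra over H \<otimes> H, and
  balanced forms with equal restrictions coincide. Thus the arbitrarily chosen
  \<open>conv_inverse\<close> is the expected one.\<close>

lemma conv_inverse_unique:
  assumes F: "balanced F" and G: "balanced G" and G': "balanced G'"
    and inv: "\<And>a a'. qdd (*) G' F a a' = ee (mm a a')" "\<And>a a'. qdd (*) F G a a' = ee (mm a a')"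
  shows "G' x y = G x y"
proof -
  note c [simp] = balanced_simps(1)[OF F] balanced_simps(1)[OF G] balanced_simps(1)[OF G']
  have "qdd (*) G' F = (\<lambda>a a'. ee (mm a a'))" "qdd (*) F G = (\<lambda>a a'. ee (mm a a'))"
    using inv by (simp_all add: fun_eq_iff)
  then have 1: "HH.conv_mult (restr G') (restr F) = H2.XY.cc 1" "HH.conv_mult (restr F) (restr G) = H2.XY.cc 1"
    using restr_qdd[OF c(3,1)] restr_qdd[OF c(1,2)] by (simp_all add: restr_unit)
  have "restr G' = HH.conv_mult (restr G') (HH.conv_mult (restr F) (restr G))"
    by (simp add: 1)
  also have "\<dots> = HH.conv_mult (HH.conv_mult (restr G') (restr F)) (restr G)"
    by (rule HH.mult_assoc[symmetric]) simp_all
  also have "\<dots> = restr G" by (simp add: 1)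
  finally have "restr G' = restr G" .
  then have "G' (tri 1 1 h) (tri 1 1 k) = G (tri 1 1 h) (tri 1 1 k)" for h k
    using eval_gen2[OF c(2), of 1 1 1 1 h k] eval_gen2[OF c(3), of 1 1 1 1 h k] by simp
  then show ?thesis by (rule balanced_ext[OF G' G])
qed

lemma is_conv_inverse_coordinates:
  assumes F: "balanced F" and G: "balanced G"
    and f: "\<And>x y. f (P x) (P y) = F x y" and g: "\<And>x y. g (P x) (P y) = G x y"
    and inv: "\<And>a a'. qdd (*) F G a a' = ee (mm a a')" "\<And>a a'. qdd (*) G F a a' = ee (mm a a')"
  shows "is_conv_inverse L f g"
  unfolding is_conv_inverse_def carrier
  by (auto simp: bihom_of_balanced[OF G g] conv_coordinates[OF F G f g] conv_coordinates[OF G F g f] inv mul counit)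

lemma conv_inverse_coordinates:
  assumes F: "balanced F" and G: "balanced G" and f: "\<And>x y. f (P x) (P y) = F x y"
    and inv: "\<And>a a'. qdd (*) F G a a' = ee (mm a a')" "\<And>a a'. qdd (*) G F a a' = ee (mm a a')"
  shows "conv_inverse L f (P x) (P y) = G x y"
proof -
  let ?g = "conv_inverse L f" and ?G = "\<lambda>x y. conv_inverse L f (P x) (P y)"
  have "is_conv_inverse L f (\<lambda>x y. G (R x) (R y))"
    by (rule is_conv_inverse_coordinates[OF F G f _ inv]) simp
  then have g: "is_conv_inverse L f ?g"
    unfolding conv_inverse_def by (rule someI[where P = "is_conv_inverse L f"])
  then have b: "balanced ?G" by (intro balanced_of_bihom) (simp add: is_conv_inverse_def)
  have "qdd (*) ?G F a a' = ee (mm a a')" for a a'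
    using g conv_coordinates[OF b F refl f, of a a'] by (simp add: is_conv_inverse_def carrier mul counit)
  from conv_inverse_unique[OF F G b this inv(1)] show ?thesis .
qed

text \<open>\<open>K\<close> names the left half of the twisted product. Its assumed compatibility
  with \<open>tmul\<close> is what makes the outer sum, over the last legs, balanced.\<close>

lemma twist_mult_coordinates:
  assumes F: "balanced F" and G: "balanced G" and f: "\<And>x y. f (P x) (P y) = F x y"
    and inv: "\<And>a a'. qdd (*) F G a a' = ee (mm a a')" "\<And>a a'. qdd (*) G F a a' = ee (mm a a')"
    and K: "\<And>x y. qdd smul F mm x y = K x y"
      "\<And>c x y. K (tmul c x) y = tmul c (K x y)" "\<And>c x y. K x (tmul c y) = K (mm x (tri 1 c 1)) y"
  shows "bmul (twist L f) (P a) (P a') = P (qdd (\<lambda>z p. tmul p z) K G a a')"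
proof -
  note F' = balanced_simps[OF F] and G' = balanced_simps[OF G]
  note g = conv_inverse_coordinates[OF F G f inv]
  have "qdd smul F mm = K" by (intro ext) (rule K(1))
  then have cK [simp]: "cbilinear K"
    using cbilinear_qdd[OF cbilinear_smul F'(1) cbilinear_mm] by simp
  have i: "mm x (smul b x') = mm (mm x (tri b 1 1)) x'" for x b x'
    by (simp add: mm_assoc mm_src_left)
  \<comment> \<open>With the last legs \<open>v\<close> and \<open>v'\<close> fixed, the sum over
    the first two legs is the left half \<open>K\<close>, multiplied by a constant target that
    commutes with the sources.\<close>
  have inner: "(\<Sum>(x1, x2)\<leftarrow>cop L (P u). \<Sum>(x1', x2')\<leftarrow>cop L (P u').
      bmul L (src L (f x1 x1')) (bmul L (tgt L (conv_inverse L f (P v) (P v'))) (bmul L x2 x2'))) = P (tmul (G v v') (K u u'))"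
    for u u' v v'
  proof -
    let ?c = "G v v'"
    have l: "clinear (\<lambda>x. P (tmul ?c x))" by (rule clinear_compose[OF P_linear]) simp
    have b: "cbilinear (\<lambda>x y. smul (F x x') (mm y y'))" "cbilinear (\<lambda>x' y'. smul (F x x') (mm y y'))" for x x' y y'
      by (rule cbilinear_compose[OF cbilinear_smul cbilinear_left[OF F'(1)] cbilinear_left[OF cbilinear_mm]]
          cbilinear_compose[OF cbilinear_smul cbilinear_right[OF F'(1)] cbilinear_right[OF cbilinear_mm]])+
    note B = cbilinear_post[OF l b(1)] cbilinear_post[OF l b(2)]
    have b2: "cbilinear (\<lambda>x' y'. tlift (\<lambda>x y. smul (F x x') (mm y y')) (dd u))"
      by (rule cbilinearI; rule clinear_tlift_param) (rule cbilinear_left[OF b(2)], rule cbilinear_right[OF b(2)])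
    have "(\<Sum>(x1, x2)\<leftarrow>cop L (P u). \<Sum>(x1', x2')\<leftarrow>cop L (P u').
      bmul L (src L (f x1 x1')) (bmul L (tgt L (conv_inverse L f (P v) (P v'))) (bmul L x2 x2'))) =
      tlift (\<lambda>x' y'. tlift (\<lambda>x y. P (tmul ?c (smul (F x x') (mm y y')))) (dd u)) (dd u')"
      by (subst cop_sum2) (simp_all add: f g mul src_mul tgt_mul F' smul_tmul B i mm_smul smul_smul)
    also have "\<dots> = P (tmul ?c (qdd smul F mm u u'))"
      unfolding qdd_eq tlift_post[OF l b2] tlift_post[OF l b(1)] ..
    finally show ?thesis unfolding K(1) .
  qed
  \<comment> \<open>\<open>K\<close> and \<open>G\<close> live in coordinates; reading them through
    \<open>R\<close> gives a summand on carrier elements.\<close>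
  let ?H = "\<lambda>x y x' y'. P (tmul (G (R y) (R y')) (K (R x) (R x')))"
  have "bmul (twist L f) (P a) (P a') = (\<Sum>(x, y)\<leftarrow>cop L (P a). \<Sum>(x', y')\<leftarrow>cop L (P a'). ?H x y x' y')"
  proof -
    let ?T = "\<lambda>x1 x2 y x1' x2' y'. bmul L (src L (f x1 x1')) (bmul L (tgt L (conv_inverse L f y y')) (bmul L x2 x2'))"
    have "bmul (twist L f) (P a) (P a') = (\<Sum>(x, y)\<leftarrow>cop L (P a). \<Sum>(x1, x2)\<leftarrow>cop L x.
        \<Sum>(x', y')\<leftarrow>cop L (P a'). \<Sum>(x1', x2')\<leftarrow>cop L x'. ?T x1 x2 y x1' x2' y')"
      by (simp add: twist_def sum_list_cop3)
    also have "\<dots> = (\<Sum>(x, y)\<leftarrow>cop L (P a). \<Sum>(x', y')\<leftarrow>cop L (P a').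
        \<Sum>(x1, x2)\<leftarrow>cop L x. \<Sum>(x1', x2')\<leftarrow>cop L x'. ?T x1 x2 y x1' x2' y')"
      unfolding case_prod_unfold by (subst sum_list_swap) (rule refl)
    also have "\<dots> = (\<Sum>(x, y)\<leftarrow>cop L (P a). \<Sum>(x', y')\<leftarrow>cop L (P a'). ?H x y x' y')"
    proof -
      obtain xs where xs: "cop L (P a) = map (\<lambda>(x, y). (P x, P y)) xs" by (rule cop_coordinates)
      obtain ys where ys: "cop L (P a') = map (\<lambda>(x, y). (P x, P y)) ys" by (rule cop_coordinates)
      show ?thesis unfolding xs ys by (simp add: o_def case_prod_unfold inner[unfolded case_prod_unfold])
    qed
    finally show ?thesis .
  qed
  also have "\<dots> = tlift (\<lambda>x' y'. tlift (\<lambda>x y. P (tmul (G y y') (K x x'))) (dd a)) (dd a')"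
  proof -
    have b: "cbilinear (\<lambda>x y. P (tmul (G y y') (K x x')))" "cbilinear (\<lambda>x' y'. P (tmul (G y y') (K x x')))" for x x' y y'
      by (rule cbilinear_post[OF P_linear], rule cbilinear_flip, rule cbilinear_compose[OF cbilinear_tmul],
          rule cbilinear_left[OF G'(1)] cbilinear_right[OF G'(1)], rule cbilinear_left[OF cK] cbilinear_right[OF cK])+
    show ?thesis
      by (subst cop_sum2) (simp_all add: K(2,3) G' b tmul_tmul)
  qed
  also have "\<dots> = P (qdd (\<lambda>z p. tmul p z) K G a a')"
  proof -
    have b: "cbilinear (\<lambda>x y. tmul (G y y') (K x x'))" "cbilinear (\<lambda>x' y'. tmul (G y y') (K x x'))" for x x' y y'
      by (rule cbilinear_flip, rule cbilinear_compose[OF cbilinear_tmul],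
          rule cbilinear_left[OF G'(1)] cbilinear_right[OF G'(1)], rule cbilinear_left[OF cK] cbilinear_right[OF cK])+
    have b2: "cbilinear (\<lambda>x' y'. tlift (\<lambda>x y. tmul (G y y') (K x x')) (dd a))"
      by (rule cbilinearI; rule clinear_tlift_param) (rule cbilinear_left[OF b(2)], rule cbilinear_right[OF b(2)])
    show ?thesis unfolding qdd_eq tlift_post[OF P_linear b2] tlift_post[OF P_linear b(1)] ..
  qed
  finally show ?thesis .
qed

end

lemma bbalancing_cong:
  assumes "bcar L = bcar M" "\<And>b x. x \<in> bcar L \<Longrightarrow> bmul L (tgt L b) x = bmul M (tgt M b) x"
    "\<And>b x. x \<in> bcar L \<Longrightarrow> bmul L (src L b) x = bmul M (src M b) x"
  shows "bbalancing L = bbalancing M"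
proof -
  have "{bmul L (tgt L b) x \<otimes> y - x \<otimes> bmul L (src L b) y | x b y. x \<in> bcar L \<and> y \<in> bcar L} =
      {bmul M (tgt M b) x \<otimes> y - x \<otimes> bmul M (src M b) y | x b y. x \<in> bcar L \<and> y \<in> bcar L}"
    using assms(2,3) by (intro Collect_cong) metis
  then show ?thesis by (simp add: bbalancing_def balancing_def assms(1))
qed

text \<open>In coordinates both structures are the same, so passing from one presentation to the
  other is a morphism; its inverse is built from \<open>P\<close> and \<open>T\<close> in the same
  way.\<close>

lemma presented_iso:
  assumes L: "presented_bialgebroid \<Delta> \<epsilon> S act \<sigma> \<sigma>' L P R" and M: "presented_bialgebroid \<Delta> \<epsilon> S act \<sigma> \<sigma>' M Q T"
  shows "bialgebroid_iso L M (\<lambda>x. Q (R x))"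
proof -
  interpret A: presented_bialgebroid \<Delta> \<epsilon> S act \<sigma> \<sigma>' L P R by (rule L)
  interpret B: presented_bialgebroid \<Delta> \<epsilon> S act \<sigma> \<sigma>' M Q T by (rule M)
  have com: "bialgebroid.comul M (Q t) = bclass M (\<Sum>(x, y)\<leftarrow>cop L (P t). Q (R x) \<otimes> Q (R y))" for t
    unfolding B.comul_bclass
  proof (rule B.bclass_eqI)
    have "(\<Sum>(x, y)\<leftarrow>cop L (P t). Q (R x) \<otimes> Q (R y)) - tlift (\<lambda>x y. Q (R (P x)) \<otimes> Q (R (P y))) (A.dd t) \<in> bbalancing M"
      by (rule A.cop_sum_mod[OF _ B.subspace_bbalancing]) (simp_all add: B.PP_bil B.bbalancing_base)
    then show "B.PP (A.dd t) - (\<Sum>(x, y)\<leftarrow>cop L (P t). Q (R x) \<otimes> Q (R y)) \<in> bbalancing M"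
      using cvec.subspace_neg[OF B.subspace_bbalancing] by fastforce
  qed
  have "bialgebroid_morphism L M (\<lambda>x. Q (R x))"
    unfolding bialgebroid_morphism_def A.carrier B.carrier
    by (auto simp: A.eta_mul B.eta_mul com A.counit B.counit A.mul B.mul A.one B.one intro!: A.linear_on_P')
  moreover have "bij_betw (\<lambda>x. Q (R x)) (bcar L) (bcar M)"
    by (rule bij_betw_byWitness[where f' = "\<lambda>x. P (T x)"]) (auto simp: A.carrier B.carrier)
  ultimately show ?thesis
    by (simp add: bialgebroid_iso_def A.left_bialgebroid B.left_bialgebroid)
qed

section \<open>The cocycle and the isomorphism on the spanning elements\<close>

context coalgebra
begin

text \<open>\<open>sweedler4\<close> is nested to the left, whereas convolution chains are read from
  the right; three uses of coassociativity connect them.\<close>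

lemma sweedler4_right:
  assumes F: "\<And>h2 h3 h4. clinear (\<lambda>h1. F h1 h2 h3 h4)" "\<And>h1 h3 h4. clinear (\<lambda>h2. F h1 h2 h3 h4)"
    "\<And>h1 h2 h4. clinear (\<lambda>h3. F h1 h2 h3 h4)" "\<And>h1 h2 h3. clinear (\<lambda>h4. F h1 h2 h3 h4)"
  shows "sweedler4 D F h = sweedler2 D (\<lambda>h1 y. sweedler2 D (\<lambda>h2 z. sweedler2 D (\<lambda>h3 h4. F h1 h2 h3 h4) z) y) h"
proof -
  have 1: "sweedler2 D (\<lambda>y h3. sweedler2 D (\<lambda>h1 h2. F h1 h2 h3 h4) y) x =
      sweedler2 D (\<lambda>h1 z. sweedler2 D (\<lambda>h2 h3. F h1 h2 h3 h4) z) x" for h4 x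
    by (rule sw_coassoc) (rule ctrilinearI, rule F(1), rule F(2), rule F(3))
  have 2: "sweedler2 D (\<lambda>x h4. sweedler2 D (\<lambda>h1 z. sweedler2 D (\<lambda>h2 h3. F h1 h2 h3 h4) z) x) h =
      sweedler2 D (\<lambda>h1 y. sweedler2 D (\<lambda>z h4. sweedler2 D (\<lambda>h2 h3. F h1 h2 h3 h4) z) y) h"
    by (rule sw_coassoc) (rule ctrilinearI, rule clinear_sweedler2_param, rule F(1),
      rule clinear_sweedler2[OF D_linear], rule cbilinearI, rule F(2), rule F(3), rule clinear_sweedler2_param, rule F(4))
  have 3: "sweedler2 D (\<lambda>z h4. sweedler2 D (\<lambda>h2 h3. F h1 h2 h3 h4) z) y =
      sweedler2 D (\<lambda>h2 z. sweedler2 D (\<lambda>h3 h4. F h1 h2 h3 h4) z) y" for h1 y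
    by (rule sw_coassoc) (rule ctrilinearI, rule F(2), rule F(3), rule F(4))
  show ?thesis unfolding sweedler4_def sweedler3_def 1 2 3 ..
qed

lemma sweedler4_cv:
  assumes bil: "cbilinear m" "cbilinear n" "cbilinear p" and lin: "clinear f" "clinear g" "clinear k" "clinear l"
  shows "sweedler4 D (\<lambda>h1 h2 h3 h4. m (f h1) (n (g h2) (p (k h3) (l h4)))) h = cv D m f (cv D n g (cv D p k l)) h"
proof -
  note lm = cbilinear_left[OF bil(1)] cbilinear_right[OF bil(1)] and ln = cbilinear_left[OF bil(2)] cbilinear_right[OF bil(2)]
    and lp = cbilinear_left[OF bil(3)] cbilinear_right[OF bil(3)]
  have bp: "cbilinear (\<lambda>h3 h4. p (k h3) (l h4))" by (rule cbilinear_compose[OF bil(3) lin(3,4)])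
  have bn: "cbilinear (\<lambda>h2 z. n (g h2) (cv D p k l z))"
    by (rule cbilinear_compose[OF bil(2) lin(2)]) (rule clinear_cv[OF bil(3) lin(3,4)])
  have "sweedler4 D (\<lambda>h1 h2 h3 h4. m (f h1) (n (g h2) (p (k h3) (l h4)))) h =
      sweedler2 D (\<lambda>h1 y. sweedler2 D (\<lambda>h2 z. sweedler2 D (\<lambda>h3 h4. m (f h1) (n (g h2) (p (k h3) (l h4)))) z) y) h"
    by (rule sweedler4_right)
      (rule clinear_compose[OF lm(1) lin(1)], rule clinear_compose[OF lm(2) clinear_compose[OF ln(1) lin(2)]],
       rule clinear_compose[OF lm(2) clinear_compose[OF ln(2) clinear_compose[OF lp(1) lin(3)]]],
       rule clinear_compose[OF lm(2) clinear_compose[OF ln(2) clinear_compose[OF lp(2) lin(4)]]])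
  also have "\<dots> = cv D m f (cv D n g (cv D p k l)) h"
  proof -
    have 1: "m u (cv D n g (cv D p k l) y) = sweedler2 D (\<lambda>h2 z. m u (n (g h2) (cv D p k l z))) y" for u y
      unfolding cv_def[of D n] by (rule sweedler2_post[OF lm(2) bn])
    have 2: "m u (n v (cv D p k l z)) = sweedler2 D (\<lambda>h3 h4. m u (n v (p (k h3) (l h4)))) z" for u v z
      unfolding cv_def[of D p] by (rule sweedler2_post[OF clinear_compose[OF lm(2) ln(2)] bp])
    show ?thesis unfolding cv_def[of D m] 1 2 ..
  qed
  finally show ?thesis .
qed

end

context crossed_points
begin

text \<open>With \<open>\<alpha> \<rhd> g\<close> as second coordinate, \<open>g\<close> can be
  moved to the left of the inverse of \<gamma>, so the second leg is written in the form of the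
  standard generators.\<close>

lemma psi_act_point:
  assumes pt: "pt \<alpha>" and [simp]: "clinear f" "clinear g"
  shows "(\<lambda>x. psi (X.Tp f (\<alpha> \<rhd> g) \<alpha> x)) = cv D pure (elt f \<alpha>) (elt (g \<star> sg' (\<lambda>x. S (\<alpha> x)) \<alpha>) (\<lambda>x. S (\<alpha> x)))"
proof -
  note [simp] = pt pt_linear[OF pt]
  have "\<gamma>i \<alpha> \<bullet>\<^sub>X em (\<alpha> \<rhd> g) = elt (g \<star> sg' (\<lambda>x. S (\<alpha> x)) \<alpha>) (\<lambda>x. S (\<alpha> x))"
    unfolding emb_gamma_inv[OF assms(1,3), symmetric]
    by (simp add: emb_point cleave_inv_point cmult_points act_one_point sg_one)
  then show ?thesis by (simp add: psi_point)
qed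

end

context central_crossed_product
begin

abbreviation "gact b b' \<equiv> H.Tp (H.cc b) (H.conv_act (\<lambda>x. x) (H.cc b')) (\<lambda>x. x)"

text \<open>For the trivial cocycle the inverse of \<gamma> is simply the antipode, so the generator
  has the coordinates \<open>gact b b' h\<close>.\<close>

lemma es_gen_eq: "es_gen \<Delta> S b b' h = tpsi (gact b b' h)"
proof -
  have S: "clinear S" by (rule antipode_linear)
  have "H.pt S" using H.pt_antipode[OF pt_id] by simp
  then have "(\<lambda>h. tpsi (gact b b' h)) = cv \<Delta> pure (H.elt (H.cc b) (\<lambda>x. x)) (H.elt (H.cc b') S)"
    using crossed_points.psi_act_point[OF H.trivial_points pt_id H.clinear_cc H.clinear_cc, of b b']
    by (simp add: H.tr_point)
  then have "tpsi (gact b b' h) = cv \<Delta> pure (H.elt (H.cc b) (\<lambda>x. x)) (H.elt (H.cc b') S) h"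
    by (simp add: fun_eq_iff)
  also have "\<dots> = es_gen \<Delta> S b b' h"
    by (simp add: H.cv_cc_left S es_gen_def) (simp add: cv_def)
  finally show ?thesis by simp
qed

text \<open>Cocommutativity lets the antipode in the last tensor factor take the second Sweedler leg
  and the inverse cocycle the third and fourth, as the formula prescribes.\<close>

lemma psi_gact:
  "psi (gact b b' h) = sweedler4 \<Delta> (\<lambda>h1 h2 h3 h4. (b \<otimes> h1) \<otimes> ((b' * \<sigma>' (S h3) h4) \<otimes> S h2)) h"
proof -
  note S [simp] = antipode_linear
  have f: "cbilinear (\<lambda>(s :: 'h) (v :: 'b). (b' * v) \<otimes> s)"
    by (rule cbilinear_flip, rule cbilinear_compose[OF cbilinear_pure]) simp_all
  have f0: "cbilinear (\<lambda>(s :: 'h) (v :: 'b). v \<otimes> s)" by (rule cbilinear_flip[OF cbilinear_pure])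
  have "psi (gact b b' h) = cv \<Delta> pure (H.elt (H.cc b) (\<lambda>x. x)) (H.elt (H.conv_mult (H.cc b') (H.sg' S (\<lambda>x. x))) S) h"
    using fun_cong[OF H.psi_act_point[OF pt_id H.clinear_cc H.clinear_cc, of b b'], of h] by simp
  also have "H.elt (H.conv_mult (H.cc b') (H.sg' S (\<lambda>x. x))) S = cv \<Delta> (\<lambda>s v. v \<otimes> s) S (H.conv_mult (H.cc b') (H.sg' S (\<lambda>x. x)))"
    by (rule H.cv_comm) simp_all
  also have "\<dots> = cv \<Delta> (\<lambda>s v. (b' * v) \<otimes> s) S (H.sg' S (\<lambda>x. x))"
    by (rule cv_cong) (simp add: H.cv_cc_left)
  also have "cv \<Delta> pure (H.elt (H.cc b) (\<lambda>x. x)) (cv \<Delta> (\<lambda>s v. (b' * v) \<otimes> s) S (H.sg' S (\<lambda>x. x))) h =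
      sweedler4 \<Delta> (\<lambda>h1 h2 h3 h4. H.elt (H.cc b) (\<lambda>x. x) h1 \<otimes> ((b' * \<sigma>' (S h3) h4) \<otimes> S h2)) h"
    by (rule H.sweedler4_cv[symmetric]) (simp_all add: f)
  finally show ?thesis by (simp add: H.cv_cc_left)
qed

lemma gact_pi: "(\<lambda>w. gact b b' (\<pi>1 w)) = H2.XY.Tp (H2.XY.cc b) (HH.conv_act \<pi>1 (H2.XY.cc b')) \<pi>1"
  "(\<lambda>w. gact b b' (\<pi>2 w)) = H2.XY.Tp (H2.XY.cc b) (HH.conv_act \<pi>2 (H2.XY.cc b')) \<pi>2"
  by (simp_all add: fun_eq_iff cv_pullback[OF pt_pi(1)] cv_pullback[OF pt_pi(2)]
      coalg_map_counit[OF pt_pi(1)] coalg_map_counit[OF pt_pi(2)])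

text \<open>The second coordinate of the second generator already carries an action, so acting on it
  with the first gives the action of the product; this is the source of the factor
  \<open>act (h3 * g2) c'\<close>.\<close>

lemma st_gact:
  "st (gact b b' h) (gact c c' g) = sweedler4 \<Delta> (\<lambda>h1 h2 h3 h4. sweedler2 \<Delta> (\<lambda>g1 g2.
     b * act h1 c * \<sigma> h2 g1 * act (h3 * g2) c' * act h4 b') g) h"
proof -
  note [simp] = HH.pt_linear[OF pt_pi(1)] HH.pt_linear[OF pt_pi(2)]
  let ?Q = "\<lambda>h1 h2 g1. b * act h1 c * \<sigma> h2 g1" and ?R = "\<lambda>h3 g2. act (h3 * g2) c'" and ?T = "\<lambda>h4. act h4 b'"
  let ?V = "\<lambda>y g1. sweedler2 \<Delta> (\<lambda>h1 h2. ?Q h1 h2 g1) y"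
  let ?Y = "HH.conv_mult (\<lambda>w. b * act (\<pi>1 w) c) (HH.sg \<pi>1 \<pi>2)" and ?Z = "\<lambda>w. act (HH.conv_mult \<pi>1 \<pi>2 w) c'"
  have lb: "clinear (\<lambda>h. b * act h c)" by simp
  have bQ: "cbilinear (\<lambda>h1 h2. ?Q h1 h2 g1)" for g1
    by (rule cbilinear_compose[OF cbilinear_mult lb cbilinear_left[OF sigma_bilinear]])
  have lQ: "clinear (\<lambda>g1. ?Q h1 h2 g1)" for h1 h2
    by (simp add: cbilinear_right)
  have bR: "cbilinear ?R"
    by (rule cbilinear_post[OF cbilinear_left[OF act_bilinear] cbilinear_mult])
  have bV: "cbilinear ?V"
    by (rule cbilinearI) (rule clinear_sweedler2[OF comult_linear bQ], rule clinear_sweedler2_param, rule lQ)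
  have Y: "?Y (y \<otimes> g1) = ?V y g1" for y g1
    using H2.cv_p1_left[OF cbilinear_mult lb, of "HH.sg \<pi>1 \<pi>2" y g1] by simp
  have Z: "?Z (h3 \<otimes> g2) = ?R h3 g2" for h3 g2
    using H2.cv_p1_p2[OF cbilinear_mult clinear_id clinear_id] by simp
  have cZ [simp]: "clinear ?Z" by (rule clinear_compose[OF cbilinear_left[OF act_bilinear]]) simp
  have X: "HH.conv_mult ?Y ?Z (x \<otimes> g) = sweedler2 \<Delta> (\<lambda>y h3. sweedler2 \<Delta> (\<lambda>g1 g2. ?V y g1 * ?R h3 g2) g) x" for x
    by (subst H2.cv_tD) (simp_all only: Y Z cbilinear_mult cZ, simp)
  have "st (gact b b' h) (gact c c' g) = cv E2 st (\<lambda>w. gact b b' (\<pi>1 w)) (\<lambda>w. gact c c' (\<pi>2 w)) (h \<otimes> g)"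
    by (rule H2.cv_p1_p2[symmetric]) simp_all
  also have "cv E2 st (\<lambda>w. gact b b' (\<pi>1 w)) (\<lambda>w. gact c c' (\<pi>2 w)) =
      HH.conv_mult (HH.conv_mult (HH.conv_mult (HH.conv_mult (H2.XY.cc b) (HH.conv_act \<pi>1 (H2.XY.cc c))) (HH.sg \<pi>1 \<pi>2))
        (HH.conv_act \<pi>1 (HH.conv_act \<pi>2 (H2.XY.cc c')))) (HH.conv_act \<pi>1 (H2.XY.cc b'))"
    unfolding gact_pi by (rule HH.stv_point) simp_all
  also have "\<dots> = HH.conv_mult (HH.conv_mult ?Y ?Z) (\<lambda>w. act (\<pi>1 w) b')"
  proof -
    have "HH.conv_act \<pi>1 (HH.conv_act \<pi>2 (H2.XY.cc c')) = ?Z"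
      by (subst HH.act_act_points) (simp_all add: H2.XY.cv_cc_right)
    then show ?thesis by (simp only:) (simp add: H2.XY.cv_cc_right H2.XY.cv_cc_left)
  qed
  also have "\<dots> (h \<otimes> g) = sweedler2 \<Delta> (\<lambda>x h4. sweedler2 \<Delta> (\<lambda>y h3. sweedler2 \<Delta> (\<lambda>g1 g2. ?V y g1 * ?R h3 g2) g) x * ?T h4) h"
    by (subst H2.cv_p1_right) (simp_all only: X, simp_all)
  also have "\<dots> = sweedler4 \<Delta> (\<lambda>h1 h2 h3 h4. sweedler2 \<Delta> (\<lambda>g1 g2. ?Q h1 h2 g1 * ?R h3 g2 * ?T h4) g) h"
  proof -
    have l: "clinear (\<lambda>z. z * r)" and l2: "clinear (\<lambda>z. z * r * t)" for r t :: 'b by simp_all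
    have s: "sweedler2 \<Delta> (\<lambda>h1 h2. sweedler2 \<Delta> (\<lambda>g1 g2. ?Q h1 h2 g1 * ?R h3 g2 * ?T h4) g) y =
        sweedler2 \<Delta> (\<lambda>g1 g2. ?V y g1 * ?R h3 g2) g * ?T h4" for y h3 h4
    proof -
      have "sweedler2 \<Delta> (\<lambda>h1 h2. sweedler2 \<Delta> (\<lambda>g1 g2. ?Q h1 h2 g1 * ?R h3 g2 * ?T h4) g) y =
          sweedler2 \<Delta> (\<lambda>g1 g2. sweedler2 \<Delta> (\<lambda>h1 h2. ?Q h1 h2 g1 * ?R h3 g2 * ?T h4) y) g"
        by (rule sweedler2_swap)
          (rule cbilinear_post[OF l], rule cbilinear_compose[OF cbilinear_mult lQ cbilinear_right[OF bR]], rule cbilinear_post[OF l2 bQ])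
      also have "\<dots> = sweedler2 \<Delta> (\<lambda>g1 g2. ?V y g1 * ?R h3 g2 * ?T h4) g"
        unfolding sweedler2_post[OF l2 bQ] ..
      also have "\<dots> = sweedler2 \<Delta> (\<lambda>g1 g2. ?V y g1 * ?R h3 g2) g * ?T h4"
        by (rule sweedler2_post[OF l, symmetric])
          (rule cbilinear_compose[OF cbilinear_mult cbilinear_right[OF bV] cbilinear_right[OF bR]])
      finally show ?thesis .
    qed
    have b: "cbilinear (\<lambda>y h3. sweedler2 \<Delta> (\<lambda>g1 g2. ?V y g1 * ?R h3 g2) g)"
      by (rule cbilinearI; rule clinear_sweedler2_param)
        (rule clinear_compose[OF l cbilinear_left[OF bV]], rule clinear_compose[OF cbilinear_right[OF cbilinear_mult] cbilinear_left[OF bR]])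
    show ?thesis
      unfolding sweedler4_def sweedler3_def s sweedler2_post[OF l b] ..
  qed
  finally show ?thesis .
qed

abbreviation "sES \<equiv> ES (smash_extension \<Delta> act)"

lemma presented_smash: "presented_bialgebroid \<Delta> \<epsilon> S act tr tr sES tpsi trho"
  unfolding smash_extension_eq by (rule central_crossed_product.presented_ES[OF trivial_central])

abbreviation "sigma_t \<equiv> \<lambda>x y. st (trho x) (trho y)"

text \<open>The cocycle is \<open>st\<close> read through the coordinates of the smash product.
  Twisting replaces \<open>tmm\<close> by \<open>mm\<close> and keeps all other structure, so the
  twist is presented with the data of \<sigma>.\<close>

lemma sigma_t_twist:
  shows "invertible_normalised_2cocycle sES sigma_t" (is ?A)
    and "presented_bialgebroid \<Delta> \<epsilon> S act \<sigma> \<sigma>' (twist sES sigma_t) tpsi trho" (is ?B)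
proof -
  interpret T: presented_bialgebroid \<Delta> \<epsilon> S act tr tr sES tpsi trho by (rule presented_smash)
  have bal: "T.balanced st" "T.balanced st'"
    unfolding T.balanced_def by (simp_all add: stv_smul_left stv_tmul_left stv_right)
  have f: "st (trho (tpsi x)) (trho (tpsi y)) = st x y" and g: "st' (trho (tpsi x)) (trho (tpsi y)) = st' x y" for x y
    by simp_all
  have inv: "qdd (*) st st' a a' = ee (tmm a a')" "qdd (*) st' st a a' = ee (tmm a a')" for a a'
    by (rule stv_conv; simp add: HH.sg_inverse)+
  have ltm: "left_twisted_mult sES sigma_t (tpsi u) (tpsi v) = tpsi (ltm u v)" for u v
    using T.left_twisted_mult_coordinates[OF bal(1) f] by (simp add: ltm_def)
  show ?A
    unfolding invertible_normalised_2cocycle_def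
  proof (intro conjI)
    show "left_bialgebroid sES" by (rule T.left_bialgebroid)
    show "bihom sES sigma_t" by (rule T.bihom_of_balanced[OF bal(1) f])
    show "\<exists>g. is_conv_inverse sES sigma_t g"
      by (rule exI, rule T.is_conv_inverse_coordinates[OF bal f g inv])
  qed (auto simp: T.carrier ltm st_cocycle T.one st_one T.counit)
  have L: "bcar (twist sES sigma_t) = bcar sES" "bone (twist sES sigma_t) = bone sES" "src (twist sES sigma_t) = src sES"
    "tgt (twist sES sigma_t) = tgt sES" "bialgebroid.comul (twist sES sigma_t) = bialgebroid.comul sES"
    "bialgebroid.counit (twist sES sigma_t) = bialgebroid.counit sES"
    by (simp_all add: twist_def)
  have mul: "bmul (twist sES sigma_t) (tpsi x) (tpsi y) = tpsi (mm x y)" for x y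
    using T.twist_mult_coordinates[OF bal f inv, of ltm x y] twisted_product[of x y]
    by (simp add: ltm_def[symmetric] ltm_tmul_left ltm_tmul_right)
  \<comment> \<open>Left multiplication by sources and targets is \<open>smul\<close> and
    \<open>tmul\<close> for both products, so the twist does not change the balancing and the
    coproduct may be kept.\<close>
  have bb: "bbalancing (twist sES sigma_t) = bbalancing sES"
    by (rule bbalancing_cong) (auto simp: L T.carrier T.src T.tgt T.mul mul tmm_src_left tmm_tgt_left mm_src_left mm_tgt_left)
  show ?B
    by (intro presented_bialgebroid.intro central_crossed_product_axioms presented_bialgebroid_axioms.intro)
      (simp_all add: L bb mul T.carrier T.one T.src T.tgt T.comul T.counit)
qed

lemma twist_iso: "bialgebroid_iso (twist sES sigma_t) (ES ext) (\<lambda>x. psi (trho x))"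
  by (rule presented_iso[OF sigma_t_twist(2) presented_ES])

lemma trho_es_gen: "trho (es_gen \<Delta> S b b' h) = gact b b' h"
  using presented_bialgebroid.RP[OF presented_smash] by (simp add: es_gen_eq)

end

theorem theorem3p4:
  fixes \<Delta> :: "'h::calgebra \<Rightarrow> ('h, 'h) tensor"
    and \<epsilon> :: "'h \<Rightarrow> complex"
    and S :: "'h \<Rightarrow> 'h"
    and act :: "'h \<Rightarrow> 'b::calgebra \<Rightarrow> 'b"
    and \<sigma> \<sigma>' :: "'h \<Rightarrow> 'h \<Rightarrow> 'b"
  assumes "crossed_product \<Delta> \<epsilon> S act \<sigma> \<sigma>'"
    and "cocommutative \<Delta>"
    and "\<And>h k b. \<sigma> h k * b = b * \<sigma> h k"
  shows "\<exists>\<sigma>t \<phi>.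
    invertible_normalised_2cocycle (ES (smash_extension \<Delta> act)) \<sigma>t \<and>
    bialgebroid_iso (twist (ES (smash_extension \<Delta> act)) \<sigma>t) (ES (crossed_extension \<Delta> act \<sigma>)) \<phi> \<and>
    (\<forall>b b' c c' h g. \<sigma>t (es_gen \<Delta> S b b' h) (es_gen \<Delta> S c c' g) =
       sweedler4 \<Delta> (\<lambda>h1 h2 h3 h4. sweedler2 \<Delta> (\<lambda>g1 g2.
         b * act h1 c * \<sigma> h2 g1 * act (h3 * g2) c' * act h4 b') g) h) \<and>
    (\<forall>b b' h. \<phi> (es_gen \<Delta> S b b' h) =
       sweedler4 \<Delta> (\<lambda>h1 h2 h3 h4.
         (b \<otimes> h1) \<otimes> ((b' * \<sigma>' (S h3) h4) \<otimes> S h2)) h)"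
proof -
  have C: "central_crossed_product \<Delta> \<epsilon> S act \<sigma> \<sigma>'"
    by (intro central_crossed_product.intro central_crossed_product_axioms.intro assms)
  note facts = central_crossed_product.sigma_t_twist(1)[OF C] central_crossed_product.twist_iso[OF C]
    central_crossed_product.st_gact[OF C] central_crossed_product.psi_gact[OF C] central_crossed_product.trho_es_gen[OF C]
  show ?thesis
    \<comment> \<open>Unification with the first two facts fixes the witnesses as \<open>st\<close>
      read through \<open>trho\<close> and \<open>psi\<close> after \<open>trho\<close>;
      \<open>trho_es_gen\<close> then reduces the two formulas to \<open>st_gact\<close> and
      \<open>psi_gact\<close>.\<close>
    by (intro exI conjI, rule facts(1), rule facts(2)) (simp_all only: facts(3-5), simp_all)
qed

end
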